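(* Let $\mathbb{F}$ be a finite field and $G$ a finite group with $\mathrm{char}\,\mathbb{F}\nmid|G|$. (1) Fix $t\in\mathbb{K}$. The restriction (forgetful) functor $\mathrm{Res}:\mathrm{Rep}(G,\mathbb{F})\to\mathbf{Vect}_{\mathbb{F}}$ preserves the degree functions $\delta_{\tau_t}$ (on $\mathrm{Rep}(G,\mathbb{F})$) and $\delta_t$ (on $\mathbf{Vect}_{\mathbb{F}}$), the pullbacks and the terminal objects. In particular, one obtains a symmetric monoidal functor $$\overline{\mathrm{Res}}:\mathcal{T}(\mathrm{Rep}(G,\mathbb{F}),\delta_{\tau_t})\to\underline{\mathrm{Rep}}(GL_t(\mathbb{F})):=\mathcal{T}(\mathbf{Vect}_{\mathbb{F}},\delta_t).$$ (2) Fix a function $\tau:Irr(G)\to\mathbb{K}$. The induction functor $\mathrm{Ind}:\mathbf{Vect}_{\mathbb{F}}\to\mathrm{Rep}(G,\mathbb{F})$, $V\mapsto\mathbb{F}[G]\otimes V$, preserves the degree functions $\delta_{t_\tau}$ (on $\mathbf{Vect}_{\mathbb{F}}$) and $\delta_\tau$ (on $\mathrm{Rep}(G,\mathbb{F})$), the pullbacks and the terminal objects. In particular, one obtains a symmetric monoidal functor $$\overline{\mathrm{Ind}}:\underline{\mathrm{Rep}}(GL_{t_\tau}(\mathbb{F})):=\mathcal{T}(\mathbf{Vect}_{\mathbb{F}},\delta_{t_\tau})\to\mathcal{T}(\mathrm{Rep}(G,\mathbb{F}),\delta_\tau).$$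
   Context: $\mathbb{K}$ is a fixed field. $\mathbf{Vect}_{\mathbb{F}}$ is the category of finite-dimensional $\mathbb{F}$-vector spaces, $\mathrm{Rep}(G,\mathbb{F})$ the category of finite-dimensional representations of $G$ over $\mathbb{F}$, and $Irr(G)$ the set of (isomorphism classes of) irreducible representations of $G$ over $\mathbb{F}$. $[V:I]$ is the multiplicity of $I$ in $V$. A category $\mathcal{A}$ is regular (Knop) if it has a terminal object; all morphisms have images (epi-mono factorizations, unique up to isomorphism); the pullback $x\times_z y$ exists whenever $x\to z\leftarrow y$ can be completed to a commutative square; for any epimorphism $x\twoheadrightarrow z$ and any $y\to z$ the pullback exists; and epimorphisms are preserved under pullbacks. Both categories above are regular. A degree function on a regular category is a map $\delta$ from its epimorphisms to $\mathbb{K}$, multiplicative under composition, equal to $1$ on identities, and invariant under pullback. A functor $F:\mathcal{A}\to\mathcal{A}'$ preserves the degree functions $\delta$ on $\mathcal{A}$ and $\delta'$ on $\mathcal{A}'$ if it preserves epimorphisms and $\delta'(F(e))=\delta(e)$ for every epimorphism $e$ in $\mathcal{A}$. Degree functions used: on $\mathbf{Vect}_{\mathbb{F}}$, $\delta_t(e):=t^{\dim\ker e}$ for $t\in\mathbb{K}$; on $\mathrm{Rep}(G,\mathbb{F})$, for $\tau:Irr(G)\to\mathbb{K}$, $\delta_\tau(e:V\twoheadrightarrow W):=\prod_{I\in Irr(G)}\tau(I)^{[\ker(e):I]}$. For $t\in\mathbb{K}$, $\tau_t:Irr(G)\to\mathbb{K}$ is $\tau_t(I):=t^{\dim I}$.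 For $\tau:Irr(G)\to\mathbb{K}$, $t_\tau:=\prod_{I\in Irr(G)}\tau(I)^{\dim I}\in\mathbb{K}$. For a regular category $\mathcal{A}$ with degree function $\delta$, the $\mathbb{K}$-linear category $\mathcal{T}^0(\mathcal{A},\delta)$ has objects $[x]$ for $x\in\mathcal{A}$; morphisms $[x]\to[y]$ are formal $\mathbb{K}$-linear combinations of symbols $\langle r\rangle$ with $r\subset x\times y$ a subobject; composition for $r\subset x\times y$, $s\subset y\times z$ is $\langle s\rangle\circ\langle r\rangle:=\delta(e)\langle r\star s\rangle$ if $r\times_y s$ exists, where $r\star s:=\mathrm{im}(r\times_y s\to x\times z)$ and $e:r\times_y s\twoheadrightarrow r\star s$, and $0$ otherwise. $\mathcal{T}(\mathcal{A},\delta)$ is its additive Karoubi completion, symmetric monoidal via $[x]\otimes[y]:=[x\times y]$. For a functor $F$ preserving degree functions, pullbacks and terminal objects, $\overline{F}:\mathcal{T}(\mathcal{A},\delta)\to\mathcal{T}(\mathcal{A}',\delta')$ is the $\mathbb{K}$-linear extension to Karoubi completions of $[x]\mapsto[F(x)]$, $\langle r\rangle\mapsto\langle F(r)\rangle$.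
   Formalization: In (2), preservation of degree functions and the functor Ind-bar are proved only when F is a splitting field for G (endomorphisms of every irreducible are scalars); without it the claim fails, e.g. F=F_2, G=Z/3, K=Q, τ(1)=1, τ(J)=2 for the 2-dimensional J: δ_τ(Ind e)=2 but t_τ=4. *)

theory Defs
  imports "Jordan_Normal_Form.VS_Connect" "HOL-Library.Poly_Mapping"
begin

section \<open>Categories\<close>

record ('o, 'a) cat =
  Obj :: "'o set"
  Arr :: "'a set"
  Dom :: "'a \<Rightarrow> 'o"
  Cod :: "'a \<Rightarrow> 'o"
  Ident :: "'o \<Rightarrow> 'a"
  Comp :: "'a \<Rightarrow> 'a \<Rightarrow> 'a" (infixl \<open>\<cdot>\<index>\<close> 75)

definition Hom :: "('o, 'a, 'z) cat_scheme \<Rightarrow> 'o \<Rightarrow> 'o \<Rightarrow> 'a set" where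
  "Hom C x y = {f \<in> Arr C. Dom C f = x \<and> Cod C f = y}"

locale category =
  fixes C :: "('o, 'a, 'z) cat_scheme" (structure)
  assumes dom_obj: "f \<in> Arr C \<Longrightarrow> Dom C f \<in> Obj C"
    and cod_obj: "f \<in> Arr C \<Longrightarrow> Cod C f \<in> Obj C"
    and ident_hom: "x \<in> Obj C \<Longrightarrow> Ident C x \<in> Hom C x x"
    and comp_hom: "\<lbrakk>f \<in> Hom C x y; g \<in> Hom C y z\<rbrakk> \<Longrightarrow> g \<cdot> f \<in> Hom C x z"
    and ident_left: "f \<in> Hom C x y \<Longrightarrow> Ident C y \<cdot> f = f"
    and ident_right: "f \<in> Hom C x y \<Longrightarrow> f \<cdot> Ident C x = f"
    and comp_assoc: "\<lbrakk>f \<in> Hom C w x; g \<in> Hom C x y; h \<in> Hom C y z\<rbrakk>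
      \<Longrightarrow> (h \<cdot> g) \<cdot> f = h \<cdot> (g \<cdot> f)"

definition is_mono :: "('o, 'a, 'z) cat_scheme \<Rightarrow> 'a \<Rightarrow> bool" where
  "is_mono C m \<longleftrightarrow> m \<in> Arr C \<and>
    (\<forall>w. \<forall>f\<in>Hom C w (Dom C m). \<forall>g\<in>Hom C w (Dom C m). m \<cdot>\<^bsub>C\<^esub> f = m \<cdot>\<^bsub>C\<^esub> g \<longrightarrow> f = g)"

definition is_epi :: "('o, 'a, 'z) cat_scheme \<Rightarrow> 'a \<Rightarrow> bool" where
  "is_epi C e \<longleftrightarrow> e \<in> Arr C \<and>
    (\<forall>z. \<forall>f\<in>Hom C (Cod C e) z. \<forall>g\<in>Hom C (Cod C e) z. f \<cdot>\<^bsub>C\<^esub> e = g \<cdot>\<^bsub>C\<^esub> e \<longrightarrow> f = g)"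

definition is_iso :: "('o, 'a, 'z) cat_scheme \<Rightarrow> 'a \<Rightarrow> bool" where
  "is_iso C i \<longleftrightarrow> i \<in> Arr C \<and> (\<exists>j\<in>Hom C (Cod C i) (Dom C i).
    j \<cdot>\<^bsub>C\<^esub> i = Ident C (Dom C i) \<and> i \<cdot>\<^bsub>C\<^esub> j = Ident C (Cod C i))"

definition isomorphic :: "('o, 'a, 'z) cat_scheme \<Rightarrow> 'o \<Rightarrow> 'o \<Rightarrow> bool" where
  "isomorphic C x y \<longleftrightarrow> (\<exists>i\<in>Hom C x y. is_iso C i)"

definition is_terminal :: "('o, 'a, 'z) cat_scheme \<Rightarrow> 'o \<Rightarrow> bool" where
  "is_terminal C t \<longleftrightarrow> t \<in> Obj C \<and> (\<forall>x\<in>Obj C. \<exists>!f. f \<in> Hom C x t)"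

definition commuting_square :: "('o, 'a, 'z) cat_scheme \<Rightarrow> 'a \<Rightarrow> 'a \<Rightarrow> 'a \<Rightarrow> 'a \<Rightarrow> bool" where
  "commuting_square C f g p q \<longleftrightarrow> {f, g, p, q} \<subseteq> Arr C \<and> Cod C f = Cod C g \<and> Dom C p = Dom C q
    \<and> Cod C p = Dom C f \<and> Cod C q = Dom C g \<and> f \<cdot>\<^bsub>C\<^esub> p = g \<cdot>\<^bsub>C\<^esub> q"

definition is_pullback :: "('o, 'a, 'z) cat_scheme \<Rightarrow> 'a \<Rightarrow> 'a \<Rightarrow> 'a \<Rightarrow> 'a \<Rightarrow> bool" where
  "is_pullback C f g p q \<longleftrightarrow> commuting_square C f g p q \<and>
    (\<forall>p' q'. commuting_square C f g p' q' \<longrightarrow>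
      (\<exists>!h. h \<in> Hom C (Dom C p') (Dom C p) \<and> p \<cdot>\<^bsub>C\<^esub> h = p' \<and> q \<cdot>\<^bsub>C\<^esub> h = q'))"

definition is_product :: "('o, 'a, 'z) cat_scheme \<Rightarrow> 'o \<Rightarrow> 'o \<Rightarrow> 'a \<Rightarrow> 'a \<Rightarrow> bool" where
  "is_product C x y p q \<longleftrightarrow> p \<in> Arr C \<and> q \<in> Arr C \<and> Dom C p = Dom C q
    \<and> Cod C p = x \<and> Cod C q = y \<and>
    (\<forall>w. \<forall>f\<in>Hom C w x. \<forall>g\<in>Hom C w y.
      \<exists>!h. h \<in> Hom C w (Dom C p) \<and> p \<cdot>\<^bsub>C\<^esub> h = f \<and> q \<cdot>\<^bsub>C\<^esub> h = g)"

definition is_image_factorization :: "('o, 'a, 'z) cat_scheme \<Rightarrow> 'a \<Rightarrow> 'a \<Rightarrow> 'a \<Rightarrow> bool" where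
  "is_image_factorization C f e m \<longleftrightarrow>
    is_epi C e \<and> is_mono C m \<and> Cod C e = Dom C m \<and> m \<cdot>\<^bsub>C\<^esub> e = f"

record ('o, 'a, 'p, 'b) ftr =
  on_obj :: "'o \<Rightarrow> 'p"
  on_arr :: "'a \<Rightarrow> 'b"

locale is_functor = C: category C + D: category D
  for C :: "('o, 'a, 'z) cat_scheme" and D :: "('p, 'b, 'y) cat_scheme" +
  fixes F :: "('o, 'a, 'p, 'b, 'x) ftr_scheme"
  assumes on_obj_obj: "x \<in> Obj C \<Longrightarrow> on_obj F x \<in> Obj D"
    and on_arr_hom: "f \<in> Hom C x y \<Longrightarrow> on_arr F f \<in> Hom D (on_obj F x) (on_obj F y)"
    and on_arr_ident: "x \<in> Obj C \<Longrightarrow> on_arr F (Ident C x) = Ident D (on_obj F x)"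
    and on_arr_comp: "\<lbrakk>f \<in> Hom C x y; g \<in> Hom C y z\<rbrakk>
      \<Longrightarrow> on_arr F (g \<cdot>\<^bsub>C\<^esub> f) = on_arr F g \<cdot>\<^bsub>D\<^esub> on_arr F f"

definition preserves_pullbacks ::
  "('o, 'a, 'z) cat_scheme \<Rightarrow> ('p, 'b, 'y) cat_scheme \<Rightarrow> ('o, 'a, 'p, 'b, 'x) ftr_scheme \<Rightarrow> bool" where
  "preserves_pullbacks C D F \<longleftrightarrow> (\<forall>f g p q. is_pullback C f g p q \<longrightarrow>
    is_pullback D (on_arr F f) (on_arr F g) (on_arr F p) (on_arr F q))"

definition preserves_terminals ::
  "('o, 'a, 'z) cat_scheme \<Rightarrow> ('p, 'b, 'y) cat_scheme \<Rightarrow> ('o, 'a, 'p, 'b, 'x) ftr_scheme \<Rightarrow> bool" where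
  "preserves_terminals C D F \<longleftrightarrow> (\<forall>t. is_terminal C t \<longrightarrow> is_terminal D (on_obj F t))"


section \<open>Regular categories and degree functions\<close>

locale regular_category = category C for C :: "('o, 'a, 'z) cat_scheme" (structure) +
  assumes terminal_exists: "\<exists>t. is_terminal C t"
    and image_exists: "f \<in> Arr C \<Longrightarrow> \<exists>e m. is_image_factorization C f e m"
    and image_unique:
      "\<lbrakk>is_image_factorization C f e m; is_image_factorization C f e' m'\<rbrakk>
        \<Longrightarrow> \<exists>i\<in>Hom C (Cod C e) (Cod C e'). is_iso C i \<and> i \<cdot> e = e' \<and> m' \<cdot> i = m"
    and pullback_exists:
      "commuting_square C f g p q \<Longrightarrow> \<exists>p' q'. is_pullback C f g p' q'"
    and pullback_of_epi_exists:
      "\<lbrakk>is_epi C e; g \<in> Arr C; Cod C e = Cod C g\<rbrakk> \<Longrightarrow> \<exists>p q. is_pullback C e g p q"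
    and pullback_of_epi:
      "\<lbrakk>is_epi C e; is_pullback C e g p q\<rbrakk> \<Longrightarrow> is_epi C q"

locale degree_function = regular_category C for C :: "('o, 'a, 'z) cat_scheme" (structure) +
  fixes \<delta> :: "'a \<Rightarrow> 'k::field"
  assumes degree_ident: "x \<in> Obj C \<Longrightarrow> \<delta> (Ident C x) = 1"
    and degree_comp: "\<lbrakk>is_epi C e; is_epi C e'; Cod C e = Dom C e'\<rbrakk> \<Longrightarrow> \<delta> (e' \<cdot> e) = \<delta> e' * \<delta> e"
    and degree_pullback: "\<lbrakk>is_epi C e; is_pullback C e g p q\<rbrakk> \<Longrightarrow> \<delta> q = \<delta> e"

locale preserves_degree =
  is_functor C D F + C: degree_function C \<delta> + D: degree_function D \<delta>'
  for C :: "('o, 'a, 'z) cat_scheme" and \<delta> :: "'a \<Rightarrow> 'k::field"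
    and D :: "('p, 'b, 'y) cat_scheme" and \<delta>' :: "'b \<Rightarrow> 'k"
    and F :: "('o, 'a, 'p, 'b, 'x) ftr_scheme" +
  assumes on_arr_epi: "is_epi C e \<Longrightarrow> is_epi D (on_arr F e)"
    and degree_on_arr: "is_epi C e \<Longrightarrow> \<delta>' (on_arr F e) = \<delta> e"


section \<open>Symmetric monoidal categories and functors\<close>

record ('o, 'a) smcat = "('o, 'a) cat" +
  Tens_obj :: "'o \<Rightarrow> 'o \<Rightarrow> 'o" (infixl \<open>\<boxtimes>\<index>\<close> 80)
  Tens_arr :: "'a \<Rightarrow> 'a \<Rightarrow> 'a" (infixl \<open>\<star>\<index>\<close> 80)
  Unit :: "'o"
  Assoc :: "'o \<Rightarrow> 'o \<Rightarrow> 'o \<Rightarrow> 'a"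
  Lunit :: "'o \<Rightarrow> 'a"
  Runit :: "'o \<Rightarrow> 'a"
  Braid :: "'o \<Rightarrow> 'o \<Rightarrow> 'a"

locale symmetric_monoidal_category = category C
  for C :: "('o, 'a, 'z) smcat_scheme" (structure) +
  assumes unit_obj: "Unit C \<in> Obj C"
    and tens_obj: "\<lbrakk>x \<in> Obj C; y \<in> Obj C\<rbrakk> \<Longrightarrow> x \<boxtimes> y \<in> Obj C"
    and tens_hom: "\<lbrakk>f \<in> Hom C x y; f' \<in> Hom C x' y'\<rbrakk> \<Longrightarrow> f \<star> f' \<in> Hom C (x \<boxtimes> x') (y \<boxtimes> y')"
    and tens_ident: "\<lbrakk>x \<in> Obj C; y \<in> Obj C\<rbrakk> \<Longrightarrow> Ident C x \<star> Ident C y = Ident C (x \<boxtimes> y)"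
    and tens_comp:
      "\<lbrakk>f \<in> Hom C x y; g \<in> Hom C y z; f' \<in> Hom C x' y'; g' \<in> Hom C y' z'\<rbrakk>
        \<Longrightarrow> (g \<cdot> f) \<star> (g' \<cdot> f') = (g \<star> g') \<cdot> (f \<star> f')"
    and assoc_hom:
      "\<lbrakk>x \<in> Obj C; y \<in> Obj C; z \<in> Obj C\<rbrakk>
        \<Longrightarrow> Assoc C x y z \<in> Hom C (x \<boxtimes> y \<boxtimes> z) (x \<boxtimes> (y \<boxtimes> z)) \<and> is_iso C (Assoc C x y z)"
    and assoc_natural:
      "\<lbrakk>f \<in> Hom C x x'; g \<in> Hom C y y'; h \<in> Hom C z z'\<rbrakk>
        \<Longrightarrow> Assoc C x' y' z' \<cdot> (f \<star> g \<star> h) = (f \<star> (g \<star> h)) \<cdot> Assoc C x y z"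
    and lunit_hom: "x \<in> Obj C \<Longrightarrow> Lunit C x \<in> Hom C (Unit C \<boxtimes> x) x \<and> is_iso C (Lunit C x)"
    and lunit_natural:
      "f \<in> Hom C x y \<Longrightarrow> Lunit C y \<cdot> (Ident C (Unit C) \<star> f) = f \<cdot> Lunit C x"
    and runit_hom: "x \<in> Obj C \<Longrightarrow> Runit C x \<in> Hom C (x \<boxtimes> Unit C) x \<and> is_iso C (Runit C x)"
    and runit_natural:
      "f \<in> Hom C x y \<Longrightarrow> Runit C y \<cdot> (f \<star> Ident C (Unit C)) = f \<cdot> Runit C x"
    and braid_hom:
      "\<lbrakk>x \<in> Obj C; y \<in> Obj C\<rbrakk> \<Longrightarrow> Braid C x y \<in> Hom C (x \<boxtimes> y) (y \<boxtimes> x)"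
    and braid_natural:
      "\<lbrakk>f \<in> Hom C x x'; g \<in> Hom C y y'\<rbrakk> \<Longrightarrow> Braid C x' y' \<cdot> (f \<star> g) = (g \<star> f) \<cdot> Braid C x y"
    and braid_symmetric:
      "\<lbrakk>x \<in> Obj C; y \<in> Obj C\<rbrakk> \<Longrightarrow> Braid C y x \<cdot> Braid C x y = Ident C (x \<boxtimes> y)"
    and pentagon:
      "\<lbrakk>w \<in> Obj C; x \<in> Obj C; y \<in> Obj C; z \<in> Obj C\<rbrakk> \<Longrightarrow>
        (Ident C w \<star> Assoc C x y z) \<cdot> Assoc C w (x \<boxtimes> y) z \<cdot> (Assoc C w x y \<star> Ident C z)
          = Assoc C w x (y \<boxtimes> z) \<cdot> Assoc C (w \<boxtimes> x) y z"
    and triangle: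
      "\<lbrakk>x \<in> Obj C; y \<in> Obj C\<rbrakk> \<Longrightarrow>
        (Ident C x \<star> Lunit C y) \<cdot> Assoc C x (Unit C) y = Runit C x \<star> Ident C y"
    and hexagon:
      "\<lbrakk>x \<in> Obj C; y \<in> Obj C; z \<in> Obj C\<rbrakk> \<Longrightarrow>
        Assoc C y z x \<cdot> Braid C x (y \<boxtimes> z) \<cdot> Assoc C x y z
          = (Ident C y \<star> Braid C x z) \<cdot> Assoc C y x z \<cdot> (Braid C x y \<star> Ident C z)"

record ('o, 'a, 'p, 'b) smftr = "('o, 'a, 'p, 'b) ftr" +
  Mu :: "'o \<Rightarrow> 'o \<Rightarrow> 'b"
  Eps :: "'b"

locale symmetric_monoidal_functor =
  C: symmetric_monoidal_category C + D: symmetric_monoidal_category D + is_functor C D F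
  for C :: "('o, 'a, 'z) smcat_scheme" and D :: "('p, 'b, 'y) smcat_scheme"
    and F :: "('o, 'a, 'p, 'b, 'x) smftr_scheme" +
  assumes mu_hom:
      "\<lbrakk>x \<in> Obj C; y \<in> Obj C\<rbrakk> \<Longrightarrow>
        Mu F x y \<in> Hom D (on_obj F x \<boxtimes>\<^bsub>D\<^esub> on_obj F y) (on_obj F (x \<boxtimes>\<^bsub>C\<^esub> y)) \<and> is_iso D (Mu F x y)"
    and mu_natural:
      "\<lbrakk>f \<in> Hom C x x'; g \<in> Hom C y y'\<rbrakk> \<Longrightarrow>
        on_arr F (f \<star>\<^bsub>C\<^esub> g) \<cdot>\<^bsub>D\<^esub> Mu F x y = Mu F x' y' \<cdot>\<^bsub>D\<^esub> (on_arr F f \<star>\<^bsub>D\<^esub> on_arr F g)"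
    and eps_hom: "Eps F \<in> Hom D (Unit D) (on_obj F (Unit C)) \<and> is_iso D (Eps F)"
    and mu_assoc:
      "\<lbrakk>x \<in> Obj C; y \<in> Obj C; z \<in> Obj C\<rbrakk> \<Longrightarrow>
        on_arr F (Assoc C x y z) \<cdot>\<^bsub>D\<^esub> Mu F (x \<boxtimes>\<^bsub>C\<^esub> y) z \<cdot>\<^bsub>D\<^esub> (Mu F x y \<star>\<^bsub>D\<^esub> Ident D (on_obj F z))
          = Mu F x (y \<boxtimes>\<^bsub>C\<^esub> z) \<cdot>\<^bsub>D\<^esub> (Ident D (on_obj F x) \<star>\<^bsub>D\<^esub> Mu F y z)
              \<cdot>\<^bsub>D\<^esub> Assoc D (on_obj F x) (on_obj F y) (on_obj F z)"
    and mu_lunit: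
      "x \<in> Obj C \<Longrightarrow>
        on_arr F (Lunit C x) \<cdot>\<^bsub>D\<^esub> Mu F (Unit C) x \<cdot>\<^bsub>D\<^esub> (Eps F \<star>\<^bsub>D\<^esub> Ident D (on_obj F x))
          = Lunit D (on_obj F x)"
    and mu_runit:
      "x \<in> Obj C \<Longrightarrow>
        on_arr F (Runit C x) \<cdot>\<^bsub>D\<^esub> Mu F x (Unit C) \<cdot>\<^bsub>D\<^esub> (Ident D (on_obj F x) \<star>\<^bsub>D\<^esub> Eps F)
          = Runit D (on_obj F x)"
    and mu_braid:
      "\<lbrakk>x \<in> Obj C; y \<in> Obj C\<rbrakk> \<Longrightarrow>
        on_arr F (Braid C x y) \<cdot>\<^bsub>D\<^esub> Mu F x y = Mu F y x \<cdot>\<^bsub>D\<^esub> Braid D (on_obj F x) (on_obj F y)"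

text \<open>The linear structure on hom sets: \<open>Hzero C x y\<close> is the zero arrow from \<open>x\<close> to \<open>y\<close>.\<close>

record ('o, 'a, 'k) lincat = "('o, 'a) smcat" +
  Hadd :: "'a \<Rightarrow> 'a \<Rightarrow> 'a"
  Hzero :: "'o \<Rightarrow> 'o \<Rightarrow> 'a"
  Hscale :: "'k \<Rightarrow> 'a \<Rightarrow> 'a"

definition linear_functor ::
  "('o, 'a, 'k, 'z) lincat_scheme \<Rightarrow> ('p, 'b, 'k, 'y) lincat_scheme
    \<Rightarrow> ('o, 'a, 'p, 'b, 'x) ftr_scheme \<Rightarrow> bool" where
  "linear_functor C D F \<longleftrightarrow>
    (\<forall>x y. \<forall>f\<in>Hom C x y. \<forall>g\<in>Hom C x y.
      on_arr F (Hadd C f g) = Hadd D (on_arr F f) (on_arr F g)) \<and>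
    (\<forall>c. \<forall>f\<in>Arr C. on_arr F (Hscale C c f) = Hscale D c (on_arr F f))"


section \<open>The category of relations with respect to a degree function\<close>

text \<open>Products and the terminal object are only determined up to isomorphism; one choice is fixed.\<close>

definition prod_cone :: "('o, 'a, 'z) cat_scheme \<Rightarrow> 'o \<Rightarrow> 'o \<Rightarrow> 'a \<times> 'a" where
  "prod_cone C x y = (SOME (p, q). is_product C x y p q)"

definition pr1 :: "('o, 'a, 'z) cat_scheme \<Rightarrow> 'o \<Rightarrow> 'o \<Rightarrow> 'a" where
  "pr1 C x y = fst (prod_cone C x y)"

definition pr2 :: "('o, 'a, 'z) cat_scheme \<Rightarrow> 'o \<Rightarrow> 'o \<Rightarrow> 'a" where
  "pr2 C x y = snd (prod_cone C x y)"

definition prod_obj :: "('o, 'a, 'z) cat_scheme \<Rightarrow> 'o \<Rightarrow> 'o \<Rightarrow> 'o" where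
  "prod_obj C x y = Dom C (pr1 C x y)"

definition pairing :: "('o, 'a, 'z) cat_scheme \<Rightarrow> 'a \<Rightarrow> 'a \<Rightarrow> 'a" where
  "pairing C f g = (let x = Cod C f; y = Cod C g in
    THE h. h \<in> Hom C (Dom C f) (prod_obj C x y) \<and> pr1 C x y \<cdot>\<^bsub>C\<^esub> h = f \<and> pr2 C x y \<cdot>\<^bsub>C\<^esub> h = g)"

definition terminal_obj :: "('o, 'a, 'z) cat_scheme \<Rightarrow> 'o" where
  "terminal_obj C = (SOME t. is_terminal C t)"

definition to_terminal :: "('o, 'a, 'z) cat_scheme \<Rightarrow> 'o \<Rightarrow> 'a" where
  "to_terminal C x = (THE f. f \<in> Hom C x (terminal_obj C))"

text \<open>A subobject is an isomorphism class of monomorphisms with a common codomain.\<close>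

definition subobject :: "('o, 'a, 'z) cat_scheme \<Rightarrow> 'a \<Rightarrow> 'a set" where
  "subobject C m = {m'. is_mono C m' \<and> Cod C m' = Cod C m \<and>
    (\<exists>i\<in>Hom C (Dom C m') (Dom C m). is_iso C i \<and> m \<cdot>\<^bsub>C\<^esub> i = m')}"

definition subobjects :: "('o, 'a, 'z) cat_scheme \<Rightarrow> 'o \<Rightarrow> 'a set set" where
  "subobjects C x = {subobject C m | m. is_mono C m \<and> Cod C m = x}"

definition pscale :: "'k \<Rightarrow> ('b \<Rightarrow>\<^sub>0 'k::field) \<Rightarrow> ('b \<Rightarrow>\<^sub>0 'k)" where
  "pscale c = Poly_Mapping.map ((*) c)"

text \<open>For subobjects \<open>r\<close> of \<open>x \<times> y\<close> and \<open>s\<close> of \<open>y \<times> z\<close>, \<open>is_star C x y z r s e t\<close> says that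
  \<open>t\<close> is the image of the pullback of \<open>r\<close> and \<open>s\<close> over \<open>y\<close> in \<open>x \<times> z\<close> and that \<open>e\<close> is the
  projection of the pullback onto that image.\<close>

definition is_star ::
  "('o, 'a, 'z) cat_scheme \<Rightarrow> 'o \<Rightarrow> 'o \<Rightarrow> 'o \<Rightarrow> 'a set \<Rightarrow> 'a set \<Rightarrow> 'a \<Rightarrow> 'a set \<Rightarrow> bool" where
  "is_star C x y z r s e t \<longleftrightarrow> (\<exists>m\<in>r. \<exists>n\<in>s. \<exists>p q \<mu>.
    is_pullback C (pr2 C x y \<cdot>\<^bsub>C\<^esub> m) (pr1 C y z \<cdot>\<^bsub>C\<^esub> n) p q \<and>
    is_image_factorization C
      (pairing C (pr1 C x y \<cdot>\<^bsub>C\<^esub> m \<cdot>\<^bsub>C\<^esub> p) (pr2 C y z \<cdot>\<^bsub>C\<^esub> n \<cdot>\<^bsub>C\<^esub> q)) e \<mu> \<and>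
    t = subobject C \<mu>)"

text \<open>In a regular category every image exists, so the first case is that of an existing pullback.\<close>

definition rel_comp ::
  "('o, 'a, 'z) cat_scheme \<Rightarrow> ('a \<Rightarrow> 'k::field) \<Rightarrow> 'o \<Rightarrow> 'o \<Rightarrow> 'o \<Rightarrow> 'a set \<Rightarrow> 'a set
    \<Rightarrow> ('a set \<Rightarrow>\<^sub>0 'k)" where
  "rel_comp C \<delta> x y z s r =
    (if \<exists>e t. is_star C x y z r s e t
     then let (e, t) = (SOME (e, t). is_star C x y z r s e t) in Poly_Mapping.single t (\<delta> e)
     else 0)"

type_synonym ('o, 'a, 'k) rel_arr = "'o \<times> ('a set \<Rightarrow>\<^sub>0 'k) \<times> 'o"

definition T0_comp ::
  "('o, 'a, 'z) cat_scheme \<Rightarrow> ('a \<Rightarrow> 'k::field)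
    \<Rightarrow> ('o, 'a, 'k) rel_arr \<Rightarrow> ('o, 'a, 'k) rel_arr \<Rightarrow> ('o, 'a, 'k) rel_arr" where
  "T0_comp C \<delta> = (\<lambda>(y', \<psi>, z) (x, \<phi>, y). (x,
    \<Sum>r\<in>Poly_Mapping.keys \<phi>. \<Sum>s\<in>Poly_Mapping.keys \<psi>.
      pscale (Poly_Mapping.lookup \<psi> s * Poly_Mapping.lookup \<phi> r) (rel_comp C \<delta> x y z s r), z))"

definition graph_arr :: "('o, 'a, 'z) cat_scheme \<Rightarrow> 'a \<Rightarrow> ('o, 'a, 'k::field) rel_arr" where
  "graph_arr C f = (Dom C f,
    Poly_Mapping.single (subobject C (pairing C (Ident C (Dom C f)) f)) 1, Cod C f)"

text \<open>The product of a subobject of \<open>x \<times> y\<close> with one of \<open>x' \<times> y'\<close>, as a subobject of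
  \<open>(x \<times> x') \<times> (y \<times> y')\<close>.\<close>

definition rel_tens ::
  "('o, 'a, 'z) cat_scheme \<Rightarrow> 'o \<Rightarrow> 'o \<Rightarrow> 'o \<Rightarrow> 'o \<Rightarrow> 'a set \<Rightarrow> 'a set \<Rightarrow> 'a set" where
  "rel_tens C x y x' y' r r' =
    (let m = SOME m. m \<in> r; m' = SOME m'. m' \<in> r';
         p = pr1 C (Dom C m) (Dom C m'); p' = pr2 C (Dom C m) (Dom C m')
     in subobject C (pairing C
          (pairing C (pr1 C x y \<cdot>\<^bsub>C\<^esub> m \<cdot>\<^bsub>C\<^esub> p) (pr1 C x' y' \<cdot>\<^bsub>C\<^esub> m' \<cdot>\<^bsub>C\<^esub> p'))
          (pairing C (pr2 C x y \<cdot>\<^bsub>C\<^esub> m \<cdot>\<^bsub>C\<^esub> p) (pr2 C x' y' \<cdot>\<^bsub>C\<^esub> m' \<cdot>\<^bsub>C\<^esub> p'))))"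

definition T0_tens ::
  "('o, 'a, 'z) cat_scheme
    \<Rightarrow> ('o, 'a, 'k::field) rel_arr \<Rightarrow> ('o, 'a, 'k) rel_arr \<Rightarrow> ('o, 'a, 'k) rel_arr" where
  "T0_tens C = (\<lambda>(x, \<phi>, y) (x', \<phi>', y'). (prod_obj C x x',
    \<Sum>r\<in>Poly_Mapping.keys \<phi>. \<Sum>r'\<in>Poly_Mapping.keys \<phi>'.
      Poly_Mapping.single (rel_tens C x y x' y' r r')
        (Poly_Mapping.lookup \<phi> r * Poly_Mapping.lookup \<phi>' r'), prod_obj C y y'))"

definition T0 ::
  "('o, 'a, 'z) cat_scheme \<Rightarrow> ('a \<Rightarrow> 'k::field) \<Rightarrow> ('o, ('o, 'a, 'k) rel_arr, 'k) lincat" where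
  "T0 C \<delta> =
    \<lparr>Obj = Obj C,
     Arr = {(x, \<phi>, y). x \<in> Obj C \<and> y \<in> Obj C
              \<and> Poly_Mapping.keys \<phi> \<subseteq> subobjects C (prod_obj C x y)},
     Dom = (\<lambda>(x, \<phi>, y). x),
     Cod = (\<lambda>(x, \<phi>, y). y),
     Ident = (\<lambda>x. graph_arr C (Ident C x)),
     Comp = T0_comp C \<delta>,
     Tens_obj = prod_obj C,
     Tens_arr = T0_tens C,
     Unit = terminal_obj C,
     Assoc = (\<lambda>x y z.
       let p = pr1 C (prod_obj C x y) z; q = pr2 C (prod_obj C x y) z
       in graph_arr C (pairing C (pr1 C x y \<cdot>\<^bsub>C\<^esub> p) (pairing C (pr2 C x y \<cdot>\<^bsub>C\<^esub> p) q))),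
     Lunit = (\<lambda>x. graph_arr C (pr2 C (terminal_obj C) x)),
     Runit = (\<lambda>x. graph_arr C (pr1 C x (terminal_obj C))),
     Braid = (\<lambda>x y. graph_arr C (pairing C (pr2 C x y) (pr1 C x y))),
     Hadd = (\<lambda>(x, \<phi>, y) (_, \<psi>, _). (x, \<phi> + \<psi>, y)),
     Hzero = (\<lambda>x y. (x, 0, y)),
     Hscale = (\<lambda>c (x, \<phi>, y). (x, pscale c \<phi>, y))\<rparr>"

text \<open>The functor induced by \<open>F\<close> sends a subobject \<open>r\<close> of \<open>x \<times> y\<close> to \<open>F r\<close>, regarded as a
  subobject of \<open>F x \<times> F y\<close> along the comparison arrow from \<open>F (x \<times> y)\<close> to \<open>F x \<times> F y\<close>.\<close>

definition sub_map ::
  "('o, 'a, 'z) cat_scheme \<Rightarrow> ('p, 'b, 'y) cat_scheme \<Rightarrow> ('o, 'a, 'p, 'b, 'x) ftr_scheme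
    \<Rightarrow> 'o \<Rightarrow> 'o \<Rightarrow> 'a set \<Rightarrow> 'b set" where
  "sub_map C D F x y r = (let m = SOME m. m \<in> r in
    subobject D (pairing D (on_arr F (pr1 C x y \<cdot>\<^bsub>C\<^esub> m)) (on_arr F (pr2 C x y \<cdot>\<^bsub>C\<^esub> m))))"

text \<open>\<open>Mu\<close> and \<open>Eps\<close> are the transposed graphs of the comparison arrows from \<open>F (x \<times> y)\<close> to
  \<open>F x \<times> F y\<close> and from \<open>F 1\<close> to \<open>1\<close>, that is, the graphs of their inverses.\<close>

definition transposed_graph_arr :: "('o, 'a, 'z) cat_scheme \<Rightarrow> 'a \<Rightarrow> ('o, 'a, 'k::field) rel_arr" where
  "transposed_graph_arr C f = (Cod C f,
    Poly_Mapping.single (subobject C (pairing C f (Ident C (Dom C f)))) 1, Dom C f)"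

definition T0_functor ::
  "('o, 'a, 'z) cat_scheme \<Rightarrow> ('p, 'b, 'y) cat_scheme \<Rightarrow> ('o, 'a, 'p, 'b, 'x) ftr_scheme
    \<Rightarrow> ('o, ('o, 'a, 'k::field) rel_arr, 'p, ('p, 'b, 'k) rel_arr) smftr" where
  "T0_functor C D F =
    \<lparr>on_obj = on_obj F,
     on_arr = (\<lambda>(x, \<phi>, y). (on_obj F x,
       \<Sum>r\<in>Poly_Mapping.keys \<phi>. Poly_Mapping.single (sub_map C D F x y r) (Poly_Mapping.lookup \<phi> r),
       on_obj F y)),
     Mu = (\<lambda>x y. transposed_graph_arr D (pairing D (on_arr F (pr1 C x y)) (on_arr F (pr2 C x y)))),
     Eps = transposed_graph_arr D (to_terminal D (on_obj F (terminal_obj C)))\<rparr>"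


section \<open>The additive Karoubi completion\<close>

text \<open>Objects are pairs of a list of objects, standing for their formal direct sum, and an
  idempotent matrix; the entry \<open>(i, j)\<close> of a matrix is an arrow from the \<open>j\<close>-th summand of the
  source to the \<open>i\<close>-th summand of the target.\<close>

type_synonym ('o, 'a) kar_obj = "'o list \<times> 'a mat"
type_synonym ('o, 'a) kar_arr = "('o, 'a) kar_obj \<times> 'a mat \<times> ('o, 'a) kar_obj"

primrec hsum :: "('o, 'a, 'k, 'z) lincat_scheme \<Rightarrow> 'o \<Rightarrow> 'o \<Rightarrow> (nat \<Rightarrow> 'a) \<Rightarrow> nat \<Rightarrow> 'a" where
  "hsum L x y f 0 = Hzero L x y"
| "hsum L x y f (Suc n) = Hadd L (hsum L x y f n) (f n)"

definition hom_mats :: "('o, 'a, 'k, 'z) lincat_scheme \<Rightarrow> 'o list \<Rightarrow> 'o list \<Rightarrow> 'a mat set" where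
  "hom_mats L xs ys = {M \<in> carrier_mat (length ys) (length xs).
    \<forall>i<length ys. \<forall>j<length xs. M $$ (i, j) \<in> Hom L (xs ! j) (ys ! i)}"

definition mat_comp ::
  "('o, 'a, 'k, 'z) lincat_scheme \<Rightarrow> 'o list \<Rightarrow> 'o list \<Rightarrow> 'o list \<Rightarrow> 'a mat \<Rightarrow> 'a mat \<Rightarrow> 'a mat" where
  "mat_comp L xs ys zs N M = mat (length zs) (length xs) (\<lambda>(i, k).
    hsum L (xs ! k) (zs ! i) (\<lambda>j. N $$ (i, j) \<cdot>\<^bsub>L\<^esub> M $$ (j, k)) (length ys))"

definition kar_objs :: "('o, 'a, 'k, 'z) lincat_scheme \<Rightarrow> ('o, 'a) kar_obj set" where
  "kar_objs L = {(xs, E). set xs \<subseteq> Obj L \<and> E \<in> hom_mats L xs xs \<and> mat_comp L xs xs xs E E = E}"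

text \<open>The arrow obtained from a matrix by cutting it down with the idempotents of its source and
  target.\<close>

definition cut ::
  "('o, 'a, 'k, 'z) lincat_scheme \<Rightarrow> ('o, 'a) kar_obj \<Rightarrow> 'a mat \<Rightarrow> ('o, 'a) kar_obj
    \<Rightarrow> ('o, 'a) kar_arr" where
  "cut L X M Y = (X, mat_comp L (fst X) (fst Y) (fst Y) (snd Y)
    (mat_comp L (fst X) (fst X) (fst Y) M (snd X)), Y)"

definition diag_mat ::
  "('o, 'a, 'k, 'z) lincat_scheme \<Rightarrow> 'o list \<Rightarrow> 'o list \<Rightarrow> (nat \<Rightarrow> 'a) \<Rightarrow> 'a mat" where
  "diag_mat L xs ys f = mat (length ys) (length xs) (\<lambda>(i, j).
    if i = j then f i else Hzero L (xs ! j) (ys ! i))"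

text \<open>The summand \<open>(i, j)\<close> of a tensor product has index \<open>i * length ys + j\<close>. With this
  enumeration the two bracketings of a triple tensor product, and the tensor product with the unit,
  have the same list of indices, so that the associator and the unitors are diagonal.\<close>

definition tens_list :: "('o, 'a, 'z) smcat_scheme \<Rightarrow> 'o list \<Rightarrow> 'o list \<Rightarrow> 'o list" where
  "tens_list L xs ys =
    map (\<lambda>k. xs ! (k div length ys) \<boxtimes>\<^bsub>L\<^esub> ys ! (k mod length ys)) [0..<length xs * length ys]"

definition tens_mat :: "('o, 'a, 'z) smcat_scheme \<Rightarrow> 'a mat \<Rightarrow> 'a mat \<Rightarrow> 'a mat" where
  "tens_mat L M N = mat (dim_row M * dim_row N) (dim_col M * dim_col N) (\<lambda>(i, j).
    M $$ (i div dim_row N, j div dim_col N) \<star>\<^bsub>L\<^esub> N $$ (i mod dim_row N, j mod dim_col N))"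

definition kar_tens ::
  "('o, 'a, 'z) smcat_scheme \<Rightarrow> ('o, 'a) kar_obj \<Rightarrow> ('o, 'a) kar_obj \<Rightarrow> ('o, 'a) kar_obj" where
  "kar_tens L X Y = (tens_list L (fst X) (fst Y), tens_mat L (snd X) (snd Y))"

definition kar_unit :: "('o, 'a, 'z) smcat_scheme \<Rightarrow> ('o, 'a) kar_obj" where
  "kar_unit L = ([Unit L], mat 1 1 (\<lambda>_. Ident L (Unit L)))"

definition Karoubi ::
  "('o, 'a, 'k, 'z) lincat_scheme \<Rightarrow> (('o, 'a) kar_obj, ('o, 'a) kar_arr, 'k) lincat" where
  "Karoubi L =
    \<lparr>Obj = kar_objs L,
     Arr = {(X, M, Y). X \<in> kar_objs L \<and> Y \<in> kar_objs L \<and> M \<in> hom_mats L (fst X) (fst Y)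
              \<and> mat_comp L (fst X) (fst Y) (fst Y) (snd Y) M = M
              \<and> mat_comp L (fst X) (fst X) (fst Y) M (snd X) = M},
     Dom = (\<lambda>(X, M, Y). X),
     Cod = (\<lambda>(X, M, Y). Y),
     Ident = (\<lambda>X. (X, snd X, X)),
     Comp = (\<lambda>(Y', N, Z) (X, M, Y). (X, mat_comp L (fst X) (fst Y) (fst Z) N M, Z)),
     Tens_obj = kar_tens L,
     Tens_arr = (\<lambda>(X, M, Y) (X', M', Y'). (kar_tens L X X', tens_mat L M M', kar_tens L Y Y')),
     Unit = kar_unit L,
     Assoc = (\<lambda>X Y Z.
       let U = kar_tens L (kar_tens L X Y) Z; V = kar_tens L X (kar_tens L Y Z);
           m = length (fst Y); n = length (fst Z)
       in cut L U (diag_mat L (fst U) (fst V) (\<lambda>k.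
            Assoc L (fst X ! (k div (m * n))) (fst Y ! (k div n mod m)) (fst Z ! (k mod n)))) V),
     Lunit = (\<lambda>X. let U = kar_tens L (kar_unit L) X
       in cut L U (diag_mat L (fst U) (fst X) (\<lambda>k. Lunit L (fst X ! k))) X),
     Runit = (\<lambda>X. let U = kar_tens L X (kar_unit L)
       in cut L U (diag_mat L (fst U) (fst X) (\<lambda>k. Runit L (fst X ! k))) X),
     Braid = (\<lambda>X Y.
       let U = kar_tens L X Y; V = kar_tens L Y X; m = length (fst X); n = length (fst Y)
       in cut L U (mat (n * m) (m * n) (\<lambda>(i, j).
            if i div m = j mod n \<and> i mod m = j div n
            then Braid L (fst X ! (j div n)) (fst Y ! (j mod n))
            else Hzero L (fst U ! j) (fst V ! i))) V),
     Hadd = (\<lambda>(X, M, Y) (_, N, _). (X, mat (dim_row M) (dim_col M)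
       (\<lambda>ij. Hadd L (M $$ ij) (N $$ ij)), Y)),
     Hzero = (\<lambda>X Y. (X, mat (length (fst Y)) (length (fst X))
       (\<lambda>(i, j). Hzero L (fst X ! j) (fst Y ! i)), Y)),
     Hscale = (\<lambda>c (X, M, Y). (X, map_mat (Hscale L c) M, Y))\<rparr>"

definition Karoubi_functor ::
  "('o, 'a, 'k, 'z) lincat_scheme \<Rightarrow> ('p, 'b, 'k, 'y) lincat_scheme
    \<Rightarrow> ('o, 'a, 'p, 'b, 'x) smftr_scheme
    \<Rightarrow> (('o, 'a) kar_obj, ('o, 'a) kar_arr, ('p, 'b) kar_obj, ('p, 'b) kar_arr) smftr" where
  "Karoubi_functor L L' F =
    (let obj = (\<lambda>X. (map (on_obj F) (fst X), map_mat (on_arr F) (snd X)))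
     in \<lparr>on_obj = obj,
         on_arr = (\<lambda>(X, M, Y). (obj X, map_mat (on_arr F) M, obj Y)),
         Mu = (\<lambda>X Y.
           let U = kar_tens L' (obj X) (obj Y); V = obj (kar_tens L X Y); n = length (fst Y)
           in cut L' U (diag_mat L' (fst U) (fst V)
                (\<lambda>k. Mu F (fst X ! (k div n)) (fst Y ! (k mod n)))) V),
         Eps = cut L' (kar_unit L') (mat 1 1 (\<lambda>_. Eps F)) (obj (kar_unit L))\<rparr>)"

type_synonym ('o, 'a, 'k) tensor_obj = "('o, ('o, 'a, 'k) rel_arr) kar_obj"
type_synonym ('o, 'a, 'k) tensor_arr = "('o, ('o, 'a, 'k) rel_arr) kar_arr"

definition tensor_envelope ::
  "('o, 'a, 'z) cat_scheme \<Rightarrow> ('a \<Rightarrow> 'k::field)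
    \<Rightarrow> (('o, 'a, 'k) tensor_obj, ('o, 'a, 'k) tensor_arr, 'k) lincat" (\<open>\<T>\<close>) where
  "\<T> C \<delta> = Karoubi (T0 C \<delta>)"

definition induced_functor ::
  "('o, 'a, 'z) cat_scheme \<Rightarrow> ('a \<Rightarrow> 'k::field) \<Rightarrow> ('p, 'b, 'y) cat_scheme \<Rightarrow> ('b \<Rightarrow> 'k)
    \<Rightarrow> ('o, 'a, 'p, 'b, 'x) ftr_scheme
    \<Rightarrow> (('o, 'a, 'k) tensor_obj, ('o, 'a, 'k) tensor_arr,
        ('p, 'b, 'k) tensor_obj, ('p, 'b, 'k) tensor_arr) smftr" where
  "induced_functor C \<delta> D \<delta>' F = Karoubi_functor (T0 C \<delta>) (T0 D \<delta>') (T0_functor C D F)"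


section \<open>Vector spaces and representations\<close>

text \<open>The objects are all finite-dimensional vector spaces over the field \<open>'f\<close> whose vectors are
  drawn from the type \<open>'u\<close>. If \<open>'f\<close> is finite and \<open>'u\<close> is infinite, these are all
  finite-dimensional vector spaces up to isomorphism. The fields \<open>mult\<close> and \<open>one\<close> of the
  record type of modules carry no meaning.\<close>

type_synonym ('f, 'u) vect_arr = "('f, 'u) module \<times> ('u \<Rightarrow> 'u) \<times> ('f, 'u) module"

definition Vect :: "(('f::field, 'u) module, ('f, 'u) vect_arr) cat" where
  "Vect =
    (let obj = {V. vectorspace class_ring V \<and> vectorspace.fin_dim class_ring V}
     in \<lparr>Obj = obj,
         Arr = {(V, f, W). V \<in> obj \<and> W \<in> obj \<and> linear_map class_ring V W f
                  \<and> f \<in> extensional (carrier V)},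
         Dom = (\<lambda>(V, f, W). V),
         Cod = (\<lambda>(V, f, W). W),
         Ident = (\<lambda>V. (V, \<lambda>v\<in>carrier V. v, V)),
         Comp = (\<lambda>(W', g, X) (V, f, W). (V, compose (carrier V) g f, X))\<rparr>)"

definition vdim :: "('f::field, 'u) module \<Rightarrow> nat" where
  "vdim V = vectorspace.dim class_ring V"

definition vker :: "('f::field, 'u) vect_arr \<Rightarrow> ('f, 'u) module" where
  "vker = (\<lambda>(V, f, W). V\<lparr>carrier := mod_hom.ker V W f\<rparr>)"

definition deg_Vect :: "'k::field \<Rightarrow> ('f::field, 'u) vect_arr \<Rightarrow> 'k" where
  "deg_Vect t e = t ^ vdim (vker e)"

type_synonym ('f, 'g, 'u) rep = "('f, 'u) module \<times> ('g \<Rightarrow> 'u \<Rightarrow> 'u)"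
type_synonym ('f, 'g, 'u) rep_arr = "('f, 'g, 'u) rep \<times> ('u \<Rightarrow> 'u) \<times> ('f, 'g, 'u) rep"

definition Rep :: "('g, 'm) monoid_scheme \<Rightarrow> (('f::field, 'g, 'u) rep, ('f, 'g, 'u) rep_arr) cat" where
  "Rep G =
    (let obj = {(V, \<rho>). V \<in> Obj Vect \<and> (\<forall>g\<in>carrier G. linear_map class_ring V V (\<rho> g))
           \<and> (\<forall>v\<in>carrier V. \<rho> \<one>\<^bsub>G\<^esub> v = v)
           \<and> (\<forall>g\<in>carrier G. \<forall>h\<in>carrier G. \<forall>v\<in>carrier V. \<rho> (g \<otimes>\<^bsub>G\<^esub> h) v = \<rho> g (\<rho> h v))}
     in \<lparr>Obj = obj,
         Arr = {((V, \<rho>), f, (W, \<sigma>)). (V, \<rho>) \<in> obj \<and> (W, \<sigma>) \<in> obj \<and> (V, f, W) \<in> Arr Vect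
                  \<and> (\<forall>g\<in>carrier G. \<forall>v\<in>carrier V. f (\<rho> g v) = \<sigma> g (f v))},
         Dom = (\<lambda>(S, f, T). S),
         Cod = (\<lambda>(S, f, T). T),
         Ident = (\<lambda>S. (S, \<lambda>v\<in>carrier (fst S). v, S)),
         Comp = (\<lambda>(T', g, U) (S, f, T). (S, compose (carrier (fst S)) g f, U))\<rparr>)"

definition subrep :: "('f, 'g, 'u) rep \<Rightarrow> 'u set \<Rightarrow> ('f, 'g, 'u) rep" where
  "subrep S U = ((fst S)\<lparr>carrier := U\<rparr>, snd S)"

definition invariant_subspace ::
  "('g, 'm) monoid_scheme \<Rightarrow> ('f::field, 'g, 'u) rep \<Rightarrow> 'u set \<Rightarrow> bool" where
  "invariant_subspace G S U \<longleftrightarrow> VectorSpace.subspace class_ring U (fst S)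
    \<and> (\<forall>g\<in>carrier G. \<forall>u\<in>U. snd S g u \<in> U)"

definition irreducible_rep :: "('g, 'm) monoid_scheme \<Rightarrow> ('f::field, 'g, 'u) rep \<Rightarrow> bool" where
  "irreducible_rep G S \<longleftrightarrow> S \<in> Obj (Rep G) \<and> carrier (fst S) \<noteq> {\<zero>\<^bsub>fst S\<^esub>}
    \<and> (\<forall>U. invariant_subspace G S U \<longrightarrow> U = {\<zero>\<^bsub>fst S\<^esub>} \<or> U = carrier (fst S))"

definition Irr :: "('g, 'm) monoid_scheme \<Rightarrow> ('f::field, 'g, 'u) rep set set" where
  "Irr G = {{T \<in> Obj (Rep G). isomorphic (Rep G) T S} | S. irreducible_rep G S}"

definition irr_dim :: "('f::field, 'g, 'u) rep set \<Rightarrow> nat" where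
  "irr_dim I = vdim (fst (SOME S. S \<in> I))"

text \<open>\<open>S\<close> is the internal direct sum of the irreducible subrepresentations
  \<open>U 0, \<dots>, U (n - 1)\<close>.\<close>

definition irr_decomposition ::
  "('g, 'm) monoid_scheme \<Rightarrow> ('f::field, 'g, 'u) rep \<Rightarrow> nat \<Rightarrow> (nat \<Rightarrow> 'u set) \<Rightarrow> bool" where
  "irr_decomposition G S n U \<longleftrightarrow>
    (\<forall>i<n. invariant_subspace G S (U i) \<and> irreducible_rep G (subrep S (U i))) \<and>
    bij_betw (\<lambda>u. \<Oplus>\<^bsub>fst S\<^esub>i\<in>{..<n}. u i) (Pi\<^sub>E {..<n} U) (carrier (fst S))"

definition multiplicity_in ::
  "('g, 'm) monoid_scheme \<Rightarrow> ('f::field, 'g, 'u) rep \<Rightarrow> ('f, 'g, 'u) rep set \<Rightarrow> nat" where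
  "multiplicity_in G S I =
    (THE k. \<exists>n U. irr_decomposition G S n U \<and> k = card {i. i < n \<and> subrep S (U i) \<in> I})"

definition rker :: "('f::field, 'g, 'u) rep_arr \<Rightarrow> ('f, 'g, 'u) rep" where
  "rker = (\<lambda>(S, f, T). subrep S (mod_hom.ker (fst S) (fst T) f))"

definition deg_Rep ::
  "('g, 'm) monoid_scheme \<Rightarrow> (('f::field, 'g, 'u) rep set \<Rightarrow> 'k::field)
    \<Rightarrow> ('f, 'g, 'u) rep_arr \<Rightarrow> 'k" where
  "deg_Rep G \<tau> e = (\<Prod>I\<in>Irr G. \<tau> I ^ multiplicity_in G (rker e) I)"

definition tau_of :: "'k::field \<Rightarrow> ('f::field, 'g, 'u) rep set \<Rightarrow> 'k" where
  "tau_of t I = t ^ irr_dim I"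

definition t_of ::
  "('g, 'm) monoid_scheme \<Rightarrow> (('f::field, 'g, 'u) rep set \<Rightarrow> 'k::field) \<Rightarrow> 'k" where
  "t_of G \<tau> = (\<Prod>I\<in>Irr G. \<tau> I ^ irr_dim I)"

definition Rep_GL ::
  "'k::field \<Rightarrow> ((('f::field, 'u) module, ('f, 'u) vect_arr, 'k) tensor_obj,
    (('f, 'u) module, ('f, 'u) vect_arr, 'k) tensor_arr, 'k) lincat" where
  "Rep_GL t = \<T> Vect (deg_Vect t)"

text \<open>The field \<open>'f\<close> is a splitting field for \<open>G\<close>: the endomorphisms of the irreducible
  representations are the scalars. In general, if \<open>G\<close> is finite and the characteristic does not
  divide its order, the multiplicity of \<open>I\<close> in \<open>F[G]\<close> is \<open>dim I / dim (End I)\<close>; it equals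
  the exponent \<open>dim I\<close> in \<open>t_of\<close> for every irreducible \<open>I\<close> if and only if \<open>'f\<close> is a
  splitting field.\<close>

definition splitting_field ::
  "('g, 'm) monoid_scheme \<Rightarrow> 'f::field itself \<Rightarrow> 'u itself \<Rightarrow> bool" where
  "splitting_field G _ _ \<longleftrightarrow>
    (\<forall>(S :: ('f, 'g, 'u) rep) f. irreducible_rep G S \<and> (S, f, S) \<in> Arr (Rep G)
      \<longrightarrow> (\<exists>c. \<forall>v\<in>carrier (fst S). f v = c \<odot>\<^bsub>fst S\<^esub> v))"


subsection \<open>Restriction and induction\<close>

definition Res ::
  "(('f::field, 'g, 'u) rep, ('f, 'g, 'u) rep_arr, ('f, 'u) module, ('f, 'u) vect_arr) ftr" where
  "Res = \<lparr>on_obj = fst, on_arr = (\<lambda>(S, f, T). (fst S, f, fst T))\<rparr>"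

text \<open>Since \<open>F[G]\<close> has the basis \<open>G\<close>, every element of \<open>F[G] \<otimes> V\<close> is uniquely of the form
  \<open>\<Sum>g. g \<otimes> v g\<close>; it is represented by the function \<open>v\<close> from \<open>G\<close> to \<open>V\<close>. An element \<open>h\<close>
  of \<open>G\<close> maps it to \<open>\<Sum>g. h g \<otimes> v g\<close>, whose coefficient at \<open>g\<close> is \<open>v (inv h \<otimes> g)\<close>.\<close>

definition ind_module ::
  "('g, 'm) monoid_scheme \<Rightarrow> ('f::field, 'u) module \<Rightarrow> ('f, 'g \<Rightarrow> 'u) module" where
  "ind_module G V =
    \<lparr>carrier = carrier G \<rightarrow>\<^sub>E carrier V,
     mult = (\<lambda>v w. \<lambda>g\<in>carrier G. \<zero>\<^bsub>V\<^esub>),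
     one = (\<lambda>g\<in>carrier G. \<zero>\<^bsub>V\<^esub>),
     zero = (\<lambda>g\<in>carrier G. \<zero>\<^bsub>V\<^esub>),
     add = (\<lambda>v w. \<lambda>g\<in>carrier G. v g \<oplus>\<^bsub>V\<^esub> w g),
     smult = (\<lambda>c v. \<lambda>g\<in>carrier G. c \<odot>\<^bsub>V\<^esub> v g)\<rparr>"

definition ind_rep ::
  "('g, 'm) monoid_scheme \<Rightarrow> ('f::field, 'u) module \<Rightarrow> ('f, 'g, 'g \<Rightarrow> 'u) rep" where
  "ind_rep G V =
    (ind_module G V, \<lambda>h v. \<lambda>g\<in>carrier G. v (inv\<^bsub>G\<^esub> h \<otimes>\<^bsub>G\<^esub> g))"

definition Ind ::
  "('g, 'm) monoid_scheme
    \<Rightarrow> (('f::field, 'u) module, ('f, 'u) vect_arr,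
        ('f, 'g, 'g \<Rightarrow> 'u) rep, ('f, 'g, 'g \<Rightarrow> 'u) rep_arr) ftr" where
  "Ind G =
    \<lparr>on_obj = ind_rep G,
     on_arr = (\<lambda>(V, f, W). (ind_rep G V,
       \<lambda>v\<in>carrier G \<rightarrow>\<^sub>E carrier V. \<lambda>g\<in>carrier G. f (v g), ind_rep G W))\<rparr>"

text \<open>The bilinear map \<open>(a, v) \<mapsto> a \<otimes> v\<close> from \<open>F[G] \<times> V\<close> to \<open>F[G] \<otimes> V\<close>, where an element
  of \<open>F[G]\<close> is the function of its coefficients, and its universal property.\<close>

definition ptens ::
  "('g, 'm) monoid_scheme \<Rightarrow> ('f::field, 'u) module \<Rightarrow> ('g \<Rightarrow> 'f) \<Rightarrow> 'u \<Rightarrow> 'g \<Rightarrow> 'u" where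
  "ptens G V a v = (\<lambda>g\<in>carrier G. a g \<odot>\<^bsub>V\<^esub> v)"

lemma ind_rep_ptens:
  assumes "group G" "h \<in> carrier G"
  shows "snd (ind_rep G V) h (ptens G V a v) = ptens G V (\<lambda>g\<in>carrier G. a (inv\<^bsub>G\<^esub> h \<otimes>\<^bsub>G\<^esub> g)) v"
proof -
  interpret group G by fact
  show ?thesis using assms(2) by (auto simp: ind_rep_def ptens_def)
qed

lemma ind_module_universal:
  fixes V :: "('f::field, 'u) module" and W :: "('f, 'w) module" and G :: "('g, 'm) monoid_scheme"
  defines "FG \<equiv> carrier G \<rightarrow>\<^sub>E (UNIV :: 'f set)"
  assumes fin: "finite (carrier G)"
    and V: "vectorspace class_ring V" and W: "vectorspace class_ring W"
    and B: "\<And>a v. \<lbrakk>a \<in> FG; v \<in> carrier V\<rbrakk> \<Longrightarrow> B a v \<in> carrier W"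
    and B_add1: "\<And>a b v. \<lbrakk>a \<in> FG; b \<in> FG; v \<in> carrier V\<rbrakk>
      \<Longrightarrow> B (\<lambda>g\<in>carrier G. a g + b g) v = B a v \<oplus>\<^bsub>W\<^esub> B b v"
    and B_smult1: "\<And>c a v. \<lbrakk>a \<in> FG; v \<in> carrier V\<rbrakk>
      \<Longrightarrow> B (\<lambda>g\<in>carrier G. c * a g) v = c \<odot>\<^bsub>W\<^esub> B a v"
    and B_add2: "\<And>a v w. \<lbrakk>a \<in> FG; v \<in> carrier V; w \<in> carrier V\<rbrakk>
      \<Longrightarrow> B a (v \<oplus>\<^bsub>V\<^esub> w) = B a v \<oplus>\<^bsub>W\<^esub> B a w"
    and B_smult2: "\<And>c a v. \<lbrakk>a \<in> FG; v \<in> carrier V\<rbrakk> \<Longrightarrow> B a (c \<odot>\<^bsub>V\<^esub> v) = c \<odot>\<^bsub>W\<^esub> B a v"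
  shows "\<exists>!T. T \<in> LinearCombinations.module_hom class_ring (ind_module G V) W \<inter> extensional (carrier (ind_module G V))
    \<and> (\<forall>a\<in>FG. \<forall>v\<in>carrier V. T (ptens G V a v) = B a v)"
proof -
  interpret V: vectorspace class_ring V by fact
  interpret W: vectorspace class_ring W by fact
  let ?I = "carrier (ind_module G V)"
  have I: "?I = carrier G \<rightarrow>\<^sub>E carrier V" by (simp add: ind_module_def)
  define e where "e g = (\<lambda>h\<in>carrier G. if h = g then 1 else (0::'f))" for g
  have e: "e g \<in> FG" for g by (auto simp: e_def FG_def)
  define T where "T = (\<lambda>\<phi>\<in>?I. \<Oplus>\<^bsub>W\<^esub>g\<in>carrier G. B (e g) (\<phi> g))"
  have Be: "B (e g) (\<phi> g) \<in> carrier W" if "\<phi> \<in> ?I" "g \<in> carrier G" for \<phi> g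
    using that B[OF e] unfolding I by auto
  have hom: "T \<in> LinearCombinations.module_hom class_ring (ind_module G V) W"
    unfolding LinearCombinations.module_hom_def
  proof (intro CollectI conjI allI impI)
    show "T \<in> ?I \<rightarrow> carrier W"
      by (auto simp: T_def intro!: W.finsum_closed Be)
  next
    fix \<phi> \<psi> assume *: "\<phi> \<in> ?I \<and> \<psi> \<in> ?I"
    have s: "\<phi> \<oplus>\<^bsub>ind_module G V\<^esub> \<psi> = (\<lambda>g\<in>carrier G. \<phi> g \<oplus>\<^bsub>V\<^esub> \<psi> g)"
      by (simp add: ind_module_def)
    have m: "\<phi> g \<in> carrier V" "\<psi> g \<in> carrier V" if "g \<in> carrier G" for g
      using * that unfolding I by auto
    have sI: "\<phi> \<oplus>\<^bsub>ind_module G V\<^esub> \<psi> \<in> ?I"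
      unfolding s I using m by auto
    have "T (\<phi> \<oplus>\<^bsub>ind_module G V\<^esub> \<psi>)
        = (\<Oplus>\<^bsub>W\<^esub>g\<in>carrier G. B (e g) (\<phi> g) \<oplus>\<^bsub>W\<^esub> B (e g) (\<psi> g))"
      using sI m e * unfolding T_def s
      by (auto intro!: W.finsum_cong' W.add.m_closed Be simp: B_add2)
    also have "\<dots> = T \<phi> \<oplus>\<^bsub>W\<^esub> T \<psi>"
      using * Be unfolding T_def by (simp add: W.finsum_addf Pi_def)
    finally show "T (\<phi> \<oplus>\<^bsub>ind_module G V\<^esub> \<psi>) = T \<phi> \<oplus>\<^bsub>W\<^esub> T \<psi>" .
  next
    fix c :: 'f and \<phi> assume *: "c \<in> carrier class_ring \<and> \<phi> \<in> ?I"
    have s: "c \<odot>\<^bsub>ind_module G V\<^esub> \<phi> = (\<lambda>g\<in>carrier G. c \<odot>\<^bsub>V\<^esub> \<phi> g)"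
      by (simp add: ind_module_def)
    have m: "\<phi> g \<in> carrier V" if "g \<in> carrier G" for g
      using * that unfolding I by auto
    have sI: "c \<odot>\<^bsub>ind_module G V\<^esub> \<phi> \<in> ?I"
      unfolding s I using m by auto
    have "T (c \<odot>\<^bsub>ind_module G V\<^esub> \<phi>) = (\<Oplus>\<^bsub>W\<^esub>g\<in>carrier G. c \<odot>\<^bsub>W\<^esub> B (e g) (\<phi> g))"
      using sI m e * unfolding T_def s
      by (auto intro!: W.finsum_cong' W.smult_closed Be simp: B_smult2)
    also have "\<dots> = c \<odot>\<^bsub>W\<^esub> T \<phi>"
      using * Be fin unfolding T_def by (simp add: W.finsum_smult_ldistr Pi_def)
    finally show "T (c \<odot>\<^bsub>ind_module G V\<^esub> \<phi>) = c \<odot>\<^bsub>W\<^esub> T \<phi>" .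
  qed
  have B0: "B (\<lambda>g\<in>carrier G. 0) v = \<zero>\<^bsub>W\<^esub>" if "v \<in> carrier V" for v
  proof -
    have "(\<lambda>g\<in>carrier G. (0::'f)) = (\<lambda>g\<in>carrier G. 0 * e g g)" by auto
    then have "B (\<lambda>g\<in>carrier G. 0) v = B (\<lambda>g\<in>carrier G. 0 * e undefined g) v" by simp
    also have "\<dots> = 0 \<odot>\<^bsub>W\<^esub> B (e undefined) v" by (rule B_smult1[OF e that])
    also have "\<dots> = \<zero>\<^bsub>W\<^esub>" using W.lmult_0[of "B (e undefined) v"] B[OF e that] by simp
    finally show ?thesis .
  qed
  have expand: "(\<Oplus>\<^bsub>W\<^esub>g\<in>A. a g \<odot>\<^bsub>W\<^esub> B (e g) v) = B (\<lambda>g\<in>carrier G. if g \<in> A then a g else 0) v"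
    if "A \<subseteq> carrier G" "v \<in> carrier V" for A a v
    using finite_subset[OF that(1) fin] that(1)
  proof (induction A rule: finite_induct)
    case empty
    then show ?case using B0[OF that(2)] by (simp add: restrict_def)
  next
    case (insert x A)
    have "(\<Oplus>\<^bsub>W\<^esub>g\<in>insert x A. a g \<odot>\<^bsub>W\<^esub> B (e g) v)
        = a x \<odot>\<^bsub>W\<^esub> B (e x) v \<oplus>\<^bsub>W\<^esub> (\<Oplus>\<^bsub>W\<^esub>g\<in>A. a g \<odot>\<^bsub>W\<^esub> B (e g) v)"
      using insert.hyps B[OF e that(2)] by (intro W.finsum_insert) (auto intro!: W.smult_closed)
    also have "\<dots> = B (\<lambda>g\<in>carrier G. a x * e x g) v
        \<oplus>\<^bsub>W\<^esub> B (\<lambda>g\<in>carrier G. if g \<in> A then a g else 0) v"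
      using insert.IH insert.prems unfolding B_smult1[OF e that(2)] by (simp add: restrict_def)
    also have "\<dots> = B (\<lambda>g\<in>carrier G. (\<lambda>g\<in>carrier G. a x * e x g) g
        + (\<lambda>g\<in>carrier G. if g \<in> A then a g else 0) g) v"
      by (rule B_add1[symmetric]) (auto simp: FG_def that(2))
    also have "(\<lambda>g\<in>carrier G. (\<lambda>g\<in>carrier G. a x * e x g) g
        + (\<lambda>g\<in>carrier G. if g \<in> A then a g else 0) g)
        = (\<lambda>g\<in>carrier G. if g \<in> insert x A then a g else 0)"
      using insert.hyps by (auto simp: e_def)
    finally show ?case .
  qed
  have pure: "T (ptens G V a v) = B a v" if a: "a \<in> FG" and v: "v \<in> carrier V" for a v
  proof -
    have "ptens G V a v \<in> ?I" using v by (auto simp: I ptens_def)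
    then have "T (ptens G V a v) = (\<Oplus>\<^bsub>W\<^esub>g\<in>carrier G. a g \<odot>\<^bsub>W\<^esub> B (e g) v)"
      unfolding T_def using v e B
      by (auto intro!: W.finsum_cong' W.smult_closed simp: ptens_def B_smult2)
    also have "\<dots> = B (\<lambda>g\<in>carrier G. if g \<in> carrier G then a g else 0) v"
      by (rule expand) (use v in auto)
    also have "(\<lambda>g\<in>carrier G. if g \<in> carrier G then a g else 0) = a"
      using a by (auto simp: FG_def PiE_def extensional_def)
    finally show ?thesis .
  qed
  have uniq: "T' \<phi> = T'' \<phi>"
    if T': "T' \<in> LinearCombinations.module_hom class_ring (ind_module G V) W"
      "\<forall>a\<in>FG. \<forall>v\<in>carrier V. T' (ptens G V a v) = B a v"
    and T'': "T'' \<in> LinearCombinations.module_hom class_ring (ind_module G V) W"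
      "\<forall>a\<in>FG. \<forall>v\<in>carrier V. T'' (ptens G V a v) = B a v"
    and \<phi>: "\<phi> \<in> ?I" for T' T'' \<phi>
  proof -
    have "T' (\<lambda>g\<in>carrier G. if g \<in> A then \<phi> g else \<zero>\<^bsub>V\<^esub>)
        = T'' (\<lambda>g\<in>carrier G. if g \<in> A then \<phi> g else \<zero>\<^bsub>V\<^esub>)" if "A \<subseteq> carrier G" for A
      using finite_subset[OF that fin] that
    proof (induction A rule: finite_induct)
      case empty
      have "(\<lambda>g\<in>carrier G. if g \<in> {} then \<phi> g else \<zero>\<^bsub>V\<^esub>) = ptens G V (e undefined) \<zero>\<^bsub>V\<^esub>"
        by (auto simp: ptens_def)
      then show ?case using T'(2) T''(2) e by simp
    next
      case (insert x A)
      have mem: "\<phi> g \<in> carrier V" if "g \<in> carrier G" for g using \<phi> that unfolding I by auto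
      let ?f = "\<lambda>g\<in>carrier G. if g \<in> A then \<phi> g else \<zero>\<^bsub>V\<^esub>"
      have eq: "(\<lambda>g\<in>carrier G. if g \<in> insert x A then \<phi> g else \<zero>\<^bsub>V\<^esub>)
          = ptens G V (e x) (\<phi> x) \<oplus>\<^bsub>ind_module G V\<^esub> ?f"
        using insert.hyps insert.prems mem V.lmult_0 V.smult_one
        by (auto simp: ptens_def ind_module_def e_def fun_eq_iff)
      have x: "ptens G V (e x) (\<phi> x) \<in> ?I" "?f \<in> ?I"
        using mem insert.prems by (auto simp: ptens_def I)
      have IH: "T' ?f = T'' ?f" using insert by (simp add: restrict_def)
      have "B (e x) (\<phi> x) = T' (ptens G V (e x) (\<phi> x))"
        "B (e x) (\<phi> x) = T'' (ptens G V (e x) (\<phi> x))"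
        using insert.prems T'(2) T''(2) e mem by simp_all
      then show ?case unfolding eq
        by (metis IH LinearCombinations.module_hom_add[OF T'(1) x]
            LinearCombinations.module_hom_add[OF T''(1) x])
    qed
    from this[of "carrier G"] have "T' (\<lambda>g\<in>carrier G. \<phi> g) = T'' (\<lambda>g\<in>carrier G. \<phi> g)"
      by (simp cong: restrict_cong)
    moreover have "(\<lambda>g\<in>carrier G. \<phi> g) = \<phi>" using \<phi> unfolding I by auto
    ultimately show ?thesis by simp
  qed
  show ?thesis
  proof (rule ex1I[of _ T], goal_cases)
    case 1
    have "T \<in> extensional ?I" by (simp add: T_def)
    then show ?case using hom pure by blast
  next
    case (2 T')
    show ?case
    proof (rule extensionalityI[where A = ?I])
      show "T' \<in> extensional ?I" "T \<in> extensional ?I" using 2 by (simp_all add: T_def)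
      show "T' \<phi> = T \<phi>" if "\<phi> \<in> ?I" for \<phi>
        using uniq[OF _ _ hom _ that] 2 pure by blast
    qed
  qed
qed

end

(* Over a finite field every object is a finite set of vectors, so a subobject of x * y is an invariant
linear relation and composition in T^0 is composition of relations, weighted by the degree of the kernel
of r *_y s -> r * s. Multiplying a degree along exact sequences makes these weights a cocycle, whence T^0;
its Karoubi completion is treated for an arbitrary additive symmetric monoidal category.
The vectors of Res V and Ind V are families of vectors of V, so both functors act on relations
componentwise and preserve pullbacks, composition and weights. For the degrees, Maschke's theorem makes
|Hom(-, I)| multiplicative on exact sequences, so that |Hom(V, I)| = |End I|^[V : I]; this yields
dim V = sum_I [V : I] dim I, and Frobenius reciprocity yields [Ind V : I] = dim I * dim V when End I
is the field. *)


theory Submission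
 imports Defs
begin

section \<open>The additive Karoubi completion of a symmetric monoidal category\<close>

text \<open>Everything that \<open>T0\<close> mentions is chosen only up to isomorphism: products by
  \<open>SOME\<close>, subobjects as classes of monomorphisms, composites through some pullback and
  some image. A subobject of a product is therefore replaced by the set of pairs of vectors that it
  represents. This set is independent of all choices, and an identity between arrows of
  \<open>T0\<close> becomes an identity of relations together with a comparison of coefficients. A
  degree enters only through a value attached to objects, multiplicative on exact sequences, so one
  criterion builds the degree functions of both categories. The functors need not carry a chosen
  product to the chosen product of the images, nor the chosen terminal object to the chosen one; the
  comparison arrows have to be followed through every coherence law. Induction also changes the type
  of vectors from \<open>'u\<close> to \<open>'g => 'u\<close>, so source and target are kept
  independent throughout. Finite cardinalities stand in for dimensions and for the uniqueness of
  decompositions, because an exponent can be read off from a power of a base greater than 1.\<close>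

locale additive_smc = symmetric_monoidal_category L
 for L :: "('o, 'o \<times> 'h::ab_group_add \<times> 'o, 'k, 'z) lincat_scheme" (structure) +
 fixes H :: "'o => 'o => 'h set"
 assumes Arr_eq: "Arr L = {(x, \<phi>, y). x : Obj L & y : Obj L & \<phi> : H x y}"
  and Dom_eq: "Dom L = (%(x, \<phi>, y). x)"
  and Cod_eq: "Cod L = (%(x, \<phi>, y). y)"
  and Hadd_eq: "Hadd L = (%(x, \<phi>, y) (_, \<psi>, _). (x, \<phi> + \<psi>, y))"
  and Hzero_eq: "Hzero L = (%x y. (x, 0, y))"
  and H_zero: "[|x : Obj L; y : Obj L|] ==> 0 : H x y"
  and H_add: "[|\<phi> : H x y; \<psi> : H x y|] ==> \<phi> + \<psi> : H x y"
  and comp_add_left: "[|f : Hom L x y; g : Hom L y z; g' : Hom L y z|]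
   ==> Hadd L g g' \<cdot> f = Hadd L (g \<cdot> f) (g' \<cdot> f)"
  and comp_add_right: "[|f : Hom L x y; f' : Hom L x y; g : Hom L y z|]
   ==> g \<cdot> Hadd L f f' = Hadd L (g \<cdot> f) (g \<cdot> f')"
  and tens_add_left: "[|f : Hom L x y; f' : Hom L x y; g : Hom L z w|]
   ==> Hadd L f f' \<star> g = Hadd L (f \<star> g) (f' \<star> g)"
  and tens_add_right: "[|f : Hom L x y; g : Hom L z w; g' : Hom L z w|]
   ==> f \<star> Hadd L g g' = Hadd L (f \<star> g) (f \<star> g')"
begin

abbreviation "obs xs == set xs <= Obj L"

lemma Hom_eq: "Hom L x y = {(x, \<phi>, y) | \<phi>. x : Obj L & y : Obj L & \<phi> : H x y}"
 by (auto simp: Hom_def Arr_eq Dom_eq Cod_eq)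

lemma Hom_obj: "f : Hom L x y ==> x : Obj L & y : Obj L"
 by (auto simp: Hom_eq)

lemma Hzero_hom: "[|x : Obj L; y : Obj L|] ==> Hzero L x y : Hom L x y"
 by (auto simp: Hom_eq Hzero_eq H_zero)

text \<open>In a group, zero is the only element with a + a = a. Preservation of zero arrows by
  composition, by tensor products and later by functors thus follows from additivity.\<close>

lemma Hadd_self_eq_imp_zero:
 assumes "f : Hom L x y" "Hadd L f f = f"
 shows "f = Hzero L x y"
 using assms by (auto simp: Hom_eq Hadd_eq Hzero_eq)

lemma Hadd_Hzero: "[|x : Obj L; y : Obj L|] ==> Hadd L (Hzero L x y) (Hzero L x y) = Hzero L x y"
 by (auto simp: Hadd_eq Hzero_eq)

lemma comp_zero_left: "[|f : Hom L x y; z : Obj L|] ==> Hzero L y z \<cdot> f = Hzero L x z"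
 by (rule Hadd_self_eq_imp_zero)
  (metis Hom_obj Hzero_hom comp_hom, metis Hadd_Hzero Hom_obj Hzero_hom comp_add_left)

lemma comp_zero_right: "[|x : Obj L; g : Hom L y z|] ==> g \<cdot> Hzero L x y = Hzero L x z"
 by (rule Hadd_self_eq_imp_zero)
  (metis Hom_obj Hzero_hom comp_hom, metis Hadd_Hzero Hom_obj Hzero_hom comp_add_right)

lemma tens_zero_left:
 "[|x : Obj L; y : Obj L; g : Hom L z w|] ==> Hzero L x y \<star> g = Hzero L (x \<boxtimes> z) (y \<boxtimes> w)"
 by (rule Hadd_self_eq_imp_zero)
  (metis Hzero_hom tens_hom, metis Hadd_Hzero Hzero_hom tens_add_left)

lemma tens_zero_right:
 "[|x : Obj L; y : Obj L; g : Hom L z w|] ==> g \<star> Hzero L x y = Hzero L (z \<boxtimes> x) (w \<boxtimes> y)"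
 by (rule Hadd_self_eq_imp_zero)
  (metis Hzero_hom tens_hom, metis Hadd_Hzero Hzero_hom tens_add_right)

text \<open>\<open>hsum\<close> adds in a fixed order over an initial segment; sums over arbitrary
  finite sets can be reindexed and interchanged. Source and target are arguments because an empty
  sum still has to be an arrow between two given objects.\<close>

definition asum :: "'o => 'o => ('i => 'o \<times> 'h \<times> 'o) => 'i set => 'o \<times> 'h \<times> 'o" where
 "asum x y f A = (x, \<Sum>a\<in>A. fst (snd (f a)), y)"

lemma hsum_eq_asum: "hsum L x y f n = asum x y f {..<n}"
 by (induction n) (auto simp: asum_def Hzero_eq Hadd_eq add.commute split: prod.splits)

lemma asum_empty: "asum x y f {} = Hzero L x y"
 by (simp add: asum_def Hzero_eq)

lemma asum_insert:
 "[|finite A; a \<notin> A; f a : Hom L x y|] ==> asum x y f (insert a A) = Hadd L (f a) (asum x y f A)"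
 by (auto simp: asum_def Hadd_eq Hom_eq)

lemma asum_cong: "(!!a. a : A ==> f a = g a) ==> asum x y f A = asum x y g A"
 by (simp add: asum_def cong: sum.cong)

lemma asum_hom:
 assumes "x : Obj L" "y : Obj L" "!!a. a : A ==> f a : Hom L x y"
 shows "asum x y f A : Hom L x y"
proof -
have "fst (snd (f a)) : H x y" if "a : A" for a
 using assms(3)[OF that] by (auto simp: Hom_eq)
then have "(\<Sum>a\<in>A. fst (snd (f a))) : H x y"
 by (induction A rule: infinite_finite_induct) (use assms(1,2) in "auto simp: H_zero intro!: H_add")
then show ?thesis using assms(1,2) by (auto simp: asum_def Hom_eq)
qed

lemma comp_asum_right:
 assumes "finite A" "g : Hom L y z" "x : Obj L" "!!a. a : A ==> f a : Hom L x y"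
 shows "g \<cdot> asum x y f A = asum x z (%a. g \<cdot> f a) A"
 using assms(1,4)
proof (induction A rule: finite_induct)
case empty
then show ?case using assms(2,3) by (simp add: asum_empty comp_zero_right)
next
case (insert a A)
then show ?case using assms(2,3) Hom_obj[OF assms(2)]
 by (simp add: asum_insert comp_add_right[OF _ asum_hom] comp_hom[of _ x y])
qed

lemma comp_asum_left:
 assumes "finite A" "f : Hom L x y" "z : Obj L" "!!a. a : A ==> g a : Hom L y z"
 shows "asum y z g A \<cdot> f = asum x z (%a. g a \<cdot> f) A"
 using assms(1,4)
proof (induction A rule: finite_induct)
case empty
then show ?case using assms(2,3) by (simp add: asum_empty comp_zero_left)
next
case (insert a A)
then show ?case using assms(2,3) Hom_obj[OF assms(2)]
 by (simp add: asum_insert comp_add_left[OF _ _ asum_hom] comp_hom[of _ x y])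
qed

lemma tens_asum_left:
 assumes "finite A" "g : Hom L z w" "x : Obj L" "y : Obj L" "!!a. a : A ==> f a : Hom L x y"
 shows "asum x y f A \<star> g = asum (x \<boxtimes> z) (y \<boxtimes> w) (%a. f a \<star> g) A"
 using assms(1,5)
proof (induction A rule: finite_induct)
case empty
then show ?case using assms by (simp add: asum_empty tens_zero_left)
next
case (insert a A)
then show ?case using assms(2-4)
 by (simp add: asum_insert tens_add_left[OF _ asum_hom] tens_hom)
qed

lemma tens_asum_right:
 assumes "finite A" "g : Hom L z w" "x : Obj L" "y : Obj L" "!!a. a : A ==> f a : Hom L x y"
 shows "g \<star> asum x y f A = asum (z \<boxtimes> x) (w \<boxtimes> y) (%a. g \<star> f a) A"
 using assms(1,5)
proof (induction A rule: finite_induct)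
case empty
then show ?case using assms by (simp add: asum_empty tens_zero_right)
next
case (insert a A)
then show ?case using assms(2-4)
 by (simp add: asum_insert tens_add_right[OF _ _ asum_hom] tens_hom)
qed

lemma asum_swap:
 "asum x y (%a. asum u v (f a) B) A = asum x y (%b. asum u v (%a. f a b) A) B"
 by (simp add: asum_def) (rule sum.swap)

lemma asum_delta:
 assumes "finite A" "b : A" "f b : Hom L x y"
 shows "asum x y (%a. if a = b then f a else Hzero L x y) A = f b"
proof -
have "(\<Sum>a\<in>A. fst (snd (if a = b then f a else Hzero L x y))) = (\<Sum>a\<in>A. if a = b then fst (snd (f a)) else 0)"
 by (rule sum.cong) (auto simp: Hzero_eq)
then show ?thesis using assms by (auto simp: asum_def Hom_eq)
qed

lemma mult_add_less: "[|i < m; j < n|] ==> i * n + j < m * (n::nat)"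
 by (metis add_less_cancel_left add.commute dual_order.strict_trans1 mult.commute mult_Suc_right mult_le_mono2 Suc_leI)

text \<open>Row-major numbering, \<open>k\<close> standing for the pair of its quotient and its
  remainder. It merges the two sums in a tensor product of matrix products into the one sum over a
  tensor list.\<close>

lemma asum_mult:
 "asum x y (%k. f (k div n) (k mod n)) {..<m * n}
  = asum x y (%i. asum x y (f i) {..<n}) {..<m::nat}"
proof (cases "n = 0")
case False
have "(\<Sum>k<m * n. fst (snd (f (k div n) (k mod n)))) = (\<Sum>(i,j)\<in>{..<m} \<times> {..<n}. fst (snd (f i j)))"
 using False
 by (intro sum.reindex_bij_witness[of _ "%(i, j). i * n + j" "%k. (k div n, k mod n)"])
  (auto simp: less_mult_imp_div_less mult_add_less)
then show ?thesis by (simp add: asum_def sum.cartesian_product)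
qed (simp add: asum_def)


subsection \<open>Matrices\<close>

abbreviation mc where "mc \<equiv> mat_comp L"

lemma hom_mats_entry:
 "[|M : hom_mats L xs ys; i < length ys; j < length xs|] ==> M $$ (i, j) : Hom L (xs ! j) (ys ! i)"
 by (auto simp: hom_mats_def)

lemma hom_mats_dim:
 "M : hom_mats L xs ys ==> dim_row M = length ys" "M : hom_mats L xs ys ==> dim_col M = length xs"
 by (auto simp: hom_mats_def)

lemma mat_hom_matsI:
 "(!!i j. [|i < length ys; j < length xs|] ==> f (i, j) : Hom L (xs ! j) (ys ! i))
  ==> mat (length ys) (length xs) f : hom_mats L xs ys"
 by (auto simp: hom_mats_def)

lemma mc_index: "[|i < length zs; k < length xs|] ==>
 mc xs ys zs N M $$ (i, k) = asum (xs ! k) (zs ! i) (%j. N $$ (i, j) \<cdot> M $$ (j, k)) {..<length ys}"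
 by (simp add: mat_comp_def hsum_eq_asum)

lemma mc_dim: "dim_row (mc xs ys zs N M) = length zs" "dim_col (mc xs ys zs N M) = length xs"
 by (simp_all add: mat_comp_def)

lemma mc_hom:
 assumes "M : hom_mats L xs ys" "N : hom_mats L ys zs" "obs xs" "obs zs"
 shows "mc xs ys zs N M : hom_mats L xs zs"
 unfolding mat_comp_def hsum_eq_asum using assms
 by (intro mat_hom_matsI) (auto intro!: asum_hom comp_hom dest: hom_mats_entry nth_mem)

text \<open>Distributivity writes both sides as sums over all pairs of intermediate indices; after
  interchanging the two sums, associativity in \<open>L\<close> remains.\<close>

lemma mc_assoc:
 assumes "M : hom_mats L ws xs" "N : hom_mats L xs ys" "P : hom_mats L ys zs"
  and "obs ws" "obs xs" "obs ys" "obs zs"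
 shows "mc ws xs zs (mc xs ys zs P N) M = mc ws ys zs P (mc ws xs ys N M)"
proof (rule eq_matI, goal_cases)
case (1 i k)
then have i: "i < length zs" and k: "k < length ws" by (auto simp: mc_dim)
note obj = assms(4-7)[THEN subsetD, OF nth_mem]
note ent = assms(1-3)[THEN hom_mats_entry]
have "mc ws xs zs (mc xs ys zs P N) M $$ (i, k)
  = asum (ws ! k) (zs ! i) (%j. asum (xs ! j) (zs ! i) (%l. P $$ (i, l) \<cdot> N $$ (l, j)) {..<length ys}
    \<cdot> M $$ (j, k)) {..<length xs}"
 using i k by (auto simp: mc_index intro!: asum_cong)
also have "... = asum (ws ! k) (zs ! i) (%j. asum (ws ! k) (zs ! i)
  (%l. P $$ (i, l) \<cdot> N $$ (l, j) \<cdot> M $$ (j, k)) {..<length ys}) {..<length xs}"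
 using i k obj ent by (intro asum_cong comp_asum_left) (auto intro: comp_hom[OF ent(2) ent(3)])
also have "... = asum (ws ! k) (zs ! i) (%l. asum (ws ! k) (zs ! i)
  (%j. P $$ (i, l) \<cdot> N $$ (l, j) \<cdot> M $$ (j, k)) {..<length xs}) {..<length ys}"
 by (rule asum_swap)
also have "... = asum (ws ! k) (zs ! i) (%l. asum (ws ! k) (zs ! i)
  (%j. P $$ (i, l) \<cdot> (N $$ (l, j) \<cdot> M $$ (j, k))) {..<length xs}) {..<length ys}"
 using i k ent by (intro asum_cong comp_assoc) auto
also have "... = asum (ws ! k) (zs ! i) (%l. P $$ (i, l) \<cdot> asum (ws ! k) (ys ! l)
  (%j. N $$ (l, j) \<cdot> M $$ (j, k)) {..<length xs}) {..<length ys}"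
 using i k obj ent by (intro asum_cong comp_asum_right[symmetric]) (auto intro: comp_hom[OF ent(1) ent(2)])
also have "... = mc ws ys zs P (mc ws xs ys N M) $$ (i, k)"
 using i k by (auto simp: mc_index intro!: asum_cong)
finally show ?case .
qed (simp_all add: mc_dim)

section \<open>Tensor products of lists and of matrices\<close>

abbreviation tl where "tl \<equiv> tens_list L"
abbreviation tm where "tm \<equiv> tens_mat L"

lemma tens_list_length: "length (tl xs ys) = length xs * length ys"
 by (simp add: tens_list_def)

lemma tens_list_nth:
 "k < length xs * length ys ==> tl xs ys ! k = xs ! (k div length ys) \<boxtimes> ys ! (k mod length ys)"
 by (simp add: tens_list_def)

lemma mult_add_div_mod: "j < n ==> (i * n + j) div n = (i::nat)" "j < n ==> (i * n + j) mod n = (j::nat)"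
 by auto

lemma div_mod_less:
 assumes "k < m * (n::nat)" shows "k div n < m" "k mod n < n"
 using assms by (auto simp: less_mult_imp_div_less intro!: mod_less_divisor gr0I)

lemma tens_list_obj:
 assumes "obs xs" "obs ys" shows "set (tl xs ys) <= Obj L"
proof -
have "tl xs ys ! k : Obj L" if "k < length xs * length ys" for k
 using that assms div_mod_less[OF that] by (auto simp: tens_list_nth intro!: tens_obj)
then show ?thesis by (auto simp: in_set_conv_nth tens_list_length)
qed

lemma tm_dim: "dim_row (tm M N) = dim_row M * dim_row N" "dim_col (tm M N) = dim_col M * dim_col N"
 by (simp_all add: tens_mat_def)

lemma tm_index: "[|i < dim_row M * dim_row N; j < dim_col M * dim_col N|] ==> tm M N $$ (i, j) =
  M $$ (i div dim_row N, j div dim_col N) \<star> N $$ (i mod dim_row N, j mod dim_col N)"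
 by (simp add: tens_mat_def)

lemma tm_hom:
 assumes "M : hom_mats L xs ys" "M' : hom_mats L xs' ys'"
 shows "tm M M' : hom_mats L (tl xs xs') (tl ys ys')"
 using assms[THEN hom_mats_dim(1)] assms[THEN hom_mats_dim(2)] assms[THEN hom_mats_entry] div_mod_less
 by (auto simp: hom_mats_def tm_dim tm_index tens_list_length tens_list_nth intro!: tens_hom)

text \<open>Bilinearity of the tensor product expands both inner sums, the interchange law of
  \<open>L\<close> applies to each term, and the double sum over \<open>ys\<close> and
  \<open>ys'\<close> is one sum over the tensor list.\<close>

lemma tm_mc:
 assumes "M : hom_mats L xs ys" "N : hom_mats L ys zs" "M' : hom_mats L xs' ys'" "N' : hom_mats L ys' zs'"
  and "obs xs" "obs ys" "obs zs"
  and "set xs' <= Obj L" "set ys' <= Obj L" "set zs' <= Obj L"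
 shows "tm (mc xs ys zs N M) (mc xs' ys' zs' N' M')
  = mc (tl xs xs') (tl ys ys') (tl zs zs') (tm N N') (tm M M')"
proof (rule eq_matI, goal_cases)
case (1 i k)
define i1 i2 k1 k2 where "i1 = i div length zs'" "i2 = i mod length zs'"
 "k1 = k div length xs'" "k2 = k mod length xs'"
have i: "i < length zs * length zs'" and k: "k < length xs * length xs'"
 using 1 by (auto simp: mc_dim tens_list_length)
have ik: "i1 < length zs" "i2 < length zs'" "k1 < length xs" "k2 < length xs'"
 using div_mod_less[OF i] div_mod_less[OF k] by (auto simp: i1_i2_k1_k2_def)
note obj = assms(5-10)[THEN subsetD, OF nth_mem]
note ent = assms(1-4)[THEN hom_mats_entry]
note dim = assms(1-4)[THEN hom_mats_dim(1)] assms(1-4)[THEN hom_mats_dim(2)]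
have NM: "N $$ (i1, j) \<cdot> M $$ (j, k1) : Hom L (xs ! k1) (zs ! i1)" if "j < length ys" for j
 using comp_hom[OF ent(1) ent(2)] that ik by simp
have NM': "N' $$ (i2, j) \<cdot> M' $$ (j, k2) : Hom L (xs' ! k2) (zs' ! i2)" if "j < length ys'" for j
 using comp_hom[OF ent(3) ent(4)] that ik by simp
let ?x = "xs ! k1 \<boxtimes> xs' ! k2" and ?z = "zs ! i1 \<boxtimes> zs' ! i2"
have "tm (mc xs ys zs N M) (mc xs' ys' zs' N' M') $$ (i, k)
 = asum (xs ! k1) (zs ! i1) (%j. N $$ (i1, j) \<cdot> M $$ (j, k1)) {..<length ys}
  \<star> asum (xs' ! k2) (zs' ! i2) (%j. N' $$ (i2, j) \<cdot> M' $$ (j, k2)) {..<length ys'}"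
 using i k ik by (simp add: tm_index mc_dim mc_index i1_i2_k1_k2_def)
also have "... = asum ?x ?z (%j. (N $$ (i1, j) \<cdot> M $$ (j, k1))
  \<star> asum (xs' ! k2) (zs' ! i2) (%j. N' $$ (i2, j) \<cdot> M' $$ (j, k2)) {..<length ys'}) {..<length ys}"
 using ik obj NM NM' by (intro tens_asum_left asum_hom) auto
also have "... = asum ?x ?z (%j. asum ?x ?z (%j'. (N $$ (i1, j) \<cdot> M $$ (j, k1))
  \<star> (N' $$ (i2, j') \<cdot> M' $$ (j', k2))) {..<length ys'}) {..<length ys}"
 using ik obj NM NM' by (intro asum_cong tens_asum_right) auto
also have "... = asum ?x ?z (%j. asum ?x ?z (%j'. (N $$ (i1, j) \<star> N' $$ (i2, j'))
  \<cdot> (M $$ (j, k1) \<star> M' $$ (j', k2))) {..<length ys'}) {..<length ys}"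
 using ik ent by (intro asum_cong tens_comp) auto
also have "... = asum ?x ?z (%l. (N $$ (i1, l div length ys') \<star> N' $$ (i2, l mod length ys'))
  \<cdot> (M $$ (l div length ys', k1) \<star> M' $$ (l mod length ys', k2))) {..<length ys * length ys'}"
 by (rule asum_mult[symmetric])
also have "... = mc (tl xs xs') (tl ys ys') (tl zs zs') (tm N N') (tm M M') $$ (i, k)"
 using i k ik
 by (auto simp: mc_index tens_list_length tens_list_nth tm_index dim i1_i2_k1_k2_def intro!: asum_cong)
finally show ?case .
qed (use assms in "simp_all add: mc_dim tm_dim tens_list_length")

text \<open>Matrices with at most one nonzero entry in each row: the row \<open>i\<close> has the entry \<open>f i\<close> in
 the column \<open>\<sigma> i\<close>. All structure arrows of the completion are of this form.\<close>

definition mono_mat where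
 "mono_mat xs ys \<sigma> f = mat (length ys) (length xs)
  (%(i, j). if j = \<sigma> i then f i else Hzero L (xs ! j) (ys ! i))"

definition row_ok where
 "row_ok xs ys \<sigma> f \<longleftrightarrow> (\<forall>i<length ys. \<sigma> i < length xs & f i : Hom L (xs ! \<sigma> i) (ys ! i))"

lemma diag_mat_eq_mono: "diag_mat L xs ys f = mono_mat xs ys (%i. i) f"
 by (auto simp: diag_mat_def mono_mat_def)

lemma mono_mat_cong:
 "(!!i. i < length ys ==> \<sigma> i = \<sigma>' i & f i = f' i) ==> mono_mat xs ys \<sigma> f = mono_mat xs ys \<sigma>' f'"
 by (auto simp: mono_mat_def)

lemma mono_mat_hom:
 "[|row_ok xs ys \<sigma> f; obs xs; obs ys|] ==> mono_mat xs ys \<sigma> f : hom_mats L xs ys"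
 unfolding mono_mat_def row_ok_def by (rule mat_hom_matsI) (auto intro!: Hzero_hom dest: nth_mem)

lemma mono_mat_comp:
 assumes "row_ok ys zs \<sigma> f" "M : hom_mats L xs ys"
  and "obs xs" "obs ys" "obs zs"
 shows "mc xs ys zs (mono_mat ys zs \<sigma> f) M
  = mat (length zs) (length xs) (%(i, k). f i \<cdot> M $$ (\<sigma> i, k))"
proof (rule eq_matI, goal_cases)
case (1 i k)
then have i: "i < length zs" and k: "k < length xs" by auto
have \<sigma>: "\<sigma> i < length ys" "f i : Hom L (ys ! \<sigma> i) (zs ! i)" using assms(1) i by (auto simp: row_ok_def)
have "mc xs ys zs (mono_mat ys zs \<sigma> f) M $$ (i, k) = asum (xs ! k) (zs ! i)
  (%j. if j = \<sigma> i then f i \<cdot> M $$ (j, k) else Hzero L (xs ! k) (zs ! i)) {..<length ys}"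
 using i k hom_mats_entry[OF assms(2)] assms(5)[THEN subsetD, OF nth_mem]
 by (auto simp: mc_index mono_mat_def intro!: asum_cong comp_zero_left)
also have "... = f i \<cdot> M $$ (\<sigma> i, k)"
 using \<sigma> hom_mats_entry[OF assms(2) \<sigma>(1) k] by (intro asum_delta) (auto intro: comp_hom)
finally show ?case using i k by simp
qed (simp_all add: mc_dim)

text \<open>Such a matrix controls its rows, whereas a product with it on the right sees its
  columns; these have one nonzero entry each because \<open>\<tau>\<close> inverts
  \<open>\<sigma>\<close>.\<close>

lemma comp_mono_mat:
 assumes "row_ok xs ys \<sigma> f" "M : hom_mats L ys zs"
  and \<tau>: "!!j k. [|j < length ys; k < length xs|] ==> k = \<sigma> j \<longleftrightarrow> j = \<tau> k"
   "!!k. k < length xs ==> \<tau> k < length ys"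
  and "obs xs" "obs ys" "obs zs"
 shows "mc xs ys zs M (mono_mat xs ys \<sigma> f)
  = mat (length zs) (length xs) (%(i, k). M $$ (i, \<tau> k) \<cdot> f (\<tau> k))"
proof (rule eq_matI, goal_cases)
case (1 i k)
then have i: "i < length zs" and k: "k < length xs" by auto
have f: "f (\<tau> k) : Hom L (xs ! k) (ys ! \<tau> k)"
 using assms(1) \<tau>(1)[OF \<tau>(2)[OF k] k] \<tau>(2)[OF k] by (auto simp: row_ok_def)
have "mc xs ys zs M (mono_mat xs ys \<sigma> f) $$ (i, k) = asum (xs ! k) (zs ! i)
  (%j. if j = \<tau> k then M $$ (i, j) \<cdot> f j else Hzero L (xs ! k) (zs ! i)) {..<length ys}"
 using i k \<tau> hom_mats_entry[OF assms(2)] assms(5)[THEN subsetD, OF nth_mem]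
 by (auto simp: mc_index mono_mat_def intro!: asum_cong comp_zero_right)
also have "... = M $$ (i, \<tau> k) \<cdot> f (\<tau> k)"
 using \<tau>(2)[OF k] f hom_mats_entry[OF assms(2) i \<tau>(2)[OF k]] by (intro asum_delta) (auto intro: comp_hom)
finally show ?case using i k by simp
qed (simp_all add: mc_dim)

lemma row_ok_comp:
 "[|row_ok ys zs \<sigma> f; row_ok xs ys \<sigma>' g|] ==> row_ok xs zs (%i. \<sigma>' (\<sigma> i)) (%i. f i \<cdot> g (\<sigma> i))"
 by (auto simp: row_ok_def intro!: comp_hom)

lemma mono_mat_mono_mat:
 assumes "row_ok ys zs \<sigma> f" "row_ok xs ys \<sigma>' g"
  and "obs xs" "obs ys" "obs zs"
 shows "mc xs ys zs (mono_mat ys zs \<sigma> f) (mono_mat xs ys \<sigma>' g)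
  = mono_mat xs zs (%i. \<sigma>' (\<sigma> i)) (%i. f i \<cdot> g (\<sigma> i))"
proof -
have "f i \<cdot> Hzero L (xs ! k) (ys ! \<sigma> i) = Hzero L (xs ! k) (zs ! i)"
 if "i < length zs" "k < length xs" for i k
 using that assms by (intro comp_zero_right) (auto simp: row_ok_def)
then show ?thesis
 unfolding mono_mat_comp[OF assms(1) mono_mat_hom[OF assms(2-4)] assms(3-5)]
 using assms(1) by (intro eq_matI) (auto simp: mono_mat_def row_ok_def)
qed

lemma row_ok_tens:
 assumes "row_ok xs ys \<sigma> f" "row_ok xs' ys' \<sigma>' f'"
 shows "row_ok (tl xs xs') (tl ys ys')
  (%k. \<sigma> (k div length ys') * length xs' + \<sigma>' (k mod length ys'))
  (%k. f (k div length ys') \<star> f' (k mod length ys'))"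
 unfolding row_ok_def tens_list_length
proof (intro allI impI)
fix k assume k: "k < length ys * length ys'"
let ?i = "k div length ys'" and ?i' = "k mod length ys'"
have 1: "\<sigma> ?i < length xs" "f ?i : Hom L (xs ! \<sigma> ?i) (ys ! ?i)"
 "\<sigma>' ?i' < length xs'" "f' ?i' : Hom L (xs' ! \<sigma>' ?i') (ys' ! ?i')"
 using assms div_mod_less[OF k] by (auto simp: row_ok_def)
then have "\<sigma> ?i * length xs' + \<sigma>' ?i' < length xs * length xs'" by (intro mult_add_less)
then show "\<sigma> ?i * length xs' + \<sigma>' ?i' < length xs * length xs' &
  f ?i \<star> f' ?i' : Hom L (tl xs xs' ! (\<sigma> ?i * length xs' + \<sigma>' ?i')) (tl ys ys' ! k)"
 using 1 k by (simp add: tens_list_nth tens_hom mult_add_div_mod del: div_mult_self3 div_mult_self4)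
qed

lemma tm_mono_mat:
 assumes "row_ok xs ys \<sigma> f" "row_ok xs' ys' \<sigma>' f'"
  and "obs xs" "obs ys" "set xs' <= Obj L" "set ys' <= Obj L"
 shows "tm (mono_mat xs ys \<sigma> f) (mono_mat xs' ys' \<sigma>' f') = mono_mat (tl xs xs') (tl ys ys')
  (%k. \<sigma> (k div length ys') * length xs' + \<sigma>' (k mod length ys'))
  (%k. f (k div length ys') \<star> f' (k mod length ys'))" (is "?l = ?r")
proof (rule eq_matI, goal_cases)
case (1 i k)
then have i: "i < length ys * length ys'" and k: "k < length xs * length xs'"
 by (auto simp: mono_mat_def tens_list_length)
let ?i = "i div length ys'" and ?i' = "i mod length ys'"
let ?k = "k div length xs'" and ?k' = "k mod length xs'"
note ik = div_mod_less[OF i] div_mod_less[OF k]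
have 1: "\<sigma> ?i < length xs" "f ?i : Hom L (xs ! \<sigma> ?i) (ys ! ?i)"
 "\<sigma>' ?i' < length xs'" "f' ?i' : Hom L (xs' ! \<sigma>' ?i') (ys' ! ?i')"
 using assms(1,2) ik by (auto simp: row_ok_def)
note obj = assms(3-6)[THEN subsetD, OF nth_mem]
have eq: "k = \<sigma> ?i * length xs' + \<sigma>' ?i' \<longleftrightarrow> ?k = \<sigma> ?i & ?k' = \<sigma>' ?i'"
 using 1(3) by (metis add.commute add_cancel_right_left div_less div_mult_mod_eq div_mult_self3 less_nat_zero_code
   mod_less mod_mult_self3)
have "?l $$ (i, k) = (if ?k = \<sigma> ?i then f ?i else Hzero L (xs ! ?k) (ys ! ?i))
  \<star> (if ?k' = \<sigma>' ?i' then f' ?i' else Hzero L (xs' ! ?k') (ys' ! ?i'))"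
 using i k ik by (simp add: tm_index mono_mat_def)
also have "... = ?r $$ (i, k)"
 using i k ik 1 obj eq Hzero_hom
 by (auto simp: mono_mat_def tens_list_length tens_list_nth intro!: tens_zero_left tens_zero_right)
finally show ?case .
qed (simp_all add: mono_mat_def tm_dim tens_list_length)

text \<open>The two bracketings of a triple tensor product read the same three digits from
  \<open>k\<close>. The equations include empty lists because \<open>k div 0 = 0\<close> and
  \<open>k mod 0 = k\<close>.\<close>

lemma index_simps:
 "k div (m * n) = k div n div (m::nat)"
 "k mod (m * n) div n = k div n mod (m::nat)"
 "k mod (m * n) mod n = k mod (n::nat)"
 by (cases "n = 0"; simp add: div_mult2_eq mult.commute[of m n] mod_mult2_eq)+

section \<open>The coherence isomorphisms as matrices\<close>

definition "idm xs = mono_mat xs xs (%i. i) (%i. Ident L (xs ! i))"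

definition "assoc_mat xs ys zs = mono_mat (tl (tl xs ys) zs) (tl xs (tl ys zs)) (%k. k)
 (%k. Assoc L (xs ! (k div length zs div length ys)) (ys ! (k div length zs mod length ys))
  (zs ! (k mod length zs)))"

definition "lunit_mat xs = mono_mat (tl [Unit L] xs) xs (%k. k) (%k. Lunit L (xs ! k))"

definition "runit_mat xs = mono_mat (tl xs [Unit L]) xs (%k. k) (%k. Runit L (xs ! k))"

text \<open>A row \<open>i\<close> of the target has the digits \<open>i div length xs\<close> in
  \<open>ys\<close> and \<open>i mod length xs\<close> in \<open>xs\<close>; its only nonzero entry
  is in the column with these digits exchanged.\<close>

definition "braid_mat xs ys = mono_mat (tl xs ys) (tl ys xs)
 (%i. (i mod length xs) * length ys + i div length xs)
 (%i. Braid L (xs ! (i mod length xs)) (ys ! (i div length xs)))"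

lemma idm_row: "obs xs ==> row_ok xs xs (%i. i) (%i. Ident L (xs ! i))"
 by (auto simp: row_ok_def intro!: ident_hom)

lemma nth3:
 assumes "k < length xs * (length ys * length zs)"
 shows "tl (tl xs ys) zs ! k = xs ! (k div length zs div length ys) \<boxtimes> ys ! (k div length zs mod length ys)
   \<boxtimes> zs ! (k mod length zs)" (is ?P)
  and "tl xs (tl ys zs) ! k = xs ! (k div length zs div length ys) \<boxtimes> (ys ! (k div length zs mod length ys)
   \<boxtimes> zs ! (k mod length zs))" (is ?P1)
  and "k div length zs div length ys < length xs" (is ?P2) "k div length zs mod length ys < length ys"
   "k mod length zs < length zs"
proof -
have k: "k < length xs * length ys * length zs" using assms by (simp add: mult.assoc)
note 1 = div_mod_less[OF k]
note 2 = div_mod_less[OF 1(1)] div_mod_less[OF assms]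
show ?P
 using 1 2 k by (simp add: tens_list_nth tens_list_length)
show ?P1
 using 1 2 assms by (simp add: tens_list_nth tens_list_length index_simps)
show ?P2 "k div length zs mod length ys < length ys"
  "k mod length zs < length zs"
 using 1 2 by auto
qed

lemma assoc_row:
 assumes "obs xs" "obs ys" "obs zs"
 shows "row_ok (tl (tl xs ys) zs) (tl xs (tl ys zs)) (%k. k)
  (%k. Assoc L (xs ! (k div length zs div length ys)) (ys ! (k div length zs mod length ys))
  (zs ! (k mod length zs)))"
 using assms[THEN subsetD, OF nth_mem] assoc_hom
 by (auto simp: row_ok_def tens_list_length nth3 mult.assoc)

lemma lunit_row:
 assumes "obs xs" shows "row_ok (tl [Unit L] xs) xs (%k. k) (%k. Lunit L (xs ! k))"
 using assms[THEN subsetD, OF nth_mem] lunit_hom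
 by (auto simp: row_ok_def tens_list_length tens_list_nth)

lemma runit_row:
 assumes "obs xs" shows "row_ok (tl xs [Unit L]) xs (%k. k) (%k. Runit L (xs ! k))"
 using assms[THEN subsetD, OF nth_mem] runit_hom
 by (auto simp: row_ok_def tens_list_length tens_list_nth)

lemma braid_row:
 assumes "obs xs" "obs ys"
 shows "row_ok (tl xs ys) (tl ys xs)
  (%i. (i mod length xs) * length ys + i div length xs)
  (%i. Braid L (xs ! (i mod length xs)) (ys ! (i div length xs)))"
 unfolding row_ok_def tens_list_length
proof (intro allI impI)
fix i assume i: "i < length ys * length xs"
note d = div_mod_less[OF i]
show "i mod length xs * length ys + i div length xs < length xs * length ys &
 Braid L (xs ! (i mod length xs)) (ys ! (i div length xs))
  : Hom L (tl xs ys ! (i mod length xs * length ys + i div length xs)) (tl ys xs ! i)"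
 using d i assms[THEN subsetD, OF nth_mem] mult_add_less[OF d(2,1)]
 by (simp add: tens_list_nth mult_add_div_mod braid_hom)
qed

lemmas coh_defs = idm_def assoc_mat_def lunit_mat_def runit_mat_def braid_mat_def

lemma unit_list_obj: "set [Unit L] <= Obj L"
 by (simp add: unit_obj)

lemma coh_homs:
 assumes "obs xs" "obs ys" "obs zs"
 shows "idm xs : hom_mats L xs xs"
  "assoc_mat xs ys zs : hom_mats L (tl (tl xs ys) zs) (tl xs (tl ys zs))"
  "lunit_mat xs : hom_mats L (tl [Unit L] xs) xs"
  "runit_mat xs : hom_mats L (tl xs [Unit L]) xs"
  "braid_mat xs ys : hom_mats L (tl xs ys) (tl ys xs)"
 unfolding coh_defs
 by (rule mono_mat_hom[OF idm_row] mono_mat_hom[OF assoc_row] mono_mat_hom[OF lunit_row]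
    mono_mat_hom[OF runit_row] mono_mat_hom[OF braid_row]; intro tens_list_obj assms unit_list_obj)+

lemma mc_idm_left:
 assumes "M : hom_mats L xs ys" "obs xs" "obs ys"
 shows "mc xs ys ys (idm ys) M = M"
 unfolding idm_def mono_mat_comp[OF idm_row[OF assms(3)] assms(1,2,3,3)]
 by (rule eq_matI)
  (use ident_left[OF hom_mats_entry[OF assms(1)]] in "auto simp: hom_mats_dim[OF assms(1)]")

lemma mc_idm_right:
 assumes "M : hom_mats L xs ys" "obs xs" "obs ys"
 shows "mc xs xs ys M (idm xs) = M"
 unfolding idm_def
 by (subst comp_mono_mat[where \<tau> = "%k. k", OF idm_row[OF assms(2)] assms(1) _ _ assms(2,2,3)])
  (use ident_right[OF hom_mats_entry[OF assms(1)]] in "auto simp: hom_mats_dim[OF assms(1)] intro!: eq_matI")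

text \<open>Inverting the diagonal entries suffices. Only the existence of an inverse is recorded,
  since \<open>cut_iso\<close> does not look at its form.\<close>

lemma diag_inverse:
 assumes "row_ok xs ys (%k. k) f" "length xs = length ys" "!!k. k < length ys ==> is_iso L (f k)"
  and "obs xs" "obs ys"
 shows "EX N:hom_mats L ys xs. mc xs ys xs N (mono_mat xs ys (%k. k) f) = idm xs
  & mc ys xs ys (mono_mat xs ys (%k. k) f) N = idm ys"
proof -
have "\<forall>k<length ys. EX j:Hom L (ys ! k) (xs ! k). j \<cdot> f k = Ident L (xs ! k) & f k \<cdot> j = Ident L (ys ! k)"
 using assms(1,3) by (fastforce simp: is_iso_def row_ok_def Hom_def)
then obtain g where g: "!!k. k < length ys ==> g k : Hom L (ys ! k) (xs ! k)"
 "!!k. k < length ys ==> g k \<cdot> f k = Ident L (xs ! k)" "!!k. k < length ys ==> f k \<cdot> g k = Ident L (ys ! k)"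
 by metis
have r: "row_ok ys xs (%k. k) g" using g assms(2) by (simp add: row_ok_def)
show ?thesis
 by (rule bexI[OF _ mono_mat_hom[OF r assms(5,4)]])
  (use assms g r in "auto simp: mono_mat_mono_mat idm_def intro!: mono_mat_cong")
qed

section \<open>Naturality of the coherence matrices\<close>

lemma assoc_mat_natural:
 assumes M: "M : hom_mats L xs xs'" "N : hom_mats L ys ys'" "P : hom_mats L zs zs'"
  and "obs xs" "obs ys" "obs zs"
  and "set xs' <= Obj L" "set ys' <= Obj L" "set zs' <= Obj L"
 shows "mc (tl (tl xs ys) zs) (tl (tl xs' ys') zs') (tl xs' (tl ys' zs')) (assoc_mat xs' ys' zs') (tm (tm M N) P)
  = mc (tl (tl xs ys) zs) (tl xs (tl ys zs)) (tl xs' (tl ys' zs')) (tm M (tm N P)) (assoc_mat xs ys zs)"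
 unfolding assoc_mat_def
  mono_mat_comp[OF assoc_row[OF assms(7-9)] tm_hom[OF tm_hom[OF M(1,2)] M(3)]
   tens_list_obj[OF tens_list_obj[OF assms(4,5)] assms(6)]
   tens_list_obj[OF tens_list_obj[OF assms(7,8)] assms(9)]
   tens_list_obj[OF assms(7) tens_list_obj[OF assms(8,9)]]]
proof (subst comp_mono_mat[OF assoc_row[OF assms(4-6)] tm_hom[OF M(1) tm_hom[OF M(2,3)]],
  where \<tau> = "%k. k"], goal_cases)
case 6
show ?case
proof (rule cong_mat, simp, simp, unfold tens_list_length prod.case)
 fix i k assume "i < length xs' * (length ys' * length zs')" "k < length xs * length ys * length zs"
 then have i: "i < length xs' * (length ys' * length zs')" and k: "k < length xs * (length ys * length zs)"
  by (simp_all add: mult.assoc)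
 note ent = M[THEN hom_mats_entry]
 note dim = M[THEN hom_mats_dim(1)] M[THEN hom_mats_dim(2)]
 note n = nth3(3-5)[OF i] nth3(3-5)[OF k]
 have l: "i < length xs' * length ys' * length zs'" "k < length xs * length ys * length zs"
  using i k by (simp_all add: mult.assoc)
 show "Assoc L (xs' ! (i div length zs' div length ys')) (ys' ! (i div length zs' mod length ys'))
    (zs' ! (i mod length zs')) \<cdot> tm (tm M N) P $$ (i, k)
  = tm M (tm N P) $$ (i, k) \<cdot> Assoc L (xs ! (k div length zs div length ys))
    (ys ! (k div length zs mod length ys)) (zs ! (k mod length zs))"
  using assoc_natural[OF ent(1)[OF n(1) n(4)] ent(2)[OF n(2) n(5)] ent(3)[OF n(3) n(6)]]
   div_mod_less[OF i] div_mod_less[OF k] div_mod_less[OF l(1)] div_mod_less[OF l(2)] i k l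
  by (simp add: tm_index tm_dim dim index_simps)
qed
qed (use assms in "simp_all add: tens_list_obj tens_list_length mult.assoc eq_commute")

lemma lunit_mat_natural:
 assumes M: "M : hom_mats L xs ys" and "obs xs" "obs ys"
 shows "mc (tl [Unit L] xs) (tl [Unit L] ys) ys (lunit_mat ys) (tm (idm [Unit L]) M)
  = mc (tl [Unit L] xs) xs ys M (lunit_mat xs)"
 unfolding lunit_mat_def
  mono_mat_comp[OF lunit_row[OF assms(3)] tm_hom[OF coh_homs(1)[OF unit_list_obj unit_list_obj unit_list_obj] M]
   tens_list_obj[OF unit_list_obj assms(2)] tens_list_obj[OF unit_list_obj assms(3)] assms(3)]
proof (subst comp_mono_mat[OF lunit_row[OF assms(2)] M, where \<tau> = "%k. k"], goal_cases)
case 6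
show ?case
 using lunit_natural[OF hom_mats_entry[OF M]]
 by (intro cong_mat)
  (auto simp: tm_index hom_mats_dim[OF M] tens_list_length idm_def mono_mat_def)
qed (use assms in "auto simp: tens_list_obj tens_list_length unit_list_obj unit_obj")

lemma runit_mat_natural:
 assumes M: "M : hom_mats L xs ys" and "obs xs" "obs ys"
 shows "mc (tl xs [Unit L]) (tl ys [Unit L]) ys (runit_mat ys) (tm M (idm [Unit L]))
  = mc (tl xs [Unit L]) xs ys M (runit_mat xs)"
 unfolding runit_mat_def
  mono_mat_comp[OF runit_row[OF assms(3)] tm_hom[OF M coh_homs(1)[OF unit_list_obj unit_list_obj unit_list_obj]]
   tens_list_obj[OF assms(2) unit_list_obj] tens_list_obj[OF assms(3) unit_list_obj] assms(3)]
proof (subst comp_mono_mat[OF runit_row[OF assms(2)] M, where \<tau> = "%k. k"], goal_cases)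
case 6
show ?case
 using runit_natural[OF hom_mats_entry[OF M]]
 by (intro cong_mat)
  (auto simp: tm_index hom_mats_dim[OF M] tens_list_length idm_def mono_mat_def)
qed (use assms in "auto simp: tens_list_obj tens_list_length unit_list_obj unit_obj")

lemma swap_index:
 assumes "i < m * (n::nat)"
 shows "(i mod n) * m + i div n < n * m"
  "((i mod n) * m + i div n) div m = i mod n" "((i mod n) * m + i div n) mod m = i div n"
 using div_mod_less[OF assms] mult_add_less[of "i mod n" n "i div n" m] by (auto simp: mult_add_div_mod)

text \<open>Exchanging the two digits is a bijection between the index sets of the two orders; this
  supplies the inverse \<open>\<tau>\<close> that \<open>comp_mono_mat\<close> asks for.\<close>

lemma swap_index_iff:
 assumes "i < m * (n::nat)" "k < n * m"
 shows "k = (i mod n) * m + i div n \<longleftrightarrow> i = (k mod m) * n + k div m"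
 using swap_index[OF assms(1)] swap_index[OF assms(2)]
 by (metis div_mult_mod_eq)

lemma braid_mat_natural:
 assumes M: "M : hom_mats L xs xs'" and N: "N : hom_mats L ys ys'"
  and "obs xs" "obs ys" "set xs' <= Obj L" "set ys' <= Obj L"
 shows "mc (tl xs ys) (tl xs' ys') (tl ys' xs') (braid_mat xs' ys') (tm M N)
  = mc (tl xs ys) (tl ys xs) (tl ys' xs') (tm N M) (braid_mat xs ys)"
 unfolding braid_mat_def mono_mat_comp[OF braid_row[OF assms(5,6)] tm_hom[OF M N] tens_list_obj[OF assms(3,4)]
   tens_list_obj[OF assms(5,6)] tens_list_obj[OF assms(6,5)]]
proof (subst comp_mono_mat[OF braid_row[OF assms(3,4)] tm_hom[OF N M],
  where \<tau> = "%k. (k mod length ys) * length xs + k div length ys"], goal_cases)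
case 6
show ?case
proof (rule cong_mat, simp, simp, unfold tens_list_length prod.case)
 fix i k assume i: "i < length ys' * length xs'" and k: "k < length xs * length ys"
 note n = div_mod_less[OF i] div_mod_less[OF k]
 note ent = hom_mats_entry[OF M n(2,3)] hom_mats_entry[OF N n(1,4)]
 show "Braid L (xs' ! (i mod length xs')) (ys' ! (i div length xs'))
   \<cdot> tm M N $$ (i mod length xs' * length ys' + i div length xs', k)
  = tm N M $$ (i, k mod length ys * length xs + k div length ys)
   \<cdot> Braid L (xs ! ((k mod length ys * length xs + k div length ys) mod length xs))
     (ys ! ((k mod length ys * length xs + k div length ys) div length xs))"
  using braid_natural[OF ent] i k n swap_index[OF i] swap_index[OF k]
  by (simp add: tm_index hom_mats_dim[OF M] hom_mats_dim[OF N])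
qed
next
case (1 j k)
then show ?case unfolding tens_list_length by (rule swap_index_iff)
next
case (2 k)
then show ?case unfolding tens_list_length by (rule swap_index)
qed (use assms in "auto simp: tens_list_obj")

section \<open>Coherence laws for matrices\<close>

lemma braid_mat_symmetric:
 assumes "obs xs" "obs ys"
 shows "mc (tl xs ys) (tl ys xs) (tl xs ys) (braid_mat ys xs) (braid_mat xs ys) = idm (tl xs ys)"
 unfolding braid_mat_def idm_def mono_mat_mono_mat[OF braid_row[OF assms(2,1)] braid_row[OF assms]
  tens_list_obj[OF assms] tens_list_obj[OF assms(2,1)] tens_list_obj[OF assms]]
proof (rule mono_mat_cong, unfold tens_list_length, goal_cases)
case (1 i)
then show ?case
 using div_mod_less[OF 1] swap_index[OF 1] assms[THEN subsetD, OF nth_mem]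
 by (simp add: tens_list_nth braid_symmetric)
qed

text \<open>All matrices involved are diagonal for the row-major numbering, so both sides have one
  relevant entry in the row \<open>i\<close>, and equality of these entries is the pentagon of
  \<open>L\<close> at the four objects given by the digits of \<open>i\<close>.\<close>

lemma pentagon_mat:
 assumes obj: "obs ws" "obs xs" "obs ys" "obs zs"
 shows "mc (tl (tl (tl ws xs) ys) zs) (tl (tl ws (tl xs ys)) zs) (tl ws (tl xs (tl ys zs)))
   (mc (tl (tl ws (tl xs ys)) zs) (tl ws (tl (tl xs ys) zs)) (tl ws (tl xs (tl ys zs)))
    (tm (idm ws) (assoc_mat xs ys zs)) (assoc_mat ws (tl xs ys) zs))
   (tm (assoc_mat ws xs ys) (idm zs))
  = mc (tl (tl (tl ws xs) ys) zs) (tl (tl ws xs) (tl ys zs)) (tl ws (tl xs (tl ys zs)))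
   (assoc_mat ws xs (tl ys zs)) (assoc_mat (tl ws xs) ys zs)"
proof -
note o = tens_list_obj[OF obj(1,2)] tens_list_obj[OF obj(2,3)] tens_list_obj[OF obj(3,4)]
note a1 = assoc_row[OF obj(2-4)] and a2 = assoc_row[OF obj(1) o(2) obj(4)]
 and a3 = assoc_row[OF obj(1-3)] and a4 = assoc_row[OF obj(1,2) o(3)] and a5 = assoc_row[OF o(1) obj(3,4)]
note t1 = row_ok_tens[OF idm_row[OF obj(1)] a1] and t2 = row_ok_tens[OF a3 idm_row[OF obj(4)]]
note c1 = row_ok_comp[OF t1 a2]
show ?thesis
 unfolding assoc_mat_def idm_def
 apply (simp only: tm_mono_mat[OF idm_row[OF obj(1)] a1] tm_mono_mat[OF a3 idm_row[OF obj(4)]]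
  mono_mat_mono_mat[OF a4 a5] mono_mat_mono_mat[OF t1 a2] mono_mat_mono_mat[OF c1 t2] tens_list_obj obj)
proof (rule mono_mat_cong, goal_cases)
 case (1 i)
 define w x y z where wxyz: "w = i div length zs div length ys div length xs"
  "x = i div length zs div length ys mod length xs" "y = i div length zs mod length ys" "z = i mod length zs"
 have i: "i < length ws * length xs * length ys * length zs"
  using 1 by (simp add: tens_list_length mult.assoc)
 note d1 = div_mod_less[OF i]
 note d2 = div_mod_less[OF d1(1)]
 have lt: "w < length ws" "x < length xs" "y < length ys" "z < length zs"
  unfolding wxyz using d1(2) d2(2) div_mod_less[OF d2(1)] by auto
 have i_div: "i div length zs = (w * length xs + x) * length ys + y" "i mod length zs = z"
  unfolding wxyz by simp_all
 have i_eq: "i = ((w * length xs + x) * length ys + y) * length zs + z"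
  unfolding wxyz by simp
 have r: "(x * length ys + y) * length zs + z < length xs * (length ys * length zs)"
  "y * length zs + z < length ys * length zs" "x * length ys + y < length xs * length ys"
  using lt by (auto intro!: mult_add_less simp flip: mult.assoc)
 \<comment> \<open>Splitting off the first factor and recombining the digits gives \<open>i\<close>
   back, so the column maps of the tensored matrices are identities on indices.\<close>
 have "i = w * (length xs * (length ys * length zs)) + ((x * length ys + y) * length zs + z)"
  "i = (w * length xs + x) * (length ys * length zs) + (y * length zs + z)"
  unfolding i_eq by (simp_all add: algebra_simps)
 then have i_mod: "i mod (length xs * (length ys * length zs)) = (x * length ys + y) * length zs + z"
  "i mod (length ys * length zs) = y * length zs + z"
  and i_eq': "w * (length xs * (length ys * length zs)) + ((x * length ys + y) * length zs + z) = i"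
  using r by (metis mult_add_div_mod(2))+
 have "(w * length xs + x) * length ys + y = w * (length xs * length ys) + (x * length ys + y)"
  by (simp add: algebra_simps)
 then have xy: "((w * length xs + x) * length ys + y) mod (length xs * length ys) = x * length ys + y"
  using r by (metis mult_add_div_mod(2))
 have wx: "w * length xs + x < length ws * length xs" using lt by (intro mult_add_less)
 have "Ident L (ws ! w) \<star> Assoc L (xs ! x) (ys ! y) (zs ! z) \<cdot>
   Assoc L (ws ! w) (xs ! x \<boxtimes> ys ! y) (zs ! z) \<cdot>
   (Assoc L (ws ! w) (xs ! x) (ys ! y) \<star> Ident L (zs ! z))
  = Assoc L (ws ! w) (xs ! x) (ys ! y \<boxtimes> zs ! z) \<cdot> Assoc L (ws ! w \<boxtimes> xs ! x) (ys ! y) (zs ! z)"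
  by (rule pentagon) (use lt obj in auto)
 then show ?case
  using lt r i
  by (simp add: tens_list_length tens_list_nth i_div i_mod i_eq' xy wx index_simps(1) mult_add_div_mod mult.assoc
    i_eq[symmetric] del: div_mult_self3 div_mult_self4)
qed
qed

lemma triangle_mat:
 assumes obj: "obs xs" "obs ys"
 shows "mc (tl (tl xs [Unit L]) ys) (tl xs (tl [Unit L] ys)) (tl xs ys)
   (tm (idm xs) (lunit_mat ys)) (assoc_mat xs [Unit L] ys)
  = tm (runit_mat xs) (idm ys)"
proof -
note u = unit_list_obj
note a1 = assoc_row[OF obj(1) u obj(2)]
note t1 = row_ok_tens[OF idm_row[OF obj(1)] lunit_row[OF obj(2)]]
 and t2 = row_ok_tens[OF runit_row[OF obj(1)] idm_row[OF obj(2)]]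
show ?thesis
 unfolding assoc_mat_def idm_def runit_mat_def lunit_mat_def
 apply (simp only: tm_mono_mat[OF idm_row[OF obj(1)] lunit_row[OF obj(2)]]
   tm_mono_mat[OF runit_row[OF obj(1)] idm_row[OF obj(2)]]
  mono_mat_mono_mat[OF t1 a1] tens_list_obj obj u)
proof (rule mono_mat_cong, goal_cases)
 case (1 i)
 then have i: "i < length xs * length ys" by (simp add: tens_list_length)
 show ?case using div_mod_less[OF i] obj[THEN subsetD, OF nth_mem] i by (simp add: tens_list_length triangle)
qed
qed

lemma hexagon_mat:
 assumes obj: "obs xs" "obs ys" "obs zs"
 shows "mc (tl (tl xs ys) zs) (tl xs (tl ys zs)) (tl ys (tl zs xs))
   (mc (tl xs (tl ys zs)) (tl (tl ys zs) xs) (tl ys (tl zs xs)) (assoc_mat ys zs xs) (braid_mat xs (tl ys zs)))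
   (assoc_mat xs ys zs)
  = mc (tl (tl xs ys) zs) (tl (tl ys xs) zs) (tl ys (tl zs xs))
   (mc (tl (tl ys xs) zs) (tl ys (tl xs zs)) (tl ys (tl zs xs)) (tm (idm ys) (braid_mat xs zs)) (assoc_mat ys xs zs))
   (tm (braid_mat xs ys) (idm zs))"
proof -
note o = tens_list_obj[OF obj(1,2)] tens_list_obj[OF obj(2,3)]
note a1 = assoc_row[OF obj(2,3,1)] and a2 = assoc_row[OF obj] and a3 = assoc_row[OF obj(2,1,3)]
note b1 = braid_row[OF obj(1) o(2)] and b2 = braid_row[OF obj(1,3)] and b3 = braid_row[OF obj(1,2)]
note i1 = idm_row[OF obj(2)] and i2 = idm_row[OF obj(3)]
note t1 = row_ok_tens[OF i1 b2] and t2 = row_ok_tens[OF b3 i2]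
note c1 = row_ok_comp[OF a1 b1] and c2 = row_ok_comp[OF t1 a3]
show ?thesis
 unfolding assoc_mat_def idm_def braid_mat_def
 apply (simp only: tm_mono_mat[OF i1 b2] tm_mono_mat[OF b3 i2]
  mono_mat_mono_mat[OF a1 b1] mono_mat_mono_mat[OF c1 a2] mono_mat_mono_mat[OF t1 a3]
  mono_mat_mono_mat[OF c2 t2] tens_list_obj obj)
proof (rule mono_mat_cong, goal_cases)
 case (1 i)
 \<comment> \<open>Rows are numbered by the target, whose factors come in the order
   \<open>ys\<close>, \<open>zs\<close>, \<open>xs\<close>.\<close>
 define a c b where "a = i mod length xs" "c = i div length xs mod length zs"
  "b = i div length xs div length zs"
 have i: "i < length ys * (length zs * length xs)" using 1 by (simp add: tens_list_length)
 have lt: "a < length xs" "b < length ys" "c < length zs"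
  using nth3(3-5)[OF i] by (simp_all add: a_c_b_def)
 have i_eq: "i = (b * length zs + c) * length xs + a"
  by (simp add: a_c_b_def)
 have bc: "b * length zs + c < length ys * length zs" using lt by (intro mult_add_less)
 have ba: "b * length xs + a < length ys * length xs" using lt by (intro mult_add_less)
 have eq: "Assoc L (ys ! b) (zs ! c) (xs ! a) \<cdot> Braid L (xs ! a) (ys ! b \<boxtimes> zs ! c) \<cdot> Assoc L (xs ! a) (ys ! b) (zs ! c)
  = (Ident L (ys ! b) \<star> Braid L (xs ! a) (zs ! c)) \<cdot> Assoc L (ys ! b) (xs ! a) (zs ! c)
    \<cdot> (Braid L (xs ! a) (ys ! b) \<star> Ident L (zs ! c))"
  by (rule hexagon) (use lt obj in auto)
 have r: "b * (length xs * length zs) + (a * length zs + c) = (b * length xs + a) * length zs + c"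
  by (simp add: algebra_simps)
 have l: "a * (length ys * length zs) + (b * length zs + c) = (a * length ys + b) * length zs + c"
  by (simp add: algebra_simps)
 show ?case
  using eq lt bc ba unfolding i_eq
  by (simp add: tens_list_length tens_list_nth index_simps mult_add_div_mod r l del: div_mult_self3 div_mult_self4)
qed
qed

end

context additive_smc
begin

subsection \<open>Cutting down with idempotents\<close>

lemma kar_obj:
 assumes "X : kar_objs L"
 shows "set (fst X) <= Obj L" "snd X : hom_mats L (fst X) (fst X)"
  "mc (fst X) (fst X) (fst X) (snd X) (snd X) = snd X"
 using assms by (auto simp: kar_objs_def)

lemma kar_tens_obj:
 assumes "X : kar_objs L" "Y : kar_objs L"
 shows "kar_tens L X Y : kar_objs L"
 using kar_obj[OF assms(1)] kar_obj[OF assms(2)]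
 by (simp add: kar_objs_def kar_tens_def tens_list_obj tm_hom flip: tm_mc)

lemma kar_unit_obj: "kar_unit L : kar_objs L"
proof -
have "kar_unit L = ([Unit L], idm [Unit L])"
 by (auto simp: kar_unit_def idm_def mono_mat_def)
then show ?thesis
 using unit_list_obj coh_homs(1)[OF unit_list_obj unit_list_obj unit_list_obj]
 by (simp add: kar_objs_def mc_idm_left)
qed

text \<open>\<open>\<alpha>\<close> intertwines the idempotents of its source and target. Identities
  between such matrices survive cutting, so the laws already proved for plain matrices pass to the
  completion.\<close>

definition compat where
 "compat X \<alpha> Y \<longleftrightarrow> X : kar_objs L & Y : kar_objs L & \<alpha> : hom_mats L (fst X) (fst Y)
  & mc (fst X) (fst X) (fst Y) \<alpha> (snd X) = mc (fst X) (fst Y) (fst Y) (snd Y) \<alpha>"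

lemma kar_sel:
 "Obj (Karoubi L) = kar_objs L"
 "Dom (Karoubi L) (X, M, Y) = X" "Cod (Karoubi L) (X, M, Y) = Y"
 "Ident (Karoubi L) X = (X, snd X, X)"
 "Comp (Karoubi L) (Y', N, Z) (X, M, Y) = (X, mc (fst X) (fst Y) (fst Z) N M, Z)"
 "Tens_obj (Karoubi L) = kar_tens L"
 "Tens_arr (Karoubi L) (X, M, Y) (X', M', Y') = (kar_tens L X X', tm M M', kar_tens L Y Y')"
 "Unit (Karoubi L) = kar_unit L"
 by (simp_all add: Karoubi_def)

lemma kar_Arr:
 "(X, M, Y) : Arr (Karoubi L) \<longleftrightarrow> X : kar_objs L & Y : kar_objs L & M : hom_mats L (fst X) (fst Y)
  & mc (fst X) (fst Y) (fst Y) (snd Y) M = M & mc (fst X) (fst X) (fst Y) M (snd X) = M"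
 by (simp add: Karoubi_def)

lemma kar_Hom:
 "f : Hom (Karoubi L) X Y \<longleftrightarrow> (EX M. f = (X, M, Y) & X : kar_objs L & Y : kar_objs L
  & M : hom_mats L (fst X) (fst Y)
  & mc (fst X) (fst Y) (fst Y) (snd Y) M = M & mc (fst X) (fst X) (fst Y) M (snd X) = M)"
 by (cases f) (auto simp: Hom_def kar_Arr kar_sel)

text \<open>With e the idempotent of \<open>X\<close> and f that of \<open>Y\<close>, f (\<alpha> e)
  = f (f \<alpha>) = f \<alpha>, and this is \<alpha> e again; cutting on one side is
  enough.\<close>

lemma cut_eq:
 assumes "compat X \<alpha> Y"
 shows "cut L X \<alpha> Y = (X, mc (fst X) (fst X) (fst Y) \<alpha> (snd X), Y)" (is ?P)
  "cut L X \<alpha> Y = (X, mc (fst X) (fst Y) (fst Y) (snd Y) \<alpha>, Y)"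
proof -
have X: "X : kar_objs L" and Y: "Y : kar_objs L" and h: "\<alpha> : hom_mats L (fst X) (fst Y)"
 and eq: "mc (fst X) (fst X) (fst Y) \<alpha> (snd X) = mc (fst X) (fst Y) (fst Y) (snd Y) \<alpha>"
 using assms by (auto simp: compat_def)
note x = kar_obj[OF X] and y = kar_obj[OF Y]
have "mc (fst X) (fst Y) (fst Y) (snd Y) (mc (fst X) (fst X) (fst Y) \<alpha> (snd X))
 = mc (fst X) (fst Y) (fst Y) (mc (fst Y) (fst Y) (fst Y) (snd Y) (snd Y)) \<alpha>"
 unfolding eq by (rule mc_assoc[symmetric, OF h y(2,2) x(1) y(1,1,1)])
then show ?P
 "cut L X \<alpha> Y = (X, mc (fst X) (fst Y) (fst Y) (snd Y) \<alpha>, Y)"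
 by (simp_all add: cut_def eq y(3))
qed

lemma cut_hom:
 assumes "compat X \<alpha> Y"
 shows "cut L X \<alpha> Y : Hom (Karoubi L) X Y"
proof -
have X: "X : kar_objs L" and Y: "Y : kar_objs L" and h: "\<alpha> : hom_mats L (fst X) (fst Y)"
 and eq: "mc (fst X) (fst X) (fst Y) \<alpha> (snd X) = mc (fst X) (fst Y) (fst Y) (snd Y) \<alpha>"
 using assms by (auto simp: compat_def)
note x = kar_obj[OF X] and y = kar_obj[OF Y]
let ?M = "mc (fst X) (fst X) (fst Y) \<alpha> (snd X)"
have "mc (fst X) (fst Y) (fst Y) (snd Y) ?M = ?M"
 unfolding eq using mc_assoc[OF h y(2,2) x(1) y(1,1,1)] y(3) by simp
moreover have "mc (fst X) (fst X) (fst Y) ?M (snd X) = ?M"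
 using mc_assoc[OF x(2,2) h x(1,1,1) y(1)] x(3) by simp
ultimately show ?thesis
 unfolding cut_eq(1)[OF assms] kar_Hom using X Y mc_hom[OF x(2) h x(1) y(1)] by simp
qed

lemma compat_comp:
 assumes "compat X \<alpha> Y" "compat Y \<beta> Z"
 shows "compat X (mc (fst X) (fst Y) (fst Z) \<beta> \<alpha>) Z"
proof -
have X: "X : kar_objs L" and Y: "Y : kar_objs L" and Z: "Z : kar_objs L"
 and a: "\<alpha> : hom_mats L (fst X) (fst Y)" and b: "\<beta> : hom_mats L (fst Y) (fst Z)"
 and eq: "mc (fst X) (fst X) (fst Y) \<alpha> (snd X) = mc (fst X) (fst Y) (fst Y) (snd Y) \<alpha>"
  "mc (fst Y) (fst Y) (fst Z) \<beta> (snd Y) = mc (fst Y) (fst Z) (fst Z) (snd Z) \<beta>"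
 using assms by (auto simp: compat_def)
note x = kar_obj[OF X] and y = kar_obj[OF Y] and z = kar_obj[OF Z]
have "mc (fst X) (fst X) (fst Z) (mc (fst X) (fst Y) (fst Z) \<beta> \<alpha>) (snd X)
  = mc (fst X) (fst Y) (fst Z) \<beta> (mc (fst X) (fst Y) (fst Y) (snd Y) \<alpha>)"
 using mc_assoc[OF x(2) a b x(1,1) y(1) z(1)] eq(1) by simp
also have "... = mc (fst X) (fst Y) (fst Z) (mc (fst Y) (fst Z) (fst Z) (snd Z) \<beta>) \<alpha>"
 using mc_assoc[OF a y(2) b x(1) y(1,1) z(1)] eq(2) by simp
also have "... = mc (fst X) (fst Z) (fst Z) (snd Z) (mc (fst X) (fst Y) (fst Z) \<beta> \<alpha>)"
 by (rule mc_assoc[OF a b z(2) x(1) y(1) z(1,1)])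
finally show ?thesis using X Z mc_hom[OF a b x(1) z(1)] by (simp add: compat_def)
qed

text \<open>An arrow of the completion absorbs the idempotents at its ends and so meets the uncut
  matrix; together with \<open>cut_arr\<close> this reduces naturality to naturality of
  matrices.\<close>

lemma arr_cut:
 assumes "(X, M, Y) : Arr (Karoubi L)" "compat W \<alpha> X"
 shows "Comp (Karoubi L) (X, M, Y) (cut L W \<alpha> X) = (W, mc (fst W) (fst X) (fst Y) M \<alpha>, Y)"
proof -
have W: "W : kar_objs L" and X: "X : kar_objs L" and Y: "Y : kar_objs L" and h: "\<alpha> : hom_mats L (fst W) (fst X)"
 and M: "M : hom_mats L (fst X) (fst Y)" "mc (fst X) (fst X) (fst Y) M (snd X) = M"
 using assms by (auto simp: compat_def kar_Arr)
note w = kar_obj[OF W] and x = kar_obj[OF X] and y = kar_obj[OF Y]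
show ?thesis
 unfolding cut_eq(2)[OF assms(2)] using mc_assoc[OF h x(2) M(1) w(1) x(1,1) y(1)] M(2)
 by (simp add: kar_sel)
qed

lemma cut_arr:
 assumes "(X, M, Y) : Arr (Karoubi L)" "compat Y \<alpha> Z"
 shows "Comp (Karoubi L) (cut L Y \<alpha> Z) (X, M, Y) = (X, mc (fst X) (fst Y) (fst Z) \<alpha> M, Z)"
proof -
have X: "X : kar_objs L" and Y: "Y : kar_objs L" and Z: "Z : kar_objs L" and h: "\<alpha> : hom_mats L (fst Y) (fst Z)"
 and M: "M : hom_mats L (fst X) (fst Y)" "mc (fst X) (fst Y) (fst Y) (snd Y) M = M"
 using assms by (auto simp: compat_def kar_Arr)
note x = kar_obj[OF X] and y = kar_obj[OF Y] and z = kar_obj[OF Z]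
show ?thesis
 unfolding cut_eq(1)[OF assms(2)] using mc_assoc[OF M(1) y(2) h x(1) y(1,1) z(1)] M(2)
 by (simp add: kar_sel)
qed

lemma cut_cut:
 assumes "compat X \<alpha> Y" "compat Y \<beta> Z"
 shows "Comp (Karoubi L) (cut L Y \<beta> Z) (cut L X \<alpha> Y) = cut L X (mc (fst X) (fst Y) (fst Z) \<beta> \<alpha>) Z"
proof -
have X: "X : kar_objs L" and Y: "Y : kar_objs L" and Z: "Z : kar_objs L"
 and a: "\<alpha> : hom_mats L (fst X) (fst Y)" and b: "\<beta> : hom_mats L (fst Y) (fst Z)"
 using assms by (auto simp: compat_def)
note x = kar_obj[OF X] and y = kar_obj[OF Y] and z = kar_obj[OF Z]
have "(X, mc (fst X) (fst X) (fst Y) \<alpha> (snd X), Y) : Arr (Karoubi L)"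
 using cut_hom[OF assms(1)] unfolding cut_eq(1)[OF assms(1)] by (simp add: Hom_def)
from cut_arr[OF this assms(2)] show ?thesis
 unfolding cut_eq(1)[OF assms(1)] cut_eq(1)[OF compat_comp[OF assms]]
 by (simp add: mc_assoc[OF x(2) a b x(1,1) y(1) z(1)])
qed

lemma compat_tens:
 assumes "compat X \<alpha> Y" "compat X' \<alpha>' Y'"
 shows "compat (kar_tens L X X') (tm \<alpha> \<alpha>') (kar_tens L Y Y')"
  "Tens_arr (Karoubi L) (cut L X \<alpha> Y) (cut L X' \<alpha>' Y') = cut L (kar_tens L X X') (tm \<alpha> \<alpha>') (kar_tens L Y Y')" (is ?P)
proof -
have X: "X : kar_objs L" "X' : kar_objs L" and Y: "Y : kar_objs L" "Y' : kar_objs L"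
 and a: "\<alpha> : hom_mats L (fst X) (fst Y)" "\<alpha>' : hom_mats L (fst X') (fst Y')"
 and eq: "mc (fst X) (fst X) (fst Y) \<alpha> (snd X) = mc (fst X) (fst Y) (fst Y) (snd Y) \<alpha>"
  "mc (fst X') (fst X') (fst Y') \<alpha>' (snd X') = mc (fst X') (fst Y') (fst Y') (snd Y') \<alpha>'"
 using assms by (auto simp: compat_def)
note x = X[THEN kar_obj(1)] X[THEN kar_obj(2)] and y = Y[THEN kar_obj(1)] Y[THEN kar_obj(2)]
show 1: "compat (kar_tens L X X') (tm \<alpha> \<alpha>') (kar_tens L Y Y')"
 using X Y a x y eq
 by (simp add: compat_def kar_tens_obj) (simp add: kar_tens_def tm_hom flip: tm_mc)
show ?P
 unfolding cut_eq(1)[OF 1] cut_eq(1)[OF assms(1)] cut_eq(1)[OF assms(2)] kar_sel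
 using tm_mc[OF x(3) a(1) x(4) a(2) x(1,1) y(1) x(2,2) y(2)] by (simp add: kar_tens_def)
qed

lemma compat_idm:
 assumes "X : kar_objs L"
 shows "compat X (idm (fst X)) X" "Ident (Karoubi L) X = cut L X (idm (fst X)) X" (is ?P)
proof -
note x = kar_obj[OF assms]
show 1: "compat X (idm (fst X)) X"
 using x assms by (simp add: compat_def coh_homs(1)[OF x(1,1,1)] mc_idm_left mc_idm_right)
show ?P
 unfolding cut_eq(1)[OF 1] kar_sel using x by (simp add: mc_idm_left)
qed

text \<open>The inverse matrix is automatically compatible: with e and f the idempotents of
  \<open>X\<close> and \<open>Y\<close>, e \<beta> = (\<beta> \<alpha>) e \<beta> = \<beta> f
  (\<alpha> \<beta>) = \<beta> f.\<close>

lemma cut_iso: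
 assumes "compat X \<alpha> Y" "\<beta> : hom_mats L (fst Y) (fst X)"
  and "mc (fst X) (fst Y) (fst X) \<beta> \<alpha> = idm (fst X)" "mc (fst Y) (fst X) (fst Y) \<alpha> \<beta> = idm (fst Y)"
 shows "is_iso (Karoubi L) (cut L X \<alpha> Y)"
proof -
have X: "X : kar_objs L" and Y: "Y : kar_objs L" and a: "\<alpha> : hom_mats L (fst X) (fst Y)"
 and eq: "mc (fst X) (fst X) (fst Y) \<alpha> (snd X) = mc (fst X) (fst Y) (fst Y) (snd Y) \<alpha>"
 using assms by (auto simp: compat_def)
note b = assms(2)
note x = kar_obj[OF X] and y = kar_obj[OF Y]
let ?x = "fst X" and ?y = "fst Y" and ?E = "snd X" and ?F = "snd Y"
have "mc ?y ?x ?x ?E \<beta> = mc ?y ?x ?x (mc ?x ?x ?x (mc ?x ?y ?x \<beta> \<alpha>) ?E) \<beta>"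
 unfolding assms(3) using x by (simp add: mc_idm_left)
also have "mc ?x ?x ?x (mc ?x ?y ?x \<beta> \<alpha>) ?E = mc ?x ?y ?x \<beta> (mc ?x ?y ?y ?F \<alpha>)"
 using mc_assoc[OF x(2) a b x(1,1) y(1) x(1)] eq by simp
also have "... = mc ?x ?y ?x (mc ?y ?y ?x \<beta> ?F) \<alpha>"
 using mc_assoc[OF a y(2) b x(1) y(1,1) x(1)] by simp
also have "mc ?y ?x ?x ... \<beta> = mc ?y ?y ?x (mc ?y ?y ?x \<beta> ?F) (mc ?y ?x ?y \<alpha> \<beta>)"
 by (rule mc_assoc[OF b a mc_hom[OF y(2) b y(1) x(1)] y(1) x(1) y(1) x(1)])
also have "... = mc ?y ?y ?x \<beta> ?F"
 unfolding assms(4) by (rule mc_idm_right[OF mc_hom[OF y(2) b y(1) x(1)] y(1) x(1)])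
finally have c: "compat Y \<beta> X" using X Y b by (simp add: compat_def)
have "Dom (Karoubi L) (cut L X \<alpha> Y) = X" "Cod (Karoubi L) (cut L X \<alpha> Y) = Y" "cut L X \<alpha> Y : Arr (Karoubi L)"
 using cut_hom[OF assms(1)] by (auto simp: Hom_def)
then show ?thesis
 unfolding is_iso_def using cut_hom[OF c] cut_cut[OF c assms(1)] cut_cut[OF assms(1) c] assms(3,4)
  compat_idm(2)[OF X] compat_idm(2)[OF Y]
 by auto
qed

lemma fst_kar_tens: "fst (kar_tens L X Y) = tl (fst X) (fst Y)"
 and snd_kar_tens: "snd (kar_tens L X Y) = tm (snd X) (snd Y)"
 by (simp_all add: kar_tens_def)

lemma kar_unit_eq: "fst (kar_unit L) = [Unit L]" "snd (kar_unit L) = idm [Unit L]"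
 by (auto simp: kar_unit_def idm_def mono_mat_def)

lemma kar_coh:
 "Assoc (Karoubi L) X Y Z = cut L (kar_tens L (kar_tens L X Y) Z) (assoc_mat (fst X) (fst Y) (fst Z))
  (kar_tens L X (kar_tens L Y Z))"
 "Lunit (Karoubi L) X = cut L (kar_tens L (kar_unit L) X) (lunit_mat (fst X)) X"
 "Runit (Karoubi L) X = cut L (kar_tens L X (kar_unit L)) (runit_mat (fst X)) X"
 "Braid (Karoubi L) X Y = cut L (kar_tens L X Y) (braid_mat (fst X) (fst Y)) (kar_tens L Y X)"
proof -
show "Assoc (Karoubi L) X Y Z = cut L (kar_tens L (kar_tens L X Y) Z) (assoc_mat (fst X) (fst Y) (fst Z))
 (kar_tens L X (kar_tens L Y Z))"
 by (simp add: Karoubi_def Let_def fst_kar_tens diag_mat_eq_mono assoc_mat_def index_simps(1))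
show "Lunit (Karoubi L) X = cut L (kar_tens L (kar_unit L) X) (lunit_mat (fst X)) X"
 by (simp add: Karoubi_def Let_def fst_kar_tens kar_unit_eq diag_mat_eq_mono lunit_mat_def)
show "Runit (Karoubi L) X = cut L (kar_tens L X (kar_unit L)) (runit_mat (fst X)) X"
 by (simp add: Karoubi_def Let_def fst_kar_tens kar_unit_eq diag_mat_eq_mono runit_mat_def)
let ?m = "length (fst X)" and ?n = "length (fst Y)"
have "mat (?n * ?m) (?m * ?n) (%(i, j). if i div ?m = j mod ?n & i mod ?m = j div ?n
  then Braid L (fst X ! (j div ?n)) (fst Y ! (j mod ?n))
  else Hzero L (tl (fst X) (fst Y) ! j) (tl (fst Y) (fst X) ! i)) = braid_mat (fst X) (fst Y)"
 unfolding braid_mat_def mono_mat_def tens_list_length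
proof (rule cong_mat, simp, simp, unfold prod.case)
 fix i j assume i: "i < ?n * ?m" and j: "j < ?m * ?n"
 have "j = i mod ?m * ?n + i div ?m \<longleftrightarrow> i div ?m = j mod ?n & i mod ?m = j div ?n"
  using swap_index[OF i] by (metis div_mult_mod_eq)
 then show "(if i div ?m = j mod ?n & i mod ?m = j div ?n then Braid L (fst X ! (j div ?n)) (fst Y ! (j mod ?n))
   else Hzero L (tl (fst X) (fst Y) ! j) (tl (fst Y) (fst X) ! i)) =
   (if j = i mod ?m * ?n + i div ?m then Braid L (fst X ! (i mod ?m)) (fst Y ! (i div ?m))
   else Hzero L (tl (fst X) (fst Y) ! j) (tl (fst Y) (fst X) ! i))"
  by auto
qed
then show "Braid (Karoubi L) X Y = cut L (kar_tens L X Y) (braid_mat (fst X) (fst Y)) (kar_tens L Y X)"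
 unfolding fst_kar_tens[symmetric] by (simp add: Karoubi_def Let_def)
qed

text \<open>The idempotents that define the objects are matrices themselves, and each instance is
  naturality of a coherence matrix with respect to them.\<close>

lemma compat_coh:
 assumes "X : kar_objs L"
 shows "[|Y : kar_objs L; Z : kar_objs L|] ==> compat (kar_tens L (kar_tens L X Y) Z)
   (assoc_mat (fst X) (fst Y) (fst Z)) (kar_tens L X (kar_tens L Y Z))"
  "compat (kar_tens L (kar_unit L) X) (lunit_mat (fst X)) X"
  "compat (kar_tens L X (kar_unit L)) (runit_mat (fst X)) X"
  "Y : kar_objs L ==> compat (kar_tens L X Y) (braid_mat (fst X) (fst Y)) (kar_tens L Y X)"
 using kar_obj[OF assms] assms coh_homs(3,4)[OF kar_obj(1,1,1), OF assms assms assms]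
 by (auto simp: compat_def kar_tens_obj kar_unit_obj fst_kar_tens snd_kar_tens kar_unit_eq
   coh_homs coh_homs(5)[where zs = "[]"] kar_obj assoc_mat_natural lunit_mat_natural runit_mat_natural braid_mat_natural)

lemma kar_iso:
 assumes "X : kar_objs L"
 shows "[|Y : kar_objs L; Z : kar_objs L|] ==> is_iso (Karoubi L) (Assoc (Karoubi L) X Y Z)"
  "is_iso (Karoubi L) (Lunit (Karoubi L) X)" (is ?P)
  "is_iso (Karoubi L) (Runit (Karoubi L) X)" (is ?P1)
proof -
note x = kar_obj[OF assms]
note xn = x(1)[THEN subsetD, OF nth_mem]
show "is_iso (Karoubi L) (Assoc (Karoubi L) X Y Z)" if Y: "Y : kar_objs L" and Z: "Z : kar_objs L"
proof -
 note y = kar_obj[OF Y] and z = kar_obj[OF Z]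
 have "EX N:hom_mats L (tl (fst X) (tl (fst Y) (fst Z))) (tl (tl (fst X) (fst Y)) (fst Z)).
   mc (tl (tl (fst X) (fst Y)) (fst Z)) (tl (fst X) (tl (fst Y) (fst Z))) (tl (tl (fst X) (fst Y)) (fst Z))
    N (assoc_mat (fst X) (fst Y) (fst Z)) = idm (tl (tl (fst X) (fst Y)) (fst Z)) &
   mc (tl (fst X) (tl (fst Y) (fst Z))) (tl (tl (fst X) (fst Y)) (fst Z)) (tl (fst X) (tl (fst Y) (fst Z)))
    (assoc_mat (fst X) (fst Y) (fst Z)) N = idm (tl (fst X) (tl (fst Y) (fst Z)))"
  unfolding assoc_mat_def
 proof (rule diag_inverse[OF assoc_row[OF x(1) y(1) z(1)]], goal_cases)
  case (2 k)
  then have "k < length (fst X) * (length (fst Y) * length (fst Z))" by (simp add: tens_list_length)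
  from nth3(3-5)[OF this] show ?case
   using x(1) y(1) z(1) by (intro conjunct2[OF assoc_hom]) auto
 qed (use x y z in "simp_all add: tens_list_length tens_list_obj")
 then show ?thesis
  unfolding kar_coh using compat_coh(1)[OF assms Y Z] by (auto intro: cut_iso simp: fst_kar_tens)
qed
have "EX N:hom_mats L (fst X) (tl [Unit L] (fst X)).
  mc (tl [Unit L] (fst X)) (fst X) (tl [Unit L] (fst X)) N (lunit_mat (fst X)) = idm (tl [Unit L] (fst X)) &
  mc (fst X) (tl [Unit L] (fst X)) (fst X) (lunit_mat (fst X)) N = idm (fst X)"
 unfolding lunit_mat_def
 by (rule diag_inverse[OF lunit_row[OF x(1)]])
  (use x xn lunit_hom in "auto simp only: tens_list_length tens_list_obj unit_list_obj length_Cons list.size")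
then show ?P
 unfolding kar_coh using compat_coh(2)[OF assms] by (auto intro: cut_iso simp: fst_kar_tens kar_unit_eq)
have "EX N:hom_mats L (fst X) (tl (fst X) [Unit L]).
  mc (tl (fst X) [Unit L]) (fst X) (tl (fst X) [Unit L]) N (runit_mat (fst X)) = idm (tl (fst X) [Unit L]) &
  mc (fst X) (tl (fst X) [Unit L]) (fst X) (runit_mat (fst X)) N = idm (fst X)"
 unfolding runit_mat_def
 by (rule diag_inverse[OF runit_row[OF x(1)]])
  (use x xn runit_hom in "auto simp only: tens_list_length tens_list_obj unit_list_obj length_Cons list.size")
then show ?P1
 unfolding kar_coh using compat_coh(3)[OF assms] by (auto intro: cut_iso simp: fst_kar_tens kar_unit_eq)
qed

text \<open>Every structure arrow is the cut of a compatible matrix, and cutting respects composites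
  and tensor products; each coherence law is thus the cut of the corresponding law for
  matrices.\<close>

theorem Karoubi_smc: "symmetric_monoidal_category (Karoubi L)"
proof (unfold_locales, goal_cases)
case (1 f) then show ?case by (cases f) (auto simp: kar_Arr kar_sel)
next
case (2 f) then show ?case by (cases f) (auto simp: kar_Arr kar_sel)
next
case (3 x)
then show ?case by (auto simp: kar_Hom kar_sel kar_obj)
next
case (4 f X Y g Z)
then obtain M N where f: "f = (X, M, Y)" "g = (Y, N, Z)"
 and o: "X : kar_objs L" "Y : kar_objs L" "Z : kar_objs L"
 and h: "M : hom_mats L (fst X) (fst Y)" "N : hom_mats L (fst Y) (fst Z)"
 and e: "mc (fst Y) (fst Z) (fst Z) (snd Z) N = N" "mc (fst X) (fst X) (fst Y) M (snd X) = M"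
 by (auto simp: kar_Hom)
note x = kar_obj[OF o(1)] and y = kar_obj[OF o(2)] and z = kar_obj[OF o(3)]
show ?case
 using mc_assoc[OF x(2) h x(1,1) y(1) z(1)] mc_assoc[OF h z(2) x(1) y(1) z(1,1)] mc_hom[OF h x(1) z(1)] o
 by (simp add: f kar_Hom kar_sel e)
next
case (5 f X Y) then show ?case by (auto simp: kar_Hom kar_sel)
next
case (6 f X Y) then show ?case by (auto simp: kar_Hom kar_sel)
next
case (7 f W X g Y h Z)
then show ?case by (auto simp: kar_Hom kar_sel intro!: mc_assoc kar_obj(1))
next
case 8 then show ?case by (simp add: kar_sel kar_unit_obj)
next
case (9 x y) then show ?case by (simp add: kar_sel kar_tens_obj)
next
case (10 f x y f' x' y')
then show ?case
 by (auto simp: kar_Hom kar_sel kar_tens_obj fst_kar_tens snd_kar_tens tm_hom kar_obj simp flip: tm_mc)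
next
case (11 x y) then show ?case by (simp add: kar_sel snd_kar_tens)
next
case (12 f x y g z f' x' y' g' z')
then show ?case
 by (auto simp: kar_Hom kar_sel fst_kar_tens intro!: tm_mc kar_obj(1))
next
case (13 x y z)
then show ?case using compat_coh(1) kar_iso(1) by (simp add: kar_sel kar_coh(1) cut_hom)
next
case (14 f X X' g Y Y' h Z Z')
then obtain M N P where *: "f = (X, M, X')" "g = (Y, N, Y')" "h = (Z, P, Z')"
 and o: "X : kar_objs L" "X' : kar_objs L" "Y : kar_objs L" "Y' : kar_objs L" "Z : kar_objs L" "Z' : kar_objs L"
 and h: "M : hom_mats L (fst X) (fst X')" "N : hom_mats L (fst Y) (fst Y')" "P : hom_mats L (fst Z) (fst Z')"
 and e: "mc (fst X) (fst X') (fst X') (snd X') M = M" "mc (fst X) (fst X) (fst X') M (snd X) = M"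
  "mc (fst Y) (fst Y') (fst Y') (snd Y') N = N" "mc (fst Y) (fst Y) (fst Y') N (snd Y) = N"
  "mc (fst Z) (fst Z') (fst Z') (snd Z') P = P" "mc (fst Z) (fst Z) (fst Z') P (snd Z) = P"
 by (auto simp: kar_Hom)
note ob = o[THEN kar_obj(1)] o[THEN kar_obj(2)]
\<comment> \<open>By \<open>tm_mc\<close> a tensor product of arrows absorbs the tensored
  idempotents, so \<open>cut_arr\<close> and \<open>arr_cut\<close> apply to both sides.\<close>
have a: "(kar_tens L (kar_tens L X Y) Z, tm (tm M N) P, kar_tens L (kar_tens L X' Y') Z') : Arr (Karoubi L)"
 "(kar_tens L X (kar_tens L Y Z), tm M (tm N P), kar_tens L X' (kar_tens L Y' Z')) : Arr (Karoubi L)"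
 using o h ob by (simp_all add: kar_Arr kar_tens_obj fst_kar_tens snd_kar_tens tm_hom tens_list_obj e flip: tm_mc)
show ?case
 unfolding * kar_sel kar_coh cut_arr[OF a(1) compat_coh(1)[OF o(2,4,6)]] arr_cut[OF a(2) compat_coh(1)[OF o(1,3,5)]]
 using assoc_mat_natural[OF h ob(1,3,5,2,4,6)] by (simp add: fst_kar_tens)
next
case (15 x)
then show ?case using compat_coh(2) kar_iso(2) by (simp add: kar_sel kar_coh(2) cut_hom)
next
case (16 f X Y)
then obtain M where *: "f = (X, M, Y)" and o: "X : kar_objs L" "Y : kar_objs L"
 and h: "M : hom_mats L (fst X) (fst Y)" and a: "(X, M, Y) : Arr (Karoubi L)"
 and e: "mc (fst X) (fst Y) (fst Y) (snd Y) M = M" "mc (fst X) (fst X) (fst Y) M (snd X) = M"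
 by (auto simp: kar_Hom kar_Arr)
note ob = o[THEN kar_obj(1)] unit_list_obj o[THEN kar_obj(2)] coh_homs(1)[OF unit_list_obj unit_list_obj unit_list_obj]
have b: "(kar_tens L (kar_unit L) X, tm (idm [Unit L]) M, kar_tens L (kar_unit L) Y) : Arr (Karoubi L)"
 using o h ob by (simp add: kar_Arr kar_tens_obj kar_unit_obj fst_kar_tens snd_kar_tens kar_unit_eq
   tm_hom tens_list_obj e mc_idm_left flip: tm_mc)
show ?case
 unfolding * kar_sel kar_coh kar_unit_eq cut_arr[OF b compat_coh(2)[OF o(2)]] arr_cut[OF a compat_coh(2)[OF o(1)]]
 using lunit_mat_natural[OF h ob(1,2)] by (simp add: fst_kar_tens kar_unit_eq)
next
case (17 x)
then show ?case using compat_coh(3) kar_iso(3) by (simp add: kar_sel kar_coh(3) cut_hom)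
next
case (18 f X Y)
then obtain M where *: "f = (X, M, Y)" and o: "X : kar_objs L" "Y : kar_objs L"
 and h: "M : hom_mats L (fst X) (fst Y)" and a: "(X, M, Y) : Arr (Karoubi L)"
 and e: "mc (fst X) (fst Y) (fst Y) (snd Y) M = M" "mc (fst X) (fst X) (fst Y) M (snd X) = M"
 by (auto simp: kar_Hom kar_Arr)
note ob = o[THEN kar_obj(1)] unit_list_obj o[THEN kar_obj(2)] coh_homs(1)[OF unit_list_obj unit_list_obj unit_list_obj]
have b: "(kar_tens L X (kar_unit L), tm M (idm [Unit L]), kar_tens L Y (kar_unit L)) : Arr (Karoubi L)"
 using o h ob by (simp add: kar_Arr kar_tens_obj kar_unit_obj fst_kar_tens snd_kar_tens kar_unit_eq
   tm_hom tens_list_obj e mc_idm_left flip: tm_mc)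
show ?case
 unfolding * kar_sel kar_coh kar_unit_eq cut_arr[OF b compat_coh(3)[OF o(2)]] arr_cut[OF a compat_coh(3)[OF o(1)]]
 using runit_mat_natural[OF h ob(1,2)] by (simp add: fst_kar_tens kar_unit_eq)
next
case (19 x y)
then show ?case using compat_coh(4) by (simp add: kar_sel kar_coh cut_hom)
next
case (20 f X X' g Y Y')
then obtain M N where *: "f = (X, M, X')" "g = (Y, N, Y')"
 and o: "X : kar_objs L" "X' : kar_objs L" "Y : kar_objs L" "Y' : kar_objs L"
 and h: "M : hom_mats L (fst X) (fst X')" "N : hom_mats L (fst Y) (fst Y')"
 and e: "mc (fst X) (fst X') (fst X') (snd X') M = M" "mc (fst X) (fst X) (fst X') M (snd X) = M"
  "mc (fst Y) (fst Y') (fst Y') (snd Y') N = N" "mc (fst Y) (fst Y) (fst Y') N (snd Y) = N"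
 by (auto simp: kar_Hom)
note ob = o[THEN kar_obj(1)] o[THEN kar_obj(2)]
have a: "(kar_tens L X Y, tm M N, kar_tens L X' Y') : Arr (Karoubi L)"
 "(kar_tens L Y X, tm N M, kar_tens L Y' X') : Arr (Karoubi L)"
 using o h ob by (simp_all add: kar_Arr kar_tens_obj fst_kar_tens snd_kar_tens tm_hom tens_list_obj e flip: tm_mc)
show ?case
 unfolding * kar_sel kar_coh cut_arr[OF a(1) compat_coh(4)[OF o(2,4)]] arr_cut[OF a(2) compat_coh(4)[OF o(1,3)]]
 using braid_mat_natural[OF h ob(1,3,2,4)] by (simp add: fst_kar_tens)
next
case (21 X Y)
then have o: "X : kar_objs L" "Y : kar_objs L" by (simp_all add: kar_sel)
show ?case
 unfolding kar_coh kar_sel(6) cut_cut[OF compat_coh(4)[OF o] compat_coh(4)[OF o(2,1)]] compat_idm(2)[OF kar_tens_obj[OF o]]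
 using o by (simp add: fst_kar_tens braid_mat_symmetric kar_obj)
next
case (22 W X Y Z)
then have o: "W : kar_objs L" "X : kar_objs L" "Y : kar_objs L" "Z : kar_objs L" by (simp_all add: kar_sel)
note i1 = compat_idm[OF o(1)] and i4 = compat_idm[OF o(4)]
note a = compat_coh(1)[OF o(2-4)] compat_coh(1)[OF o(1) kar_tens_obj[OF o(2,3)] o(4)]
 compat_coh(1)[OF o(1-3)] compat_coh(1)[OF o(1,2) kar_tens_obj[OF o(3,4)]]
 compat_coh(1)[OF kar_tens_obj[OF o(1,2)] o(3,4)]
note t1 = compat_tens[OF i1(1) a(1)] and t2 = compat_tens[OF a(3) i4(1)]
show ?case
 unfolding kar_coh kar_sel(6) i1(2) i4(2) t1(2) t2(2) cut_cut[OF a(2) t1(1)]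
  cut_cut[OF t2(1) compat_comp[OF a(2) t1(1)]] cut_cut[OF a(5) a(4)]
 using pentagon_mat[OF o[THEN kar_obj(1)]] by (simp add: fst_kar_tens)
next
case (23 X Y)
then have o: "X : kar_objs L" "Y : kar_objs L" by (simp_all add: kar_sel)
note i = compat_idm[OF o(1)] compat_idm[OF o(2)]
note a = compat_coh(1)[OF o(1) kar_unit_obj o(2)]
note t1 = compat_tens[OF i(1) compat_coh(2)[OF o(2)]] and t2 = compat_tens[OF compat_coh(3)[OF o(1)] i(3)]
show ?case
 unfolding kar_coh kar_sel(6,8) i(2,4) t1(2) t2(2) cut_cut[OF a t1(1)]
 using triangle_mat[OF o[THEN kar_obj(1)]] by (simp add: fst_kar_tens kar_unit_eq)
next
case (24 X Y Z)
then have o: "X : kar_objs L" "Y : kar_objs L" "Z : kar_objs L" by (simp_all add: kar_sel)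
note i = compat_idm[OF o(2)] compat_idm[OF o(3)]
note a = compat_coh(1)[OF o(2,3,1)] compat_coh(1)[OF o] compat_coh(1)[OF o(2,1,3)]
note b = compat_coh(4)[OF o(1) kar_tens_obj[OF o(2,3)]] compat_coh(4)[OF o(1,3)] compat_coh(4)[OF o(1,2)]
note t1 = compat_tens[OF i(1) b(2)] and t2 = compat_tens[OF b(3) i(3)]
show ?case
 unfolding kar_coh kar_sel(6) i(2,4) t1(2) t2(2) cut_cut[OF b(1) a(1)] cut_cut[OF a(2) compat_comp[OF b(1) a(1)]]
  cut_cut[OF a(3) t1(1)] cut_cut[OF t2(1) compat_comp[OF a(3) t1(1)]]
 using hexagon_mat[OF o[THEN kar_obj(1)]] by (simp add: fst_kar_tens)
qed

end

subsection \<open>Extending functors to the completion\<close>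

locale additive_smf = L: additive_smc L H + L': additive_smc L' H' + symmetric_monoidal_functor L L' F
 for L :: "('o, 'o \<times> 'h::ab_group_add \<times> 'o, 'k, 'z) lincat_scheme" and H
  and L' :: "('p, 'p \<times> 'i::ab_group_add \<times> 'p, 'k, 'y) lincat_scheme" and H'
  and F :: "('o, 'o \<times> 'h \<times> 'o, 'p, 'p \<times> 'i \<times> 'p, 'x) smftr_scheme" +
 assumes linear: "linear_functor L L' F"
begin

abbreviation "FO \<equiv> map (on_obj F)"
abbreviation "FM \<equiv> map_mat (on_arr F)"

lemma on_arr_add: "[|f : Hom L x y; g : Hom L x y|] ==>
  on_arr F (Hadd L f g) = Hadd L' (on_arr F f) (on_arr F g)"
 using linear by (auto simp: linear_functor_def)

lemma on_arr_zero: "[|x : Obj L; y : Obj L|] ==> on_arr F (Hzero L x y) = Hzero L' (on_obj F x) (on_obj F y)"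
 by (rule L'.Hadd_self_eq_imp_zero)
  (metis L.Hzero_hom on_arr_hom, metis L.Hadd_Hzero L.Hzero_hom on_arr_add)

lemma on_arr_asum:
 assumes "finite A" "x : Obj L" "y : Obj L" "!!a. a : A ==> f a : Hom L x y"
 shows "on_arr F (L.asum x y f A) = L'.asum (on_obj F x) (on_obj F y) (%a. on_arr F (f a)) A"
 using assms(1,4)
proof (induction A rule: finite_induct)
case empty
then show ?case using assms(2,3) by (simp add: L.asum_empty L'.asum_empty on_arr_zero)
next
case (insert a A)
have "on_arr F (f a) : Hom L' (on_obj F x) (on_obj F y)"
 using insert.prems by (auto intro: on_arr_hom)
then show ?case using insert assms(2,3)
 by (simp add: L.asum_insert L'.asum_insert on_arr_add[OF _ L.asum_hom])
qed

lemma FO_obj: "set xs <= Obj L ==> set (FO xs) <= Obj L'"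
 by (auto intro: on_obj_obj)

lemma FM_hom: "M : hom_mats L xs ys ==> FM M : hom_mats L' (FO xs) (FO ys)"
 by (auto simp: hom_mats_def intro!: on_arr_hom)

lemma FM_mc:
 assumes M: "M : hom_mats L xs ys" and N: "N : hom_mats L ys zs"
  and "set xs <= Obj L" "set ys <= Obj L" "set zs <= Obj L"
 shows "FM (L.mc xs ys zs N M) = L'.mc (FO xs) (FO ys) (FO zs) (FM N) (FM M)"
proof (rule eq_matI, goal_cases)
case (1 i k)
then have i: "i < length zs" and k: "k < length xs" by (auto simp: L'.mc_dim)
have "FM (L.mc xs ys zs N M) $$ (i, k)
  = on_arr F (L.asum (xs ! k) (zs ! i) (%j. N $$ (i, j) \<cdot>\<^bsub>L\<^esub> M $$ (j, k)) {..<length ys})"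
 using i k by (simp add: L.mc_dim L.mc_index)
also have "... = L'.asum (on_obj F (xs ! k)) (on_obj F (zs ! i))
  (%j. on_arr F (N $$ (i, j) \<cdot>\<^bsub>L\<^esub> M $$ (j, k))) {..<length ys}"
 using i k assms(3-5)[THEN subsetD, OF nth_mem]
 by (intro on_arr_asum) (auto intro: L.comp_hom[OF L.hom_mats_entry[OF M] L.hom_mats_entry[OF N]])
also have "... = L'.asum (on_obj F (xs ! k)) (on_obj F (zs ! i))
  (%j. on_arr F (N $$ (i, j)) \<cdot>\<^bsub>L'\<^esub> on_arr F (M $$ (j, k))) {..<length ys}"
 using i k by (intro L'.asum_cong on_arr_comp[OF L.hom_mats_entry[OF M] L.hom_mats_entry[OF N]]) auto
also have "... = L'.mc (FO xs) (FO ys) (FO zs) (FM N) (FM M) $$ (i, k)"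
 using i k by (auto simp: L'.mc_index L.hom_mats_dim[OF M] L.hom_mats_dim[OF N] intro!: L'.asum_cong)
finally show ?case .
qed (simp_all add: L'.mc_dim L.mc_dim)

lemma FM_row:
 assumes "L.row_ok xs ys \<sigma> f"
 shows "L'.row_ok (FO xs) (FO ys) \<sigma> (%i. on_arr F (f i))"
 using assms by (auto simp: L.row_ok_def L'.row_ok_def intro!: on_arr_hom)

lemma FM_mono_mat:
 assumes "L.row_ok xs ys \<sigma> f" "set xs <= Obj L" "set ys <= Obj L"
 shows "FM (L.mono_mat xs ys \<sigma> f) = L'.mono_mat (FO xs) (FO ys) \<sigma> (%i. on_arr F (f i))"
 using assms(2,3)[THEN subsetD, OF nth_mem]
 by (intro eq_matI) (auto simp: L.mono_mat_def L'.mono_mat_def on_arr_zero)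

lemma FM_idm:
 assumes "set xs <= Obj L" shows "FM (L.idm xs) = L'.idm (FO xs)"
 unfolding L.idm_def L'.idm_def FM_mono_mat[OF L.idm_row[OF assms] assms assms]
 using assms[THEN subsetD, OF nth_mem] by (auto simp: on_arr_ident intro!: L'.mono_mat_cong)

text \<open>Mapping \<open>on_obj F\<close> over a tensor list keeps its numbering, so the
  comparison is diagonal.\<close>

definition "mu_mat xs ys = L'.mono_mat (L'.tl (FO xs) (FO ys)) (FO (L.tl xs ys)) (%k. k)
 (%k. Mu F (xs ! (k div length ys)) (ys ! (k mod length ys)))"

definition "eps_mat = L'.mono_mat [Unit L'] (FO [Unit L]) (%k. k) (%k. Eps F)"

lemma mu_row:
 assumes "set xs <= Obj L" "set ys <= Obj L"
 shows "L'.row_ok (L'.tl (FO xs) (FO ys)) (FO (L.tl xs ys)) (%k. k)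
  (%k. Mu F (xs ! (k div length ys)) (ys ! (k mod length ys)))"
 unfolding L'.row_ok_def
proof (intro allI impI)
fix k assume "k < length (FO (L.tl xs ys))"
then have k: "k < length xs * length ys" by (simp add: L.tens_list_length)
then show "k < length (L'.tl (FO xs) (FO ys)) &
 Mu F (xs ! (k div length ys)) (ys ! (k mod length ys)) : Hom L' (L'.tl (FO xs) (FO ys) ! k) (FO (L.tl xs ys) ! k)"
 using L.div_mod_less[OF k] mu_hom assms[THEN subsetD, OF nth_mem]
 by (simp add: L.tens_list_length L'.tens_list_length L.tens_list_nth L'.tens_list_nth)
qed

lemma eps_row: "L'.row_ok [Unit L'] (FO [Unit L]) (%k. k) (%k. Eps F)"
 using eps_hom by (simp add: L'.row_ok_def)

lemma mu_mat_natural: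
 assumes M: "M : hom_mats L xs xs'" and N: "N : hom_mats L ys ys'"
  and o: "set xs <= Obj L" "set ys <= Obj L" "set xs' <= Obj L" "set ys' <= Obj L"
 shows "L'.mc (L'.tl (FO xs) (FO ys)) (FO (L.tl xs ys)) (FO (L.tl xs' ys')) (FM (L.tm M N)) (mu_mat xs ys)
  = L'.mc (L'.tl (FO xs) (FO ys)) (L'.tl (FO xs') (FO ys')) (FO (L.tl xs' ys')) (mu_mat xs' ys') (L'.tm (FM M) (FM N))"
proof -
note h = FM_hom[OF L.tm_hom[OF M N]] L'.tm_hom[OF FM_hom[OF M] FM_hom[OF N]]
note o1 = L'.tens_list_obj[OF FO_obj[OF o(1)] FO_obj[OF o(2)]] FO_obj[OF L.tens_list_obj[OF o(1,2)]]
  L'.tens_list_obj[OF FO_obj[OF o(3)] FO_obj[OF o(4)]] FO_obj[OF L.tens_list_obj[OF o(3,4)]]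
show ?thesis
 unfolding mu_mat_def L'.mono_mat_comp[OF mu_row[OF o(3,4)] h(2) o1(1,3,4)]
proof (subst L'.comp_mono_mat[OF mu_row[OF o(1,2)] h(1), where \<tau> = "%k. k"], goal_cases)
 case 6
 show ?case
 proof (rule cong_mat, simp, simp, unfold length_map L.tens_list_length L'.tens_list_length prod.case)
  fix i k assume i: "i < length xs' * length ys'" and k: "k < length xs * length ys"
  note n = L.div_mod_less[OF i] L.div_mod_less[OF k]
  note ent = L.hom_mats_entry[OF M n(1,3)] L.hom_mats_entry[OF N n(2,4)]
  show "FM (L.tm M N) $$ (i, k) \<cdot>\<^bsub>L'\<^esub> Mu F (xs ! (k div length ys)) (ys ! (k mod length ys))
   = Mu F (xs' ! (i div length ys')) (ys' ! (i mod length ys')) \<cdot>\<^bsub>L'\<^esub> L'.tm (FM M) (FM N) $$ (i, k)"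
   using mu_natural[OF ent] i k n
   by (simp add: L.tm_index L'.tm_index L.tm_dim L.hom_mats_dim[OF M] L.hom_mats_dim[OF N])
 qed
qed (use o1 in "auto simp: L.tens_list_length L'.tens_list_length")
qed

abbreviation "FX X \<equiv> (FO (fst X), FM (snd X))"

lemma FX_obj:
 assumes "X : kar_objs L" shows "FX X : kar_objs L'"
 using L.kar_obj[OF assms] FM_mc[OF L.kar_obj(2)[OF assms] L.kar_obj(2)[OF assms]]
  FO_obj[OF L.kar_obj(1)[OF assms]]
 by (auto simp: kar_objs_def FM_hom)

lemma FM_compat:
 assumes "L.compat X \<alpha> Y"
 shows "L'.compat (FX X) (FM \<alpha>) (FX Y)"
proof -
have X: "X : kar_objs L" and Y: "Y : kar_objs L" and h: "\<alpha> : hom_mats L (fst X) (fst Y)"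
 and eq: "L.mc (fst X) (fst X) (fst Y) \<alpha> (snd X) = L.mc (fst X) (fst Y) (fst Y) (snd Y) \<alpha>"
 using assms by (auto simp: L.compat_def)
note x = L.kar_obj[OF X] and y = L.kar_obj[OF Y]
show ?thesis
 using arg_cong[OF eq, of FM] FM_mc[OF x(2) h x(1,1) y(1)] FM_mc[OF h y(2) x(1) y(1,1)]
 by (simp add: L'.compat_def FX_obj X Y FM_hom h)
qed

lemma kar_functor_sel:
 "on_obj (Karoubi_functor L L' F) X = FX X"
 "on_arr (Karoubi_functor L L' F) (X, M, Y) = (FX X, FM M, FX Y)"
 by (simp_all add: Karoubi_functor_def Let_def)

lemma kar_functor_cut:
 assumes "L.compat X \<alpha> Y"
 shows "on_arr (Karoubi_functor L L' F) (cut L X \<alpha> Y) = cut L' (FX X) (FM \<alpha>) (FX Y)"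
proof -
have X: "X : kar_objs L" and Y: "Y : kar_objs L" and h: "\<alpha> : hom_mats L (fst X) (fst Y)"
 using assms by (auto simp: L.compat_def)
note x = L.kar_obj[OF X] and y = L.kar_obj[OF Y]
show ?thesis
 unfolding L.cut_eq(1)[OF assms] L'.cut_eq(1)[OF FM_compat[OF assms]] kar_functor_sel
 using FM_mc[OF x(2) h x(1,1) y(1)] by simp
qed

lemma kar_functor_coh:
 "Mu (Karoubi_functor L L' F) X Y
  = cut L' (kar_tens L' (FX X) (FX Y)) (mu_mat (fst X) (fst Y)) (FX (kar_tens L X Y))"
 "Eps (Karoubi_functor L L' F) = cut L' (kar_unit L') eps_mat (FX (kar_unit L))"
proof -
have "mat 1 1 (%_. Eps F) = eps_mat" by (auto simp: eps_mat_def L'.mono_mat_def)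
then show "Eps (Karoubi_functor L L' F) = cut L' (kar_unit L') eps_mat (FX (kar_unit L))"
 by (simp add: Karoubi_functor_def Let_def)
show "Mu (Karoubi_functor L L' F) X Y
 = cut L' (kar_tens L' (FX X) (FX Y)) (mu_mat (fst X) (fst Y)) (FX (kar_tens L X Y))"
 by (simp add: Karoubi_functor_def Let_def L'.diag_mat_eq_mono mu_mat_def L.fst_kar_tens L'.fst_kar_tens)
qed

lemma mu_mat_hom:
 assumes "set xs <= Obj L" "set ys <= Obj L"
 shows "mu_mat xs ys : hom_mats L' (L'.tl (FO xs) (FO ys)) (FO (L.tl xs ys))"
 unfolding mu_mat_def
 by (rule L'.mono_mat_hom[OF mu_row[OF assms]]; intro L'.tens_list_obj FO_obj L.tens_list_obj assms)

text \<open>This is naturality of the comparison at the two idempotents.\<close>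

lemma compat_mu:
 assumes "X : kar_objs L" "Y : kar_objs L"
 shows "L'.compat (kar_tens L' (FX X) (FX Y)) (mu_mat (fst X) (fst Y)) (FX (kar_tens L X Y))"
 using assms mu_mat_natural[OF L.kar_obj(2)[OF assms(1)] L.kar_obj(2)[OF assms(2)]]
  mu_mat_hom L.kar_obj(1) FX_obj[OF L.kar_tens_obj[OF assms], unfolded L.fst_kar_tens L.snd_kar_tens]
 by (simp add: L'.compat_def L'.kar_tens_obj FX_obj L.kar_tens_obj L'.fst_kar_tens L'.snd_kar_tens
   L.fst_kar_tens L.snd_kar_tens)

lemma compat_eps: "L'.compat (kar_unit L') eps_mat (FX (kar_unit L))"
proof -
have o: "set (FO [Unit L]) <= Obj L'" by (rule FO_obj[OF L.unit_list_obj])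
have h: "eps_mat : hom_mats L' [Unit L'] (FO [Unit L])"
 unfolding eps_mat_def by (rule L'.mono_mat_hom[OF eps_row L'.unit_list_obj o])
show ?thesis
 using L'.mc_idm_left[OF h L'.unit_list_obj o] L'.mc_idm_right[OF h L'.unit_list_obj o] h
  FM_idm[OF L.unit_list_obj] FX_obj[OF L.kar_unit_obj]
 by (simp add: L'.compat_def L'.kar_unit_obj L'.kar_unit_eq L.kar_unit_eq)
qed

text \<open>All factors are diagonal again, and the entry in the row \<open>k\<close> is the
  associativity law of \<open>Mu\<close> at the three digits of \<open>k\<close>.\<close>

lemma mu_assoc_mat:
 assumes o: "set xs <= Obj L" "set ys <= Obj L" "set zs <= Obj L"
 shows "L'.mc (L'.tl (L'.tl (FO xs) (FO ys)) (FO zs)) (L'.tl (FO (L.tl xs ys)) (FO zs)) (FO (L.tl xs (L.tl ys zs)))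
   (L'.mc (L'.tl (FO (L.tl xs ys)) (FO zs)) (FO (L.tl (L.tl xs ys) zs)) (FO (L.tl xs (L.tl ys zs)))
    (FM (L.assoc_mat xs ys zs)) (mu_mat (L.tl xs ys) zs)) (L'.tm (mu_mat xs ys) (L'.idm (FO zs)))
  = L'.mc (L'.tl (L'.tl (FO xs) (FO ys)) (FO zs)) (L'.tl (FO xs) (L'.tl (FO ys) (FO zs))) (FO (L.tl xs (L.tl ys zs)))
   (L'.mc (L'.tl (FO xs) (L'.tl (FO ys) (FO zs))) (L'.tl (FO xs) (FO (L.tl ys zs))) (FO (L.tl xs (L.tl ys zs)))
    (mu_mat xs (L.tl ys zs)) (L'.tm (L'.idm (FO xs)) (mu_mat ys zs))) (L'.assoc_mat (FO xs) (FO ys) (FO zs))"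
proof -
note o' = o[THEN FO_obj]
note o1 = L.tens_list_obj[OF o(1,2)] L.tens_list_obj[OF o(2,3)]
 L.tens_list_obj[OF L.tens_list_obj[OF o(1,2)] o(3)] L.tens_list_obj[OF o(1) L.tens_list_obj[OF o(2,3)]]
note a = FM_row[OF L.assoc_row[OF o]] and a' = L'.assoc_row[OF o']
note m = mu_row[OF o1(1) o(3)] mu_row[OF o(1) o1(2)] mu_row[OF o(1,2)] mu_row[OF o(2,3)]
note i = L'.idm_row[OF o'(3)] L'.idm_row[OF o'(1)]
note t = L'.row_ok_tens[OF m(3) i(1)] L'.row_ok_tens[OF i(2) m(4)]
note c = L'.row_ok_comp[OF a m(1)] L'.row_ok_comp[OF m(2) t(2)]
show ?thesis
 unfolding L.assoc_mat_def L'.assoc_mat_def mu_mat_def L'.idm_def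
 apply (simp only: FM_mono_mat[OF L.assoc_row[OF o] o1(3,4)] L'.tm_mono_mat[OF m(3) i(1)] L'.tm_mono_mat[OF i(2) m(4)]
   L'.mono_mat_mono_mat[OF a m(1)] L'.mono_mat_mono_mat[OF m(2) t(2)]
   L'.mono_mat_mono_mat[OF c(1) t(1)] L'.mono_mat_mono_mat[OF c(2) a'] L.tens_list_obj L'.tens_list_obj o o' FO_obj[OF o1(1)]
   FO_obj[OF o1(2)] FO_obj[OF o1(3)] FO_obj[OF o1(4)])
proof (rule L'.mono_mat_cong, goal_cases)
 case (1 k)
 define x y z where xyz: "x = k div length zs div length ys" "y = k div length zs mod length ys" "z = k mod length zs"
 have k: "k < length xs * (length ys * length zs)" using 1 by (simp add: L.tens_list_length)
 have lt: "x < length xs" "y < length ys" "z < length zs"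
  using L.nth3(3-5)[OF k] by (simp_all add: xyz)
 have k': "k < length xs * length ys * length zs" using k by (simp add: mult.assoc)
 note d = L.div_mod_less[OF k] L.div_mod_less[OF k']
 have k_div: "k div length zs = x * length ys + y" "k mod length zs = z" "k div (length ys * length zs) = x"
  unfolding xyz by (simp_all add: L.index_simps)
 have k_mod: "k mod (length ys * length zs) = y * length zs + z"
  unfolding xyz by (metis L.index_simps(2,3) div_mult_mod_eq)
 \<comment> \<open>Both bracketings rebuild the same index from the three digits.\<close>
 have e: "x * (length ys * length zs) + (y * length zs + z) = (x * length ys + y) * length zs + z"
  by (simp add: algebra_simps)
 have yz: "y * length zs + z < length ys * length zs" using lt by (intro L.mult_add_less)
 show ?case
  using mu_assoc[of "xs ! x" "ys ! y" "zs ! z"] lt d k o[THEN subsetD, OF nth_mem] yz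
  by (simp add: L.tens_list_length L'.tens_list_length L.tens_list_nth L'.tens_list_nth k_div k_mod e
   L.mult_add_div_mod del: div_mult_self3 div_mult_self4)
qed
qed

lemma mu_unit_mat:
 assumes o: "set xs <= Obj L"
 shows "L'.mc (L'.tl [Unit L'] (FO xs)) (L'.tl (FO [Unit L]) (FO xs)) (FO xs)
   (L'.mc (L'.tl (FO [Unit L]) (FO xs)) (FO (L.tl [Unit L] xs)) (FO xs)
    (FM (L.lunit_mat xs)) (mu_mat [Unit L] xs)) (L'.tm eps_mat (L'.idm (FO xs)))
  = L'.lunit_mat (FO xs)" (is ?P)
  and "L'.mc (L'.tl (FO xs) [Unit L']) (L'.tl (FO xs) (FO [Unit L])) (FO xs)
   (L'.mc (L'.tl (FO xs) (FO [Unit L])) (FO (L.tl xs [Unit L])) (FO xs)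
    (FM (L.runit_mat xs)) (mu_mat xs [Unit L])) (L'.tm (L'.idm (FO xs)) eps_mat)
  = L'.runit_mat (FO xs)" (is ?P1)
proof -
note o' = o[THEN FO_obj]
note u = L.unit_list_obj
note u' = L'.unit_list_obj
note o1 = L.tens_list_obj[OF u o] L.tens_list_obj[OF o u]
note r = FM_row[OF L.lunit_row[OF o]] FM_row[OF L.runit_row[OF o]]
note m = mu_row[OF u o] mu_row[OF o u]
note i = L'.idm_row[OF o']
note t = L'.row_ok_tens[OF eps_row i] L'.row_ok_tens[OF i eps_row]
note c = L'.row_ok_comp[OF r(1) m(1)] L'.row_ok_comp[OF r(2) m(2)]
show ?P
 unfolding L.lunit_mat_def L'.lunit_mat_def mu_mat_def L'.idm_def eps_mat_def
 apply (simp only: FM_mono_mat[OF L.lunit_row[OF o] o1(1) o] L'.tm_mono_mat[OF eps_row i]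
   L'.mono_mat_mono_mat[OF r(1) m(1)] L'.mono_mat_mono_mat[OF c(1) t(1)] L.tens_list_obj L'.tens_list_obj o o' u u'
   FO_obj[OF o1(1)] FO_obj[OF u])
 using o[THEN subsetD, OF nth_mem] mu_lunit by (intro L'.mono_mat_cong) auto
show ?P1
 unfolding L.runit_mat_def L'.runit_mat_def mu_mat_def L'.idm_def eps_mat_def
 apply (simp only: FM_mono_mat[OF L.runit_row[OF o] o1(2) o] L'.tm_mono_mat[OF i eps_row]
   L'.mono_mat_mono_mat[OF r(2) m(2)] L'.mono_mat_mono_mat[OF c(2) t(2)] L.tens_list_obj L'.tens_list_obj o o' u u'
   FO_obj[OF o1(2)] FO_obj[OF u])
 using o[THEN subsetD, OF nth_mem] mu_runit by (intro L'.mono_mat_cong) auto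
qed

lemma mu_braid_mat:
 assumes o: "set xs <= Obj L" "set ys <= Obj L"
 shows "L'.mc (L'.tl (FO xs) (FO ys)) (FO (L.tl xs ys)) (FO (L.tl ys xs)) (FM (L.braid_mat xs ys)) (mu_mat xs ys)
  = L'.mc (L'.tl (FO xs) (FO ys)) (L'.tl (FO ys) (FO xs)) (FO (L.tl ys xs))
    (mu_mat ys xs) (L'.braid_mat (FO xs) (FO ys))"
proof -
note o' = o[THEN FO_obj]
note o1 = L.tens_list_obj[OF o] L.tens_list_obj[OF o(2,1)]
note r = FM_row[OF L.braid_row[OF o]] L'.braid_row[OF o']
note m = mu_row[OF o] mu_row[OF o(2,1)]
show ?thesis
 unfolding L.braid_mat_def L'.braid_mat_def mu_mat_def
 apply (simp only: FM_mono_mat[OF L.braid_row[OF o] o1]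
   L'.mono_mat_mono_mat[OF r(1) m(1)] L'.mono_mat_mono_mat[OF m(2) r(2)] L.tens_list_obj L'.tens_list_obj o o'
   FO_obj[OF o1(1)] FO_obj[OF o1(2)])
proof (rule L'.mono_mat_cong, goal_cases)
 case (1 i)
 then have i: "i < length ys * length xs" by (simp add: L.tens_list_length)
 show ?case
  using L.div_mod_less[OF i] L.swap_index[OF i] mu_braid o[THEN subsetD, OF nth_mem] by simp
qed
qed

lemma kar_mu_iso:
 assumes "X : kar_objs L" "Y : kar_objs L"
 shows "is_iso (Karoubi L') (Mu (Karoubi_functor L L' F) X Y)"
proof -
note o = L.kar_obj(1)[OF assms(1)] L.kar_obj(1)[OF assms(2)]
let ?U = "L'.tl (FO (fst X)) (FO (fst Y))" and ?V = "FO (L.tl (fst X) (fst Y))"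
have "EX N:hom_mats L' ?V ?U. L'.mc ?U ?V ?U N (mu_mat (fst X) (fst Y)) = L'.idm ?U &
  L'.mc ?V ?U ?V (mu_mat (fst X) (fst Y)) N = L'.idm ?V"
 unfolding mu_mat_def
proof (rule L'.diag_inverse[OF mu_row[OF o]], goal_cases)
 case (2 k)
 then have "k < length (fst X) * length (fst Y)" by (simp add: L.tens_list_length)
 from L.div_mod_less[OF this] show ?case using mu_hom o[THEN subsetD, OF nth_mem] by simp
next
 case 3 show ?case by (intro L'.tens_list_obj FO_obj o)
next
 case 4 show ?case by (intro L.tens_list_obj FO_obj o)
qed (simp add: L.tens_list_length L'.tens_list_length)
then show ?thesis
 unfolding kar_functor_coh using L'.cut_iso[OF compat_mu[OF assms]]
 by (auto simp: L.fst_kar_tens L'.fst_kar_tens)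
qed

lemma kar_eps_iso: "is_iso (Karoubi L') (Eps (Karoubi_functor L L' F))"
proof -
have "EX N:hom_mats L' (FO [Unit L]) [Unit L']. L'.mc [Unit L'] (FO [Unit L]) [Unit L'] N eps_mat = L'.idm [Unit L'] &
  L'.mc (FO [Unit L]) [Unit L'] (FO [Unit L]) eps_mat N = L'.idm (FO [Unit L])"
 unfolding eps_mat_def
 by (rule L'.diag_inverse[OF eps_row])
  (use eps_hom L'.unit_list_obj FO_obj[OF L.unit_list_obj] in auto)
then show ?thesis
 unfolding kar_functor_coh using L'.cut_iso[OF compat_eps]
 by (auto simp: L.kar_unit_eq L'.kar_unit_eq)
qed

theorem Karoubi_functor_smf:
 "symmetric_monoidal_functor (Karoubi L) (Karoubi L') (Karoubi_functor L L' F)"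
proof -
interpret K: symmetric_monoidal_category "Karoubi L" by (rule L.Karoubi_smc)
interpret K': symmetric_monoidal_category "Karoubi L'" by (rule L'.Karoubi_smc)
show ?thesis
proof (unfold_locales, goal_cases)
 case (1 x) then show ?case unfolding L.kar_sel L'.kar_sel kar_functor_sel by (rule FX_obj)
next
 case (2 f X Y)
 then obtain M where f: "f = (X, M, Y)" and o: "X : kar_objs L" "Y : kar_objs L"
  and h: "M : hom_mats L (fst X) (fst Y)"
  and e: "L.mc (fst X) (fst Y) (fst Y) (snd Y) M = M" "L.mc (fst X) (fst X) (fst Y) M (snd X) = M"
  by (auto simp: L.kar_Hom)
 note x = L.kar_obj[OF o(1)] and y = L.kar_obj[OF o(2)]
 show ?case
  using FM_mc[OF h y(2) x(1) y(1,1)] FM_mc[OF x(2) h x(1,1) y(1)] o FM_hom[OF h]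
  by (auto simp: f kar_functor_sel L'.kar_Hom FX_obj e)
next
 case (3 x) then show ?case by (simp add: L.kar_sel L'.kar_sel kar_functor_sel)
next
 case (4 f X Y g Z)
 then show ?case
  by (auto simp: L.kar_Hom L.kar_sel L'.kar_sel kar_functor_sel intro!: FM_mc L.kar_obj(1))
next
 case (5 X Y)
 then show ?case
  unfolding L.kar_sel L'.kar_sel
  by (auto simp: kar_mu_iso) (simp add: kar_functor_coh kar_functor_sel compat_mu L'.cut_hom)
next
 case (6 f X X' g Y Y')
 then obtain M N where *: "f = (X, M, X')" "g = (Y, N, Y')"
  and o: "X : kar_objs L" "X' : kar_objs L" "Y : kar_objs L" "Y' : kar_objs L"
  and h: "M : hom_mats L (fst X) (fst X')" "N : hom_mats L (fst Y) (fst Y')"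
  and e: "L.mc (fst X) (fst X') (fst X') (snd X') M = M" "L.mc (fst X) (fst X) (fst X') M (snd X) = M"
   "L.mc (fst Y) (fst Y') (fst Y') (snd Y') N = N" "L.mc (fst Y) (fst Y) (fst Y') N (snd Y) = N"
  by (auto simp: L.kar_Hom)
 note ob = o[THEN L.kar_obj(1)]
 note ob2 = o[THEN L.kar_obj(2)]
 note F = h[THEN FM_hom]
 have e': "L'.mc (FO (fst X)) (FO (fst X')) (FO (fst X')) (FM (snd X')) (FM M) = FM M"
  "L'.mc (FO (fst X)) (FO (fst X)) (FO (fst X')) (FM M) (FM (snd X)) = FM M"
  "L'.mc (FO (fst Y)) (FO (fst Y')) (FO (fst Y')) (FM (snd Y')) (FM N) = FM N"
  "L'.mc (FO (fst Y)) (FO (fst Y)) (FO (fst Y')) (FM N) (FM (snd Y)) = FM N"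
  using FM_mc[OF h(1) ob2(2) ob(1,2,2)] FM_mc[OF ob2(1) h(1) ob(1,1,2)]
   FM_mc[OF h(2) ob2(4) ob(3,4,4)] FM_mc[OF ob2(3) h(2) ob(3,3,4)] e by simp_all
 have tm_e: "L.mc (fst (kar_tens L X Y)) (fst (kar_tens L X' Y')) (fst (kar_tens L X' Y')) (snd (kar_tens L X' Y')) (L.tm M N) = L.tm M N"
  "L.mc (fst (kar_tens L X Y)) (fst (kar_tens L X Y)) (fst (kar_tens L X' Y')) (L.tm M N) (snd (kar_tens L X Y)) = L.tm M N"
  using ob ob2 h by (simp_all add: L.fst_kar_tens L.snd_kar_tens e flip: L.tm_mc)
 \<comment> \<open>The image of the tensored arrow and the tensor product of the images are both
   arrows of the completion, so each absorbs the idempotent hidden in the cut comparison next to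
   it.\<close>
 have a: "(FX (kar_tens L X Y), FM (L.tm M N), FX (kar_tens L X' Y')) : Arr (Karoubi L')"
  unfolding L'.kar_Arr fst_conv snd_conv
 proof (intro conjI FX_obj L.kar_tens_obj o FM_hom)
  show h': "L.tm M N : hom_mats L (fst (kar_tens L X Y)) (fst (kar_tens L X' Y'))"
   unfolding L.fst_kar_tens by (rule L.tm_hom[OF h])
  have o3: "kar_tens L X Y : kar_objs L" "kar_tens L X' Y' : kar_objs L" using o by (simp_all add: L.kar_tens_obj)
  note k = o3[THEN L.kar_obj(1)] and k2 = o3[THEN L.kar_obj(2)]
  show "L'.mc (FO (fst (kar_tens L X Y))) (FO (fst (kar_tens L X' Y'))) (FO (fst (kar_tens L X' Y')))
    (FM (snd (kar_tens L X' Y'))) (FM (L.tm M N)) = FM (L.tm M N)"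
   using FM_mc[OF h' k2(2) k(1,2,2)] tm_e by simp
  show "L'.mc (FO (fst (kar_tens L X Y))) (FO (fst (kar_tens L X Y))) (FO (fst (kar_tens L X' Y')))
    (FM (L.tm M N)) (FM (snd (kar_tens L X Y))) = FM (L.tm M N)"
   using FM_mc[OF k2(1) h' k(1,1,2)] tm_e by simp
 qed
 have b: "(kar_tens L' (FX X) (FX Y), L'.tm (FM M) (FM N), kar_tens L' (FX X') (FX Y')) : Arr (Karoubi L')"
  using o F FO_obj[OF ob(1)] FO_obj[OF ob(2)] FO_obj[OF ob(3)] FO_obj[OF ob(4)] ob2[THEN FM_hom]
  by (simp add: L'.kar_Arr L'.kar_tens_obj FX_obj L'.fst_kar_tens L'.snd_kar_tens L'.tm_hom e' flip: L'.tm_mc)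
 show ?case
  unfolding * L.kar_sel L'.kar_sel kar_functor_sel kar_functor_coh
   L'.arr_cut[OF a compat_mu[OF o(1,3)]] L'.cut_arr[OF b compat_mu[OF o(2,4)]]
  using mu_mat_natural[OF h ob(1,3,2,4)] by (simp add: L.fst_kar_tens L'.fst_kar_tens)
next
 case 7
 show ?case
  using kar_eps_iso L'.cut_hom[OF compat_eps] by (simp add: L.kar_sel L'.kar_sel kar_functor_coh kar_functor_sel)
next
 case (8 X Y Z)
 then have o: "X : kar_objs L" "Y : kar_objs L" "Z : kar_objs L" by (simp_all add: L.kar_sel)
 note o' = o[THEN FX_obj]
 note i = L'.compat_idm[OF o'(3)] L'.compat_idm[OF o'(1)]
 note m = compat_mu[OF L.kar_tens_obj[OF o(1,2)] o(3)] compat_mu[OF o(1,2)]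
  compat_mu[OF o(1) L.kar_tens_obj[OF o(2,3)]] compat_mu[OF o(2,3)]
 note t = L'.compat_tens[OF m(2) i(1)] L'.compat_tens[OF i(3) m(4)]
 note a = FM_compat[OF L.compat_coh(1)[OF o]] L'.compat_coh(1)[OF o']
 show ?case
  unfolding kar_functor_coh L.kar_sel(6) kar_functor_sel(1) i(2,4) t(2,4) L.kar_coh L'.kar_coh
   kar_functor_cut[OF L.compat_coh(1)[OF o]] L'.cut_cut[OF m(1) a(1)]
   L'.cut_cut[OF t(1) L'.compat_comp[OF m(1) a(1)]]
   L'.cut_cut[OF t(3) m(3)] L'.cut_cut[OF a(2) L'.compat_comp[OF t(3) m(3)]]
  using mu_assoc_mat[OF o[THEN L.kar_obj(1)]]
  by (simp add: L.fst_kar_tens L'.fst_kar_tens)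
next
 case (9 X)
 then have o: "X : kar_objs L" by (simp_all add: L.kar_sel)
 note o' = o[THEN FX_obj]
 note i = L'.compat_idm[OF o']
 note m = compat_mu[OF L.kar_unit_obj o]
 note t = L'.compat_tens[OF compat_eps i(1)]
 note a = FM_compat[OF L.compat_coh(2)[OF o]]
 show ?case
  unfolding kar_functor_coh L.kar_sel(6,8) kar_functor_sel(1) i(2) t(2) L.kar_coh L'.kar_coh
   kar_functor_cut[OF L.compat_coh(2)[OF o]] L'.cut_cut[OF m a] L'.cut_cut[OF t(1) L'.compat_comp[OF m a]]
  using mu_unit_mat(1)[OF o[THEN L.kar_obj(1)]]
  by (simp add: L.fst_kar_tens L'.fst_kar_tens L.kar_unit_eq L'.kar_unit_eq)
next
 case (10 X)
 then have o: "X : kar_objs L" by (simp_all add: L.kar_sel)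
 note o' = o[THEN FX_obj]
 note i = L'.compat_idm[OF o']
 note m = compat_mu[OF o L.kar_unit_obj]
 note t = L'.compat_tens[OF i(1) compat_eps]
 note a = FM_compat[OF L.compat_coh(3)[OF o]]
 show ?case
  unfolding kar_functor_coh L.kar_sel(6,8) kar_functor_sel(1) i(2) t(2) L.kar_coh L'.kar_coh
   kar_functor_cut[OF L.compat_coh(3)[OF o]] L'.cut_cut[OF m a] L'.cut_cut[OF t(1) L'.compat_comp[OF m a]]
  using mu_unit_mat(2)[OF o[THEN L.kar_obj(1)]]
  by (simp add: L.fst_kar_tens L'.fst_kar_tens L.kar_unit_eq L'.kar_unit_eq)
next
 case (11 X Y)
 then have o: "X : kar_objs L" "Y : kar_objs L" by (simp_all add: L.kar_sel)
 note o' = o[THEN FX_obj]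
 note m = compat_mu[OF o] compat_mu[OF o(2,1)]
 note a = FM_compat[OF L.compat_coh(4)[OF o]] L'.compat_coh(4)[OF o']
 show ?case
  unfolding kar_functor_coh L.kar_sel(6) kar_functor_sel(1) L.kar_coh L'.kar_coh
   kar_functor_cut[OF L.compat_coh(4)[OF o]] L'.cut_cut[OF m(1) a(1)] L'.cut_cut[OF a(2) m(2)]
  using mu_braid_mat[OF o[THEN L.kar_obj(1)]]
  by (simp add: L.fst_kar_tens L'.fst_kar_tens)
qed
qed

theorem Karoubi_functor_linear: "linear_functor (Karoubi L) (Karoubi L') (Karoubi_functor L L' F)"
 unfolding linear_functor_def
proof (intro conjI allI ballI)
fix X Y f g assume "f : Hom (Karoubi L) X Y" "g : Hom (Karoubi L) X Y"
then obtain M N where f: "f = (X, M, Y)" "g = (X, N, Y)"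
 and h: "M : hom_mats L (fst X) (fst Y)" "N : hom_mats L (fst X) (fst Y)"
 by (auto simp: L.kar_Hom)
show "on_arr (Karoubi_functor L L' F) (Hadd (Karoubi L) f g)
  = Hadd (Karoubi L') (on_arr (Karoubi_functor L L' F) f) (on_arr (Karoubi_functor L L' F) g)"
 using on_arr_add[OF L.hom_mats_entry[OF h(1)] L.hom_mats_entry[OF h(2)]]
  L.hom_mats_dim[OF h(1)] L.hom_mats_dim[OF h(2)]
 by (auto simp: f Karoubi_def kar_functor_sel intro!: eq_matI)
next
fix c f assume "f : Arr (Karoubi L)"
then obtain X M Y where f: "f = (X, M, Y)" and h: "M : hom_mats L (fst X) (fst Y)"
 by (cases f) (auto simp: L.kar_Arr)
have "on_arr F (Hscale L c a) = Hscale L' c (on_arr F a)" if "a : Arr L" for a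
 using that linear by (auto simp: linear_functor_def)
moreover have "M $$ (i, j) : Arr L" if "i < length (fst Y)" "j < length (fst X)" for i j
 using L.hom_mats_entry[OF h that] by (simp add: Hom_def)
ultimately show "on_arr (Karoubi_functor L L' F) (Hscale (Karoubi L) c f)
  = Hscale (Karoubi L') c (on_arr (Karoubi_functor L L' F) f)"
 unfolding f using L.hom_mats_dim[OF h]
 by (simp add: Karoubi_def kar_functor_sel) (rule eq_matI; simp)
qed

end

section \<open>Finite vector spaces and representations\<close>

lemma field_class_ring: "field (class_ring :: 'f::field ring)"
 by (rule class_field)

lemma submodule_iff:
 assumes "vectorspace class_ring V"
 shows "VectorSpace.subspace class_ring U V \<longleftrightarrow> U <= carrier V & \<zero>\<^bsub>V\<^esub> : U
  & (ALL a:U. ALL b:U. a \<oplus>\<^bsub>V\<^esub> b : U) & (ALL c. ALL a:U. c \<odot>\<^bsub>V\<^esub> a : U)"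
proof -
interpret vectorspace class_ring V by fact
have "module class_ring V" by unfold_locales
then show ?thesis using assms by (auto simp: VectorSpace.subspace_def submodule_def)
qed

lemma linear_map_iff:
 "linear_map class_ring V W f \<longleftrightarrow> vectorspace class_ring V & vectorspace class_ring W
  & f : carrier V \<rightarrow> carrier W
  & (ALL a:carrier V. ALL b:carrier V. f (a \<oplus>\<^bsub>V\<^esub> b) = f a \<oplus>\<^bsub>W\<^esub> f b)
  & (ALL c. ALL a:carrier V. f (c \<odot>\<^bsub>V\<^esub> a) = c \<odot>\<^bsub>W\<^esub> f a)"
 by (auto simp: linear_map_def mod_hom_def mod_hom_axioms_def LinearCombinations.module_hom_def vectorspace_def)

text \<open>Taking coordinates is a bijection onto the functions from the basis to the
  field.\<close>

lemma basis_card: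
 fixes V :: "('f::{field, finite}, 'u) module"
 assumes "vectorspace class_ring V" "finite B" "vectorspace.basis class_ring V B"
 shows "card (carrier V) = card (UNIV :: 'f set) ^ card B" (is ?P) "finite (carrier V)"
proof -
interpret vectorspace class_ring V by fact
have B: "B <= carrier V" using assms(3) by (simp add: basis_def)
have u: "ALL v. v : carrier V --> (\<exists>!a. a : B \<rightarrow>\<^sub>E carrier class_ring & lincomb a B = v)"
 using assms(3) basis_criterion[OF assms(2) B] by blast
have "bij_betw (%a. lincomb a B) (B \<rightarrow>\<^sub>E (UNIV :: 'f set)) (carrier V)"
 unfolding bij_betw_def inj_on_def
proof (intro conjI ballI impI equalityI subsetI)
 fix a b assume "a : B \<rightarrow>\<^sub>E (UNIV :: 'f set)" "b : B \<rightarrow>\<^sub>E (UNIV :: 'f set)" "lincomb a B = lincomb b B"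
 moreover have "lincomb a B : carrier V" by (rule lincomb_closed) (use B in auto)
 ultimately show "a = b" using u by auto
next
 fix v assume "v : (%a. lincomb a B) ` (B \<rightarrow>\<^sub>E (UNIV :: 'f set))"
 then show "v : carrier V" using B by (auto intro!: lincomb_closed)
next
 fix v assume "v : carrier V"
 then obtain a where "a : B \<rightarrow>\<^sub>E carrier class_ring & lincomb a B = v" using u by blast
 then show "v : (%a. lincomb a B) ` (B \<rightarrow>\<^sub>E (UNIV :: 'f set))" by auto
qed
moreover have "finite (B \<rightarrow>\<^sub>E (UNIV :: 'f set))" using assms(2) by (intro finite_PiE) auto
ultimately show ?P "finite (carrier V)"
 using assms(2) by (auto simp: bij_betw_same_card[symmetric] card_PiE bij_betw_finite)
qed

lemma fin_dim_iff_finite: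
 fixes V :: "('f::{field, finite}, 'u) module"
 assumes "vectorspace class_ring V"
 shows "vectorspace.fin_dim class_ring V \<longleftrightarrow> finite (carrier V)"
proof -
interpret vectorspace class_ring V by fact
show ?thesis
proof
 assume "fin_dim"
 then obtain B where "finite B" "basis B" using finite_basis_exists by auto
 then show "finite (carrier V)" using basis_card[OF assms] by blast
next
 assume "finite (carrier V)"
 moreover have "gen_set (carrier V)"
  using in_own_span[of "carrier V"] span_is_subset2[of "carrier V"] by auto
 ultimately show fin_dim by (auto simp: fin_dim_def)
qed
qed

text \<open>Turns questions about dimensions into counting; \<open>vdim_eqI\<close> and
  \<open>vdim_sum\<close> recover dimensions by comparing exponents.\<close>

lemma card_eq_power_vdim:
 fixes V :: "('f::{field, finite}, 'u) module"
 assumes "vectorspace class_ring V" "finite (carrier V)"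
 shows "card (carrier V) = card (UNIV :: 'f set) ^ vdim V"
proof -
interpret vectorspace class_ring V by fact
have "fin_dim" using assms fin_dim_iff_finite by blast
then obtain B where "finite B" "basis B" using finite_basis_exists by auto
then show ?thesis using basis_card[OF assms(1)] dim_basis by (simp add: vdim_def)
qed

lemma Obj_Vect:
 "Obj Vect = {V :: ('f::{field, finite}, 'u) module. vectorspace class_ring V & finite (carrier V)}"
 by (auto simp: Vect_def Let_def fin_dim_iff_finite)

lemma Obj_Rep:
 fixes V :: "('f::{field, finite}, 'u) module"
 shows "(V, \<rho>) : Obj (Rep G) \<longleftrightarrow> vectorspace class_ring V & finite (carrier V)
  & (ALL g:carrier G. ALL a:carrier V. \<rho> g a : carrier V)
  & (ALL g:carrier G. ALL a:carrier V. ALL b:carrier V. \<rho> g (a \<oplus>\<^bsub>V\<^esub> b) = \<rho> g a \<oplus>\<^bsub>V\<^esub> \<rho> g b)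
  & (ALL g:carrier G. ALL c. ALL a:carrier V. \<rho> g (c \<odot>\<^bsub>V\<^esub> a) = c \<odot>\<^bsub>V\<^esub> \<rho> g a)
  & (ALL v:carrier V. \<rho> \<one>\<^bsub>G\<^esub> v = v)
  & (ALL g:carrier G. ALL h:carrier G. ALL v:carrier V. \<rho> (g \<otimes>\<^bsub>G\<^esub> h) v = \<rho> g (\<rho> h v))"
 by (simp add: Rep_def Let_def Obj_Vect linear_map_iff) blast

lemma Arr_Rep:
 fixes V :: "('f::{field, finite}, 'u) module"
 shows "((V, \<rho>), f, (W, \<sigma>)) : Arr (Rep G) \<longleftrightarrow> (V, \<rho>) : Obj (Rep G) & (W, \<sigma>) : Obj (Rep G)
  & f : carrier V \<rightarrow> carrier W
  & (ALL a:carrier V. ALL b:carrier V. f (a \<oplus>\<^bsub>V\<^esub> b) = f a \<oplus>\<^bsub>W\<^esub> f b)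
  & (ALL c. ALL a:carrier V. f (c \<odot>\<^bsub>V\<^esub> a) = c \<odot>\<^bsub>W\<^esub> f a)
  & (ALL g:carrier G. ALL v:carrier V. f (\<rho> g v) = \<sigma> g (f v))
  & f : extensional (carrier V)"
proof -
have "Arr (Rep G) = {((V :: ('f, 'u) module, \<rho>), f, (W, \<sigma>)). (V, \<rho>) : Obj (Rep G) & (W, \<sigma>) : Obj (Rep G)
  & (V, f, W) : Arr Vect & (ALL g:carrier G. ALL v:carrier V. f (\<rho> g v) = \<sigma> g (f v))}"
 by (simp add: Rep_def Let_def)
moreover have "(V, f, W) : Arr Vect \<longleftrightarrow> V : Obj Vect & W : Obj Vect & linear_map class_ring V W f
  & f : extensional (carrier V)"
 by (simp add: Vect_def Let_def)
moreover have "(V, \<rho>) : Obj (Rep G) ==> V : Obj Vect" "(W, \<sigma>) : Obj (Rep G) ==> W : Obj Vect"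
 by (simp_all add: Rep_def Let_def)
ultimately show ?thesis
 by (auto simp: linear_map_iff Obj_Vect)
qed

text \<open>A subspace \<open>W\<close> of largest cardinality among those meeting \<open>U\<close>
  in zero is a complement of \<open>U\<close>, since a vector outside U + W could be adjoined to it;
  the retraction is the projection along \<open>W\<close>.\<close>

lemma linear_retraction:
 fixes V :: "('f::field, 'u) module" (structure)
 assumes V: "vectorspace class_ring V" and finV: "finite (carrier V)"
  and U: "VectorSpace.subspace class_ring U V"
 shows "EX p. linear_map class_ring V V p & p ` carrier V <= U & (ALL u:U. p u = u)"
proof -
interpret vectorspace class_ring V by fact
define ok where "ok W \<longleftrightarrow> VectorSpace.subspace class_ring W V & W \<inter> U = {\<zero>}" for W
note sub = submodule_iff[OF V]
have "ok {\<zero>}" using U by (auto simp: ok_def sub smult_r_null)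
moreover have "W <= carrier V" if "ok W" for W using that by (auto simp: ok_def sub)
\<comment> \<open>The cardinality of the whole space bounds all candidates, so a maximum
  exists.\<close>
ultimately obtain W where W: "ok W" and max: "!!W'. ok W' ==> card W' <= card W"
 using ex_has_greatest_nat[of ok "{\<zero>}" card "Suc (card (carrier V))"] finV by (metis card_mono le_imp_less_Suc)
have Wc: "W <= carrier V" and Uc: "U <= carrier V" using W U by (auto simp: ok_def sub)
have Wcl: "\<zero> : W" "!!a b. [|a : W; b : W|] ==> a \<oplus> b : W" "!!c a. a : W ==> c \<odot> a : W"
 and Ucl: "\<zero> : U" "!!a b. [|a : U; b : U|] ==> a \<oplus> b : U" "!!c a. a : U ==> c \<odot> a : U"
 using W U by (auto simp: ok_def sub)
have neg: "\<ominus> a = (-1) \<odot> a" if "a : carrier V" for a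
proof -
 have "a \<oplus> (-1) \<odot> a = (1 + (-1)) \<odot> a"
  using smult_l_distr[of 1 "-1" a] smult_one[OF that] that by simp
 also have "... = \<zero>" using lmult_0[OF that] by simp
 finally show ?thesis using that M.minus_equality[of "(-1) \<odot> a" a] smult_closed[of "-1" a] M.a_comm by simp
qed
have Umin: "\<ominus> a : U" if "a : U" for a using neg Ucl(3) Uc that by auto
have Wmin: "\<ominus> a : W" if "a : W" for a using neg Wcl(3) Wc that by auto
have uniq: "u = u'" if "u : U" "u' : U" "w : W" "w' : W" "u \<oplus> w = u' \<oplus> w'" for u u' w w'
proof -
 have c: "u : carrier V" "u' : carrier V" "w : carrier V" "w' : carrier V" using that Uc Wc by auto
 have "u \<ominus> u' = w' \<ominus> w"
 proof -
  have "u = (u' \<oplus> w') \<oplus> \<ominus> w"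
   using M.add.inv_solve_right[of u "u' \<oplus> w'" w] c that(5) by simp
  then have "u = (w' \<ominus> w) \<oplus> u'"
   using c by (simp add: M.a_ac M.minus_eq)
  then show ?thesis using M.add.inv_solve_right[of "w' \<ominus> w" u u'] c by (simp add: M.minus_eq)
 qed
 moreover have "u \<ominus> u' : U" "w' \<ominus> w : W"
  using that Umin Wmin Ucl Wcl by (auto simp: M.minus_eq)
 ultimately have "u \<ominus> u' = \<zero>" using W by (auto simp: ok_def)
 then show ?thesis using c by simp
qed
have span: "EX u:U. EX w:W. v = u \<oplus> w" if v: "v : carrier V" for v
proof (rule ccontr)
 assume no: "\<not> ?thesis"
 \<comment> \<open>The span of \<open>W\<close> and \<open>v\<close>. It is strictly larger than
   \<open>W\<close> and still meets \<open>U\<close> trivially, against maximality.\<close>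
 define W' where "W' = {w \<oplus> c \<odot> v | w c. w : W}"
 have W'I: "w \<oplus> c \<odot> v : W'" if "w : W" for w c using that by (auto simp: W'_def)
 have "W <= W'"
 proof
  fix w assume "w : W"
  moreover have "w = w \<oplus> 0 \<odot> v" using \<open>w : W\<close> Wc v lmult_0[OF v] by auto
  ultimately show "w : W'" using W'I by metis
 qed
 moreover have "v : W'"
  using W'I[OF Wcl(1), of 1] v smult_one[OF v] by simp
 moreover have "v \<notin> W"
  using no v Ucl(1) by (metis M.l_zero)
 moreover have W'c: "W' <= carrier V" using Wc v by (auto simp: W'_def)
 ultimately have "card W < card W'" using finV by (intro psubset_card_mono) (auto intro: finite_subset)
 moreover have "ok W'"
  unfolding ok_def sub
 proof (intro conjI W'c ballI allI)
  show "\<zero> : W'" using \<open>W <= W'\<close> Wcl by auto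
  show "a \<oplus> b : W'" if "a : W'" "b : W'" for a b
  proof -
   obtain w c w' c' where *: "a = w \<oplus> c \<odot> v" "b = w' \<oplus> c' \<odot> v" "w : W" "w' : W"
    using \<open>a : W'\<close> \<open>b : W'\<close> unfolding W'_def by auto
   have "a \<oplus> b = (w \<oplus> w') \<oplus> (c + c') \<odot> v"
    using smult_l_distr[of c c' v] * Wc v by (simp add: subset_iff M.a_ac)
   then show ?thesis using W'I Wcl * by simp
  qed
  show "c \<odot> a : W'" if "a : W'" for c a
  proof -
   obtain w c' where *: "a = w \<oplus> c' \<odot> v" "w : W"
    using \<open>a : W'\<close> unfolding W'_def by auto
   have "c \<odot> a = c \<odot> w \<oplus> (c * c') \<odot> v"
    using smult_r_distr[of c w "c' \<odot> v"] smult_assoc1[of c c' v] * Wc v by auto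
   then show ?thesis using W'I Wcl * by simp
  qed
  have "a = \<zero>" if "a : W'" "a : U" for a
  proof -
   obtain w c where *: "a = w \<oplus> c \<odot> v" "w : W"
    using \<open>a : W'\<close> unfolding W'_def by auto
   have wc: "w : carrier V" "a : carrier V" using * Wc that Uc by auto
   show ?thesis
   proof (cases "c = 0")
    case True
    then have "a = w" using * wc lmult_0[OF v] by simp
    then show ?thesis using * W that by (auto simp: ok_def)
   next
    \<comment> \<open>Dividing by \<open>c\<close> would write \<open>v\<close> as a vector of
      \<open>U\<close> plus a vector of \<open>W\<close>, which \<open>no\<close> excludes.\<close>
    case False
    have "c \<odot> v = a \<oplus> \<ominus> w" using *(1) wc v
     M.add.inv_solve_right[of "c \<odot> v" a w] M.a_comm[of w "c \<odot> v"] by simp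
    then have "inverse c \<odot> (c \<odot> v) = inverse c \<odot> a \<oplus> inverse c \<odot> (\<ominus> w)"
     using smult_r_distr[of "inverse c" a "\<ominus> w"] wc by simp
    moreover have "inverse c \<odot> (c \<odot> v) = v"
     using smult_assoc1[of "inverse c" c v] v False smult_one[OF v] by simp
    ultimately show ?thesis using no Ucl(3)[OF that(2), of "inverse c"] Wcl(3)[OF Wmin[OF *(2)], of "inverse c"] by auto
   qed
  qed
  then show "W' \<inter> U = {\<zero>}" using Ucl(1) Wcl(1) \<open>W <= W'\<close> by blast
 qed
 ultimately show False using max by fastforce
qed
\<comment> \<open>By \<open>uniq\<close> the choice is forced and \<open>p_eq\<close> computes it;
  linearity follows by adding and scaling decompositions.\<close>
define p where "p v = (SOME u. u : U & (EX w:W. v = u \<oplus> w))" for v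
have p: "p v : U & (EX w:W. v = p v \<oplus> w)" if "v : carrier V" for v
 unfolding p_def by (rule someI_ex) (use span[OF that] in blast)
have p_eq: "p (u \<oplus> w) = u" if "u : U" "w : W" for u w
 using p[of "u \<oplus> w"] that Uc Wc uniq by (metis M.a_closed subsetD)
have "p (a \<oplus> b) = p a \<oplus> p b" if ab: "a : carrier V" "b : carrier V" for a b
proof -
 obtain w w' where w: "w : W" "a = p a \<oplus> w" "w' : W" "b = p b \<oplus> w'" using p ab by blast
 then have c: "w : carrier V" "w' : carrier V" "p a : carrier V" "p b : carrier V" using Wc Uc p ab by blast+
 have "a \<oplus> b = (p a \<oplus> w) \<oplus> (p b \<oplus> w')" using w by simp
 also have "... = (p a \<oplus> p b) \<oplus> (w \<oplus> w')" using c by (simp add: M.a_ac)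
 finally show ?thesis using p_eq[of "p a \<oplus> p b" "w \<oplus> w'"] p ab w Ucl Wcl by metis
qed
moreover have "p (c \<odot> a) = c \<odot> p a" if a: "a : carrier V" for a c
proof -
 obtain w where w: "w : W" "a = p a \<oplus> w" using p a by blast
 then have wc: "w : carrier V" "p a : carrier V" using Wc Uc p a by blast+
 have "c \<odot> a = c \<odot> p a \<oplus> c \<odot> w" using w(2) smult_r_distr[of c "p a" w] wc by simp
 then show ?thesis using p_eq[of "c \<odot> p a" "c \<odot> w"] p a w Ucl Wcl by metis
qed
moreover have "p u = u" if "u : U" for u
 using p_eq[OF that Wcl(1)] that Uc by auto
ultimately show ?thesis
 using p V Uc by (intro exI[of _ p]) (auto simp: linear_map_iff)
qed

section \<open>Categories of representations\<close>

text \<open>\<open>Rep G\<close> and, for the trivial group, \<open>Vect\<close> are both of this shape: an object \<open>S\<close> has an underlying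
 representation \<open>emb S\<close>, and every representation is, up to its values outside of the carriers,
 the underlying representation of an object.\<close>

locale rep_category =
 fixes G :: "('g, 'm) monoid_scheme"
  and C :: "('o, 'o \<times> ('u => 'u) \<times> 'o) cat" (structure)
  and emb :: "'o => ('f::{field, finite}, 'g, 'u) rep"
  and mk :: "('f, 'g, 'u) rep => 'o"
 assumes group: "group G"
  and finite_group: "finite (carrier G)"
  and char: "\<not> CHAR('f) dvd Coset.order G"
  and infinite_UNIV: "infinite (UNIV :: 'u set)"
  and Obj_C: "Obj C = {S. emb S : Obj (Rep G)}"
  and Arr_C: "Arr C = {(S, f, T). (emb S, f, emb T) : Arr (Rep G)}"
  and Dom_C: "Dom C = (%(S, f, T). S)"
  and Cod_C: "Cod C = (%(S, f, T). T)"
  and Ident_C: "Ident C = (%S. (S, \<lambda>v\<in>carrier (fst (emb S)). v, S))"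
  and Comp_C: "Comp C = (%(T', g, U) (S, f, T). (S, compose (carrier (fst (emb S))) g f, U))"
  and fst_emb_mk: "R : Obj (Rep G) ==> fst (emb (mk R)) = fst R"
  and snd_emb_mk: "[|R : Obj (Rep G); g : carrier G; v : carrier (fst R)|]
   ==> snd (emb (mk R)) g v = snd R g v"
begin

sublocale G: group G by (rule group)

section \<open>Vectors, operations and arrows\<close>

definition "car S = carrier (fst (emb S))"
definition "zr S = \<zero>\<^bsub>fst (emb S)\<^esub>"
definition "pl S a b = a \<oplus>\<^bsub>fst (emb S)\<^esub> b"
definition "sm S c a = c \<odot>\<^bsub>fst (emb S)\<^esub> a"
definition "ac S g a = snd (emb S) g a"
definition fn :: "'o \<times> ('u => 'u) \<times> 'o => 'u => 'u" where "fn f = fst (snd f)"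

lemmas ops_def = car_def zr_def pl_def sm_def ac_def

lemma Obj_iff:
 "S : Obj C \<longleftrightarrow> vectorspace class_ring (fst (emb S)) & finite (car S)
  & (ALL g:carrier G. ALL a:car S. ac S g a : car S)
  & (ALL g:carrier G. ALL a:car S. ALL b:car S. ac S g (pl S a b) = pl S (ac S g a) (ac S g b))
  & (ALL g:carrier G. ALL c. ALL a:car S. ac S g (sm S c a) = sm S c (ac S g a))
  & (ALL v:car S. ac S \<one>\<^bsub>G\<^esub> v = v)
  & (ALL g:carrier G. ALL h:carrier G. ALL v:car S. ac S (g \<otimes>\<^bsub>G\<^esub> h) v = ac S g (ac S h v))"
 unfolding Obj_C mem_Collect_eq by (subst prod.collapse[symmetric], subst Obj_Rep) (simp add: ops_def)

lemma Obj_vs: "S : Obj C ==> vectorspace class_ring (fst (emb S))"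
 by (simp add: Obj_iff)

lemma Obj_facts:
 assumes "S : Obj C"
 shows zr_closed: "zr S : car S"
  and pl_closed: "[|a : car S; b : car S|] ==> pl S a b : car S"
  and sm_closed: "a : car S ==> sm S c a : car S"
  and ac_closed: "[|g : carrier G; a : car S|] ==> ac S g a : car S"
  and car_finite: "finite (car S)"
  and pl_assoc: "[|a : car S; b : car S; e : car S|] ==> pl S (pl S a b) e = pl S a (pl S b e)"
  and pl_comm: "[|a : car S; b : car S|] ==> pl S a b = pl S b a"
  and pl_zr: "a : car S ==> pl S a (zr S) = a"
  and zr_pl: "a : car S ==> pl S (zr S) a = a"
  and pl_neg: "a : car S ==> pl S a (sm S (-1) a) = zr S"
  and sm_zero: "a : car S ==> sm S 0 a = zr S"
  and sm_zr: "sm S c (zr S) = zr S"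
  and ac_pl: "[|g : carrier G; a : car S; b : car S|] ==> ac S g (pl S a b) = pl S (ac S g a) (ac S g b)"
  and ac_sm: "[|g : carrier G; a : car S|] ==> ac S g (sm S c a) = sm S c (ac S g a)"
  and ac_zr: "g : carrier G ==> ac S g (zr S) = zr S"
  and ac_one: "a : car S ==> ac S \<one>\<^bsub>G\<^esub> a = a"
  and ac_mult: "[|g : carrier G; h : carrier G; a : car S|] ==> ac S (g \<otimes>\<^bsub>G\<^esub> h) a = ac S g (ac S h a)"
  and sm_pl: "[|a : car S; b : car S|] ==> sm S c (pl S a b) = pl S (sm S c a) (sm S c b)"
  and add_sm: "a : car S ==> sm S (c + d) a = pl S (sm S c a) (sm S d a)"
  and sm_sm: "a : car S ==> sm S c (sm S d a) = sm S (c * d) a"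
  and sm_one: "a : car S ==> sm S 1 a = a"
  and pl_eq_imp: "[|a : car S; b : car S; pl S a (sm S (-1) b) = zr S|] ==> a = b"
proof -
interpret vectorspace class_ring "fst (emb S)" by (rule Obj_vs[OF assms])
show zr: "zr S : car S" and sm: "!!a c. a : car S ==> sm S c a : car S"
 and "!!a b. [|a : car S; b : car S|] ==> pl S a b : car S"
 by (simp_all add: ops_def)
show "g : carrier G ==> a : car S ==> ac S g a : car S" and "finite (car S)"
 using assms by (auto simp: Obj_iff)
show assoc: "!!a b e. [|a : car S; b : car S; e : car S|] ==> pl S (pl S a b) e = pl S a (pl S b e)"
 by (simp add: ops_def M.a_assoc)
show comm: "!!a b. [|a : car S; b : car S|] ==> pl S a b = pl S b a"
 and pz: "!!a. a : car S ==> pl S a (zr S) = a" "!!a. a : car S ==> pl S (zr S) a = a"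
 by (simp_all add: ops_def M.a_comm)
show 0: "!!a. a : car S ==> sm S 0 a = zr S"
 using lmult_0 by (simp add: ops_def)
show "!!c. sm S c (zr S) = zr S" by (simp add: ops_def)
show add: "!!a c d. a : car S ==> sm S (c + d) a = pl S (sm S c a) (sm S d a)"
 using smult_l_distr by (simp add: ops_def)
show one: "!!a. a : car S ==> sm S 1 a = a"
 using smult_one by (simp add: ops_def)
show neg: "!!a. a : car S ==> pl S a (sm S (-1) a) = zr S"
 using add[of _ 1 "-1"] one 0 by simp
show "!!a c d. a : car S ==> sm S c (sm S d a) = sm S (c * d) a"
 using smult_assoc1 by (simp add: ops_def)
show "!!a b c. [|a : car S; b : car S|] ==> sm S c (pl S a b) = pl S (sm S c a) (sm S c b)"
 using smult_r_distr by (simp add: ops_def)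
show "!!g a b. [|g : carrier G; a : car S; b : car S|] ==> ac S g (pl S a b) = pl S (ac S g a) (ac S g b)"
 and acs: "!!g a c. [|g : carrier G; a : car S|] ==> ac S g (sm S c a) = sm S c (ac S g a)"
 and "!!a. a : car S ==> ac S \<one>\<^bsub>G\<^esub> a = a"
 and "!!g h a. [|g : carrier G; h : carrier G; a : car S|] ==> ac S (g \<otimes>\<^bsub>G\<^esub> h) a = ac S g (ac S h a)"
 using assms unfolding Obj_iff by blast+
have acc: "!!g a. g : carrier G ==> a : car S ==> ac S g a : car S"
 using assms unfolding Obj_iff by blast
show "g : carrier G ==> ac S g (zr S) = zr S"
 using acs[of g "zr S" 0] acc[of g "zr S"] zr 0 by simp
show "a = b" if "a : car S" "b : car S" "pl S a (sm S (-1) b) = zr S"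
proof -
 have "a = pl S a (pl S (sm S (-1) b) b)" using that sm neg[of b] pz comm[of b] by simp
 then show ?thesis using that sm assoc[of a "sm S (-1) b" b] pz by simp
qed
qed

lemma hom_iff:
 "(S', \<phi>, T') : Hom C S T \<longleftrightarrow> S' = S & T' = T & S : Obj C & T : Obj C
  & \<phi> : car S \<rightarrow> car T
  & (ALL a:car S. ALL b:car S. \<phi> (pl S a b) = pl T (\<phi> a) (\<phi> b))
  & (ALL c. ALL a:car S. \<phi> (sm S c a) = sm T c (\<phi> a))
  & (ALL g:carrier G. ALL v:car S. \<phi> (ac S g v) = ac T g (\<phi> v))
  & \<phi> : extensional (car S)"
proof -
have "(emb S, \<phi>, emb T) : Arr (Rep G) \<longleftrightarrow> ((fst (emb S), snd (emb S)), \<phi>, (fst (emb T), snd (emb T))) : Arr (Rep G)"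
 by simp
note 1 = this[unfolded Arr_Rep]
show ?thesis
 unfolding Hom_def Arr_C Dom_C Cod_C Obj_C by (auto simp: 1 ops_def)
qed

lemma hom_Dom: "f : Hom C S T ==> Dom C f = S"
 and hom_Cod: "f : Hom C S T ==> Cod C f = T"
 and hom_Arr: "f : Hom C S T ==> f : Arr C"
 by (simp_all add: Hom_def)

lemma hom_dom_obj: "f : Hom C S T ==> S : Obj C"
 and hom_cod_obj: "f : Hom C S T ==> T : Obj C"
 and fn_closed: "[|f : Hom C S T; a : car S|] ==> fn f a : car T"
 and fn_pl: "[|f : Hom C S T; a : car S; b : car S|] ==> fn f (pl S a b) = pl T (fn f a) (fn f b)"
 and fn_sm: "[|f : Hom C S T; a : car S|] ==> fn f (sm S c a) = sm T c (fn f a)"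
 and fn_ac: "[|f : Hom C S T; g : carrier G; a : car S|] ==> fn f (ac S g a) = ac T g (fn f a)"
 by (cases f; auto simp: hom_iff fn_def)+

lemma hom_eqI:
 assumes "f : Hom C S T" "g : Hom C S T" "!!a. a : car S ==> fn f a = fn g a"
 shows "f = g"
 using assms by (cases f; cases g) (auto simp: hom_iff fn_def intro: extensionalityI)

lemma fn_zr: "f : Hom C S T ==> fn f (zr S) = zr T"
 by (metis fn_closed fn_sm hom_cod_obj hom_dom_obj sm_zero zr_closed)

lemma Arr_hom: "f : Arr C ==> f : Hom C (Dom C f) (Cod C f)"
 by (simp add: Hom_def)

text \<open>\<open>restrict\<close> fixes the values off the carrier, so that arrows agreeing on all
  vectors are equal.\<close>

definition "arr S \<phi> T = (S, restrict \<phi> (car S), T)"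

lemma fn_arr: "a : car S ==> fn (arr S \<phi> T) a = \<phi> a"
 by (simp add: arr_def fn_def)

lemma arr_hom:
 assumes "S : Obj C" "T : Obj C" "!!a. a : car S ==> \<phi> a : car T"
  "!!a b. [|a : car S; b : car S|] ==> \<phi> (pl S a b) = pl T (\<phi> a) (\<phi> b)"
  "!!c a. a : car S ==> \<phi> (sm S c a) = sm T c (\<phi> a)"
  "!!g a. [|g : carrier G; a : car S|] ==> \<phi> (ac S g a) = ac T g (\<phi> a)"
 shows "arr S \<phi> T : Hom C S T"
 unfolding arr_def hom_iff
 using assms by (auto simp: pl_closed[OF assms(1)] sm_closed[OF assms(1)] ac_closed[OF assms(1)])

lemma comp_eq: "[|f : Hom C S T; g : Hom C T U|] ==> g \<cdot> f = arr S (%a. fn g (fn f a)) U"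
 by (cases f; cases g) (auto simp: Comp_C arr_def compose_def car_def fn_def Hom_def Dom_C Cod_C)

lemma comp_in_hom: "[|f : Hom C S T; g : Hom C T U|] ==> g \<cdot> f : Hom C S U"
 unfolding comp_eq
 by (rule arr_hom) (auto simp: fn_pl fn_sm fn_ac fn_closed hom_dom_obj hom_cod_obj)

lemma fn_comp: "[|f : Hom C S T; g : Hom C T U; a : car S|] ==> fn (g \<cdot> f) a = fn g (fn f a)"
 by (simp add: comp_eq fn_arr)

lemma ident_eq: "Ident C S = arr S (%a. a) S"
 by (simp add: Ident_C arr_def car_def)

lemma ident_in_hom: "S : Obj C ==> Ident C S : Hom C S S"
 unfolding ident_eq by (rule arr_hom) auto

lemma fn_ident: "a : car S ==> fn (Ident C S) a = a"
 by (simp add: ident_eq fn_arr)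

sublocale category C
proof (unfold_locales, goal_cases)
case (1 f) then show ?case by (metis Arr_hom hom_dom_obj)
next
case (2 f) then show ?case by (metis Arr_hom hom_cod_obj)
next
case (3 x) then show ?case by (rule ident_in_hom)
next
case (4 f x y g z) then show ?case by (rule comp_in_hom)
next
case (5 f x y)
have i: "Ident C y : Hom C y y" using 5 by (intro ident_in_hom hom_cod_obj)
show ?case
 by (rule hom_eqI[OF comp_in_hom[OF 5 i] 5]) (simp add: fn_comp[OF 5 i] fn_ident fn_closed[OF 5])
next
case (6 f x y)
have i: "Ident C x : Hom C x x" using 6 by (intro ident_in_hom hom_dom_obj)
show ?case
 by (rule hom_eqI[OF comp_in_hom[OF i 6] 6]) (simp add: fn_comp[OF i 6] fn_ident)
next
case (7 f w x g y h z)
show ?case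
 by (rule hom_eqI[OF comp_in_hom[OF 7(1) comp_in_hom[OF 7(2,3)]] comp_in_hom[OF comp_in_hom[OF 7(1,2)] 7(3)]])
  (simp add: fn_comp[OF 7(1) comp_in_hom[OF 7(2,3)]] fn_comp[OF 7(2,3)] fn_comp[OF comp_in_hom[OF 7(1,2)] 7(3)] fn_comp[OF 7(1,2)] fn_closed[OF 7(1)])
qed

subsection \<open>Construction of objects\<close>

text \<open>Transport of structure: \<open>infinite_UNIV\<close> offers a set of the right finite
  size inside the vector type of the category. In this way representations on pairs, on the
  one-point type or, for Frobenius reciprocity, on functions on a group yield objects of the
  category.\<close>

lemma copy:
 fixes V :: "('f, 'v) module"
 assumes R: "(V, \<rho>) : Obj (Rep G)"
 shows "EX S:Obj C. EX j. bij_betw j (car S) (carrier V) & (ALL a:car S. ALL b:car S. j (pl S a b) = j a \<oplus>\<^bsub>V\<^esub> j b)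
  & (ALL c. ALL a:car S. j (sm S c a) = c \<odot>\<^bsub>V\<^esub> j a) & (ALL g:carrier G. ALL a:car S. j (ac S g a) = \<rho> g (j a))"
proof -
have V: "vectorspace class_ring V" and finV: "finite (carrier V)"
 and ac: "!!g a. [|g : carrier G; a : carrier V|] ==> \<rho> g a : carrier V"
 and ac_add: "!!g a b. [|g : carrier G; a : carrier V; b : carrier V|] ==> \<rho> g (a \<oplus>\<^bsub>V\<^esub> b) = \<rho> g a \<oplus>\<^bsub>V\<^esub> \<rho> g b"
 and ac_smult: "!!g c a. [|g : carrier G; a : carrier V|] ==> \<rho> g (c \<odot>\<^bsub>V\<^esub> a) = c \<odot>\<^bsub>V\<^esub> \<rho> g a"
 and ac_1: "!!a. a : carrier V ==> \<rho> \<one>\<^bsub>G\<^esub> a = a"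
 and ac_m: "!!g h a. [|g : carrier G; h : carrier G; a : carrier V|] ==> \<rho> (g \<otimes>\<^bsub>G\<^esub> h) a = \<rho> g (\<rho> h a)"
 using R by (auto simp: Obj_Rep)
interpret vectorspace class_ring V by fact
obtain B :: "'u set" where B: "finite B" "card B = card (carrier V)"
 using infinite_arbitrarily_large[OF infinite_UNIV] by blast
then obtain j where j: "bij_betw j B (carrier V)"
 using finite_same_card_bij finV by metis
define i where "i = inv_into B j"
have ji: "!!a. a : carrier V ==> j (i a) = a" and iB: "!!a. a : carrier V ==> i a : B"
 and ij: "!!b. b : B ==> i (j b) = b" and jV: "!!b. b : B ==> j b : carrier V"
 using j unfolding i_def bij_betw_def by (auto simp: f_inv_into_f inv_into_into)
define W :: "('f, 'u) module" where "W = \<lparr>carrier = B, mult = (%a b. a), one = i \<zero>\<^bsub>V\<^esub>, zero = i \<zero>\<^bsub>V\<^esub>,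
 add = (%a b. i (j a \<oplus>\<^bsub>V\<^esub> j b)), smult = (%c a. i (c \<odot>\<^bsub>V\<^esub> j a))\<rparr>"
define \<sigma> where "\<sigma> g a = i (\<rho> g (j a))" for g a
have "vectorspace class_ring W"
proof (rule vs_criteria)
 show "ALL v:carrier W. EX neg_v:carrier W. v \<oplus>\<^bsub>W\<^esub> neg_v = \<zero>\<^bsub>W\<^esub>"
 proof
  fix v assume "v : carrier W"
  then show "EX neg_v:carrier W. v \<oplus>\<^bsub>W\<^esub> neg_v = \<zero>\<^bsub>W\<^esub>"
   using jV ji iB by (intro bexI[of _ "i (\<ominus>\<^bsub>V\<^esub> j v)"]) (auto simp: W_def M.r_neg)
 qed
qed (auto simp: W_def iB ji ij jV field_class_ring M.a_ac smult_one[simplified]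
  smult_l_distr[simplified] smult_r_distr[simplified] smult_assoc1[simplified])
then have W: "vectorspace class_ring W" .
then have "(W, \<sigma>) : Obj (Rep G)"
 using B by (auto simp: Obj_Rep \<sigma>_def W_def iB ji ij jV ac ac_add ac_smult ac_1 ac_m)
then have mk: "fst (emb (mk (W, \<sigma>))) = W"
 "!!g a. [|g : carrier G; a : B|] ==> ac (mk (W, \<sigma>)) g a = i (\<rho> g (j a))"
 using fst_emb_mk snd_emb_mk[of "(W, \<sigma>)"] by (auto simp: \<sigma>_def W_def ac_def)
have ops: "car (mk (W, \<sigma>)) = B" "!!a b. pl (mk (W, \<sigma>)) a b = i (j a \<oplus>\<^bsub>V\<^esub> j b)"
 "!!c a. sm (mk (W, \<sigma>)) c a = i (c \<odot>\<^bsub>V\<^esub> j a)"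
 by (simp_all add: car_def pl_def sm_def mk) (simp_all add: W_def)
have "mk (W, \<sigma>) : Obj C"
 unfolding Obj_iff mk(1) ops using W B by (auto simp: mk ac ac_add ac_smult ac_1 ac_m iB ji ij jV)
then show ?thesis
 by (rule bexI[rotated]) (use j in "auto simp: ops mk ji jV ac intro!: exI[of _ j]")
qed

text \<open>An invariant linear relation, that is, a subrepresentation of the direct sum given by
  its pairs of vectors, without reference to a product object of the category.\<close>

definition is_rel where
 "is_rel S T R \<longleftrightarrow> R <= car S \<times> car T & (zr S, zr T) : R
  & (ALL a b a' b'. (a, b) : R --> (a', b') : R --> (pl S a a', pl T b b') : R)
  & (ALL c a b. (a, b) : R --> (sm S c a, sm T c b) : R)
  & (ALL g:carrier G. ALL a b. (a, b) : R --> (ac S g a, ac T g b) : R)"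

definition is_sub where
 "is_sub S A \<longleftrightarrow> A <= car S & zr S : A & (ALL a:A. ALL b:A. pl S a b : A) & (ALL c. ALL a:A. sm S c a : A)
  & (ALL g:carrier G. ALL a:A. ac S g a : A)"

definition "sub S A = mk (subrep (emb S) A)"
definition "incl S A = arr (sub S A) (%a. a) S"

lemma is_sub_iff:
 assumes "S : Obj C"
 shows "is_sub S A \<longleftrightarrow> invariant_subspace G (emb S) A"
 unfolding invariant_subspace_def submodule_iff[OF Obj_vs[OF assms]] by (auto simp: is_sub_def ops_def)

lemma subrep_obj:
 assumes "S : Obj C" "is_sub S A"
 shows "subrep (emb S) A : Obj (Rep G)"
proof -
interpret vectorspace class_ring "fst (emb S)" by (rule Obj_vs[OF assms(1)])
have A: "VectorSpace.subspace class_ring A (fst (emb S))"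
 using assms by (simp add: is_sub_iff invariant_subspace_def)
have "finite A" "A <= car S" using assms(2) car_finite[OF assms(1)] by (auto simp: is_sub_def intro: finite_subset)
then show ?thesis
 using subspace_is_vs[OF A] assms(2) ac_pl[OF assms(1)] ac_sm[OF assms(1)] ac_one[OF assms(1)] ac_mult[OF assms(1)]
 unfolding subrep_def Obj_Rep is_sub_def ops_def by (auto simp: subset_iff)
qed

lemma sub_obj:
 assumes "S : Obj C" "is_sub S A"
 shows "sub S A : Obj C" "car (sub S A) = A" "zr (sub S A) = zr S"
  "!!a b. pl (sub S A) a b = pl S a b" "!!c a. sm (sub S A) c a = sm S c a"
  "!!g a. [|g : carrier G; a : A|] ==> ac (sub S A) g a = ac S g a"
proof -
note R = subrep_obj[OF assms]
note 1 = fst_emb_mk[OF R] snd_emb_mk[OF R]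
show 2: "car (sub S A) = A" "zr (sub S A) = zr S"
 "!!a b. pl (sub S A) a b = pl S a b" "!!c a. sm (sub S A) c a = sm S c a"
 "!!g a. [|g : carrier G; a : A|] ==> ac (sub S A) g a = ac S g a"
 using 1 by (auto simp: sub_def ops_def subrep_def)
have "vectorspace class_ring (fst (emb (sub S A)))"
 using R unfolding sub_def 1 by (auto simp: subrep_def Obj_Rep)
moreover have "finite A" "A <= car S" using assms(2) car_finite[OF assms(1)] by (auto simp: is_sub_def intro: finite_subset)
ultimately show "sub S A : Obj C"
 unfolding Obj_iff 2 using assms(2) ac_pl[OF assms(1)] ac_sm[OF assms(1)] ac_one[OF assms(1)] ac_mult[OF assms(1)]
 by (auto simp: is_sub_def subset_iff 2)
qed

lemma incl_hom:
 assumes "S : Obj C" "is_sub S A"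
 shows "incl S A : Hom C (sub S A) S"
proof -
have "A <= car S" using assms(2) by (simp add: is_sub_def)
then show ?thesis
 unfolding incl_def using assms(1)
 by (intro arr_hom sub_obj(1)[OF assms]) (auto simp: sub_obj(2-)[OF assms])
qed

lemma fn_incl: "[|S : Obj C; is_sub S A; a : A|] ==> fn (incl S A) a = a"
 by (simp add: incl_def fn_arr sub_obj)

text \<open>The relation is a subspace of the external direct sum, whose vectors are pairs and so of
  the wrong type; \<open>copy\<close> turns it into an object with two projections. Products,
  pullbacks and representatives of subobjects all arise in this way.\<close>

lemma rel_object:
 assumes S: "S : Obj C" and T: "T : Obj C" and R: "is_rel S T R"
 obtains W p q where "p : Hom C W S" "q : Hom C W T" "bij_betw (%w. (fn p w, fn q w)) (car W) R"
proof -
let ?V = "(direct_sum (fst (emb S)) (fst (emb T)))\<lparr>carrier := R\<rparr>"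
interpret D: vectorspace class_ring "direct_sum (fst (emb S)) (fst (emb T))"
 by (rule direct_sum_is_vs[OF Obj_vs[OF S] Obj_vs[OF T]])
have D: "vectorspace class_ring (direct_sum (fst (emb S)) (fst (emb T)))" by unfold_locales
have Rc: "R <= car S \<times> car T" using R by (simp add: is_rel_def)
have fR: "finite R" using Rc car_finite[OF S] car_finite[OF T] by (meson finite_SigmaI finite_subset)
have "VectorSpace.subspace class_ring R (direct_sum (fst (emb S)) (fst (emb T)))"
 unfolding submodule_iff[OF D] using R by (auto simp: is_rel_def direct_sum_def ops_def)
from D.subspace_is_vs[OF this] have "vectorspace class_ring ?V" .
moreover have V_ops: "a \<oplus>\<^bsub>?V\<^esub> b = (pl S (fst a) (fst b), pl T (snd a) (snd b))"
 "c \<odot>\<^bsub>?V\<^esub> a = (sm S c (fst a), sm T c (snd a))" "carrier ?V = R" for a b c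
 by (simp_all add: direct_sum_def pl_def sm_def)
ultimately have V: "(?V, %g (a, b). (ac S g a, ac T g b)) : Obj (Rep G)"
 unfolding Obj_Rep
 using fR R Rc ac_pl[OF S] ac_sm[OF S] ac_one[OF S] ac_mult[OF S] ac_pl[OF T] ac_sm[OF T] ac_one[OF T] ac_mult[OF T]
 by (auto simp: is_rel_def V_ops subset_iff)
obtain W j where W: "W : Obj C" and j: "bij_betw j (car W) R"
 "ALL a:car W. ALL b:car W. j (pl W a b) = (pl S (fst (j a)) (fst (j b)), pl T (snd (j a)) (snd (j b)))"
 "ALL c. ALL a:car W. j (sm W c a) = (sm S c (fst (j a)), sm T c (snd (j a)))"
 "ALL g:carrier G. ALL a:car W. j (ac W g a) = (ac S g (fst (j a)), ac T g (snd (j a)))"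
 using copy[OF V] unfolding V_ops by (auto simp: split_beta)
have jc: "fst (j w) : car S" "snd (j w) : car T" if "w : car W" for w
 using subsetD[OF Rc, of "j w"] bij_betwE[OF j(1)] that by (auto simp: mem_Times_iff)
let ?p = "arr W (%w. fst (j w)) S" and ?q = "arr W (%w. snd (j w)) T"
show thesis
proof (rule that)
 show "?p : Hom C W S" using W S j jc by (intro arr_hom) auto
 show "?q : Hom C W T" using W T j jc by (intro arr_hom) auto
 show "bij_betw (%w. (fn ?p w, fn ?q w)) (car W) R"
  using j(1) by (subst bij_betw_cong[where g = j]) (auto simp: fn_arr)
qed
qed

lemma zero_object: obtains Z where "Z : Obj C" "car Z = {zr Z}"
proof -
let ?V = "\<lparr>carrier = {()}, mult = (%a b. ()), one = (), zero = (), add = (%a b. ()), smult = (%c a. ())\<rparr> :: ('f, unit) module"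
have "vectorspace class_ring ?V"
 by (rule vs_criteria) (auto simp: field_class_ring)
then have "(?V, %g a. a) : Obj (Rep G)" by (auto simp: Obj_Rep)
from copy[OF this] obtain Z j where Z: "Z : Obj C" "bij_betw j (car Z) {()}" by auto
then have "card (car Z) = 1" by (auto dest: bij_betw_same_card)
then show thesis using Z(1) zr_closed[OF Z(1)] that by (auto simp: card_1_singleton_iff)
qed

text \<open>Joint injectivity determines each value of the lift; the values at sums, multiples and
  translates are then forced, which makes the lift linear and equivariant.\<close>

lemma lift_hom:
 assumes p: "p : Hom C W X" and q: "q : Hom C W Y" and u: "u : Hom C V X" and v: "v : Hom C V Y"
  and inj: "inj_on (%w. (fn p w, fn q w)) (car W)"
  and ex: "!!a. a : car V ==> EX w:car W. fn p w = fn u a & fn q w = fn v a"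
 shows "EX h:Hom C V W. p \<cdot> h = u & q \<cdot> h = v"
proof -
obtain h where h: "!!a. a : car V ==> h a : car W & fn p (h a) = fn u a & fn q (h a) = fn v a"
 using ex by metis
have eq: "w = w'" if "w : car W" "w' : car W" "fn p w = fn p w'" "fn q w = fn q w'" for w w'
 using that inj by (auto simp: inj_on_def)
note o = hom_dom_obj[OF p] hom_dom_obj[OF u]
have hom: "arr V h W : Hom C V W"
proof (rule arr_hom[OF o(2,1)])
 show "h (pl V a b) = pl W (h a) (h b)" if "a : car V" "b : car V" for a b
  using that h by - (rule eq, auto simp: pl_closed o fn_pl[OF p] fn_pl[OF q] fn_pl[OF u] fn_pl[OF v])
 show "h (sm V c a) = sm W c (h a)" if "a : car V" for a c
  using that h by - (rule eq, auto simp: sm_closed o fn_sm[OF p] fn_sm[OF q] fn_sm[OF u] fn_sm[OF v])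
 show "h (ac V c a) = ac W c (h a)" if "c : carrier G" "a : car V" for a c
  using that h by - (rule eq, auto simp: ac_closed o fn_ac[OF p] fn_ac[OF q] fn_ac[OF u] fn_ac[OF v])
qed (use h in auto)
then show ?thesis
 using h by (intro bexI[OF _ hom] conjI hom_eqI[OF comp_in_hom[OF hom p] u] hom_eqI[OF comp_in_hom[OF hom q] v])
  (auto simp: fn_comp[OF hom p] fn_comp[OF hom q] fn_arr)
qed

lemma lift_unique:
 assumes p: "p : Hom C W X" and q: "q : Hom C W Y" and h: "h : Hom C V W" "h' : Hom C V W"
  and inj: "inj_on (%w. (fn p w, fn q w)) (car W)"
  and eq: "p \<cdot> h = p \<cdot> h'" "q \<cdot> h = q \<cdot> h'"
 shows "h = h'"
proof (rule hom_eqI[OF h])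
fix a assume a: "a : car V"
then have "fn p (fn h a) = fn p (fn h' a)" "fn q (fn h a) = fn q (fn h' a)"
 using eq fn_comp[OF h(1) p a] fn_comp[OF h(2) p a] fn_comp[OF h(1) q a] fn_comp[OF h(2) q a] by auto
then show "fn h a = fn h' a"
 using inj fn_closed[OF h(1) a] fn_closed[OF h(2) a] by (auto simp: inj_on_def)
qed

end

context rep_category
begin

subsection \<open>Limits and images\<close>

lemma comp_eq_iff:
 assumes "p : Hom C W X" "f : Hom C X Z" "q : Hom C W Y" "g : Hom C Y Z"
 shows "f \<cdot> p = g \<cdot> q \<longleftrightarrow> (ALL w:car W. fn f (fn p w) = fn g (fn q w))"
proof
assume "f \<cdot> p = g \<cdot> q"
then show "ALL w:car W. fn f (fn p w) = fn g (fn q w)"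
 using fn_comp[OF assms(1,2)] fn_comp[OF assms(3,4)] by metis
next
assume "ALL w:car W. fn f (fn p w) = fn g (fn q w)"
then show "f \<cdot> p = g \<cdot> q"
 by (intro hom_eqI[OF comp_hom[OF assms(1,2)] comp_hom[OF assms(3,4)]])
  (simp add: fn_comp[OF assms(1,2)] fn_comp[OF assms(3,4)])
qed

lemma commuting_square_iff:
 assumes f: "f : Hom C X Z" and g: "g : Hom C Y Z"
 shows "commuting_square C f g p q \<longleftrightarrow> p : Hom C (Dom C p) X & q : Hom C (Dom C p) Y & f \<cdot> p = g \<cdot> q"
 using assms by (auto simp: commuting_square_def Hom_def)

definition "pb_rel X Y f g = {(a, b). a : car X & b : car Y & fn f a = fn g b}"

lemma pb_rel_is_rel:
 assumes f: "f : Hom C X Z" and g: "g : Hom C Y Z"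
 shows "is_rel X Y (pb_rel X Y f g)"
proof -
note X = hom_dom_obj[OF f] and Y = hom_dom_obj[OF g]
show ?thesis
 unfolding is_rel_def pb_rel_def
 by (auto simp: fn_zr[OF f] fn_zr[OF g] fn_pl[OF f] fn_pl[OF g] fn_sm[OF f] fn_sm[OF g] fn_ac[OF f] fn_ac[OF g]
  zr_closed X Y pl_closed sm_closed ac_closed)
qed

text \<open>Surjectivity onto the fibre product gives the factorization of a commuting square, joint
  injectivity its uniqueness.\<close>

lemma pullbackI:
 assumes f: "f : Hom C X Z" and g: "g : Hom C Y Z" and p: "p : Hom C W X" and q: "q : Hom C W Y"
  and bij: "bij_betw (%w. (fn p w, fn q w)) (car W) (pb_rel X Y f g)"
 shows "is_pullback C f g p q"
 unfolding is_pullback_def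
proof (intro conjI allI impI)
have "fn f (fn p w) = fn g (fn q w)" if "w : car W" for w
 using bij_betwE[OF bij] that by (auto simp: pb_rel_def)
then show "commuting_square C f g p q"
 using p q comp_eq_iff[OF p f q g] unfolding commuting_square_iff[OF f g] by (simp add: hom_Dom[OF p])
fix p' q' assume "commuting_square C f g p' q'"
then have p': "p' : Hom C (Dom C p') X" and q': "q' : Hom C (Dom C p') Y" and eq: "f \<cdot> p' = g \<cdot> q'"
 unfolding commuting_square_iff[OF f g] by auto
have inj: "inj_on (%w. (fn p w, fn q w)) (car W)" using bij by (rule bij_betw_imp_inj_on)
have "EX w:car W. fn p w = fn p' a & fn q w = fn q' a" if a: "a : car (Dom C p')" for a
proof -
 have "(fn p' a, fn q' a) : pb_rel X Y f g"
  using eq a fn_closed[OF p' a] fn_closed[OF q' a] unfolding comp_eq_iff[OF p' f q' g] pb_rel_def by simp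
 then have "(fn p' a, fn q' a) : (%w. (fn p w, fn q w)) ` car W" using bij by (simp add: bij_betw_def)
 then show ?thesis by auto
qed
from lift_hom[OF p q p' q' inj this]
obtain h where "h : Hom C (Dom C p') W" "p \<cdot> h = p'" "q \<cdot> h = q'" by blast
then show "\<exists>!h. h : Hom C (Dom C p') (Dom C p) & p \<cdot> h = p' & q \<cdot> h = q'"
 unfolding hom_Dom[OF p] by (intro ex1I[of _ h]) (blast, metis lift_unique[OF p q _ _ inj])
qed

lemma pullback_ex:
 assumes f: "f : Hom C X Z" and g: "g : Hom C Y Z"
 obtains W p q where "p : Hom C W X" "q : Hom C W Y" "bij_betw (%w. (fn p w, fn q w)) (car W) (pb_rel X Y f g)"
  "is_pullback C f g p q"
 by (rule rel_object[OF hom_dom_obj[OF f] hom_dom_obj[OF g] pb_rel_is_rel[OF f g]])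
  (rule that; (assumption | rule pullbackI[OF f g]))

text \<open>A universal cone is isomorphic to any other one, here to a concrete cone
  \<open>p0\<close>, \<open>q0\<close> whose vectors are known pairs, and the description of the
  vectors is carried over. Shared by \<open>pullbackD\<close> and \<open>productD\<close>.\<close>

lemma universal_bij:
 assumes p: "p : Hom C W X" and q: "q : Hom C W Y" and p0: "p0 : Hom C W0 X" and q0: "q0 : Hom C W0 Y"
  and bij: "bij_betw (%w. (fn p0 w, fn q0 w)) (car W0) R"
  and h: "h : Hom C W W0" "p0 \<cdot> h = p" "q0 \<cdot> h = q" and k: "k : Hom C W0 W" "p \<cdot> k = p0" "q \<cdot> k = q0"
  and uniq: "!!j. [|j : Hom C W W; p \<cdot> j = p; q \<cdot> j = q|] ==> j = Ident C W"
 shows "bij_betw (%w. (fn p w, fn q w)) (car W) R"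
proof -
have "p \<cdot> (k \<cdot> h) = p" "q \<cdot> (k \<cdot> h) = q"
 using comp_assoc[OF h(1) k(1) p] comp_assoc[OF h(1) k(1) q] h k by simp_all
then have kh: "k \<cdot> h = Ident C W" using uniq comp_hom[OF h(1) k(1)] by blast
have kh_fn: "fn k (fn h w) = w" if "w : car W" for w
 using that fn_comp[OF h(1) k(1) that] fn_ident[OF that] unfolding kh by simp
have ph: "fn p0 (fn h w) = fn p w" "fn q0 (fn h w) = fn q w" if "w : car W" for w
 using fn_comp[OF h(1) p0 that] fn_comp[OF h(1) q0 that] h by auto
have pk: "fn p (fn k w) = fn p0 w" "fn q (fn k w) = fn q0 w" if "w : car W0" for w
 using fn_comp[OF k(1) p that] fn_comp[OF k(1) q that] k by auto
have "inj_on (%w. (fn p w, fn q w)) (car W)"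
proof (rule inj_onI, clarsimp)
 fix w w' assume w: "w : car W" "w' : car W" "fn p w = fn p w'" "fn q w = fn q w'"
 then have "fn h w = fn h w'"
  using bij_betw_imp_inj_on[OF bij] ph fn_closed[OF h(1)] by (auto simp: inj_on_def)
 then show "w = w'" using kh_fn w by metis
qed
moreover have "(%w. (fn p w, fn q w)) ` car W = R"
 unfolding bij_betw_imp_surj_on[OF bij, symmetric]
proof (intro equalityI subsetI)
 fix x assume "x : (%w. (fn p w, fn q w)) ` car W"
 then obtain w where "w : car W" "x = (fn p0 (fn h w), fn q0 (fn h w))" using ph by auto
 then show "x : (%w. (fn p0 w, fn q0 w)) ` car W0" using fn_closed[OF h(1)] by blast
next
 fix x assume "x : (%w. (fn p0 w, fn q0 w)) ` car W0"
 then obtain w where "w : car W0" "x = (fn p (fn k w), fn q (fn k w))" using pk by auto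
 then show "x : (%w. (fn p w, fn q w)) ` car W" using fn_closed[OF k(1)] by blast
qed
ultimately show ?thesis by (simp add: bij_betw_def)
qed

text \<open>Degree functions and preservation of pullbacks quantify over all pullbacks, not only
  over the constructed ones; comparison with a constructed one describes the vectors of each of
  them.\<close>

lemma pullbackD:
 assumes pb: "is_pullback C f g p q" and f: "f : Hom C X Z" and g: "g : Hom C Y Z"
 shows "p : Hom C (Dom C p) X" "q : Hom C (Dom C p) Y"
  "bij_betw (%w. (fn p w, fn q w)) (car (Dom C p)) (pb_rel X Y f g)" (is ?P)
proof -
have cs: "commuting_square C f g p q" using pb by (simp add: is_pullback_def)
then show p: "p : Hom C (Dom C p) X" and q: "q : Hom C (Dom C p) Y"
 unfolding commuting_square_iff[OF f g] by auto
obtain W0 p0 q0 where p0: "p0 : Hom C W0 X" "q0 : Hom C W0 Y"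
 and bij: "bij_betw (%w. (fn p0 w, fn q0 w)) (car W0) (pb_rel X Y f g)" and pb0: "is_pullback C f g p0 q0"
 using pullback_ex[OF f g] by blast
have cs0: "commuting_square C f g p0 q0" using pb0 by (simp add: is_pullback_def)
obtain h where h: "h : Hom C (Dom C p) W0" "p0 \<cdot> h = p" "q0 \<cdot> h = q"
 using pb0 cs hom_Dom[OF p0(1)] unfolding is_pullback_def by metis
obtain k where k: "k : Hom C W0 (Dom C p)" "p \<cdot> k = p0" "q \<cdot> k = q0"
 using pb cs0 hom_Dom[OF p0(1)] unfolding is_pullback_def by metis
have "\<exists>!j. j : Hom C (Dom C p) (Dom C p) & p \<cdot> j = p & q \<cdot> j = q"
 using pb cs unfolding is_pullback_def by blast
moreover have "Ident C (Dom C p) : Hom C (Dom C p) (Dom C p)" "p \<cdot> Ident C (Dom C p) = p" "q \<cdot> Ident C (Dom C p) = q"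
 using ident_hom[OF hom_dom_obj[OF p]] ident_right[OF p] ident_right[OF q] by auto
ultimately have uniq: "j = Ident C (Dom C p)" if "j : Hom C (Dom C p) (Dom C p)" "p \<cdot> j = p" "q \<cdot> j = q" for j
 using that by metis
show ?P
 by (rule universal_bij[OF p q p0 bij h k uniq])
qed

lemma productI:
 assumes p: "p : Hom C W X" and q: "q : Hom C W Y"
  and bij: "bij_betw (%w. (fn p w, fn q w)) (car W) (car X \<times> car Y)"
 shows "is_product C X Y p q"
 unfolding is_product_def
proof (intro conjI allI ballI)
fix V f g assume f: "f : Hom C V X" and g: "g : Hom C V Y"
have inj: "inj_on (%w. (fn p w, fn q w)) (car W)" using bij by (rule bij_betw_imp_inj_on)
have "EX w:car W. fn p w = fn f a & fn q w = fn g a" if a: "a : car V" for a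
proof -
 have "(fn f a, fn g a) : (%w. (fn p w, fn q w)) ` car W"
  using bij fn_closed[OF f a] fn_closed[OF g a] by (simp add: bij_betw_def)
 then show ?thesis by auto
qed
from lift_hom[OF p q f g inj this]
obtain h where "h : Hom C V W" "p \<cdot> h = f" "q \<cdot> h = g" by blast
then show "\<exists>!h. h : Hom C V (Dom C p) & p \<cdot> h = f & q \<cdot> h = g"
 unfolding hom_Dom[OF p] by (intro ex1I[of _ h]) (blast, metis lift_unique[OF p q _ _ inj])
qed (use p q in "auto simp: Hom_def")

lemma product_ex:
 assumes "X : Obj C" "Y : Obj C"
 obtains W p q where "p : Hom C W X" "q : Hom C W Y" "bij_betw (%w. (fn p w, fn q w)) (car W) (car X \<times> car Y)"
  "is_product C X Y p q"
proof -
have "is_rel X Y (car X \<times> car Y)"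
 using assms by (auto simp: is_rel_def zr_closed pl_closed sm_closed ac_closed)
then show thesis
 by (rule rel_object[OF assms]) (rule that; (assumption | rule productI))
qed

lemma productD:
 assumes pr: "is_product C X Y p q" and X: "X : Obj C" and Y: "Y : Obj C"
 shows "p : Hom C (Dom C p) X" "q : Hom C (Dom C p) Y"
  "bij_betw (%w. (fn p w, fn q w)) (car (Dom C p)) (car X \<times> car Y)" (is ?P)
proof -
show p: "p : Hom C (Dom C p) X" and q: "q : Hom C (Dom C p) Y"
 using pr by (auto simp: is_product_def Hom_def)
obtain W0 p0 q0 where p0: "p0 : Hom C W0 X" "q0 : Hom C W0 Y"
 and bij: "bij_betw (%w. (fn p0 w, fn q0 w)) (car W0) (car X \<times> car Y)" and pr0: "is_product C X Y p0 q0"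
 using product_ex[OF X Y] by blast
obtain h where h: "h : Hom C (Dom C p) W0" "p0 \<cdot> h = p" "q0 \<cdot> h = q"
 using pr0 p q hom_Dom[OF p0(1)] unfolding is_product_def by metis
obtain k where k: "k : Hom C W0 (Dom C p)" "p \<cdot> k = p0" "q \<cdot> k = q0"
 using pr p0 unfolding is_product_def by metis
have "\<exists>!j. j : Hom C (Dom C p) (Dom C p) & p \<cdot> j = p & q \<cdot> j = q"
 using pr p q unfolding is_product_def by blast
moreover have "Ident C (Dom C p) : Hom C (Dom C p) (Dom C p)" "p \<cdot> Ident C (Dom C p) = p" "q \<cdot> Ident C (Dom C p) = q"
 using ident_hom[OF hom_dom_obj[OF p]] ident_right[OF p] ident_right[OF q] by auto
ultimately have uniq: "j = Ident C (Dom C p)" if "j : Hom C (Dom C p) (Dom C p)" "p \<cdot> j = p" "q \<cdot> j = q" for j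
 using that by metis
show ?P
 by (rule universal_bij[OF p q p0 bij h k uniq])
qed

text \<open>The kernel pair of \<open>m\<close> contains all pairs of vectors with equal images; for
  a monomorphism its two projections coincide, which is injectivity.\<close>

lemma mono_iff:
 assumes m: "m : Hom C W X"
 shows "is_mono C m \<longleftrightarrow> inj_on (fn m) (car W)"
proof
assume mono: "is_mono C m"
obtain V p q where p: "p : Hom C V W" and q: "q : Hom C V W"
 and bij: "bij_betw (%w. (fn p w, fn q w)) (car V) (pb_rel W W m m)" and pb: "is_pullback C m m p q"
 using pullback_ex[OF m m] by blast
have "m \<cdot> p = m \<cdot> q" using pb by (auto simp: is_pullback_def commuting_square_def)
then have "p = q" using mono p q unfolding is_mono_def hom_Dom[OF m] by blast
show "inj_on (fn m) (car W)"
proof (rule inj_onI)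
 fix w w' assume "w : car W" "w' : car W" "fn m w = fn m w'"
 then have "(w, w') : (%w. (fn p w, fn q w)) ` car V"
  unfolding bij_betw_imp_surj_on[OF bij] by (simp add: pb_rel_def)
 then show "w = w'" unfolding \<open>p = q\<close> by blast
qed
next
assume "inj_on (fn m) (car W)"
then have inj: "inj_on (%w. (fn m w, fn m w)) (car W)" by (simp add: inj_on_def)
show "is_mono C m"
 unfolding is_mono_def hom_Dom[OF m]
proof (intro conjI allI ballI impI)
 fix V f g assume f: "f : Hom C V W" and g: "g : Hom C V W" and "m \<cdot> f = m \<cdot> g"
 then show "f = g" using lift_unique[OF m m f g inj] by blast
qed (use m in "simp add: Hom_def")
qed

lemma image_is_sub:
 assumes f: "f : Hom C X Y"
 shows "is_sub Y (fn f ` car X)"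
proof -
note X = hom_dom_obj[OF f]
have "pl Y (fn f a) (fn f b) : fn f ` car X" if "a : car X" "b : car X" for a b
 using imageI[OF pl_closed[OF X that], of "fn f"] fn_pl[OF f that] by simp
moreover have "sm Y c (fn f a) : fn f ` car X" if "a : car X" for a c
 using imageI[OF sm_closed[OF X that], of "fn f"] fn_sm[OF f that] by simp
moreover have "ac Y g (fn f a) : fn f ` car X" if "g : carrier G" "a : car X" for a g
 using imageI[OF ac_closed[OF X that], of "fn f"] fn_ac[OF f that] by simp
moreover have "zr Y : fn f ` car X" using imageI[OF zr_closed[OF X], of "fn f"] fn_zr[OF f] by simp
moreover have "fn f ` car X <= car Y" using fn_closed[OF f] by blast
ultimately show ?thesis
 unfolding is_sub_def by blast
qed

lemma abelian_monoid_rep: assumes "S : Obj C" shows "abelian_monoid (fst (emb S))"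
proof -
interpret vectorspace class_ring "fst (emb S)" by (rule Obj_vs[OF assms])
show ?thesis by unfold_locales
qed

text \<open>The sum of \<open>g \<cdot> \<psi> g\<close> over the group, that is, the value at \<open>\<psi>\<close> of the equivariant map
 from \<open>F[G] \<otimes> S\<close> to \<open>S\<close>.\<close>

definition "avg S \<psi> = (\<Oplus>\<^bsub>fst (emb S)\<^esub>g\<in>carrier G. ac S g (\<psi> g))"

lemma avg_closed:
 assumes S: "S : Obj C" and "!!g. g : carrier G ==> \<psi> g : car S"
 shows "avg S \<psi> : car S"
proof -
interpret abelian_monoid "fst (emb S)" by (rule abelian_monoid_rep[OF S])
show ?thesis unfolding avg_def using finsum_closed[of "%g. ac S g (\<psi> g)" "carrier G"] ac_closed[OF S] assms(2)
 by (simp add: car_def Pi_def)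
qed

lemma avg_pl:
 assumes S: "S : Obj C" and p: "!!g. g : carrier G ==> \<psi> g : car S" and c: "!!g. g : carrier G ==> \<chi> g : car S"
 shows "avg S (%g. pl S (\<psi> g) (\<chi> g)) = pl S (avg S \<psi>) (avg S \<chi>)"
proof -
interpret abelian_monoid "fst (emb S)" by (rule abelian_monoid_rep[OF S])
have "avg S (%g. pl S (\<psi> g) (\<chi> g)) = (\<Oplus>\<^bsub>fst (emb S)\<^esub>g\<in>carrier G. ac S g (\<psi> g) \<oplus>\<^bsub>fst (emb S)\<^esub> ac S g (\<chi> g))"
 unfolding avg_def by (rule finsum_cong') (use p c ac_closed[OF S] ac_pl[OF S] in "auto simp: car_def pl_def")
also have "... = pl S (avg S \<psi>) (avg S \<chi>)"
 unfolding avg_def pl_def by (rule finsum_addf) (use p c ac_closed[OF S] in "auto simp: car_def")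
finally show ?thesis .
qed

lemma finsum_additive:
 assumes S: "S : Obj C" and \<phi>: "!!a. a : car S ==> \<phi> a : car S" "\<phi> (zr S) = zr S"
  "!!a b. [|a : car S; b : car S|] ==> \<phi> (pl S a b) = pl S (\<phi> a) (\<phi> b)"
  and "finite A" "!!g. g : A ==> f g : car S"
 shows "\<phi> (\<Oplus>\<^bsub>fst (emb S)\<^esub>g\<in>A. f g) = (\<Oplus>\<^bsub>fst (emb S)\<^esub>g\<in>A. \<phi> (f g))"
 using assms(5,6)
proof (induction A rule: finite_induct)
case empty
interpret abelian_monoid "fst (emb S)" by (rule abelian_monoid_rep[OF S])
show ?case using \<phi>(2) by (simp add: zr_def)
next
case (insert x A)
interpret abelian_monoid "fst (emb S)" by (rule abelian_monoid_rep[OF S])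
have c: "f x : carrier (fst (emb S))" "f : A \<rightarrow> carrier (fst (emb S))" "\<phi> (f x) : carrier (fst (emb S))" "(%g. \<phi> (f g)) : A \<rightarrow> carrier (fst (emb S))"
 using insert.prems \<phi>(1) by (auto simp: car_def)
have "\<phi> (f x \<oplus>\<^bsub>fst (emb S)\<^esub> (\<Oplus>\<^bsub>fst (emb S)\<^esub>g\<in>A. f g)) = \<phi> (f x) \<oplus>\<^bsub>fst (emb S)\<^esub> \<phi> (\<Oplus>\<^bsub>fst (emb S)\<^esub>g\<in>A. f g)"
 using \<phi>(3)[of "f x" "\<Oplus>\<^bsub>fst (emb S)\<^esub>g\<in>A. f g"] c(1) finsum_closed[OF c(2)] by (simp add: car_def pl_def)
then show ?case
 using insert c by (simp add: finsum_insert)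
qed

lemma avg_sm:
 assumes S: "S : Obj C" and p: "!!g. g : carrier G ==> \<psi> g : car S"
 shows "avg S (%g. sm S c (\<psi> g)) = sm S c (avg S \<psi>)"
proof -
interpret abelian_monoid "fst (emb S)" by (rule abelian_monoid_rep[OF S])
have "avg S (%g. sm S c (\<psi> g)) = (\<Oplus>\<^bsub>fst (emb S)\<^esub>g\<in>carrier G. sm S c (ac S g (\<psi> g)))"
 unfolding avg_def by (rule finsum_cong') (use p ac_closed[OF S] sm_closed[OF S] ac_sm[OF S] in "auto simp: car_def")
also have "... = sm S c (avg S \<psi>)"
 unfolding avg_def
 by (rule finsum_additive[symmetric, OF S sm_closed[OF S] sm_zr[OF S] sm_pl[OF S] finite_group]) (use p ac_closed[OF S] in auto)
finally show ?thesis .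
qed

text \<open>Substituting h g for g only permutes the summands.\<close>

lemma avg_ac:
 assumes S: "S : Obj C" and p: "!!g. g : carrier G ==> \<psi> g : car S" and h: "h : carrier G"
 shows "avg S (%g. \<psi> (inv\<^bsub>G\<^esub> h \<otimes>\<^bsub>G\<^esub> g)) = ac S h (avg S \<psi>)"
proof -
interpret abelian_monoid "fst (emb S)" by (rule abelian_monoid_rep[OF S])
have inv: "inv\<^bsub>G\<^esub> h \<otimes>\<^bsub>G\<^esub> (h \<otimes>\<^bsub>G\<^esub> g) = g" "h \<otimes>\<^bsub>G\<^esub> (inv\<^bsub>G\<^esub> h \<otimes>\<^bsub>G\<^esub> g) = g" if "g : carrier G" for g
 using h that by (simp_all add: G.m_assoc[symmetric])
have bij: "bij_betw (%g. h \<otimes>\<^bsub>G\<^esub> g) (carrier G) (carrier G)"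
 by (rule bij_betw_byWitness[where f'="%g. inv\<^bsub>G\<^esub> h \<otimes>\<^bsub>G\<^esub> g"]) (use h inv in auto)
have m: "ac S g (\<psi> (inv\<^bsub>G\<^esub> h \<otimes>\<^bsub>G\<^esub> g)) : carrier (fst (emb S))" if "g : carrier G" for g
 using ac_closed[OF S that p] h that by (simp add: car_def)
have "avg S (%g. \<psi> (inv\<^bsub>G\<^esub> h \<otimes>\<^bsub>G\<^esub> g)) = (\<Oplus>\<^bsub>fst (emb S)\<^esub>g\<in>(%g. h \<otimes>\<^bsub>G\<^esub> g) ` carrier G. ac S g (\<psi> (inv\<^bsub>G\<^esub> h \<otimes>\<^bsub>G\<^esub> g)))"
 unfolding avg_def bij_betw_imp_surj_on[OF bij] ..
also have "... = (\<Oplus>\<^bsub>fst (emb S)\<^esub>g\<in>carrier G. ac S (h \<otimes>\<^bsub>G\<^esub> g) (\<psi> (inv\<^bsub>G\<^esub> h \<otimes>\<^bsub>G\<^esub> (h \<otimes>\<^bsub>G\<^esub> g))))"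
 by (rule finsum_reindex) (use m bij h in "auto simp: bij_betw_def")
also have "... = (\<Oplus>\<^bsub>fst (emb S)\<^esub>g\<in>carrier G. ac S h (ac S g (\<psi> g)))"
 by (rule finsum_cong') (use p h ac_closed[OF S] ac_mult[OF S h] inv in "auto simp: car_def")
also have "... = ac S h (avg S \<psi>)"
 unfolding avg_def
 by (rule finsum_additive[symmetric, OF S ac_closed[OF S h] ac_zr[OF S h] ac_pl[OF S h] finite_group]) (use p ac_closed[OF S] in auto)
finally show ?thesis .
qed

lemma avg_cong:
 assumes S: "S : Obj C" and "!!g. g : carrier G ==> \<psi> g = \<chi> g" and "!!g. g : carrier G ==> \<chi> g : car S"
 shows "avg S \<psi> = avg S \<chi>"
proof -
interpret abelian_monoid "fst (emb S)" by (rule abelian_monoid_rep[OF S])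
show ?thesis unfolding avg_def by (rule finsum_cong') (use assms(2,3) ac_closed[OF S] in "auto simp: car_def")
qed

lemma avg_single:
 assumes S: "S : Obj C" and s: "s : car S"
 shows "avg S (%g. if g = \<one>\<^bsub>G\<^esub> then s else zr S) = s"
proof -
interpret abelian_monoid "fst (emb S)" by (rule abelian_monoid_rep[OF S])
have "avg S (%g. if g = \<one>\<^bsub>G\<^esub> then s else zr S) = (\<Oplus>\<^bsub>fst (emb S)\<^esub>g\<in>carrier G. if g = \<one>\<^bsub>G\<^esub> then s else \<zero>\<^bsub>fst (emb S)\<^esub>)"
 unfolding avg_def
 by (rule finsum_cong') (use s ac_one[OF S s] ac_zr[OF S] in "auto simp: car_def zr_def")
also have "... = s"
 using finsum_singleton[of "\<one>\<^bsub>G\<^esub>" "carrier G" "%_. s"] finite_group s by (simp add: car_def eq_commute)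
finally show ?thesis .
qed

lemma avg_in_sub:
 assumes S: "S : Obj C" and A: "is_sub S A" and "!!g. g : carrier G ==> \<psi> g : A"
 shows "avg S \<psi> : A"
proof -
interpret abelian_monoid "fst (emb S)" by (rule abelian_monoid_rep[OF S])
have "(\<Oplus>\<^bsub>fst (emb S)\<^esub>g\<in>X. ac S g (\<psi> g)) : A" if "X <= carrier G" for X
 using finite_subset[OF that finite_group] that
proof (induction X rule: finite_induct)
 case empty then show ?case using A by (simp add: is_sub_def zr_def)
next
 case (insert x X)
 have c: "ac S g (\<psi> g) : A" "ac S g (\<psi> g) : carrier (fst (emb S))" if "g : carrier G" for g
  using A assms(3)[OF that] that unfolding is_sub_def car_def by blast+
 have "pl S (ac S x (\<psi> x)) (\<Oplus>\<^bsub>fst (emb S)\<^esub>g\<in>X. ac S g (\<psi> g)) : A"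
  using insert c A unfolding is_sub_def by blast
 then show ?case using insert c by (subst finsum_insert) (auto simp: pl_def)
qed
then show ?thesis by (simp add: avg_def)
qed

lemma finsum_const:
 assumes S: "S : Obj C" and a: "a : car S" and "finite X"
 shows "(\<Oplus>\<^bsub>fst (emb S)\<^esub>g\<in>X. a) = sm S (of_nat (card X)) a"
 using assms(3)
proof (induction X rule: finite_induct)
interpret abelian_monoid "fst (emb S)" by (rule abelian_monoid_rep[OF S])
{
 case empty show ?case using sm_zero[OF S a] by (simp add: zr_def)
next
 case (insert x X)
 have "(\<Oplus>\<^bsub>fst (emb S)\<^esub>g\<in>insert x X. a) = pl S a (sm S (of_nat (card X)) a)"
  using insert a by (subst finsum_insert) (auto simp: car_def pl_def)
 then show ?case using insert by (simp add: add_sm[OF S a] sm_one[OF S a])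
}
qed

text \<open>Maschke's theorem: summing the conjugates g p g^-1 of a linear retraction
  \<open>p\<close> over the group makes it equivariant, and dividing by the order of the group,
  which \<open>char\<close> permits, makes it a retraction again.\<close>

lemma projection:
 assumes S: "S : Obj C" and A: "is_sub S A"
 shows "\<exists>\<pi>\<in>Hom C S S. (ALL a:car S. fn \<pi> a : A) & (ALL a:A. fn \<pi> a = a)"
proof -
have "VectorSpace.subspace class_ring A (fst (emb S))" using A is_sub_iff[OF S] by (simp add: invariant_subspace_def)
from linear_retraction[OF Obj_vs[OF S] _ this] obtain p where "linear_map class_ring (fst (emb S)) (fst (emb S)) p"
 "p ` car S <= A" and pA: "!!a. a : A ==> p a = a" using car_finite[OF S] by (auto simp: car_def)
then have p: "!!a. a : car S ==> p a : A" "!!a b. [|a : car S; b : car S|] ==> p (pl S a b) = pl S (p a) (p b)"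
 "!!c a. a : car S ==> p (sm S c a) = sm S c (p a)" by (auto simp: linear_map_iff car_def pl_def sm_def)
have Ac: "a : car S" if "a : A" for a using A that by (auto simp: is_sub_def)
define n where "n = (of_nat (Coset.order G) :: 'f)"
have n: "n ~= 0" using char by (simp add: n_def of_nat_eq_0_iff_char_dvd)
\<comment> \<open>\<open>avg\<close> applies g to the value at g, so this is the summand g p(g^-1 v)
  before that application.\<close>
define \<psi> where "\<psi> v g = p (ac S (inv\<^bsub>G\<^esub> g) v)" for v g
have i: "ac S (inv\<^bsub>G\<^esub> g) v : car S" if "v : car S" "g : carrier G" for v g
 by (rule ac_closed[OF S G.inv_closed[OF that(2)] that(1)])
have \<psi>: "\<psi> v g : A" "\<psi> v g : car S" if "v : car S" "g : carrier G" for v g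
 unfolding \<psi>_def using p(1)[OF i[OF that]] Ac by blast+
note av = avg_closed[OF S \<psi>(2)]
let ?\<pi> = "arr S (%v. sm S (inverse n) (avg S (\<psi> v))) S"
have "?\<pi> : Hom C S S"
proof (rule arr_hom[OF S S])
 fix v assume v: "v : car S"
 show "sm S (inverse n) (avg S (\<psi> v)) : car S" by (rule sm_closed[OF S av[OF v]])
 have "avg S (\<psi> (sm S c v)) = avg S (%g. sm S c (\<psi> v g))" for c
  by (rule avg_cong[OF S]) (simp_all add: \<psi>_def ac_sm[OF S G.inv_closed v] p(3)[OF i[OF v]] sm_closed[OF S \<psi>(2)[OF v, unfolded \<psi>_def]])
 then show "sm S (inverse n) (avg S (\<psi> (sm S c v))) = sm S c (sm S (inverse n) (avg S (\<psi> v)))" for c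
  using avg_sm[OF S, of "\<psi> v" c] \<psi>(2)[OF v] av[OF v] by (simp add: sm_sm[OF S] mult.commute)
 have "avg S (\<psi> (ac S h v)) = ac S h (avg S (\<psi> v))" if h: "h : carrier G" for h
 proof -
  have "avg S (\<psi> (ac S h v)) = avg S (%g. \<psi> v (inv\<^bsub>G\<^esub> h \<otimes>\<^bsub>G\<^esub> g))"
  proof (rule avg_cong[OF S])
   fix g assume g: "g : carrier G"
   show "\<psi> (ac S h v) g = \<psi> v (inv\<^bsub>G\<^esub> h \<otimes>\<^bsub>G\<^esub> g)"
    using g h by (simp add: \<psi>_def ac_mult[OF S _ _ v, symmetric] G.inv_mult_group)
   show "\<psi> v (inv\<^bsub>G\<^esub> h \<otimes>\<^bsub>G\<^esub> g) : car S" using \<psi>(2)[OF v] g h by simp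
  qed
  then show ?thesis using avg_ac[OF S, of "\<psi> v" h] \<psi>(2)[OF v] h by simp
 qed
 then show "sm S (inverse n) (avg S (\<psi> (ac S h v))) = ac S h (sm S (inverse n) (avg S (\<psi> v)))" if "h : carrier G" for h
  using that by (simp add: ac_sm[OF S that av[OF v]])
 fix w assume w: "w : car S"
 have "avg S (\<psi> (pl S v w)) = avg S (%g. pl S (\<psi> v g) (\<psi> w g))"
  by (rule avg_cong[OF S]) (simp_all add: \<psi>_def ac_pl[OF S G.inv_closed v w] p(2)[OF i[OF v] i[OF w]] pl_closed[OF S] \<psi>(2)[OF v, unfolded \<psi>_def] \<psi>(2)[OF w, unfolded \<psi>_def])
 then show "sm S (inverse n) (avg S (\<psi> (pl S v w))) = pl S (sm S (inverse n) (avg S (\<psi> v))) (sm S (inverse n) (avg S (\<psi> w)))"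
  using avg_pl[OF S, of "\<psi> v" "\<psi> w"] \<psi>(2)[OF v] \<psi>(2)[OF w] sm_pl[OF S av[OF v] av[OF w]] by simp
qed
moreover have "fn ?\<pi> v : A" if v: "v : car S" for v
 using avg_in_sub[OF S A, of "\<psi> v"] \<psi>(1)[OF v] A unfolding fn_arr[OF v] is_sub_def by blast
moreover have "fn ?\<pi> a = a" if a: "a : A" for a
proof -
 interpret abelian_monoid "fst (emb S)" by (rule abelian_monoid_rep[OF S])
 note ac' = Ac[OF a]
 \<comment> \<open>Invariance of \<open>A\<close> keeps g^-1 a in \<open>A\<close>, where
   \<open>p\<close> is the identity, so each of the \<open>n\<close> summands is
   \<open>a\<close>.\<close>
 have "ac S g (\<psi> a g) = a" if g: "g : carrier G" for g
 proof -
  have "ac S (inv\<^bsub>G\<^esub> g) a : A" using A a g by (simp add: is_sub_def)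
  then show ?thesis using g ac_mult[OF S g G.inv_closed[OF g] ac'] ac_one[OF S ac'] by (simp add: \<psi>_def pA)
 qed
 then have "avg S (\<psi> a) = (\<Oplus>\<^bsub>fst (emb S)\<^esub>g\<in>carrier G. a)"
  unfolding avg_def by (intro finsum_cong') (use ac' in "auto simp: car_def")
 also have "... = sm S n a" unfolding n_def Coset.order_def by (rule finsum_const[OF S ac' finite_group])
 finally show ?thesis unfolding fn_arr[OF ac'] using n by (simp add: sm_sm[OF S ac'] sm_one[OF S ac'])
qed
ultimately show ?thesis by blast
qed

text \<open>The equivariant projection onto the image agrees with the identity after
  \<open>e\<close>; for an epimorphism it is therefore the identity, and the image is
  everything.\<close>

lemma epi_iff:
 assumes e: "e : Hom C X Y"
 shows "is_epi C e \<longleftrightarrow> fn e ` car X = car Y"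
proof
assume epi: "is_epi C e"
note Y = hom_cod_obj[OF e]
obtain \<pi> where \<pi>: "\<pi> : Hom C Y Y" "ALL a:car Y. fn \<pi> a : fn e ` car X" "ALL a:fn e ` car X. fn \<pi> a = a"
 using projection[OF Y image_is_sub[OF e]] by blast
have "\<pi> \<cdot> e = Ident C Y \<cdot> e"
 unfolding comp_eq_iff[OF e \<pi>(1) e ident_hom[OF Y]] using \<pi>(3) fn_closed[OF e] by (simp add: fn_ident)
then have "\<pi> = Ident C Y"
 using epi \<pi>(1) ident_hom[OF Y] unfolding is_epi_def hom_Cod[OF e] by blast
then have "car Y <= fn e ` car X" using \<pi>(2) fn_ident by auto
then show "fn e ` car X = car Y" using fn_closed[OF e] by blast
next
assume surj: "fn e ` car X = car Y"
show "is_epi C e"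
 unfolding is_epi_def hom_Cod[OF e]
proof (intro conjI allI ballI impI)
 fix Z f g assume f: "f : Hom C Y Z" and g: "g : Hom C Y Z" and "f \<cdot> e = g \<cdot> e"
 then show "f = g"
  unfolding comp_eq_iff[OF e f e g] by (intro hom_eqI[OF f g]) (metis imageE surj)
qed (use e in "simp add: Hom_def")
qed

lemma inverse_ex:
 assumes i: "i : Hom C X Y" and bij: "bij_betw (fn i) (car X) (car Y)"
 shows "EX j:Hom C Y X. j \<cdot> i = Ident C X & i \<cdot> j = Ident C Y"
proof -
note X = hom_dom_obj[OF i] and Y = hom_cod_obj[OF i]
note idX = ident_hom[OF X] and idY = ident_hom[OF Y]
\<comment> \<open>An injective arrow counts as the jointly injective pair \<open>(i, i)\<close>, so
  the inverse is a lift of the identity.\<close>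
have "EX h:Hom C Y X. i \<cdot> h = Ident C Y & i \<cdot> h = Ident C Y"
proof (rule lift_hom[OF i i idY idY])
 show "inj_on (%w. (fn i w, fn i w)) (car X)" using bij by (simp add: bij_betw_def inj_on_def)
 fix a assume a: "a : car Y"
 then have "a : fn i ` car X" using bij by (simp add: bij_betw_def)
 then show "EX w:car X. fn i w = fn (Ident C Y) a & fn i w = fn (Ident C Y) a"
  using a by (auto simp: fn_ident)
qed
then obtain j where j: "j : Hom C Y X" "i \<cdot> j = Ident C Y" by blast
have "i \<cdot> (j \<cdot> i) = i \<cdot> Ident C X"
 using comp_assoc[OF i j(1) i] j(2) ident_left[OF i] ident_right[OF i] by simp
then have "j \<cdot> i = Ident C X"
 using bij by (intro lift_unique[OF i i comp_hom[OF i j(1)] idX]) (auto simp: bij_betw_def inj_on_def)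
then show ?thesis using j by blast
qed

lemma iso_iff:
 assumes i: "i : Hom C X Y"
 shows "is_iso C i \<longleftrightarrow> bij_betw (fn i) (car X) (car Y)"
proof
assume "is_iso C i"
then obtain j where j: "j : Hom C Y X" "j \<cdot> i = Ident C X" "i \<cdot> j = Ident C Y"
 using i by (auto simp: is_iso_def Hom_def)
show "bij_betw (fn i) (car X) (car Y)"
 using fn_comp[OF i j(1)] fn_comp[OF j(1) i] j(2,3) fn_closed[OF i] fn_closed[OF j(1)]
 by (intro bij_betw_byWitness[where f' = "fn j"]) (auto simp: fn_ident)
next
assume "bij_betw (fn i) (car X) (car Y)"
then show "is_iso C i" using inverse_ex[OF i] i by (auto simp: is_iso_def Hom_def)
qed

lemma zero_arr: "[|S : Obj C; T : Obj C|] ==> arr S (%_. zr T) T : Hom C S T"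
 by (rule arr_hom) (auto simp: zr_closed pl_zr sm_zr ac_zr)

text \<open>The identity and the zero arrow of a terminal object coincide.\<close>

lemma terminal_iff: "is_terminal C Z \<longleftrightarrow> Z : Obj C & car Z = {zr Z}"
proof
assume t: "is_terminal C Z"
then have Z: "Z : Obj C" by (simp add: is_terminal_def)
have "\<exists>!f. f : Hom C Z Z" using t Z by (simp add: is_terminal_def)
then have "Ident C Z = arr Z (%_. zr Z) Z" using ident_hom[OF Z] zero_arr[OF Z Z] by blast
then have "a = zr Z" if "a : car Z" for a
 using fn_ident[OF that] fn_arr[OF that, of "%_. zr Z" Z] by simp
then show "Z : Obj C & car Z = {zr Z}" using Z zr_closed by auto
next
assume Z: "Z : Obj C & car Z = {zr Z}"
show "is_terminal C Z"
 unfolding is_terminal_def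
proof (intro conjI ballI)
 fix X assume X: "X : Obj C"
 show "\<exists>!f. f : Hom C X Z"
 proof (rule ex1I[of _ "arr X (%_. zr Z) Z"])
  show z: "arr X (%_. zr Z) Z : Hom C X Z" using X Z by (simp add: zero_arr)
  show "f = arr X (%_. zr Z) Z" if f: "f : Hom C X Z" for f
   using fn_closed[OF f] fn_closed[OF z] Z by (intro hom_eqI[OF f z]) auto
 qed
qed (use Z in simp)
qed

lemma image_factorization_ex:
 assumes f: "f : Hom C X Y"
 obtains e m where "is_image_factorization C f e m"
proof -
note X = hom_dom_obj[OF f] and Y = hom_cod_obj[OF f]
let ?I = "fn f ` car X"
note s = image_is_sub[OF f]
have m: "incl Y ?I : Hom C (sub Y ?I) Y" by (rule incl_hom[OF Y s])
have e: "arr X (fn f) (sub Y ?I) : Hom C X (sub Y ?I)"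
 by (rule arr_hom[OF X sub_obj(1)[OF Y s]]) (auto simp: sub_obj[OF Y s] fn_pl[OF f] fn_sm[OF f] fn_ac[OF f])
have "incl Y ?I \<cdot> arr X (fn f) (sub Y ?I) = f"
 by (rule hom_eqI[OF comp_hom[OF e m] f]) (simp add: fn_comp[OF e m] fn_arr fn_incl[OF Y s])
moreover have "is_mono C (incl Y ?I)"
 unfolding mono_iff[OF m] by (auto simp: inj_on_def sub_obj(2)[OF Y s] fn_incl[OF Y s])
moreover have "is_epi C (arr X (fn f) (sub Y ?I))"
 unfolding epi_iff[OF e] by (auto simp: sub_obj(2)[OF Y s] fn_arr)
ultimately show thesis
 by (intro that[of "arr X (fn f) (sub Y ?I)" "incl Y ?I"])
  (simp add: is_image_factorization_def hom_Cod[OF e] hom_Dom[OF m])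
qed

lemma epi_Arr: "is_epi C e ==> e : Hom C (Dom C e) (Cod C e)"
 and mono_Arr: "is_mono C e ==> e : Hom C (Dom C e) (Cod C e)"
 unfolding is_epi_def is_mono_def using Arr_hom by blast+

lemma image_factorization_Arr:
 assumes "is_image_factorization C f e m" shows "f : Arr C"
proof -
have e: "e : Hom C (Dom C e) (Dom C m)" and m: "m : Hom C (Dom C m) (Cod C m)" and f: "m \<cdot> e = f"
 using assms epi_Arr[of e] mono_Arr[of m] by (simp_all add: is_image_factorization_def)
show ?thesis using hom_Arr[OF comp_hom[OF e m]] unfolding f .
qed

lemma image_factorizationD:
 assumes "is_image_factorization C f e m" and f: "f : Hom C X Y"
 shows "e : Hom C X (Dom C m)" "m : Hom C (Dom C m) Y" "fn e ` car X = car (Dom C m)" "inj_on (fn m) (car (Dom C m))"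
  "!!x. x : car X ==> fn m (fn e x) = fn f x" "fn m ` car (Dom C m) = fn f ` car X" (is ?P)
proof -
have em: "is_epi C e" "is_mono C m" "Cod C e = Dom C m" "m \<cdot> e = f"
 using assms(1) by (auto simp: is_image_factorization_def)
then have e: "e : Hom C (Dom C e) (Dom C m)" and m: "m : Hom C (Dom C m) (Cod C m)"
 using epi_Arr[of e] mono_Arr[of m] by auto
have "f : Hom C (Dom C e) (Cod C m)" using comp_hom[OF e m] em(4) by simp
then have "Dom C e = X" "Cod C m = Y" using f by (auto simp: Hom_def)
then show e': "e : Hom C X (Dom C m)" and m': "m : Hom C (Dom C m) Y" using e m by auto
show s: "fn e ` car X = car (Dom C m)" using em(1) epi_iff[OF e'] by simp
show "inj_on (fn m) (car (Dom C m))" using em(2) mono_iff[OF m'] by simp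
show eq: "fn m (fn e x) = fn f x" if "x : car X" for x using fn_comp[OF e' m' that] em(4) by simp
show ?P unfolding s[symmetric] image_image using eq by simp
qed

text \<open>All pullbacks of two arrows with a common codomain exist, so the existence axioms are
  immediate, and surjectivity passes to base changes because every pullback has the expected
  vectors. Two images of \<open>f\<close> have the same vectors inside the codomain, so lifting one
  monomorphism through the other gives the isomorphism.\<close>

theorem regular: "regular_category C"
proof (unfold_locales, goal_cases)
case 1
obtain Z where "Z : Obj C" "car Z = {zr Z}" by (rule zero_object)
then show ?case unfolding terminal_iff by blast
next
case (2 f)
then show ?case using image_factorization_ex[OF Arr_hom] by metis
next
case (3 f e m e' m')
have f: "f : Hom C (Dom C f) (Cod C f)"
 by (rule Arr_hom[OF image_factorization_Arr[OF 3(1)]])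
note d = image_factorizationD[OF 3(1) f] and d' = image_factorizationD[OF 3(2) f]
have "EX w:car (Dom C m'). fn m' w = fn m a & fn m' w = fn m a" if a: "a : car (Dom C m)" for a
proof -
 obtain x where "x : car (Dom C f)" "a = fn e x" using a d(3) by auto
 then show ?thesis using d(5) d'(5) fn_closed[OF d'(1)] by (intro bexI[of _ "fn e' x"]) auto
qed
from lift_hom[OF d'(2,2) d(2,2) _ this] obtain i where i: "i : Hom C (Dom C m) (Dom C m')" "m' \<cdot> i = m"
 using d'(4) by (auto simp: inj_on_def)
have mi: "fn m' (fn i a) = fn m a" if "a : car (Dom C m)" for a
 using fn_comp[OF i(1) d'(2) that] i(2) by simp
have ie: "i \<cdot> e = e'"
proof (rule hom_eqI[OF comp_hom[OF d(1) i(1)] d'(1)])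
 fix x assume x: "x : car (Dom C f)"
 show "fn (i \<cdot> e) x = fn e' x"
  unfolding fn_comp[OF d(1) i(1) x]
  using mi[OF fn_closed[OF d(1) x]] d(5)[OF x] d'(5)[OF x] fn_closed[OF d'(1) x]
   fn_closed[OF i(1) fn_closed[OF d(1) x]] inj_onD[OF d'(4), of "fn i (fn e x)" "fn e' x"] by simp
qed
have "bij_betw (fn i) (car (Dom C m)) (car (Dom C m'))"
 unfolding bij_betw_def
proof
 show "inj_on (fn i) (car (Dom C m))"
  using d(4) mi unfolding inj_on_def by metis
 have "fn i (fn e x) = fn e' x" if "x : car (Dom C f)" for x using fn_comp[OF d(1) i(1) that] ie by simp
 then show "fn i ` car (Dom C m) = car (Dom C m')"
  unfolding d(3)[symmetric] d'(3)[symmetric] image_image by simp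
qed
then show ?case
 using i ie iso_iff[OF i(1)] hom_Cod[OF d(1)] hom_Cod[OF d'(1)] by auto
next
case (4 f g p q)
then have "f : Hom C (Dom C f) (Cod C f)" "g : Hom C (Dom C g) (Cod C f)"
 by (auto simp: commuting_square_def Hom_def)
then show ?case by (rule pullback_ex) blast
next
case (5 e g)
then have "e : Hom C (Dom C e) (Cod C e)" "g : Hom C (Dom C g) (Cod C e)"
 using epi_Arr[OF 5(1)] 5 by (simp_all add: Hom_def)
then show ?case by (rule pullback_ex) blast
next
case (6 e g p q)
have e: "e : Hom C (Dom C e) (Cod C e)" by (rule epi_Arr[OF 6(1)])
have g: "g : Hom C (Dom C g) (Cod C e)"
 using 6(2) unfolding is_pullback_def commuting_square_def Hom_def by simp
note d = pullbackD[OF 6(2) e g]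
have "b : fn q ` car (Dom C p)" if b: "b : car (Dom C g)" for b
proof -
 obtain a where "a : car (Dom C e)" "fn e a = fn g b"
  using 6(1) fn_closed[OF g b] unfolding epi_iff[OF e] by (metis imageE)
 then have "(a, b) : (%w. (fn p w, fn q w)) ` car (Dom C p)"
  unfolding bij_betw_imp_surj_on[OF d(3)] using b by (simp add: pb_rel_def)
 then show ?thesis by auto
qed
then show ?case using fn_closed[OF d(2)] unfolding epi_iff[OF d(2)] by auto
qed

end

context rep_category
begin

section \<open>Subobjects of products as relations\<close>

lemma prod_cone: "[|x : Obj C; y : Obj C|] ==> is_product C x y (pr1 C x y) (pr2 C x y)"
proof -
assume "x : Obj C" "y : Obj C"
then obtain p q where "is_product C x y p q" using product_ex by metis
then have "case (prod_cone C x y) of (p, q) => is_product C x y p q"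
 unfolding prod_cone_def by (intro someI[of "%(p, q). is_product C x y p q" "(p, q)"]) simp
then show ?thesis by (simp add: pr1_def pr2_def split_beta)
qed

lemma pr_hom:
 assumes "x : Obj C" "y : Obj C"
 shows "pr1 C x y : Hom C (prod_obj C x y) x" (is ?P) "pr2 C x y : Hom C (prod_obj C x y) y"
  "bij_betw (%w. (fn (pr1 C x y) w, fn (pr2 C x y) w)) (car (prod_obj C x y)) (car x \<times> car y)"
  "prod_obj C x y : Obj C"
proof -
note d = productD[OF prod_cone[OF assms] assms, folded prod_obj_def]
show ?P "pr2 C x y : Hom C (prod_obj C x y) y"
 "bij_betw (%w. (fn (pr1 C x y) w, fn (pr2 C x y) w)) (car (prod_obj C x y)) (car x \<times> car y)"
 by (rule d)+
show "prod_obj C x y : Obj C" by (rule hom_dom_obj[OF d(1)])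
qed

abbreviation "pi1 x y \<equiv> fn (pr1 C x y)"
abbreviation "pi2 x y \<equiv> fn (pr2 C x y)"
abbreviation "PC x y \<equiv> prod_obj C x y"

lemma pr_closed:
 assumes "x : Obj C" "y : Obj C" "u : car (PC x y)"
 shows "pi1 x y u : car x" "pi2 x y u : car y"
 using fn_closed[OF pr_hom(1)[OF assms(1,2)] assms(3)] fn_closed[OF pr_hom(2)[OF assms(1,2)] assms(3)] by auto

lemma pr_surj:
 assumes "x : Obj C" "y : Obj C" "a : car x" "b : car y"
 shows "EX u:car (PC x y). pi1 x y u = a & pi2 x y u = b"
proof -
have "(a, b) : (%w. (pi1 x y w, pi2 x y w)) ` car (PC x y)"
 unfolding bij_betw_imp_surj_on[OF pr_hom(3)[OF assms(1,2)]] using assms by simp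
then show ?thesis by auto
qed

lemma pr_inj:
 assumes "x : Obj C" "y : Obj C" "u : car (PC x y)" "v : car (PC x y)"
  "pi1 x y u = pi1 x y v" "pi2 x y u = pi2 x y v"
 shows "u = v"
 using inj_onD[OF bij_betw_imp_inj_on[OF pr_hom(3)[OF assms(1,2)]] _ assms(3,4)] assms(5,6) by simp

lemma pairing_hom:
 assumes f: "f : Hom C w x" and g: "g : Hom C w y"
 shows "pairing C f g : Hom C w (PC x y)" (is ?P) "pr1 C x y \<cdot> pairing C f g = f" "pr2 C x y \<cdot> pairing C f g = g"
proof -
note x = hom_cod_obj[OF f] and y = hom_cod_obj[OF g]
have "\<exists>!h. h : Hom C w (PC x y) & pr1 C x y \<cdot> h = f & pr2 C x y \<cdot> h = g"
 using prod_cone[OF x y] f g unfolding is_product_def prod_obj_def by blast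
from theI'[OF this] show ?P "pr1 C x y \<cdot> pairing C f g = f"
 "pr2 C x y \<cdot> pairing C f g = g"
 unfolding pairing_def Let_def hom_Dom[OF f] hom_Cod[OF f] hom_Cod[OF g] by auto
qed

lemma pairing_fn:
 assumes f: "f : Hom C w x" and g: "g : Hom C w y" and a: "a : car w"
 shows "pi1 x y (fn (pairing C f g) a) = fn f a" (is ?P) "pi2 x y (fn (pairing C f g) a) = fn g a"
proof -
note p = pairing_hom[OF f g]
note h = pr_hom(1,2)[OF hom_cod_obj[OF f] hom_cod_obj[OF g]]
show ?P "pi2 x y (fn (pairing C f g) a) = fn g a"
 using fn_comp[OF p(1) h(1) a] fn_comp[OF p(1) h(2) a] unfolding p(2,3) by simp_all
qed

definition "relm x y m = (%w. (pi1 x y (fn m w), pi2 x y (fn m w))) ` car (Dom C m)"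

text \<open>A normal form for subobjects of the chosen product: the class is named by its relation
  of vectors rather than by a representative.\<close>

definition "sb x y R = {m. is_mono C m & Cod C m = PC x y & relm x y m = R}"

lemma relm_is_rel:
 assumes x: "x : Obj C" and y: "y : Obj C" and m: "m : Hom C w (PC x y)"
 shows "is_rel x y (relm x y m)"
proof -
note w = hom_dom_obj[OF m]
note p = pr_hom(1,2)[OF x y]
let ?q = "%w. (pi1 x y (fn m w), pi2 x y (fn m w))"
have cl: "?q a : ?q ` car w" if "a : car w" for a using that by (rule imageI)
have c: "fn m a : car (PC x y)" if "a : car w" for a using fn_closed[OF m that] .
have 0: "?q (zr w) = (zr x, zr y)" by (simp add: fn_zr[OF m] fn_zr[OF p(1)] fn_zr[OF p(2)])
have 1: "?q (pl w a b) = (pl x (pi1 x y (fn m a)) (pi1 x y (fn m b)), pl y (pi2 x y (fn m a)) (pi2 x y (fn m b)))"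
 if "a : car w" "b : car w" for a b
 using that c by (simp add: fn_pl[OF m] fn_pl[OF p(1)] fn_pl[OF p(2)])
have 2: "?q (sm w k a) = (sm x k (pi1 x y (fn m a)), sm y k (pi2 x y (fn m a)))" if "a : car w" for a k
 using that c by (simp add: fn_sm[OF m] fn_sm[OF p(1)] fn_sm[OF p(2)])
have 3: "?q (ac w k a) = (ac x k (pi1 x y (fn m a)), ac y k (pi2 x y (fn m a)))"
 if "k : carrier G" "a : car w" for a k
 using that c by (simp add: fn_ac[OF m] fn_ac[OF p(1)] fn_ac[OF p(2)])
show ?thesis
 unfolding is_rel_def relm_def hom_Dom[OF m]
proof (intro conjI allI impI ballI)
 show "?q ` car w <= car x \<times> car y" using c pr_closed[OF x y] by auto
 show "(zr x, zr y) : ?q ` car w" using cl[OF zr_closed[OF w]] unfolding 0 .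
 fix a b assume "(a, b) : ?q ` car w"
 then obtain u where u: "u : car w" "a = pi1 x y (fn m u)" "b = pi2 x y (fn m u)" by auto
 show "(sm x k a, sm y k b) : ?q ` car w" for k using cl[OF sm_closed[OF w u(1)], of k] unfolding 2[OF u(1)] u .
 show "(ac x k a, ac y k b) : ?q ` car w" if "k : carrier G" for k
  using cl[OF ac_closed[OF w that u(1)]] unfolding 3[OF that u(1)] u .
 fix a' b' assume "(a', b') : ?q ` car w"
 then obtain v where v: "v : car w" "a' = pi1 x y (fn m v)" "b' = pi2 x y (fn m v)" by auto
 show "(pl x a a', pl y b b') : ?q ` car w" using cl[OF pl_closed[OF w u(1) v(1)]] unfolding 1[OF u(1) v(1)] u v .
qed
qed

lemma sbD:
 assumes "m : sb x y R"
 shows "m : Hom C (Dom C m) (PC x y)" "inj_on (fn m) (car (Dom C m))"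
  "R = (%w. (pi1 x y (fn m w), pi2 x y (fn m w))) ` car (Dom C m)" (is ?P)
proof -
have m: "is_mono C m" "Cod C m = PC x y" "relm x y m = R" using assms by (auto simp: sb_def)
show h: "m : Hom C (Dom C m) (PC x y)" using mono_Arr[OF m(1)] unfolding m(2) .
show "inj_on (fn m) (car (Dom C m))" using m(1) mono_iff[OF h] by simp
show ?P using m(3) by (simp add: relm_def)
qed

text \<open>Monomorphisms with the same relation have the same image in the product, so one lifts
  through the other and the lift is bijective.\<close>

lemma subobject_eq_sb:
 assumes x: "x : Obj C" and y: "y : Obj C" and m: "m : Hom C w (PC x y)" and mono: "is_mono C m"
 shows "subobject C m = sb x y (relm x y m)"
proof (intro equalityI subsetI)
fix m' assume "m' : subobject C m"
then obtain i where m': "is_mono C m'" "Cod C m' = PC x y" and i: "i : Hom C (Dom C m') w" "is_iso C i" "m \<cdot> i = m'"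
 using hom_Dom[OF m] hom_Cod[OF m] by (auto simp: subobject_def)
have bij: "fn i ` car (Dom C m') = car w" using i(2) unfolding iso_iff[OF i(1)] by (simp add: bij_betw_def)
have "fn m' u = fn m (fn i u)" if "u : car (Dom C m')" for u
 using fn_comp[OF i(1) m that] unfolding i(3) .
then have "relm x y m' = relm x y m"
 unfolding relm_def hom_Dom[OF m] bij[symmetric] image_image by simp
then show "m' : sb x y (relm x y m)" using m' by (simp add: sb_def)
next
fix m' assume "m' : sb x y (relm x y m)"
note d = sbD[OF this]
have mono': "is_mono C m'" using \<open>m' : sb x y (relm x y m)\<close> by (simp add: sb_def)
have inj: "inj_on (%u. (fn m u, fn m u)) (car w)" "inj_on (%u. (fn m' u, fn m' u)) (car (Dom C m'))"
 using mono d(2) unfolding mono_iff[OF m] by (auto simp: inj_on_def)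
have *: "EX v:car w. fn m v = fn m' a & fn m v = fn m' a" if a: "a : car (Dom C m')" for a
proof -
 have "(pi1 x y (fn m' a), pi2 x y (fn m' a)) : relm x y m" unfolding d(3) using a by blast
 then obtain v where "v : car w" "pi1 x y (fn m' a) = pi1 x y (fn m v)" "pi2 x y (fn m' a) = pi2 x y (fn m v)"
  unfolding relm_def hom_Dom[OF m] by auto
 then show ?thesis using pr_inj[OF x y fn_closed[OF m] fn_closed[OF d(1) a]] by (intro bexI[of _ v]) auto
qed
from lift_hom[OF m m d(1,1) inj(1) *] obtain i where i: "i : Hom C (Dom C m') w" "m \<cdot> i = m'" by blast
have mi: "fn m (fn i a) = fn m' a" if "a : car (Dom C m')" for a using fn_comp[OF i(1) m that] i(2) by simp
have "bij_betw (fn i) (car (Dom C m')) (car w)"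
 unfolding bij_betw_def
proof (intro conjI equalityI subsetI)
 show "inj_on (fn i) (car (Dom C m'))" using d(2) mi unfolding inj_on_def by metis
 show "v : car w" if "v : fn i ` car (Dom C m')" for v using that fn_closed[OF i(1)] by blast
 fix v assume v: "v : car w"
 then have "(pi1 x y (fn m v), pi2 x y (fn m v)) : relm x y m" unfolding relm_def hom_Dom[OF m] by blast
 then obtain a where a: "a : car (Dom C m')" "pi1 x y (fn m' a) = pi1 x y (fn m v)" "pi2 x y (fn m' a) = pi2 x y (fn m v)"
  unfolding d(3) by auto
 then have "fn m v = fn m (fn i a)"
  using pr_inj[OF x y fn_closed[OF m v] fn_closed[OF d(1) a(1)]] mi by simp
 then have "v = fn i a" using mono v fn_closed[OF i(1) a(1)] unfolding mono_iff[OF m] by (simp add: inj_on_def)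
 then show "v : fn i ` car (Dom C m')" using a(1) by blast
qed
then have "is_iso C i" using iso_iff[OF i(1)] by simp
then show "m' : subobject C m"
 using mono' i hom_Dom[OF m] hom_Cod[OF m] hom_Cod[OF d(1)] by (auto simp: subobject_def)
qed

text \<open>Graphs, products of relations and images under functors are all given by
  \<open>pairing\<close>; this computes the classes of such arrows.\<close>

lemma subobject_pairing:
 assumes f: "f : Hom C w x" and g: "g : Hom C w y" and inj: "inj_on (%a. (fn f a, fn g a)) (car w)"
 shows "subobject C (pairing C f g) = sb x y ((%a. (fn f a, fn g a)) ` car w)" (is ?P) "pairing C f g : sb x y ((%a. (fn f a, fn g a)) ` car w)" (is ?P1)
proof -
note p = pairing_hom(1)[OF f g]
note x = hom_cod_obj[OF f] and y = hom_cod_obj[OF g]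
have rel: "relm x y (pairing C f g) = (%a. (fn f a, fn g a)) ` car w"
 unfolding relm_def hom_Dom[OF p] using pairing_fn[OF f g] by simp
have mono: "is_mono C (pairing C f g)"
 unfolding mono_iff[OF p]
proof (rule inj_onI)
 fix a b assume "a : car w" "b : car w" "fn (pairing C f g) a = fn (pairing C f g) b"
 then show "a = b" using inj_onD[OF inj, of a b] pairing_fn[OF f g, of a] pairing_fn[OF f g, of b] by simp
qed
show ?P
 using subobject_eq_sb[OF x y p mono] rel by simp
show ?P1
 using mono rel hom_Cod[OF p] by (simp add: sb_def)
qed

definition "Rel x y = {R. is_rel x y R}"

lemma RelI:
 assumes "R <= car x \<times> car y" "(zr x, zr y) : R"
  "!!a b a' b'. [|(a, b) : R; (a', b') : R|] ==> (pl x a a', pl y b b') : R"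
  "!!c a b. (a, b) : R ==> (sm x c a, sm y c b) : R"
  "!!g a b. [|g : carrier G; (a, b) : R|] ==> (ac x g a, ac y g b) : R"
 shows "R : Rel x y"
 unfolding Rel_def is_rel_def mem_Collect_eq by (intro conjI allI impI ballI) (assumption | rule assms)+

lemma Rel_car: "[|R : Rel x y; (a, b) : R|] ==> a : car x" "[|R : Rel x y; (a, b) : R|] ==> b : car y"
 and Rel_zr: "R : Rel x y ==> (zr x, zr y) : R"
 and Rel_pl: "[|R : Rel x y; (a, b) : R; (a', b') : R|] ==> (pl x a a', pl y b b') : R"
 and Rel_sm: "[|R : Rel x y; (a, b) : R|] ==> (sm x c a, sm y c b) : R"
 and Rel_ac: "[|R : Rel x y; g : carrier G; (a, b) : R|] ==> (ac x g a, ac y g b) : R"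
proof -
assume R: "R : Rel x y"
then have r: "R <= car x \<times> car y" "(zr x, zr y) : R"
 "ALL a b a' b'. (a, b) : R --> (a', b') : R --> (pl x a a', pl y b b') : R"
 "ALL c a b. (a, b) : R --> (sm x c a, sm y c b) : R"
 "ALL g:carrier G. ALL a b. (a, b) : R --> (ac x g a, ac y g b) : R"
 unfolding Rel_def is_rel_def by simp_all
show "(a, b) : R ==> a : car x" "(a, b) : R ==> b : car y" using r(1) by auto
show "(zr x, zr y) : R" by (rule r(2))
show "(a, b) : R ==> (a', b') : R ==> (pl x a a', pl y b b') : R" using r(3) by metis
show "(a, b) : R ==> (sm x c a, sm y c b) : R" using r(4) by metis
show "g : carrier G ==> (a, b) : R ==> (ac x g a, ac y g b) : R" using r(5) by metis
qed

lemma sb_nonempty: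
 assumes "x : Obj C" "y : Obj C" "R : Rel x y"
 shows "EX m. m : sb x y R"
proof -
have "is_rel x y R" using assms(3) by (simp add: Rel_def)
then obtain w p q where p: "p : Hom C w x" and q: "q : Hom C w y" and bij: "bij_betw (%a. (fn p a, fn q a)) (car w) R"
 by (rule rel_object[OF assms(1,2)])
then show ?thesis
 using subobject_pairing(2)[OF p q bij_betw_imp_inj_on[OF bij]] unfolding bij_betw_imp_surj_on[OF bij] by blast
qed

lemma subobjects_eq:
 assumes x: "x : Obj C" and y: "y : Obj C"
 shows "subobjects C (PC x y) = sb x y ` Rel x y"
proof (intro equalityI subsetI)
fix s assume "s : subobjects C (PC x y)"
then obtain m where m: "s = subobject C m" "is_mono C m" "Cod C m = PC x y" by (auto simp: subobjects_def)
have h: "m : Hom C (Dom C m) (PC x y)" using mono_Arr[OF m(2)] unfolding m(3) .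
show "s : sb x y ` Rel x y"
 unfolding m(1) subobject_eq_sb[OF x y h m(2)] Rel_def using relm_is_rel[OF x y h] by blast
next
fix s assume "s : sb x y ` Rel x y"
then obtain R where R: "R : Rel x y" "s = sb x y R" by blast
obtain m where m: "m : sb x y R" using sb_nonempty[OF x y R(1)] by blast
note d = sbD[OF m]
have mm: "is_mono C m" "Cod C m = PC x y" "relm x y m = R" using m by (simp_all add: sb_def)
have "s = subobject C m" using subobject_eq_sb[OF x y d(1) mm(1)] mm(3) R(2) by simp
then show "s : subobjects C (PC x y)" unfolding subobjects_def using mm by blast
qed

definition "grf f x = (%a. (a, fn f a)) ` car x"

lemma graph_arr_eq:
 assumes f: "f : Hom C x y"
 shows "graph_arr C f = (x, Poly_Mapping.single (sb x y (grf f x)) 1, y)"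
proof -
note i = ident_hom[OF hom_dom_obj[OF f]]
have "inj_on (%a. (fn (Ident C x) a, fn f a)) (car x)" by (auto simp: inj_on_def fn_ident)
moreover have "(%a. (fn (Ident C x) a, fn f a)) ` car x = grf f x" unfolding grf_def by (auto simp: fn_ident)
ultimately show ?thesis
 using subobject_pairing(1)[OF i f] unfolding graph_arr_def hom_Dom[OF f] hom_Cod[OF f] by simp
qed

lemma transposed_graph_arr_eq:
 assumes f: "f : Hom C x y"
 shows "transposed_graph_arr C f = (y, Poly_Mapping.single (sb y x ((grf f x)\<inverse>)) 1, x)"
proof -
note i = ident_hom[OF hom_dom_obj[OF f]]
have "inj_on (%a. (fn f a, fn (Ident C x) a)) (car x)" by (auto simp: inj_on_def fn_ident)
moreover have "(%a. (fn f a, fn (Ident C x) a)) ` car x = (grf f x)\<inverse>" unfolding grf_def by (auto simp: fn_ident)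
ultimately show ?thesis
 using subobject_pairing(1)[OF f i] unfolding transposed_graph_arr_def hom_Dom[OF f] hom_Cod[OF f] by simp
qed

text \<open>The product of two relations after the middle interchange that turns the factors (x, y),
  (x', y') into (x, x'), (y, y').\<close>

definition "trel x y x' y' R R' = {(u, v). u : car (PC x x') & v : car (PC y y')
 & (pi1 x x' u, pi1 y y' v) : R & (pi2 x x' u, pi2 y y' v) : R'}"

text \<open>\<open>rel_tens\<close> picks representatives by \<open>SOME\<close>; the relation of
  the resulting pairing depends only on \<open>R\<close> and \<open>R'\<close>.\<close>

lemma rel_tens_eq:
 assumes o: "x : Obj C" "y : Obj C" "x' : Obj C" "y' : Obj C" and R: "R : Rel x y" "R' : Rel x' y'"
 shows "rel_tens C x y x' y' (sb x y R) (sb x' y' R') = sb (PC x x') (PC y y') (trel x y x' y' R R')"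
proof -
define m where "m = (SOME m. m : sb x y R)"
define m' where "m' = (SOME m. m : sb x' y' R')"
have "m : sb x y R" unfolding m_def by (rule someI_ex[OF sb_nonempty[OF o(1,2) R(1)]])
note d = sbD[OF this]
have "m' : sb x' y' R'" unfolding m'_def by (rule someI_ex[OF sb_nonempty[OF o(3,4) R(2)]])
note d' = sbD[OF this]
let ?w = "Dom C m" and ?w' = "Dom C m'"
note w = hom_dom_obj[OF d(1)] and w' = hom_dom_obj[OF d'(1)]
note p = pr_hom(1,2)[OF w w']
note q = pr_hom(1,2)[OF o(1,2)] and q' = pr_hom(1,2)[OF o(3,4)]
note c = comp_hom[OF d(1) q(1)] comp_hom[OF d(1) q(2)] comp_hom[OF d'(1) q'(1)] comp_hom[OF d'(1) q'(2)]
note e = comp_hom[OF p(1) c(1)] comp_hom[OF p(2) c(3)] comp_hom[OF p(1) c(2)] comp_hom[OF p(2) c(4)]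
note P = pairing_hom(1)[OF e(1,2)] pairing_hom(1)[OF e(3,4)]
let ?a = "pairing C (pr1 C x y \<cdot> m \<cdot> pr1 C ?w ?w') (pr1 C x' y' \<cdot> m' \<cdot> pr2 C ?w ?w')"
let ?b = "pairing C (pr2 C x y \<cdot> m \<cdot> pr1 C ?w ?w') (pr2 C x' y' \<cdot> m' \<cdot> pr2 C ?w ?w')"
have fns: "pi1 x x' (fn ?a u) = pi1 x y (fn m (pi1 ?w ?w' u))" "pi2 x x' (fn ?a u) = pi1 x' y' (fn m' (pi2 ?w ?w' u))"
 "pi1 y y' (fn ?b u) = pi2 x y (fn m (pi1 ?w ?w' u))" "pi2 y y' (fn ?b u) = pi2 x' y' (fn m' (pi2 ?w ?w' u))"
 if u: "u : car (PC ?w ?w')" for u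
 using pairing_fn[OF e(1,2) u] pairing_fn[OF e(3,4) u] fn_comp[OF p(1) c(1) u] fn_comp[OF p(2) c(3) u]
  fn_comp[OF p(1) c(2) u] fn_comp[OF p(2) c(4) u] pr_closed[OF w w' u]
 by (simp_all add: fn_comp[OF d(1) q(1)] fn_comp[OF d(1) q(2)] fn_comp[OF d'(1) q'(1)] fn_comp[OF d'(1) q'(2)])
have inj: "inj_on (%u. (fn ?a u, fn ?b u)) (car (PC ?w ?w'))"
proof (rule inj_onI)
 fix u v assume u: "u : car (PC ?w ?w')" and v: "v : car (PC ?w ?w')" and eq: "(fn ?a u, fn ?b u) = (fn ?a v, fn ?b v)"
 note cu = pr_closed[OF w w' u] and cv = pr_closed[OF w w' v]
 have "fn m (pi1 ?w ?w' u) = fn m (pi1 ?w ?w' v)"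
  using eq fns[OF u] fns[OF v] by (intro pr_inj[OF o(1,2) fn_closed[OF d(1) cu(1)] fn_closed[OF d(1) cv(1)]]) auto
 moreover have "fn m' (pi2 ?w ?w' u) = fn m' (pi2 ?w ?w' v)"
  using eq fns[OF u] fns[OF v] by (intro pr_inj[OF o(3,4) fn_closed[OF d'(1) cu(2)] fn_closed[OF d'(1) cv(2)]]) auto
 ultimately show "u = v"
  using inj_onD[OF d(2) _ cu(1) cv(1)] inj_onD[OF d'(2) _ cu(2) cv(2)] by (intro pr_inj[OF w w' u v])
qed
have "(%u. (fn ?a u, fn ?b u)) ` car (PC ?w ?w') = trel x y x' y' R R'"
proof (intro equalityI subsetI)
 fix z assume "z : (%u. (fn ?a u, fn ?b u)) ` car (PC ?w ?w')"
 then obtain u where u: "u : car (PC ?w ?w')" "z = (fn ?a u, fn ?b u)" by blast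
 show "z : trel x y x' y' R R'"
  unfolding trel_def u(2) using fns[OF u(1)] fn_closed[OF P(1) u(1)] fn_closed[OF P(2) u(1)] pr_closed[OF w w' u(1)]
  by (auto simp: d(3) d'(3))
next
 fix z assume "z : trel x y x' y' R R'"
 then obtain s t where z: "z = (s, t)" and s: "s : car (PC x x')" and t: "t : car (PC y y')"
  and st: "(pi1 x x' s, pi1 y y' t) : R" "(pi2 x x' s, pi2 y y' t) : R'"
  by (auto simp: trel_def)
 obtain a where a: "a : car ?w" "pi1 x x' s = pi1 x y (fn m a)" "pi1 y y' t = pi2 x y (fn m a)"
  using st(1) unfolding d(3) by auto
 obtain b where b: "b : car ?w'" "pi2 x x' s = pi1 x' y' (fn m' b)" "pi2 y y' t = pi2 x' y' (fn m' b)"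
  using st(2) unfolding d'(3) by auto
 obtain u where u: "u : car (PC ?w ?w')" "pi1 ?w ?w' u = a" "pi2 ?w ?w' u = b"
  using pr_surj[OF w w' a(1) b(1)] by blast
 have "fn ?a u = s" by (rule pr_inj[OF o(1,3) fn_closed[OF P(1) u(1)] s]) (use fns[OF u(1)] u a b in auto)
 moreover have "fn ?b u = t" by (rule pr_inj[OF o(2,4) fn_closed[OF P(2) u(1)] t]) (use fns[OF u(1)] u a b in auto)
 ultimately show "z : (%u. (fn ?a u, fn ?b u)) ` car (PC ?w ?w')" using u(1) z by blast
qed
then show ?thesis
 unfolding rel_tens_def Let_def m_def[symmetric] m'_def[symmetric]
 using subobject_pairing(1)[OF P inj] by simp
qed

lemma restrict_hom:
 assumes f: "f : Hom C S T" and A: "is_sub S A" and B: "is_sub T B" and AB: "!!a. a : A ==> fn f a : B"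
 shows "arr (sub S A) (fn f) (sub T B) : Hom C (sub S A) (sub T B)" (is ?P)
  "a : A ==> fn (arr (sub S A) (fn f) (sub T B)) a = fn f a"
proof -
note S = hom_dom_obj[OF f] and T = hom_cod_obj[OF f]
note s = sub_obj[OF S A] and t = sub_obj[OF T B]
have c: "a : car S" if "a : A" for a using A that unfolding is_sub_def by blast
show ?P
 by (rule arr_hom[OF s(1) t(1)]) (simp_all add: s(2-6) t(2-6) AB c fn_pl[OF f] fn_sm[OF f] fn_ac[OF f])
show "fn (arr (sub S A) (fn f) (sub T B)) a = fn f a" if "a : A" using that by (simp add: fn_arr s(2))
qed

definition "ker S e = {a : car S. fn e a = zr (Cod C e)}"

lemma ker_is_sub:
 assumes e: "e : Hom C S T"
 shows "is_sub S (ker S e)"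
 unfolding is_sub_def ker_def hom_Cod[OF e]
 using hom_dom_obj[OF e] hom_cod_obj[OF e]
 by (auto simp: zr_closed pl_closed sm_closed ac_closed fn_zr[OF e] fn_pl[OF e] fn_sm[OF e] fn_ac[OF e] pl_zr sm_zr ac_zr)

end

subsection \<open>Degrees of composites\<close>

locale rep_degree = rep_category G C emb mk + degree_function C \<delta>
 for G :: "('g, 'm) monoid_scheme"
  and C :: "('o, 'o \<times> ('u => 'u) \<times> 'o) cat" (structure)
  and emb :: "'o => ('f::{field, finite}, 'g, 'u) rep"
  and mk :: "('f, 'g, 'u) rep => 'o"
  and \<delta> :: "'o \<times> ('u => 'u) \<times> 'o => 'k::field"
begin

text \<open>A degree function is determined by its values on the arrows to the terminal object: by
  \<open>\<delta>_eq_deg_ker\<close> the degree of an epimorphism is \<open>deg\<close> of its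
  kernel. For \<open>deg_Vect t\<close> this number is t to the dimension.\<close>

definition "deg S = \<delta> (arr S (%_. zr (terminal_obj C)) (terminal_obj C))"

lemma terminal_obj: "terminal_obj C : Obj C" "car (terminal_obj C) = {zr (terminal_obj C)}"
proof -
have "is_terminal C (terminal_obj C)" unfolding terminal_obj_def by (rule someI_ex[OF terminal_exists])
then show "terminal_obj C : Obj C" "car (terminal_obj C) = {zr (terminal_obj C)}"
 unfolding terminal_iff by auto
qed

text \<open>Both projections of a pullback of two identities may be taken to be \<open>i\<close>,
  and degrees are invariant under base change.\<close>

lemma \<delta>_iso:
 assumes i: "i : Hom C S T" and bij: "bij_betw (fn i) (car S) (car T)"
 shows "\<delta> i = 1"
proof -
note T = hom_cod_obj[OF i] and id = ident_hom[OF hom_cod_obj[OF i]]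
have "pb_rel T T (Ident C T) (Ident C T) = (%a. (a, a)) ` car T"
 unfolding pb_rel_def by (auto simp: fn_ident)
moreover have "bij_betw (%w. (fn i w, fn i w)) (car S) ((%a. (a, a)) ` car T)"
 using bij unfolding bij_betw_def by (auto simp: inj_on_def)
ultimately have "is_pullback C (Ident C T) (Ident C T) i i"
 using pullbackI[OF id id i i] by simp
moreover have "is_epi C (Ident C T)"
 unfolding epi_iff[OF id] by (simp add: fn_ident)
ultimately show ?thesis using degree_pullback degree_ident[OF T] by metis
qed

lemma deg_epi:
 assumes e: "e : Hom C S T" and surj: "fn e ` car S = car T"
 shows "deg S = \<delta> e * deg T"
proof -
let ?Z = "terminal_obj C"
note S = hom_dom_obj[OF e] and T = hom_cod_obj[OF e]
let ?s = "arr S (%_. zr ?Z) ?Z" and ?t = "arr T (%_. zr ?Z) ?Z"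
note s = zero_arr[OF S terminal_obj(1)] and t = zero_arr[OF T terminal_obj(1)]
have "?t \<cdot> e = ?s"
 by (rule hom_eqI[OF comp_hom[OF e t] s]) (simp add: fn_comp[OF e t] fn_arr fn_closed[OF e])
moreover have "is_epi C ?t"
 unfolding epi_iff[OF t] terminal_obj(2) using zr_closed[OF T] by (auto simp: fn_arr image_iff)
moreover have "is_epi C e" using surj epi_iff[OF e] by simp
ultimately show ?thesis
 using degree_comp[of e ?t] hom_Cod[OF e] hom_Dom[OF t] by (simp add: deg_def mult.commute)
qed

lemma deg_iso:
 assumes "i : Hom C S T" "bij_betw (fn i) (car S) (car T)"
 shows "deg S = deg T"
 using deg_epi[OF assms(1)] \<delta>_iso[OF assms] assms(2) by (simp add: bij_betw_def)

text \<open>The kernel is the pullback of \<open>e\<close> along the zero arrow from the terminal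
  object, and the second projection is its arrow to the terminal object, so invariance under
  pullback equates the two degrees.\<close>

lemma \<delta>_eq_deg_ker:
 assumes e: "e : Hom C S T" and surj: "fn e ` car S = car T"
 shows "\<delta> e = deg (sub S (ker S e))"
proof -
let ?Z = "terminal_obj C" and ?K = "ker S e"
note S = hom_dom_obj[OF e] and T = hom_cod_obj[OF e]
note K = ker_is_sub[OF e]
let ?s = "arr (sub S ?K) (%_. zr ?Z) ?Z" and ?t = "arr ?Z (%_. zr T) T"
note s = zero_arr[OF sub_obj(1)[OF S K] terminal_obj(1)] and t = zero_arr[OF terminal_obj(1) T]
note i = incl_hom[OF S K]
have fns: "fn (incl S ?K) a = a" "fn ?s a = zr ?Z" if "a : ?K" for a
 using that by (simp_all add: fn_incl[OF S K] fn_arr sub_obj(2)[OF S K])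
have Z: "b : car ?Z \<longleftrightarrow> b = zr ?Z" for b using terminal_obj(2) by blast
have "fn ?t (zr ?Z) = zr T" by (simp add: fn_arr Z)
then have pb: "pb_rel S ?Z e ?t = (%a. (a, zr ?Z)) ` ?K"
 unfolding pb_rel_def ker_def hom_Cod[OF e] Z by auto
have "bij_betw (%w. (fn (incl S ?K) w, fn ?s w)) (car (sub S ?K)) (pb_rel S ?Z e ?t)"
 unfolding sub_obj(2)[OF S K] pb bij_betw_def inj_on_def by (simp add: fns cong: image_cong)
from pullbackI[OF e t i s this] have "is_pullback C e ?t (incl S ?K) ?s" .
moreover have "is_epi C e" using surj epi_iff[OF e] by simp
ultimately show ?thesis using degree_pullback by (simp add: deg_def)
qed

lemma deg_ker_image:
 assumes f: "f : Hom C S T"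
 shows "deg S = deg (sub S (ker S f)) * deg (sub T (fn f ` car S))"
proof -
note S = hom_dom_obj[OF f] and T = hom_cod_obj[OF f]
note I = image_is_sub[OF f]
let ?e = "arr S (fn f) (sub T (fn f ` car S))"
have e: "?e : Hom C S (sub T (fn f ` car S))"
 by (rule arr_hom[OF S sub_obj(1)[OF T I]]) (auto simp: sub_obj[OF T I] fn_pl[OF f] fn_sm[OF f] fn_ac[OF f])
have surj: "fn ?e ` car S = car (sub T (fn f ` car S))"
 unfolding sub_obj(2)[OF T I] by (auto simp: fn_arr)
have "ker S ?e = ker S f"
 unfolding ker_def hom_Cod[OF e] hom_Cod[OF f] sub_obj(3)[OF T I] by (auto simp: fn_arr)
then show ?thesis using deg_epi[OF e surj] \<delta>_eq_deg_ker[OF e surj] by simp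
qed

lemma deg_sub_iso:
 assumes f: "f : Hom C S T" and A: "is_sub S A" and B: "is_sub T B" and bij: "bij_betw (fn f) A B"
 shows "deg (sub S A) = deg (sub T B)"
proof -
note r = restrict_hom[OF f A B bij_betwE[OF bij, rule_format]]
have "bij_betw (fn (arr (sub S A) (fn f) (sub T B))) A B"
 using bij by (rule bij_betw_cong[THEN iffD1, rotated]) (simp add: r(2))
then show ?thesis
 using deg_iso[OF r(1)] sub_obj(2)[OF hom_dom_obj[OF f] A] sub_obj(2)[OF hom_cod_obj[OF f] B] by simp
qed

lemma zero_is_sub: "S : Obj C ==> is_sub S {zr S}"
 by (simp add: is_sub_def zr_closed pl_zr sm_zr ac_zr)

lemma deg_zero:
 assumes "S : Obj C"
 shows "deg (sub S {zr S}) = 1"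
proof -
let ?Z = "terminal_obj C" and ?S = "sub S {zr S}"
note z = zero_is_sub[OF assms]
have "bij_betw (fn (arr ?S (%_. zr ?Z) ?Z)) (car ?S) (car ?Z)"
 unfolding terminal_obj(2) sub_obj(2)[OF assms z] bij_betw_def by (auto simp: fn_arr sub_obj(2)[OF assms z])
from \<delta>_iso[OF zero_arr[OF sub_obj(1)[OF assms z] terminal_obj(1)] this] show ?thesis by (simp add: deg_def)
qed

text \<open>Computes the degree of the object \<open>M\<close> in two ways, along its two projections.\<close>

lemma deg_rel:
 assumes y: "y : Obj C" and z: "z : Obj C" and M: "is_rel y z M"
 shows "deg (sub y {b. (b, zr z) : M}) * deg (sub z (Range M)) = deg (sub z {c. (zr y, c) : M}) * deg (sub y (Domain M))" (is ?P)
  "is_sub y {b. (b, zr z) : M}" "is_sub z {c. (zr y, c) : M}" "is_sub y (Domain M)" "is_sub z (Range M)"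
proof -
obtain V p q where p: "p : Hom C V y" and q: "q : Hom C V z" and bij: "bij_betw (%w. (fn p w, fn q w)) (car V) M"
 by (rule rel_object[OF y z M])
have im: "M = (%w. (fn p w, fn q w)) ` car V" using bij by (simp add: bij_betw_def)
have inj: "inj_on (%w. (fn p w, fn q w)) (car V)" using bij by (simp add: bij_betw_def)
have DR: "fn p ` car V = Domain M" "fn q ` car V = Range M" unfolding im by auto
have M': "!!a b. (a, b) : M ==> a : car y & b : car z" using M by (auto simp: is_rel_def)
show s1: "is_sub y {b. (b, zr z) : M}"
 using M M' unfolding is_sub_def is_rel_def by (auto simp: subset_iff) (metis pl_zr z zr_closed, metis sm_zr z, metis ac_zr z)
show s2: "is_sub z {c. (zr y, c) : M}"
 using M M' unfolding is_sub_def is_rel_def by (auto simp: subset_iff) (metis pl_zr y zr_closed, metis sm_zr y, metis ac_zr y)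
show "is_sub y (Domain M)" "is_sub z (Range M)" using image_is_sub[OF p] image_is_sub[OF q] DR by simp_all
have "bij_betw (fn p) (ker V q) {b. (b, zr z) : M}"
 unfolding bij_betw_def
proof
 show "inj_on (fn p) (ker V q)" using inj unfolding ker_def inj_on_def hom_Cod[OF q] by auto
 show "fn p ` ker V q = {b. (b, zr z) : M}" unfolding im ker_def hom_Cod[OF q] by (auto simp: image_iff)
qed
note 1 = deg_sub_iso[OF p ker_is_sub[OF q] s1 this]
have "bij_betw (fn q) (ker V p) {c. (zr y, c) : M}"
 unfolding bij_betw_def
proof
 show "inj_on (fn q) (ker V p)" using inj unfolding ker_def inj_on_def hom_Cod[OF p] by auto
 show "fn q ` ker V p = {c. (zr y, c) : M}" unfolding im ker_def hom_Cod[OF p] by (auto simp: image_iff) metis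
qed
note 2 = deg_sub_iso[OF q ker_is_sub[OF p] s2 this]
show ?P
 using deg_ker_image[OF p] deg_ker_image[OF q] 1 2 DR by simp
qed

text \<open>The first projection maps the product of \<open>A\<close> and \<open>B\<close> onto
  \<open>A\<close>, with a kernel that the second projection identifies with
  \<open>B\<close>.\<close>

lemma deg_product:
 assumes y: "y : Obj C" and z: "z : Obj C" and A: "is_sub y A" and B: "is_sub z B"
 shows "deg (sub (PC y z) {u : car (PC y z). pi1 y z u : A & pi2 y z u : B}) = deg (sub y A) * deg (sub z B)"
  "is_sub (PC y z) {u : car (PC y z). pi1 y z u : A & pi2 y z u : B}"
proof -
note p = pr_hom[OF y z]
let ?D = "{u : car (PC y z). pi1 y z u : A & pi2 y z u : B}"
show D: "is_sub (PC y z) ?D"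
 using A B p(4) unfolding is_sub_def
 by (auto simp: zr_closed pl_closed sm_closed ac_closed fn_zr[OF p(1)] fn_zr[OF p(2)] fn_pl[OF p(1)] fn_pl[OF p(2)]
   fn_sm[OF p(1)] fn_sm[OF p(2)] fn_ac[OF p(1)] fn_ac[OF p(2)])
have AB: "!!a. a : A ==> a : car y" "!!b. b : B ==> b : car z" using A B by (auto simp: is_sub_def)
let ?f = "pr1 C y z \<cdot> incl (PC y z) ?D"
note i = incl_hom[OF p(4) D]
note f = comp_hom[OF i p(1)]
have fn_f: "fn ?f u = pi1 y z u" if "u : ?D" for u
 using that fn_comp[OF i p(1)] by (simp add: sub_obj(2)[OF p(4) D] fn_incl[OF p(4) D])
have im: "fn ?f ` car (sub (PC y z) ?D) = A"
proof -
 have "fn ?f ` car (sub (PC y z) ?D) = pi1 y z ` ?D" unfolding sub_obj(2)[OF p(4) D] by (rule image_cong[OF refl fn_f])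
 also have "... = A"
 proof (intro equalityI subsetI)
  fix a assume a: "a : A"
  obtain u where "u : car (PC y z)" "pi1 y z u = a" "pi2 y z u = zr z"
   using pr_surj[OF y z AB(1)[OF a] zr_closed[OF z]] by blast
  then show "a : pi1 y z ` ?D" using a B by (intro image_eqI[of _ _ u]) (auto simp: is_sub_def)
 qed auto
 finally show ?thesis .
qed
let ?g = "pr2 C y z \<cdot> incl (PC y z) ?D"
note g = comp_hom[OF i p(2)]
have fn_g: "fn ?g u = pi2 y z u" if "u : ?D" for u
 using that fn_comp[OF i p(2)] by (simp add: sub_obj(2)[OF p(4) D] fn_incl[OF p(4) D])
have ker_f: "ker (sub (PC y z) ?D) ?f = {u : ?D. pi1 y z u = zr y}"
 unfolding ker_def hom_Cod[OF f] sub_obj(2)[OF p(4) D] using fn_f by auto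
have "bij_betw (fn ?g) {u : ?D. pi1 y z u = zr y} B"
 unfolding bij_betw_def
proof (intro conjI equalityI subsetI)
 show "inj_on (fn ?g) {u : ?D. pi1 y z u = zr y}"
  using pr_inj[OF y z] fn_g by (auto simp: inj_on_def)
 show "b : B" if "b : fn ?g ` {u : ?D. pi1 y z u = zr y}" for b using that fn_g by auto
 fix b assume b: "b : B"
 obtain u where u: "u : car (PC y z)" "pi1 y z u = zr y" "pi2 y z u = b"
  using pr_surj[OF y z zr_closed[OF y] AB(2)[OF b]] by blast
 then have "u : ?D" using b A by (auto simp: is_sub_def)
 then show "b : fn ?g ` {u : ?D. pi1 y z u = zr y}" using fn_g u by (intro image_eqI[of _ _ u]) auto
qed
then have "deg (sub (sub (PC y z) ?D) (ker (sub (PC y z) ?D) ?f)) = deg (sub z B)"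
 using deg_sub_iso[OF g ker_is_sub[OF f] B] ker_f by simp
then show "deg (sub (PC y z) ?D) = deg (sub y A) * deg (sub z B)"
 using deg_ker_image[OF f] im by (simp add: mult.commute)
qed

text \<open>The kernel of the epimorphism from the pullback of \<open>R\<close> and \<open>S\<close>
  to their composite: an element of the pullback over (0, 0) is given by its middle vector.\<close>

definition "nul x y z R S = {b. (zr x, b) : R & (b, zr z) : S}"
definition "wt x y z R S = deg (sub y (nul x y z R S))"

lemma nul_is_sub:
 assumes o: "x : Obj C" "y : Obj C" "z : Obj C" and R: "R : Rel x y" "S : Rel y z"
 shows "is_sub y (nul x y z R S)"
 unfolding is_sub_def nul_def
proof (intro conjI ballI allI subsetI; (elim CollectE conjE)?; (intro CollectI conjI)?)
show "b : car y" if "(zr x, b) : R" for b by (rule Rel_car(2)[OF R(1) that])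
show "(zr x, zr y) : R" "(zr y, zr z) : S" by (rule Rel_zr[OF R(1)] Rel_zr[OF R(2)])+
fix b assume b: "(zr x, b) : R" "(b, zr z) : S"
show "(zr x, sm y c b) : R" "(sm y c b, zr z) : S" for c
 using Rel_sm[OF R(1) b(1), of c] Rel_sm[OF R(2) b(2), of c] by (simp_all add: sm_zr o)
show "(zr x, ac y c b) : R" "(ac y c b, zr z) : S" if "c : carrier G" for c
 using Rel_ac[OF R(1) that b(1)] Rel_ac[OF R(2) that b(2)] by (simp_all add: ac_zr o that)
fix b' assume b': "(zr x, b') : R" "(b', zr z) : S"
show "(zr x, pl y b b') : R" "(pl y b b', zr z) : S"
 using Rel_pl[OF R(1) b(1) b'(1)] Rel_pl[OF R(2) b(2) b'(2)] by (simp_all add: pl_zr zr_closed o)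
qed

lemma Rel_comp:
 assumes R: "R : Rel x y" and S: "S : Rel y z"
 shows "R O S : Rel x z"
proof (rule RelI)
show "R O S <= car x \<times> car z" using Rel_car[OF R] Rel_car[OF S] by auto
show "(zr x, zr z) : R O S" by (rule relcompI[OF Rel_zr[OF R] Rel_zr[OF S]])
fix a c assume "(a, c) : R O S"
then obtain b where b: "(a, b) : R" "(b, c) : S" by auto
show "(sm x k a, sm z k c) : R O S" for k by (rule relcompI[OF Rel_sm[OF R b(1)] Rel_sm[OF S b(2)]])
show "(ac x k a, ac z k c) : R O S" if "k : carrier G" for k
 by (rule relcompI[OF Rel_ac[OF R that b(1)] Rel_ac[OF S that b(2)]])
fix a' c' assume "(a', c') : R O S"
then obtain b' where b': "(a', b') : R" "(b', c') : S" by auto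
show "(pl x a a', pl z c c') : R O S" by (rule relcompI[OF Rel_pl[OF R b(1) b'(1)] Rel_pl[OF S b(2) b'(2)]])
qed

text \<open>The 2-cocycle identity behind associativity. \<open>M\<close> collects the middle
  vectors of the chains 0 R b S c T 0; projecting it to \<open>z\<close> or to \<open>y\<close>
  factors its degree in the two ways that belong to the two bracketings.\<close>

lemma wt_assoc:
 assumes o: "x : Obj C" "y : Obj C" "z : Obj C" "u : Obj C" and R: "R : Rel x y" "S : Rel y z" "T : Rel z u"
 shows "wt x y z R S * wt x z u (R O S) T = wt y z u S T * wt x y u R (S O T)"
proof -
define M where "M = {(b, c). (zr x, b) : R & (b, c) : S & (c, zr u) : T}"
have "M : Rel y z"
proof (rule RelI)
 show "M <= car y \<times> car z" using Rel_car[OF R(2)] by (auto simp: M_def)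
 show "(zr y, zr z) : M" using Rel_zr[OF R(1)] Rel_zr[OF R(2)] Rel_zr[OF R(3)] by (simp add: M_def)
 fix b c assume "(b, c) : M"
 then have bc: "(zr x, b) : R" "(b, c) : S" "(c, zr u) : T" by (auto simp: M_def)
 show "(sm y k b, sm z k c) : M" for k
  using Rel_sm[OF R(1) bc(1), of k] Rel_sm[OF R(2) bc(2), of k] Rel_sm[OF R(3) bc(3), of k] by (simp add: M_def sm_zr o)
 show "(ac y k b, ac z k c) : M" if "k : carrier G" for k
  using Rel_ac[OF R(1) that bc(1)] Rel_ac[OF R(2) that bc(2)] Rel_ac[OF R(3) that bc(3)] by (simp add: M_def ac_zr o that)
 fix b' c' assume "(b', c') : M"
 then have bc': "(zr x, b') : R" "(b', c') : S" "(c', zr u) : T" by (auto simp: M_def)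
 show "(pl y b b', pl z c c') : M"
  using Rel_pl[OF R(1) bc(1) bc'(1)] Rel_pl[OF R(2) bc(2) bc'(2)] Rel_pl[OF R(3) bc(3) bc'(3)]
  by (simp add: M_def pl_zr zr_closed o)
qed
then have M: "is_rel y z M" by (simp add: Rel_def)
have z: "(zr z, zr u) : T" "(zr x, zr y) : R" by (rule Rel_zr[OF R(3)] Rel_zr[OF R(1)])+
have "{b. (b, zr z) : M} = nul x y z R S" "Range M = nul x z u (R O S) T"
 "{c. (zr y, c) : M} = nul y z u S T" "Domain M = nul x y u R (S O T)"
 using z by (auto simp: M_def nul_def)
then show ?thesis using deg_rel(1)[OF o(2,3) M] by (simp add: wt_def)
qed

text \<open>The \<open>nul\<close> of product relations is the product of the two
  \<open>nul\<close>, on which degrees multiply.\<close>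

lemma wt_tens:
 assumes o: "x : Obj C" "y : Obj C" "z : Obj C" "x' : Obj C" "y' : Obj C" "z' : Obj C"
  and R: "R : Rel x y" "S : Rel y z" "R' : Rel x' y'" "S' : Rel y' z'"
 shows "wt (PC x x') (PC y y') (PC z z') (trel x y x' y' R R') (trel y z y' z' S S') = wt x y z R S * wt x' y' z' R' S'"
proof -
have eq: "nul (PC x x') (PC y y') (PC z z') (trel x y x' y' R R') (trel y z y' z' S S')
 = {u : car (PC y y'). pi1 y y' u : nul x y z R S & pi2 y y' u : nul x' y' z' R' S'}"
 unfolding nul_def trel_def
 using zr_closed[OF pr_hom(4)[OF o(1,4)]] zr_closed[OF pr_hom(4)[OF o(3,6)]]
 by (auto simp: fn_zr[OF pr_hom(1)[OF o(1,4)]] fn_zr[OF pr_hom(2)[OF o(1,4)]]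
   fn_zr[OF pr_hom(1)[OF o(3,6)]] fn_zr[OF pr_hom(2)[OF o(3,6)]])
show ?thesis
 unfolding wt_def eq by (rule deg_product(1)[OF o(2,5) nul_is_sub[OF o(1,2,3) R(1,2)] nul_is_sub[OF o(4,5,6) R(3,4)]])
qed

lemma wt_one:
 assumes "x : Obj C" "y : Obj C" "z : Obj C" "R : Rel x y" "S : Rel y z"
  and "!!b. [|(zr x, b) : R; (b, zr z) : S|] ==> b = zr y"
 shows "wt x y z R S = 1"
proof -
have "nul x y z R S = {zr y}"
 unfolding nul_def using assms(6) Rel_zr[OF assms(4)] Rel_zr[OF assms(5)] by blast
then show ?thesis using deg_zero[OF assms(2)] by (simp add: wt_def)
qed

text \<open>Whatever representatives, pullback and image factorization are taken, the subobject and
  the degree are the same, so the choice in \<open>rel_comp\<close> is harmless.\<close>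

lemma is_star_iff:
 assumes o: "x : Obj C" "y : Obj C" "z : Obj C" and R: "R : Rel x y" "S : Rel y z"
 shows "is_star C x y z (sb x y R) (sb y z S) e t ==> t = sb x z (R O S) & \<delta> e = wt x y z R S"
  "EX e t. is_star C x y z (sb x y R) (sb y z S) e t" (is ?P)
proof -
note p = pr_hom(1,2)[OF o(1,2)] and q = pr_hom(1,2)[OF o(2,3)]
{
 fix m n a b assume m: "m : sb x y R" and n: "n : sb y z S"
  and pb: "is_pullback C (pr2 C x y \<cdot> m) (pr1 C y z \<cdot> n) a b"
 note dm = sbD[OF m] and dn = sbD[OF n]
 let ?V = "Dom C a"
 note c = comp_hom[OF dm(1) p(1)] comp_hom[OF dm(1) p(2)] comp_hom[OF dn(1) q(1)] comp_hom[OF dn(1) q(2)]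
 note ab = pullbackD[OF pb c(2,3)]
 note f = comp_hom[OF ab(1) c(1)] and g = comp_hom[OF ab(2) c(4)]
 let ?h = "pairing C (pr1 C x y \<cdot> m \<cdot> a) (pr2 C y z \<cdot> n \<cdot> b)"
 note h = pairing_hom(1)[OF f g]
 have "?h : Hom C ?V (PC x z)" by (rule h)
 note * = dm dn c ab f g this
} note * = this
show ?P
proof -
 obtain m n where m: "m : sb x y R" and n: "n : sb y z S" using sb_nonempty o R by metis
 note dm = sbD[OF m] and dn = sbD[OF n]
 obtain V a b where pb: "is_pullback C (pr2 C x y \<cdot> m) (pr1 C y z \<cdot> n) a b"
  by (rule pullback_ex[OF comp_hom[OF dm(1) p(2)] comp_hom[OF dn(1) q(1)]])
 obtain e \<mu> where "is_image_factorization C (pairing C (pr1 C x y \<cdot> m \<cdot> a) (pr2 C y z \<cdot> n \<cdot> b)) e \<mu>"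
  by (rule image_factorization_ex[OF *(16)[OF m n pb]])
 then show ?thesis unfolding is_star_def using m n pb by blast
qed
assume "is_star C x y z (sb x y R) (sb y z S) e t"
then obtain m n a b \<mu> where m: "m : sb x y R" and n: "n : sb y z S"
 and pb: "is_pullback C (pr2 C x y \<cdot> m) (pr1 C y z \<cdot> n) a b"
 and im: "is_image_factorization C (pairing C (pr1 C x y \<cdot> m \<cdot> a) (pr2 C y z \<cdot> n \<cdot> b)) e \<mu>"
 and t: "t = subobject C \<mu>"
 unfolding is_star_def by blast
note d = *[OF m n pb]
let ?V = "Dom C a"
let ?h = "pairing C (pr1 C x y \<cdot> m \<cdot> a) (pr2 C y z \<cdot> n \<cdot> b)"
note i = image_factorizationD[OF im d(16)]
have \<mu>_mono: "is_mono C \<mu>" using im by (simp add: is_image_factorization_def)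
have fns: "fn (pr1 C x y \<cdot> m \<cdot> a) v = pi1 x y (fn m (fn a v))" "fn (pr2 C y z \<cdot> n \<cdot> b) v = pi2 y z (fn n (fn b v))"
 "fn (pr2 C x y \<cdot> m) w = pi2 x y (fn m w)" "fn (pr1 C y z \<cdot> n) w' = pi1 y z (fn n w')"
 if "v : car ?V" "w : car (Dom C m)" "w' : car (Dom C n)" for v w w'
 using that fn_closed[OF d(11)] fn_closed[OF d(12)]
 by (simp_all add: fn_comp[OF d(11) comp_hom[OF d(1) p(1)]] fn_comp[OF d(12) comp_hom[OF d(4) q(2)]]
   fn_comp[OF d(1) p(1)] fn_comp[OF d(4) q(2)] fn_comp[OF d(1) p(2)] fn_comp[OF d(4) q(1)])
have fnh: "pi1 x z (fn ?h v) = pi1 x y (fn m (fn a v))" "pi2 x z (fn ?h v) = pi2 y z (fn n (fn b v))"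
 "pi2 x y (fn m (fn a v)) = pi1 y z (fn n (fn b v))" if v: "v : car ?V" for v
proof -
 note cl = fn_closed[OF d(11) v] fn_closed[OF d(12) v]
 show "pi1 x z (fn ?h v) = pi1 x y (fn m (fn a v))" "pi2 x z (fn ?h v) = pi2 y z (fn n (fn b v))"
  using pairing_fn[OF d(14,15) v] fns[OF v cl] by simp_all
 have "(fn a v, fn b v) : pb_rel (Dom C m) (Dom C n) (pr2 C x y \<cdot> m) (pr1 C y z \<cdot> n)"
  using bij_betwE[OF d(13)] v by blast
 then show "pi2 x y (fn m (fn a v)) = pi1 y z (fn n (fn b v))"
  using fns(3,4)[OF v cl] by (simp add: pb_rel_def)
qed
\<comment> \<open>Every composable pair comes from the pullback. This gives the whole composite
  relation and, for zero ends, all of \<open>nul\<close>.\<close>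
have V_ex: "EX v:car ?V. pi1 x y (fn m (fn a v)) = r & pi2 x y (fn m (fn a v)) = s & pi2 y z (fn n (fn b v)) = k"
 if "(r, s) : R" "(s, k) : S" for r s k
proof -
 obtain w where w: "w : car (Dom C m)" "r = pi1 x y (fn m w)" "s = pi2 x y (fn m w)"
  using \<open>(r, s) : R\<close> unfolding d(3) by auto
 obtain w' where w': "w' : car (Dom C n)" "s = pi1 y z (fn n w')" "k = pi2 y z (fn n w')"
  using \<open>(s, k) : S\<close> unfolding d(6) by auto
 have "(w, w') : pb_rel (Dom C m) (Dom C n) (pr2 C x y \<cdot> m) (pr1 C y z \<cdot> n)"
  using w w' zr_closed[OF hom_dom_obj[OF d(11)]] fns(3,4)[OF _ w(1) w'(1)] by (auto simp: pb_rel_def)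
 then obtain v where "v : car ?V" "fn a v = w" "fn b v = w'"
  unfolding bij_betw_imp_surj_on[OF d(13), symmetric] by auto
 then show ?thesis using w w' by blast
qed
have mem: "(pi1 x y (fn m (fn a v)), pi2 x y (fn m (fn a v))) : R" "(pi1 y z (fn n (fn b v)), pi2 y z (fn n (fn b v))) : S"
 if "v : car ?V" for v
 unfolding d(3) d(6) using fn_closed[OF d(11) that] fn_closed[OF d(12) that] by blast+
have "relm x z \<mu> = (%w. (pi1 x z w, pi2 x z w)) ` (fn \<mu> ` car (Dom C \<mu>))"
 unfolding relm_def by auto
also have "... = (%v. (pi1 x y (fn m (fn a v)), pi2 y z (fn n (fn b v)))) ` car ?V"
 unfolding i(6) image_image using fnh by (intro image_cong) auto
also have "... = R O S"
proof (intro equalityI subsetI)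
 fix t assume "t : (%v. (pi1 x y (fn m (fn a v)), pi2 y z (fn n (fn b v)))) ` car ?V"
 then obtain v where "v : car ?V" "t = (pi1 x y (fn m (fn a v)), pi2 y z (fn n (fn b v)))" by blast
 then show "t : R O S" using mem[of v] fnh(3)[of v] by auto
next
 fix t assume "t : R O S"
 then obtain r s k where "t = (r, k)" "(r, s) : R" "(s, k) : S" by auto
 then show "t : (%v. (pi1 x y (fn m (fn a v)), pi2 y z (fn n (fn b v)))) ` car ?V" using V_ex by force
qed
finally have "t = sb x z (R O S)" using subobject_eq_sb[OF o(1,3) i(2) \<mu>_mono] t by simp
moreover have "\<delta> e = wt x y z R S"
proof -
 \<comment> \<open>Since \<open>\<mu>\<close> is injective, \<open>e\<close> vanishes exactly where
   both outer components vanish.\<close>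
 have ker: "ker ?V e = {v : car ?V. pi1 x y (fn m (fn a v)) = zr x & pi2 y z (fn n (fn b v)) = zr z}"
 proof -
  have "fn e v = zr (Dom C \<mu>) \<longleftrightarrow> pi1 x y (fn m (fn a v)) = zr x & pi2 y z (fn n (fn b v)) = zr z" if v: "v : car ?V" for v
  proof -
   have "fn e v = zr (Dom C \<mu>) \<longleftrightarrow> fn \<mu> (fn e v) = zr (PC x z)"
    using inj_on_eq_iff[OF i(4) fn_closed[OF i(1) v] zr_closed[OF hom_dom_obj[OF i(2)]]] fn_zr[OF i(2)] by simp
   also have "... \<longleftrightarrow> fn ?h v = zr (PC x z)" using i(5)[OF v] by simp
   also have "... \<longleftrightarrow> pi1 x z (fn ?h v) = zr x & pi2 x z (fn ?h v) = zr z"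
    using pr_inj[OF o(1,3) fn_closed[OF d(16) v] zr_closed[OF pr_hom(4)[OF o(1,3)]]]
     fn_zr[OF pr_hom(1)[OF o(1,3)]] fn_zr[OF pr_hom(2)[OF o(1,3)]] by auto
   finally show ?thesis using fnh[OF v] by simp
  qed
  then show ?thesis unfolding ker_def hom_Cod[OF i(1)] by auto
 qed
 \<comment> \<open>The arrow to the middle vector, which identifies the kernel of \<open>e\<close>
   with \<open>nul\<close>.\<close>
 let ?g = "pr2 C x y \<cdot> m \<cdot> a"
 note g = comp_hom[OF d(11) comp_hom[OF d(1) p(2)]]
 have fng: "fn ?g v = pi2 x y (fn m (fn a v))" if "v : car ?V" for v
  using fn_comp[OF d(11) comp_hom[OF d(1) p(2)] that] fn_comp[OF d(1) p(2) fn_closed[OF d(11) that]] by simp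
 have "bij_betw (fn ?g) (ker ?V e) (nul x y z R S)"
  unfolding bij_betw_def
 proof
  show "inj_on (fn ?g) (ker ?V e)"
  proof (rule inj_onI)
   fix v v' assume "v : ker ?V e" "v' : ker ?V e" and eq: "fn ?g v = fn ?g v'"
   then have v: "v : car ?V" "v' : car ?V" and k: "pi1 x y (fn m (fn a v)) = pi1 x y (fn m (fn a v'))"
    "pi2 y z (fn n (fn b v)) = pi2 y z (fn n (fn b v'))" unfolding ker by auto
   note cl = fn_closed[OF d(11) v(1)] fn_closed[OF d(11) v(2)] fn_closed[OF d(12) v(1)] fn_closed[OF d(12) v(2)]
   have "fn m (fn a v) = fn m (fn a v')"
    by (rule pr_inj[OF o(1,2) fn_closed[OF d(1) cl(1)] fn_closed[OF d(1) cl(2)]]) (use k eq fng v in auto)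
   then have "fn a v = fn a v'" using inj_onD[OF d(2) _ cl(1,2)] by blast
   moreover have "fn n (fn b v) = fn n (fn b v')"
    by (rule pr_inj[OF o(2,3) fn_closed[OF d(4) cl(3)] fn_closed[OF d(4) cl(4)]]) (use k eq fng fnh(3) v in auto)
   then have "fn b v = fn b v'" using inj_onD[OF d(5) _ cl(3,4)] by blast
   ultimately show "v = v'" using inj_onD[OF bij_betw_imp_inj_on[OF d(13)] _ v] by simp
  qed
  show "fn ?g ` ker ?V e = nul x y z R S"
  proof (intro equalityI subsetI)
   fix s assume "s : fn ?g ` ker ?V e"
   then obtain v where "v : car ?V" "s = pi2 x y (fn m (fn a v))" "pi1 x y (fn m (fn a v)) = zr x" "pi2 y z (fn n (fn b v)) = zr z"
    unfolding ker using fng by auto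
   then show "s : nul x y z R S" using mem[of v] fnh(3)[of v] by (simp add: nul_def)
  next
   fix s assume "s : nul x y z R S"
   then obtain v where v: "v : car ?V" "pi1 x y (fn m (fn a v)) = zr x" "pi2 x y (fn m (fn a v)) = s" "pi2 y z (fn n (fn b v)) = zr z"
    using V_ex[of "zr x" s "zr z"] by (auto simp: nul_def)
   then show "s : fn ?g ` ker ?V e" unfolding ker using fng by (intro image_eqI[of _ _ v]) auto
  qed
 qed
 from deg_sub_iso[OF g ker_is_sub[OF i(1)] nul_is_sub[OF o R] this] show ?thesis
  unfolding wt_def using \<delta>_eq_deg_ker[OF i(1,3)] by simp
qed
ultimately show "t = sb x z (R O S) & \<delta> e = wt x y z R S" by blast
qed

lemma rel_comp_eq:
 assumes "x : Obj C" "y : Obj C" "z : Obj C" "R : Rel x y" "S : Rel y z"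
 shows "rel_comp C \<delta> x y z (sb y z S) (sb x y R) = Poly_Mapping.single (sb x z (R O S)) (wt x y z R S)"
proof -
note ex = is_star_iff(2)[OF assms]
then have "case (SOME (e, t). is_star C x y z (sb x y R) (sb y z S) e t) of (e, t) => is_star C x y z (sb x y R) (sb y z S) e t"
 by (intro someI_ex[of "%(e, t). is_star C x y z (sb x y R) (sb y z S) e t"]) auto
then show ?thesis
 using ex is_star_iff(1)[OF assms] unfolding rel_comp_def by (auto simp: split_beta Let_def)
qed

end

section \<open>The category of relations\<close>

lemma sum_keys_superset:
 assumes "finite A" "Poly_Mapping.keys \<phi> <= A" "!!r. g r 0 = 0"
 shows "(\<Sum>r\<in>Poly_Mapping.keys \<phi>. g r (Poly_Mapping.lookup \<phi> r)) = (\<Sum>r\<in>A. g r (Poly_Mapping.lookup \<phi> r))"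
 by (rule sum.mono_neutral_left) (use assms in "auto simp: in_keys_iff")

text \<open>The support of a sum may shrink by cancellation; extending all three sums by zeros to
  the union of the two supports repairs this.\<close>

lemma sum_keys_add:
 assumes "!!r. g r 0 = 0" "!!r c d. g r (c + d) = g r c + g r d"
 shows "(\<Sum>r\<in>Poly_Mapping.keys (\<phi> + \<psi>). g r (Poly_Mapping.lookup (\<phi> + \<psi>) r))
  = (\<Sum>r\<in>Poly_Mapping.keys \<phi>. g r (Poly_Mapping.lookup \<phi> r)) + (\<Sum>r\<in>Poly_Mapping.keys \<psi>. g r (Poly_Mapping.lookup \<psi> r))"
proof -
let ?A = "Poly_Mapping.keys \<phi> \<union> Poly_Mapping.keys \<psi>"
have A: "finite ?A" "Poly_Mapping.keys (\<phi> + \<psi>) <= ?A" "Poly_Mapping.keys \<phi> <= ?A" "Poly_Mapping.keys \<psi> <= ?A"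
 using Poly_Mapping.keys_add[of \<phi> \<psi>] by auto
show ?thesis
 unfolding sum_keys_superset[of _ _ g, OF A(1,2) assms(1)] sum_keys_superset[of _ _ g, OF A(1,3) assms(1)]
  sum_keys_superset[of _ _ g, OF A(1,4) assms(1)]
 by (simp add: lookup_add assms(2) sum.distrib)
qed

lemma sum_keys_single:
 "g k 0 = 0 ==> (\<Sum>r\<in>Poly_Mapping.keys (Poly_Mapping.single k c). g r (Poly_Mapping.lookup (Poly_Mapping.single k c) r)) = g k c"
 by (cases "c = 0") auto

lemma poly_mapping_basis_induct [consumes 1, case_names zero single add]:
 fixes \<phi> :: "'b \<Rightarrow>\<^sub>0 'k::comm_monoid_add"
 assumes "Poly_Mapping.keys \<phi> <= A" and "P 0" and "!!r c. r : A ==> P (Poly_Mapping.single r c)"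
  and "!!\<phi> \<psi>. [|P \<phi>; P \<psi>|] ==> P (\<phi> + \<psi>)"
 shows "P \<phi>"
proof -
have "P (\<Sum>k\<in>B. Poly_Mapping.single k (Poly_Mapping.lookup \<phi> k))" if "B <= A" for B
 using that by (induction B rule: infinite_finite_induct) (auto intro: assms)
moreover have "(\<Sum>k\<in>Poly_Mapping.keys \<phi>. Poly_Mapping.single k (Poly_Mapping.lookup \<phi> k)) = \<phi>"
 by (rule poly_mapping_eqI) (simp add: lookup_sum lookup_single when_def in_keys_iff)
ultimately show ?thesis using assms(1) by metis
qed

lemma lookup_pscale: "Poly_Mapping.lookup (pscale c \<phi>) k = c * Poly_Mapping.lookup \<phi> k"
 by (simp add: pscale_def Poly_Mapping.map.rep_eq when_def)

lemma pscale_simps: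
 "pscale (c + d) \<phi> = pscale c \<phi> + pscale d \<phi>" "pscale c (\<phi> + \<psi>) = pscale c \<phi> + pscale c \<psi>"
 "pscale 0 \<phi> = 0" "pscale c 0 = 0" "pscale c (Poly_Mapping.single k d) = Poly_Mapping.single k (c * d)"
 by (rule poly_mapping_eqI; simp add: lookup_pscale lookup_add algebra_simps lookup_single when_def)+

definition "rel_cmp C \<delta> x y z \<psi> \<phi> = (\<Sum>r\<in>Poly_Mapping.keys \<phi>. \<Sum>s\<in>Poly_Mapping.keys \<psi>.
 pscale (Poly_Mapping.lookup \<psi> s * Poly_Mapping.lookup \<phi> r) (rel_comp C \<delta> x y z s r))"

definition rel_tns :: "('o, 'a, 'z) cat_scheme => 'o => 'o => 'o => 'o => ('a set \<Rightarrow>\<^sub>0 'k::field)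
 => ('a set \<Rightarrow>\<^sub>0 'k) => ('a set \<Rightarrow>\<^sub>0 'k)" where
 "rel_tns C x y x' y' \<phi> \<phi>' = (\<Sum>r\<in>Poly_Mapping.keys \<phi>. \<Sum>r'\<in>Poly_Mapping.keys \<phi>'.
 Poly_Mapping.single (rel_tens C x y x' y' r r') (Poly_Mapping.lookup \<phi> r * Poly_Mapping.lookup \<phi>' r'))"

lemma T0_comp_eq: "T0_comp C \<delta> (y', \<psi>, z) (x, \<phi>, y) = (x, rel_cmp C \<delta> x y z \<psi> \<phi>, z)"
 by (simp add: T0_comp_def rel_cmp_def)

lemma T0_tens_eq: "T0_tens C (x, \<phi>, y) (x', \<phi>', y') = (prod_obj C x x', rel_tns C x y x' y' \<phi> \<phi>', prod_obj C y y')"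
 by (simp add: T0_tens_def rel_tns_def)

lemma rel_cmp_simps:
 "rel_cmp C \<delta> x y z (\<psi> + \<psi>') \<phi> = rel_cmp C \<delta> x y z \<psi> \<phi> + rel_cmp C \<delta> x y z \<psi>' \<phi>"
 "rel_cmp C \<delta> x y z \<psi> (\<phi> + \<phi>') = rel_cmp C \<delta> x y z \<psi> \<phi> + rel_cmp C \<delta> x y z \<psi> \<phi>'"
 "rel_cmp C \<delta> x y z 0 \<phi> = 0" "rel_cmp C \<delta> x y z \<psi> 0 = 0"
 "rel_cmp C \<delta> x y z (Poly_Mapping.single s d) (Poly_Mapping.single r c) = pscale (d * c) (rel_comp C \<delta> x y z s r)"
proof -
show "rel_cmp C \<delta> x y z (\<psi> + \<psi>') \<phi> = rel_cmp C \<delta> x y z \<psi> \<phi> + rel_cmp C \<delta> x y z \<psi>' \<phi>"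
 unfolding rel_cmp_def sum.distrib[symmetric]
 by (rule sum.cong[OF refl], rule sum_keys_add[of "%s c. pscale (c * Poly_Mapping.lookup \<phi> _) (rel_comp C \<delta> x y z s _)"])
  (simp_all add: pscale_simps distrib_right)
show "rel_cmp C \<delta> x y z \<psi> (\<phi> + \<phi>') = rel_cmp C \<delta> x y z \<psi> \<phi> + rel_cmp C \<delta> x y z \<psi> \<phi>'"
 unfolding rel_cmp_def
 by (rule sum_keys_add[of "%r c. \<Sum>s\<in>Poly_Mapping.keys \<psi>. pscale (Poly_Mapping.lookup \<psi> s * c) (rel_comp C \<delta> x y z s r)"])
  (simp_all add: pscale_simps distrib_left sum.distrib)
show "rel_cmp C \<delta> x y z (Poly_Mapping.single s d) (Poly_Mapping.single r c) = pscale (d * c) (rel_comp C \<delta> x y z s r)"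
 unfolding rel_cmp_def
 by (cases "c = 0"; cases "d = 0") (simp_all add: pscale_simps)
qed (simp_all add: rel_cmp_def)

lemma rel_tns_simps:
 "rel_tns C x y x' y' (\<phi> + \<psi>) \<phi>' = rel_tns C x y x' y' \<phi> \<phi>' + rel_tns C x y x' y' \<psi> \<phi>'"
 "rel_tns C x y x' y' \<phi> (\<phi>' + \<psi>') = rel_tns C x y x' y' \<phi> \<phi>' + rel_tns C x y x' y' \<phi> \<psi>'"
 "rel_tns C x y x' y' 0 \<phi>' = 0" "rel_tns C x y x' y' \<phi> 0 = 0"
 "rel_tns C x y x' y' (Poly_Mapping.single r c) (Poly_Mapping.single r' d) = Poly_Mapping.single (rel_tens C x y x' y' r r') (c * d)"
proof -
show "rel_tns C x y x' y' (\<phi> + \<psi>) \<phi>' = rel_tns C x y x' y' \<phi> \<phi>' + rel_tns C x y x' y' \<psi> \<phi>'"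
 unfolding rel_tns_def
 by (rule sum_keys_add[of "%r c. \<Sum>r'\<in>Poly_Mapping.keys \<phi>'. Poly_Mapping.single (rel_tens C x y x' y' r r') (c * Poly_Mapping.lookup \<phi>' r')"])
  (simp_all add: distrib_right sum.distrib single_add)
show "rel_tns C x y x' y' \<phi> (\<phi>' + \<psi>') = rel_tns C x y x' y' \<phi> \<phi>' + rel_tns C x y x' y' \<phi> \<psi>'"
 unfolding rel_tns_def sum.distrib[symmetric]
 by (rule sum.cong[OF refl], rule sum_keys_add[of "%r' c. Poly_Mapping.single (rel_tens C x y x' y' _ r') (Poly_Mapping.lookup \<phi> _ * c)"])
  (simp_all add: distrib_left single_add)
show "rel_tns C x y x' y' (Poly_Mapping.single r c) (Poly_Mapping.single r' d) = Poly_Mapping.single (rel_tens C x y x' y' r r') (c * d)"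
 unfolding rel_tns_def
 by (cases "c = 0"; cases "d = 0") simp_all
qed (simp_all add: rel_tns_def)

context rep_degree
begin

abbreviation "cmp \<equiv> rel_cmp C \<delta>"
abbreviation "tns \<equiv> rel_tns C"
abbreviation "bas x y R c \<equiv> Poly_Mapping.single (sb x y R) (c :: 'k)"

definition H :: "'o => 'o => (('o \<times> ('u => 'u) \<times> 'o) set \<Rightarrow>\<^sub>0 'k) set" where
 "H x y = {\<phi>. Poly_Mapping.keys \<phi> <= sb x y ` Rel x y}"

text \<open>The laws of the category of relations are multilinear in their arrows, so this principle
  reduces them to single relations with one coefficient each.\<close>

lemma H_induct [consumes 1, case_names zero single add]:
 assumes "\<phi> : H x y" "P 0" "!!R c. R : Rel x y ==> P (bas x y R c)" "!!\<phi> \<psi>. [|P \<phi>; P \<psi>|] ==> P (\<phi> + \<psi>)"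
 shows "P \<phi>"
proof -
have "Poly_Mapping.keys \<phi> <= sb x y ` Rel x y" using assms(1) by (simp add: H_def)
then show ?thesis by (induction rule: poly_mapping_basis_induct) (use assms(2-4) in blast)+
qed

lemma H_zero: "0 : H x y" by (simp add: H_def)
lemma H_bas: "R : Rel x y ==> bas x y R c : H x y" by (simp add: H_def)
lemma H_add: "[|\<phi> : H x y; \<psi> : H x y|] ==> \<phi> + \<psi> : H x y"
 unfolding H_def using Poly_Mapping.keys_add[of \<phi> \<psi>] by blast

lemma cmp_bas:
 assumes "x : Obj C" "y : Obj C" "z : Obj C" "R : Rel x y" "S : Rel y z"
 shows "cmp x y z (bas y z S d) (bas x y R c) = bas x z (R O S) (d * c * wt x y z R S)"
 by (simp add: rel_cmp_simps rel_comp_eq[OF assms] pscale_simps)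

lemma tns_bas:
 assumes "x : Obj C" "y : Obj C" "x' : Obj C" "y' : Obj C" "R : Rel x y" "R' : Rel x' y'"
 shows "tns x y x' y' (bas x y R c) (bas x' y' R' d) = bas (PC x x') (PC y y') (trel x y x' y' R R') (c * d)"
 by (simp add: rel_tns_simps rel_tens_eq[OF assms])

lemma trel_Rel:
 assumes o: "x : Obj C" "y : Obj C" "x' : Obj C" "y' : Obj C" and R: "R : Rel x y" "R' : Rel x' y'"
 shows "trel x y x' y' R R' : Rel (PC x x') (PC y y')"
proof (rule RelI)
note p = pr_hom[OF o(1,3)] and q = pr_hom[OF o(2,4)]
note 0 = fn_zr[OF p(1)] fn_zr[OF p(2)] fn_zr[OF q(1)] fn_zr[OF q(2)]
show "trel x y x' y' R R' <= car (PC x x') \<times> car (PC y y')" by (auto simp: trel_def)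
show "(zr (PC x x'), zr (PC y y')) : trel x y x' y' R R'"
 using Rel_zr[OF R(1)] Rel_zr[OF R(2)] by (simp add: trel_def 0 zr_closed[OF p(4)] zr_closed[OF q(4)])
fix a b assume "(a, b) : trel x y x' y' R R'"
then have ab: "a : car (PC x x')" "b : car (PC y y')" "(pi1 x x' a, pi1 y y' b) : R" "(pi2 x x' a, pi2 y y' b) : R'"
 by (auto simp: trel_def)
show "(sm (PC x x') c a, sm (PC y y') c b) : trel x y x' y' R R'" for c
 using Rel_sm[OF R(1) ab(3), of c] Rel_sm[OF R(2) ab(4), of c] sm_closed[OF p(4) ab(1)] sm_closed[OF q(4) ab(2)]
 by (simp add: trel_def fn_sm[OF p(1) ab(1)] fn_sm[OF p(2) ab(1)] fn_sm[OF q(1) ab(2)] fn_sm[OF q(2) ab(2)])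
show "(ac (PC x x') c a, ac (PC y y') c b) : trel x y x' y' R R'" if c: "c : carrier G" for c
 using Rel_ac[OF R(1) c ab(3)] Rel_ac[OF R(2) c ab(4)] ac_closed[OF p(4) c ab(1)] ac_closed[OF q(4) c ab(2)]
 by (simp add: trel_def fn_ac[OF p(1) c ab(1)] fn_ac[OF p(2) c ab(1)] fn_ac[OF q(1) c ab(2)] fn_ac[OF q(2) c ab(2)])
fix a' b' assume "(a', b') : trel x y x' y' R R'"
then have ab': "a' : car (PC x x')" "b' : car (PC y y')" "(pi1 x x' a', pi1 y y' b') : R" "(pi2 x x' a', pi2 y y' b') : R'"
 by (auto simp: trel_def)
show "(pl (PC x x') a a', pl (PC y y') b b') : trel x y x' y' R R'"
 using Rel_pl[OF R(1) ab(3) ab'(3)] Rel_pl[OF R(2) ab(4) ab'(4)] pl_closed[OF p(4) ab(1) ab'(1)] pl_closed[OF q(4) ab(2) ab'(2)]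
 by (simp add: trel_def fn_pl[OF p(1) ab(1) ab'(1)] fn_pl[OF p(2) ab(1) ab'(1)]
   fn_pl[OF q(1) ab(2) ab'(2)] fn_pl[OF q(2) ab(2) ab'(2)])
qed

lemma cmp_H:
 assumes o: "x : Obj C" "y : Obj C" "z : Obj C" and "\<phi> : H x y" "\<psi> : H y z"
 shows "cmp x y z \<psi> \<phi> : H x z"
 using assms(4)
proof (induction rule: H_induct)
case (single R c)
note R = this
show ?case using assms(5)
proof (induction rule: H_induct)
 case (single S d)
 then show ?case using Rel_comp[OF R] R by (simp add: cmp_bas[OF o] H_bas)
qed (simp_all add: rel_cmp_simps H_zero H_add)
qed (simp_all add: rel_cmp_simps H_zero H_add)

lemma tns_H:
 assumes o: "x : Obj C" "y : Obj C" "x' : Obj C" "y' : Obj C" and "\<phi> : H x y" "\<phi>' : H x' y'"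
 shows "tns x y x' y' \<phi> \<phi>' : H (PC x x') (PC y y')"
 using assms(5)
proof (induction rule: H_induct)
case (single R c)
note R = this
show ?case using assms(6)
proof (induction rule: H_induct)
 case (single S d)
 then show ?case using trel_Rel[OF o] R by (simp add: tns_bas[OF o] H_bas)
qed (simp_all add: rel_tns_simps H_zero H_add)
qed (simp_all add: rel_tns_simps H_zero H_add)

text \<open>On single relations the composites agree by associativity of \<open>O\<close> and the
  coefficients by \<open>wt_assoc\<close>.\<close>

lemma cmp_assoc:
 assumes o: "w : Obj C" "x : Obj C" "y : Obj C" "z : Obj C" and "\<phi> : H w x" "\<psi> : H x y" "\<chi> : H y z"
 shows "cmp w x z (cmp x y z \<chi> \<psi>) \<phi> = cmp w y z \<chi> (cmp w x y \<psi> \<phi>)"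
 using assms(5)
proof (induction rule: H_induct)
case (single R c)
note R = this
show ?case using assms(6)
proof (induction rule: H_induct)
 case (single S d)
 note S = this
 show ?case using assms(7)
 proof (induction rule: H_induct)
  case (single T e)
  show ?case
   unfolding cmp_bas[OF o(2,3,4) S single] cmp_bas[OF o(1,2,3) R S] cmp_bas[OF o(1,2,4) R Rel_comp[OF S single]]
    cmp_bas[OF o(1,3,4) Rel_comp[OF R S] single]
   using wt_assoc[OF o R S single] by (simp add: O_assoc algebra_simps)
 qed (simp_all add: rel_cmp_simps)
qed (simp_all add: rel_cmp_simps)
qed (simp_all add: rel_cmp_simps)

lemma trel_comp:
 assumes o: "x : Obj C" "y : Obj C" "z : Obj C" "x' : Obj C" "y' : Obj C" "z' : Obj C"
  and R: "R : Rel x y" "S : Rel y z" "R' : Rel x' y'" "S' : Rel y' z'"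
 shows "trel x y x' y' R R' O trel y z y' z' S S' = trel x z x' z' (R O S) (R' O S')"
proof (intro equalityI subsetI)
fix t assume "t : trel x y x' y' R R' O trel y z y' z' S S'"
then show "t : trel x z x' z' (R O S) (R' O S')" by (auto simp: trel_def)
next
fix t assume "t : trel x z x' z' (R O S) (R' O S')"
then obtain u v b b' where t: "t = (u, v)" "u : car (PC x x')" "v : car (PC z z')"
 "(pi1 x x' u, b) : R" "(b, pi1 z z' v) : S" "(pi2 x x' u, b') : R'" "(b', pi2 z z' v) : S'"
 by (auto simp: trel_def)
obtain k where "k : car (PC y y')" "pi1 y y' k = b" "pi2 y y' k = b'"
 using pr_surj[OF o(2,5) Rel_car(2)[OF R(1) t(4)] Rel_car(2)[OF R(3) t(6)]] by blast
then show "t : trel x y x' y' R R' O trel y z y' z' S S'"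
 using t by (auto simp: trel_def)
qed

lemma tns_cmp:
 assumes o: "x : Obj C" "y : Obj C" "z : Obj C" "x' : Obj C" "y' : Obj C" "z' : Obj C"
  and "\<phi> : H x y" "\<psi> : H y z" "\<phi>' : H x' y'" "\<psi>' : H y' z'"
 shows "tns x z x' z' (cmp x y z \<psi> \<phi>) (cmp x' y' z' \<psi>' \<phi>')
  = cmp (PC x x') (PC y y') (PC z z') (tns y z y' z' \<psi> \<psi>') (tns x y x' y' \<phi> \<phi>')"
 using assms(7)
proof (induction rule: H_induct)
case (single R c)
note R = this
show ?case using assms(8)
proof (induction rule: H_induct)
 case (single S d)
 note S = this
 show ?case using assms(9)
 proof (induction rule: H_induct)
  case (single R' c')
  note R' = this
  show ?case using assms(10)
  proof (induction rule: H_induct)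
   case (single S' d')
   note S' = this
   show ?case
    unfolding cmp_bas[OF o(1-3) R S] cmp_bas[OF o(4-6) R' S'] tns_bas[OF o(1,3,4,6) Rel_comp[OF R S] Rel_comp[OF R' S']]
     tns_bas[OF o(1,2,4,5) R R'] tns_bas[OF o(2,3,5,6) S S']
     cmp_bas[OF pr_hom(4)[OF o(1,4)] pr_hom(4)[OF o(2,5)] pr_hom(4)[OF o(3,6)]
      trel_Rel[OF o(1,2,4,5) R R'] trel_Rel[OF o(2,3,5,6) S S']]
     wt_tens[OF o R S R' S'] trel_comp[OF o R S R' S']
    by (simp add: algebra_simps)
  qed (simp_all add: rel_cmp_simps rel_tns_simps)
 qed (simp_all add: rel_cmp_simps rel_tns_simps)
qed (simp_all add: rel_cmp_simps rel_tns_simps)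
qed (simp_all add: rel_cmp_simps rel_tns_simps)

subsection \<open>Graphs\<close>

lemma grf_iff: "(a, b) : grf f x \<longleftrightarrow> a : car x & b = fn f a"
 by (auto simp: grf_def)

lemma grf_Rel:
 assumes f: "f : Hom C x y"
 shows "grf f x : Rel x y"
proof (rule RelI)
note x = hom_dom_obj[OF f]
show "grf f x <= car x \<times> car y" using fn_closed[OF f] by (auto simp: grf_def)
qed (use hom_dom_obj[OF f] in "auto simp: grf_iff zr_closed fn_zr[OF f] pl_closed fn_pl[OF f] sm_closed fn_sm[OF f]
   ac_closed fn_ac[OF f]")

abbreviation "gr f x y \<equiv> bas x y (grf f x) 1"

text \<open>A graph relates zero to zero only, so \<open>nul\<close> is trivial; for a graph on the
  right, injectivity of the arrow does the same. Hence \<open>gr_cmp\<close> holds without a degree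
  factor.\<close>

lemma wt_grf_left:
 assumes f: "f : Hom C x y" and z: "z : Obj C" and S: "S : Rel y z"
 shows "wt x y z (grf f x) S = 1"
 by (rule wt_one[OF hom_dom_obj[OF f] hom_cod_obj[OF f] z grf_Rel[OF f] S]) (auto simp: grf_iff fn_zr[OF f])

lemma wt_grf_right:
 assumes x: "x : Obj C" and R: "R : Rel x y" and f: "f : Hom C y z" and inj: "inj_on (fn f) (car y)"
 shows "wt x y z R (grf f y) = 1"
proof (rule wt_one[OF x hom_dom_obj[OF f] hom_cod_obj[OF f] R grf_Rel[OF f]])
fix b assume "(zr x, b) : R" "(b, zr z) : grf f y"
then have "b : car y" "fn f b = fn f (zr y)" by (auto simp: grf_iff fn_zr[OF f])
then show "b = zr y" using inj_onD[OF inj _ _ zr_closed[OF hom_dom_obj[OF f]]] by blast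
qed

lemma gr_cmp:
 assumes f: "f : Hom C x y" and g: "g : Hom C y z"
 shows "cmp x y z (gr g y z) (gr f x y) = gr (g \<cdot> f) x z"
proof -
have "grf f x O grf g y = grf (g \<cdot> f) x"
 using fn_comp[OF f g] fn_closed[OF f] by (auto simp: grf_iff relcomp_unfold)
then show ?thesis
 using cmp_bas[OF hom_dom_obj[OF f] hom_cod_obj[OF f] hom_cod_obj[OF g] grf_Rel[OF f] grf_Rel[OF g]]
  wt_grf_left[OF f hom_cod_obj[OF g] grf_Rel[OF g]] by simp
qed

lemma cmp_ident:
 assumes o: "x : Obj C" "y : Obj C" and "\<phi> : H x y"
 shows "cmp x y y (gr (Ident C y) y y) \<phi> = \<phi>" (is ?P) "cmp x x y \<phi> (gr (Ident C x) x x) = \<phi>" (is ?P1)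
proof -
have i: "inj_on (fn (Ident C y)) (car y)" by (auto simp: inj_on_def fn_ident)
show ?P
 using assms(3)
proof (induction rule: H_induct)
 case (single R c)
 have "R O grf (Ident C y) y = R"
  using Rel_car(2)[OF single] by (auto simp: grf_iff relcomp_unfold fn_ident)
 then show ?case
  using cmp_bas[OF o(1,2,2) single grf_Rel[OF ident_hom[OF o(2)]]] wt_grf_right[OF o(1) single ident_hom[OF o(2)] i] by simp
qed (simp_all add: rel_cmp_simps)
show ?P1
 using assms(3)
proof (induction rule: H_induct)
 case (single R c)
 have "grf (Ident C x) x O R = R"
  using Rel_car(1)[OF single] by (auto simp: grf_iff relcomp_unfold fn_ident)
 then show ?case
  using cmp_bas[OF o(1,1,2) grf_Rel[OF ident_hom[OF o(1)]] single] wt_grf_left[OF ident_hom[OF o(1)] o(2) single] by simp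
qed (simp_all add: rel_cmp_simps)
qed

text \<open>Naturality with respect to a relation is an equivalence of memberships.\<close>

lemma natural_square:
 assumes \<alpha>: "\<alpha> : Hom C X X'" and \<beta>: "\<beta> : Hom C Y Y'" and bij: "bij_betw (fn \<beta>) (car Y) (car Y')"
  and Q: "Q : Rel X Y" "Q' : Rel X' Y'"
  and iff: "!!u v. [|u : car X; v : car Y|] ==> (u, v) : Q \<longleftrightarrow> (fn \<alpha> u, fn \<beta> v) : Q'"
 shows "cmp X Y Y' (gr \<beta> Y Y') (bas X Y Q c) = cmp X X' Y' (bas X' Y' Q' c) (gr \<alpha> X X')"
proof -
note o = hom_dom_obj[OF \<alpha>] hom_cod_obj[OF \<alpha>] hom_dom_obj[OF \<beta>] hom_cod_obj[OF \<beta>]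
have "Q O grf \<beta> Y = grf \<alpha> X O Q'"
proof (intro equalityI subsetI)
 fix t assume "t : Q O grf \<beta> Y"
 then obtain u v where t: "t = (u, fn \<beta> v)" "(u, v) : Q" by (auto simp: grf_iff)
 then have "u : car X" "(fn \<alpha> u, fn \<beta> v) : Q'" using iff[of u v] Rel_car[OF Q(1) t(2)] by simp_all
 then show "t : grf \<alpha> X O Q'" using t(1) by (auto simp: grf_iff)
next
 fix t assume "t : grf \<alpha> X O Q'"
 then obtain u w where t: "t = (u, w)" "u : car X" "(fn \<alpha> u, w) : Q'" by (auto simp: grf_iff)
 then obtain v where v: "v : car Y" "w = fn \<beta> v" using bij Rel_car(2)[OF Q(2)] unfolding bij_betw_def by blast
 then have "(u, v) : Q" using iff[OF t(2) v(1)] t(3) by simp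
 then show "t : Q O grf \<beta> Y" using t(1) v by (auto simp: grf_iff)
qed
then show ?thesis
 using cmp_bas[OF o(1,3,4) Q(1) grf_Rel[OF \<beta>]] cmp_bas[OF o(1,2,4) grf_Rel[OF \<alpha>] Q(2)]
  wt_grf_right[OF o(1) Q(1) \<beta> bij_betw_imp_inj_on[OF bij]] wt_grf_left[OF \<alpha> o(4) Q(2)] by simp
qed

definition "pm x y f g = pairing C (f \<cdot> pr1 C x y) (g \<cdot> pr2 C x y)"

lemma pm_hom:
 assumes f: "f : Hom C x x'" and g: "g : Hom C y y'"
 shows "pm x y f g : Hom C (PC x y) (PC x' y')"
 unfolding pm_def
 by (rule pairing_hom(1)[OF comp_hom[OF pr_hom(1) f] comp_hom[OF pr_hom(2) g]])
  (use hom_dom_obj[OF f] hom_dom_obj[OF g] in auto)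

lemma pm_fn:
 assumes f: "f : Hom C x x'" and g: "g : Hom C y y'" and u: "u : car (PC x y)"
 shows "pi1 x' y' (fn (pm x y f g) u) = fn f (pi1 x y u)" (is ?P) "pi2 x' y' (fn (pm x y f g) u) = fn g (pi2 x y u)"
proof -
note p = pr_hom(1,2)[OF hom_dom_obj[OF f] hom_dom_obj[OF g]]
show ?P "pi2 x' y' (fn (pm x y f g) u) = fn g (pi2 x y u)"
 unfolding pm_def using pairing_fn[OF comp_hom[OF p(1) f] comp_hom[OF p(2) g] u] fn_comp[OF p(1) f u] fn_comp[OF p(2) g u]
 by simp_all
qed

lemma tns_gr:
 assumes f: "f : Hom C x y" and g: "g : Hom C x' y'"
 shows "tns x y x' y' (gr f x y) (gr g x' y') = gr (pm x x' f g) (PC x x') (PC y y')"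
proof -
note o = hom_dom_obj[OF f] hom_cod_obj[OF f] hom_dom_obj[OF g] hom_cod_obj[OF g]
have "trel x y x' y' (grf f x) (grf g x') = grf (pm x x' f g) (PC x x')"
proof (intro equalityI subsetI)
 fix t assume "t : trel x y x' y' (grf f x) (grf g x')"
 then obtain u v where t: "t = (u, v)" "u : car (PC x x')" "v : car (PC y y')"
  "pi1 y y' v = fn f (pi1 x x' u)" "pi2 y y' v = fn g (pi2 x x' u)" by (auto simp: trel_def grf_iff)
 have "v = fn (pm x x' f g) u"
  by (rule pr_inj[OF o(2,4) t(3) fn_closed[OF pm_hom[OF f g] t(2)]]) (simp_all add: pm_fn[OF f g t(2)] t)
 then show "t : grf (pm x x' f g) (PC x x')" using t by (simp add: grf_iff)
next
 fix t assume "t : grf (pm x x' f g) (PC x x')"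
 then obtain u where t: "t = (u, fn (pm x x' f g) u)" "u : car (PC x x')" by (auto simp: grf_def)
 show "t : trel x y x' y' (grf f x) (grf g x')"
  using pr_closed[OF o(1,3) t(2)] fn_closed[OF pm_hom[OF f g] t(2)] t(2)
  unfolding t(1) trel_def by (simp add: grf_iff pm_fn[OF f g t(2)])
qed
then show ?thesis
 using tns_bas[OF o grf_Rel[OF f] grf_Rel[OF g], of 1 1] by simp
qed

subsection \<open>The monoidal structure\<close>

definition "as x y z = pairing C (pr1 C x y \<cdot> pr1 C (PC x y) z)
 (pairing C (pr2 C x y \<cdot> pr1 C (PC x y) z) (pr2 C (PC x y) z))"
definition "br x y = pairing C (pr2 C x y) (pr1 C x y)"
abbreviation "un \<equiv> terminal_obj C"

lemma as_hom:
 assumes o: "x : Obj C" "y : Obj C" "z : Obj C"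
 shows "as x y z : Hom C (PC (PC x y) z) (PC x (PC y z))" (is ?P)
  "u : car (PC (PC x y) z) ==> pi1 x (PC y z) (fn (as x y z) u) = pi1 x y (pi1 (PC x y) z u)"
  "u : car (PC (PC x y) z) ==> pi1 y z (pi2 x (PC y z) (fn (as x y z) u)) = pi2 x y (pi1 (PC x y) z u)"
  "u : car (PC (PC x y) z) ==> pi2 y z (pi2 x (PC y z) (fn (as x y z) u)) = pi2 (PC x y) z u"
proof -
note p = pr_hom(1,2)[OF pr_hom(4)[OF o(1,2)] o(3)] and q = pr_hom(1,2)[OF o(1,2)]
note c = comp_hom[OF p(1) q(1)] comp_hom[OF p(1) q(2)]
note i = pairing_hom(1)[OF c(2) p(2)]
show ?P unfolding as_def by (rule pairing_hom(1)[OF c(1) i])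
assume u: "u : car (PC (PC x y) z)"
show "pi1 x (PC y z) (fn (as x y z) u) = pi1 x y (pi1 (PC x y) z u)"
 "pi1 y z (pi2 x (PC y z) (fn (as x y z) u)) = pi2 x y (pi1 (PC x y) z u)"
 "pi2 y z (pi2 x (PC y z) (fn (as x y z) u)) = pi2 (PC x y) z u"
 unfolding as_def pairing_fn[OF c(1) i u] pairing_fn[OF c(2) p(2) u] fn_comp[OF p(1) q(1) u] fn_comp[OF p(1) q(2) u]
 by (rule refl)+
qed

lemma br_hom:
 assumes o: "x : Obj C" "y : Obj C"
 shows "br x y : Hom C (PC x y) (PC y x)"
  "u : car (PC x y) ==> pi1 y x (fn (br x y) u) = pi2 x y u"
  "u : car (PC x y) ==> pi2 y x (fn (br x y) u) = pi1 x y u"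
 unfolding br_def using pairing_hom(1)[OF pr_hom(2,1)[OF o]] pairing_fn[OF pr_hom(2,1)[OF o]] by auto

lemma prod_eqI3:
 assumes o: "x : Obj C" "y : Obj C" "z : Obj C"
  and "u : car (PC x (PC y z))" "v : car (PC x (PC y z))" "pi1 x (PC y z) u = pi1 x (PC y z) v"
  "pi1 y z (pi2 x (PC y z) u) = pi1 y z (pi2 x (PC y z) v)" "pi2 y z (pi2 x (PC y z) u) = pi2 y z (pi2 x (PC y z) v)"
 shows "u = v"
proof (rule pr_inj[OF o(1) pr_hom(4)[OF o(2,3)] assms(4-6)])
show "pi2 x (PC y z) u = pi2 x (PC y z) v"
 by (rule pr_inj[OF o(2,3) _ _ assms(7,8)]) (rule pr_closed(2)[OF o(1) pr_hom(4)[OF o(2,3)]], fact)+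
qed

lemma as_bij:
 assumes o: "x : Obj C" "y : Obj C" "z : Obj C"
 shows "bij_betw (fn (as x y z)) (car (PC (PC x y) z)) (car (PC x (PC y z)))"
 unfolding bij_betw_def
proof (intro conjI equalityI subsetI)
note a = as_hom[OF o] and xy = pr_hom(4)[OF o(1,2)] and yz = pr_hom(4)[OF o(2,3)]
show "inj_on (fn (as x y z)) (car (PC (PC x y) z))"
proof (rule inj_onI)
 fix u v assume u: "u : car (PC (PC x y) z)" and v: "v : car (PC (PC x y) z)" and eq: "fn (as x y z) u = fn (as x y z) v"
 have "pi1 (PC x y) z u = pi1 (PC x y) z v"
  by (rule pr_inj[OF o(1,2) pr_closed(1)[OF xy o(3) u] pr_closed(1)[OF xy o(3) v]])
   (use a(2,3)[OF u] a(2,3)[OF v] eq in simp_all)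
 moreover have "pi2 (PC x y) z u = pi2 (PC x y) z v" using a(4)[OF u] a(4)[OF v] eq by simp
 ultimately show "u = v" by (rule pr_inj[OF xy o(3) u v])
qed
show "t : car (PC x (PC y z))" if "t : fn (as x y z) ` car (PC (PC x y) z)" for t
 using that fn_closed[OF a(1)] by blast
fix t assume t: "t : car (PC x (PC y z))"
note t2 = pr_closed[OF o(1) yz t]
note t3 = pr_closed[OF o(2,3) t2(2)]
obtain s where s: "s : car (PC x y)" "pi1 x y s = pi1 x (PC y z) t" "pi2 x y s = pi1 y z (pi2 x (PC y z) t)"
 using pr_surj[OF o(1,2) t2(1) t3(1)] by blast
obtain u where u: "u : car (PC (PC x y) z)" "pi1 (PC x y) z u = s" "pi2 (PC x y) z u = pi2 y z (pi2 x (PC y z) t)"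
 using pr_surj[OF xy o(3) s(1) t3(2)] by blast
have "t = fn (as x y z) u"
 by (rule prod_eqI3[OF o t fn_closed[OF a(1) u(1)]]) (simp_all add: a(2-4)[OF u(1)] u s)
then show "t : fn (as x y z) ` car (PC (PC x y) z)" using u(1) by blast
qed

lemma br_bij:
 assumes o: "x : Obj C" "y : Obj C"
 shows "bij_betw (fn (br x y)) (car (PC x y)) (car (PC y x))"
proof (rule bij_betw_byWitness[where f' = "fn (br y x)"])
note b = br_hom[OF o] and b' = br_hom[OF o(2,1)]
show "ALL u:car (PC x y). fn (br y x) (fn (br x y) u) = u"
proof
 fix u assume u: "u : car (PC x y)"
 note v = fn_closed[OF b(1) u]
 show "fn (br y x) (fn (br x y) u) = u"
  by (rule pr_inj[OF o fn_closed[OF b'(1) v] u]) (simp_all add: b'(2,3)[OF v] b(2,3)[OF u])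
qed
show "ALL u:car (PC y x). fn (br x y) (fn (br y x) u) = u"
proof
 fix u assume u: "u : car (PC y x)"
 note v = fn_closed[OF b'(1) u]
 show "fn (br x y) (fn (br y x) u) = u"
  by (rule pr_inj[OF o(2,1) fn_closed[OF b(1) v] u]) (simp_all add: b(2,3)[OF v] b'(2,3)[OF u])
qed
qed (use fn_closed[OF br_hom(1)[OF o]] fn_closed[OF br_hom(1)[OF o(2,1)]] in auto)

lemma un_eq: "a : car un \<longleftrightarrow> a = zr un"
 using terminal_obj(2) by blast

lemma lunit_bij:
 assumes o: "x : Obj C"
 shows "bij_betw (pi2 un x) (car (PC un x)) (car x)" (is ?P) "bij_betw (pi1 x un) (car (PC x un)) (car x)" (is ?P1)
proof -
note t = terminal_obj(1)
show ?P
 unfolding bij_betw_def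
proof (intro conjI equalityI subsetI)
 show "inj_on (pi2 un x) (car (PC un x))"
 proof (rule inj_onI)
  fix u v assume u: "u : car (PC un x)" and v: "v : car (PC un x)" and eq: "pi2 un x u = pi2 un x v"
  show "u = v" by (rule pr_inj[OF t o u v _ eq]) (use pr_closed(1)[OF t o u] pr_closed(1)[OF t o v] in "simp add: un_eq")
 qed
 show "a : car x" if "a : pi2 un x ` car (PC un x)" for a using that pr_closed(2)[OF t o] by blast
 show "a : pi2 un x ` car (PC un x)" if "a : car x" for a using pr_surj[OF t o zr_closed[OF t] that] by blast
qed
show ?P1
 unfolding bij_betw_def
proof (intro conjI equalityI subsetI)
 show "inj_on (pi1 x un) (car (PC x un))"
 proof (rule inj_onI)
  fix u v assume u: "u : car (PC x un)" and v: "v : car (PC x un)" and eq: "pi1 x un u = pi1 x un v"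
  show "u = v" by (rule pr_inj[OF o t u v eq]) (use pr_closed(2)[OF o t u] pr_closed(2)[OF o t v] in "simp add: un_eq")
 qed
 show "a : car x" if "a : pi1 x un ` car (PC x un)" for a using that pr_closed(1)[OF o t] by blast
 show "a : pi1 x un ` car (PC x un)" if "a : car x" for a using pr_surj[OF o t that zr_closed[OF t]] by blast
qed
qed

section \<open>Graphs of arrows inside the category of relations\<close>

abbreviation "T \<equiv> T0 C \<delta>"
abbreviation "Gr \<equiv> graph_arr C :: 'o \<times> ('u => 'u) \<times> 'o => ('o, 'o \<times> ('u => 'u) \<times> 'o, 'k) rel_arr"

lemma T0_sel:
 "Obj T = Obj C" "Dom T = (%(x, \<phi>, y). x)" "Cod T = (%(x, \<phi>, y). y)" "Ident T x = Gr (Ident C x)"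
 "Comp T (y', \<psi>, z) (x, \<phi>, y) = (x, cmp x y z \<psi> \<phi>, z)"
 "Tens_obj T = prod_obj C" "Tens_arr T (x, \<phi>, y) (x', \<phi>', y') = (PC x x', tns x y x' y' \<phi> \<phi>', PC y y')"
 "Unit T = un" "Assoc T x y z = Gr (as x y z)" "Lunit T x = Gr (pr2 C un x)" "Runit T x = Gr (pr1 C x un)"
 "Braid T x y = Gr (br x y)"
 by (simp_all add: T0_def T0_comp_eq T0_tens_eq as_def br_def Let_def)

lemma T0_Arr: "Arr T = {(x, \<phi>, y). x : Obj C & y : Obj C & \<phi> : H x y}"
 by (auto simp: T0_def H_def subobjects_eq)

lemma T0_Hom: "f : Hom T x y \<longleftrightarrow> (\<exists>\<phi>. f = (x, \<phi>, y) & x : Obj C & y : Obj C & \<phi> : H x y)"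
 by (cases f) (auto simp: Hom_def T0_Arr T0_sel)

lemma Gr_eq: "f : Hom C x y ==> Gr f = (x, gr f x y, y)"
 by (rule graph_arr_eq)

lemma Gr_hom: "f : Hom C x y ==> Gr f : Hom T x y"
 by (simp add: T0_Hom Gr_eq H_bas grf_Rel hom_dom_obj hom_cod_obj)

lemma Gr_comp: "[|f : Hom C x y; g : Hom C y z|] ==> Comp T (Gr g) (Gr f) = Gr (g \<cdot> f)"
 by (simp add: Gr_eq T0_sel gr_cmp Gr_eq[OF comp_hom])

lemma Gr_tens: "[|f : Hom C x x'; g : Hom C y y'|] ==> Tens_arr T (Gr f) (Gr g) = Gr (pm x y f g)"
 by (simp add: Gr_eq T0_sel tns_gr Gr_eq[OF pm_hom])

lemma Gr_iso:
 assumes f: "f : Hom C x y" and bij: "bij_betw (fn f) (car x) (car y)"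
 shows "is_iso T (Gr f)"
proof -
obtain j where j: "j : Hom C y x" "j \<cdot> f = Ident C x" "f \<cdot> j = Ident C y" using inverse_ex[OF f bij] by blast
have d: "Dom T (Gr f) = x" "Cod T (Gr f) = y" by (simp_all add: Gr_eq[OF f] T0_sel)
have "Gr f : Arr T" using Gr_hom[OF f] by (simp add: Hom_def)
moreover have "Comp T (Gr j) (Gr f) = Ident T x" "Comp T (Gr f) (Gr j) = Ident T y"
 using Gr_comp[OF f j(1)] Gr_comp[OF j(1) f] j by (simp_all add: T0_sel)
ultimately show ?thesis unfolding is_iso_def d using Gr_hom[OF j(1)] by blast
qed

lemma pm_ident:
 assumes "x : Obj C" "y : Obj C"
 shows "pm x y (Ident C x) (Ident C y) = Ident C (PC x y)"
proof (rule hom_eqI)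
note i = ident_hom[OF assms(1)] ident_hom[OF assms(2)]
show 1: "pm x y (Ident C x) (Ident C y) : Hom C (PC x y) (PC x y)" by (rule pm_hom[OF i])
show "Ident C (PC x y) : Hom C (PC x y) (PC x y)" by (rule ident_hom[OF pr_hom(4)[OF assms]])
fix u assume u: "u : car (PC x y)"
show "fn (pm x y (Ident C x) (Ident C y)) u = fn (Ident C (PC x y)) u"
 unfolding fn_ident[OF u]
 by (rule pr_inj[OF assms fn_closed[OF 1 u] u]) (simp_all add: pm_fn[OF i u] fn_ident pr_closed[OF assms u])
qed

end

context rep_degree
begin

section \<open>Naturality on relations and coherence on graphs\<close>

lemma tns_assoc:
 assumes o: "x : Obj C" "x' : Obj C" "y : Obj C" "y' : Obj C" "z : Obj C" "z' : Obj C"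
  and "\<phi> : H x x'" "\<psi> : H y y'" "\<chi> : H z z'"
 shows "cmp (PC (PC x y) z) (PC (PC x' y') z') (PC x' (PC y' z'))
   (gr (as x' y' z') (PC (PC x' y') z') (PC x' (PC y' z')))
   (tns (PC x y) (PC x' y') z z' (tns x x' y y' \<phi> \<psi>) \<chi>)
  = cmp (PC (PC x y) z) (PC x (PC y z)) (PC x' (PC y' z')) (tns x x' (PC y z) (PC y' z') \<phi> (tns y y' z z' \<psi> \<chi>))
   (gr (as x y z) (PC (PC x y) z) (PC x (PC y z)))"
 using assms(7)
proof (induction rule: H_induct)
case (single R c)
note R = this
show ?case using assms(8)
proof (induction rule: H_induct)
 case (single S d)
 note S = this
 show ?case using assms(9)
 proof (induction rule: H_induct)
  case (single Q e)
  note Q = this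
  note xy = pr_hom(4)[OF o(1,3)] pr_hom(4)[OF o(2,4)] pr_hom(4)[OF o(3,5)] pr_hom(4)[OF o(4,6)]
  note RS = trel_Rel[OF o(1-4) R S] and SQ = trel_Rel[OF o(3-6) S Q]
  note a = as_hom[OF o(1,3,5)] and a' = as_hom[OF o(2,4,6)]
  have "cmp (PC (PC x y) z) (PC (PC x' y') z') (PC x' (PC y' z')) (gr (as x' y' z') (PC (PC x' y') z') (PC x' (PC y' z')))
     (bas (PC (PC x y) z) (PC (PC x' y') z') (trel (PC x y) (PC x' y') z z' (trel x x' y y' R S) Q) (c * d * e))
    = cmp (PC (PC x y) z) (PC x (PC y z)) (PC x' (PC y' z'))
     (bas (PC x (PC y z)) (PC x' (PC y' z')) (trel x x' (PC y z) (PC y' z') R (trel y y' z z' S Q)) (c * d * e))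
     (gr (as x y z) (PC (PC x y) z) (PC x (PC y z)))"
  proof (rule natural_square[OF a(1) a'(1) as_bij[OF o(2,4,6)] trel_Rel[OF xy(1,2) o(5,6) RS Q] trel_Rel[OF o(1,2) xy(3,4) R SQ]])
   fix u v assume u: "u : car (PC (PC x y) z)" and v: "v : car (PC (PC x' y') z')"
   note cu = fn_closed[OF a(1) u] and cv = fn_closed[OF a'(1) v]
   show "(u, v) : trel (PC x y) (PC x' y') z z' (trel x x' y y' R S) Q \<longleftrightarrow>
    (fn (as x y z) u, fn (as x' y' z') v) : trel x x' (PC y z) (PC y' z') R (trel y y' z z' S Q)"
    using u v cu cv pr_closed[OF xy(1) o(5) u] pr_closed[OF xy(2) o(6) v] pr_closed[OF o(1) xy(3) cu] pr_closed[OF o(2) xy(4) cv]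
    by (simp add: trel_def a(2-4)[OF u] a'(2-4)[OF v])
  qed
  then show ?case
   by (simp add: tns_bas[OF o(1-4) R S] tns_bas[OF o(3-6) S Q] tns_bas[OF xy(1,2) o(5,6) RS Q] tns_bas[OF o(1,2) xy(3,4) R SQ] mult.assoc)
 qed (simp_all add: rel_cmp_simps rel_tns_simps)
qed (simp_all add: rel_cmp_simps rel_tns_simps)
qed (simp_all add: rel_cmp_simps rel_tns_simps)

lemma tns_braid:
 assumes o: "x : Obj C" "x' : Obj C" "y : Obj C" "y' : Obj C" and "\<phi> : H x x'" "\<psi> : H y y'"
 shows "cmp (PC x y) (PC x' y') (PC y' x') (gr (br x' y') (PC x' y') (PC y' x')) (tns x x' y y' \<phi> \<psi>)
  = cmp (PC x y) (PC y x) (PC y' x') (tns y y' x x' \<psi> \<phi>) (gr (br x y) (PC x y) (PC y x))"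
 using assms(5)
proof (induction rule: H_induct)
case (single R c)
note R = this
show ?case using assms(6)
proof (induction rule: H_induct)
 case (single S d)
 note S = this
 note b = br_hom[OF o(1,3)] and b' = br_hom[OF o(2,4)]
 have "cmp (PC x y) (PC x' y') (PC y' x') (gr (br x' y') (PC x' y') (PC y' x')) (bas (PC x y) (PC x' y') (trel x x' y y' R S) (c * d))
  = cmp (PC x y) (PC y x) (PC y' x') (bas (PC y x) (PC y' x') (trel y y' x x' S R) (c * d)) (gr (br x y) (PC x y) (PC y x))"
 proof (rule natural_square[OF b(1) b'(1) br_bij[OF o(2,4)] trel_Rel[OF o R S] trel_Rel[OF o(3,4,1,2) S R]])
  fix u v assume u: "u : car (PC x y)" and v: "v : car (PC x' y')"
  show "(u, v) : trel x x' y y' R S \<longleftrightarrow> (fn (br x y) u, fn (br x' y') v) : trel y y' x x' S R"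
   using u v fn_closed[OF b(1) u] fn_closed[OF b'(1) v] by (auto simp: trel_def b(2,3)[OF u] b'(2,3)[OF v])
 qed
 then show ?case by (simp add: tns_bas[OF o R S] tns_bas[OF o(3,4,1,2) S R] mult.commute)
qed (simp_all add: rel_cmp_simps rel_tns_simps)
qed (simp_all add: rel_cmp_simps rel_tns_simps)

lemma tns_unit:
 assumes o: "x : Obj C" "y : Obj C" and "\<phi> : H x y"
 shows "cmp (PC un x) (PC un y) y (gr (pr2 C un y) (PC un y) y) (tns un un x y (gr (Ident C un) un un) \<phi>)
   = cmp (PC un x) x y \<phi> (gr (pr2 C un x) (PC un x) x)" (is ?P)
  "cmp (PC x un) (PC y un) y (gr (pr1 C y un) (PC y un) y) (tns x y un un \<phi> (gr (Ident C un) un un))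
   = cmp (PC x un) x y \<phi> (gr (pr1 C x un) (PC x un) x)" (is ?P1)
proof -
note t = terminal_obj(1)
note I = grf_Rel[OF ident_hom[OF t]]
have I_iff: "(a, b) : grf (Ident C un) un" if "a : car un" "b : car un" for a b
 using that by (simp add: grf_iff fn_ident un_eq)
show ?P
 using assms(3)
proof (induction rule: H_induct)
 case (single R c)
 show ?case
  unfolding tns_bas[OF t t o I single] mult_1
  using I_iff pr_closed[OF t o(1)] pr_closed[OF t o(2)]
  by (intro natural_square[OF pr_hom(2)[OF t o(1)] pr_hom(2)[OF t o(2)] lunit_bij(1)[OF o(2)] trel_Rel[OF t t o I single] single])
   (auto simp: trel_def)
qed (simp_all add: rel_cmp_simps rel_tns_simps)
show ?P1
 using assms(3)
proof (induction rule: H_induct)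
 case (single R c)
 show ?case
  unfolding tns_bas[OF o t t single I] mult_1_right
  using I_iff pr_closed[OF o(1) t] pr_closed[OF o(2) t]
  by (intro natural_square[OF pr_hom(1)[OF o(1) t] pr_hom(1)[OF o(2) t] lunit_bij(2)[OF o(2)] trel_Rel[OF o t t single I] single])
   (auto simp: trel_def)
qed (simp_all add: rel_cmp_simps rel_tns_simps)
qed

text \<open>An element of a product is determined by its projections, so it suffices to compare the
  four components of both sides; \<open>Gr\<close> then carries this cartesian law over to
  relations.\<close>

lemma pentagon_C:
 assumes o: "w : Obj C" "x : Obj C" "y : Obj C" "z : Obj C"
 shows "pm w (PC (PC x y) z) (Ident C w) (as x y z) \<cdot> as w (PC x y) z \<cdot> pm (PC (PC w x) y) z (as w x y) (Ident C z)
  = as w x (PC y z) \<cdot> as (PC w x) y z"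
proof -
note wx = pr_hom(4)[OF o(1,2)] and xy = pr_hom(4)[OF o(2,3)] and yz = pr_hom(4)[OF o(3,4)]
note iw = ident_hom[OF o(1)] and iz = ident_hom[OF o(4)]
note a1 = as_hom[OF o(2-4)] and a2 = as_hom[OF o(1) xy o(4)] and a3 = as_hom[OF o(1-3)]
 and a4 = as_hom[OF o(1,2) yz] and a5 = as_hom[OF wx o(3,4)]
note p1 = pm_hom[OF iw a1(1)] and p2 = pm_hom[OF a3(1) iz]
note c1 = comp_hom[OF p2 comp_hom[OF a2(1) p1]] and c2 = comp_hom[OF a5(1) a4(1)]
show ?thesis
proof (rule hom_eqI[OF c1 c2])
 fix u assume u: "u : car (PC (PC (PC w x) y) z)"
 define d where "d = fn (pm (PC (PC w x) y) z (as w x y) (Ident C z)) u"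
 define b where "b = fn (as w (PC x y) z) d"
 define e where "e = fn (as (PC w x) y z) u"
 let ?l = "fn (pm w (PC (PC x y) z) (Ident C w) (as x y z)) b" and ?r = "fn (as w x (PC y z)) e"
 have d: "d : car (PC (PC w (PC x y)) z)" unfolding d_def by (rule fn_closed[OF p2 u])
 have b: "b : car (PC w (PC (PC x y) z))" unfolding b_def by (rule fn_closed[OF a2(1) d])
 have e: "e : car (PC (PC w x) (PC y z))" unfolding e_def by (rule fn_closed[OF a5(1) u])
 note u' = pr_closed[OF pr_hom(4)[OF wx o(3)] o(4) u]
 note d' = pr_closed[OF pr_hom(4)[OF o(1) xy] o(4) d]
 note b' = pr_closed[OF o(1) pr_hom(4)[OF xy o(4)] b]
 have ds: "pi1 (PC w (PC x y)) z d = fn (as w x y) (pi1 (PC (PC w x) y) z u)" "pi2 (PC w (PC x y)) z d = pi2 (PC (PC w x) y) z u"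
  unfolding d_def pm_fn[OF a3(1) iz u] fn_ident[OF u'(2)] by (rule refl)+
 have bs: "pi1 w (PC (PC x y) z) b = pi1 w (PC x y) (pi1 (PC w (PC x y)) z d)"
  "pi1 (PC x y) z (pi2 w (PC (PC x y) z) b) = pi2 w (PC x y) (pi1 (PC w (PC x y)) z d)"
  "pi2 (PC x y) z (pi2 w (PC (PC x y) z) b) = pi2 (PC w (PC x y)) z d"
  unfolding b_def a2(2-4)[OF d] by (rule refl)+
 have es: "pi1 (PC w x) (PC y z) e = pi1 (PC w x) y (pi1 (PC (PC w x) y) z u)"
  "pi1 y z (pi2 (PC w x) (PC y z) e) = pi2 (PC w x) y (pi1 (PC (PC w x) y) z u)"
  "pi2 y z (pi2 (PC w x) (PC y z) e) = pi2 (PC (PC w x) y) z u"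
  unfolding e_def a5(2-4)[OF u] by (rule refl)+
 have ls: "pi1 w (PC x (PC y z)) ?l = pi1 w (PC (PC x y) z) b" "pi2 w (PC x (PC y z)) ?l = fn (as x y z) (pi2 w (PC (PC x y) z) b)"
  unfolding pm_fn[OF iw a1(1) b] fn_ident[OF b'(1)] by (rule refl)+
 note l = fn_closed[OF p1 b] and r = fn_closed[OF a4(1) e]
 have "pi2 w (PC x (PC y z)) ?l = pi2 w (PC x (PC y z)) ?r"
 proof (rule prod_eqI3[OF o(2-4) pr_closed(2)[OF o(1) pr_hom(4)[OF o(2) yz] l] pr_closed(2)[OF o(1) pr_hom(4)[OF o(2) yz] r]])
 qed (simp_all add: ls a1(2-4)[OF b'(2)] bs ds a3(2-4)[OF u'(1)] a4(2-4)[OF e] es)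
 moreover have "pi1 w (PC x (PC y z)) ?l = pi1 w (PC x (PC y z)) ?r"
  by (simp add: ls bs ds a3(2)[OF u'(1)] a4(2)[OF e] es)
 ultimately have "?l = ?r" by (intro pr_inj[OF o(1) pr_hom(4)[OF o(2) yz] l r])
 then show "fn (pm w (PC (PC x y) z) (Ident C w) (as x y z) \<cdot> as w (PC x y) z \<cdot> pm (PC (PC w x) y) z (as w x y) (Ident C z)) u
  = fn (as w x (PC y z) \<cdot> as (PC w x) y z) u"
  unfolding fn_comp[OF p2 comp_hom[OF a2(1) p1] u] d_def[symmetric] fn_comp[OF a2(1) p1 d] b_def[symmetric]
   fn_comp[OF a5(1) a4(1) u] e_def[symmetric] .
qed
qed

lemma triangle_C:
 assumes o: "x : Obj C" "y : Obj C"
 shows "pm x (PC un y) (Ident C x) (pr2 C un y) \<cdot> as x un y = pm (PC x un) y (pr1 C x un) (Ident C y)"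
proof -
note t = terminal_obj(1)
note i = ident_hom[OF o(1)] ident_hom[OF o(2)]
note a = as_hom[OF o(1) t o(2)]
note p = pm_hom[OF i(1) pr_hom(2)[OF t o(2)]] and q = pm_hom[OF pr_hom(1)[OF o(1) t] i(2)]
show ?thesis
proof (rule hom_eqI[OF comp_hom[OF a(1) p] q])
 fix u assume u: "u : car (PC (PC x un) y)"
 note d = fn_closed[OF a(1) u]
 show "fn (pm x (PC un y) (Ident C x) (pr2 C un y) \<cdot> as x un y) u = fn (pm (PC x un) y (pr1 C x un) (Ident C y)) u"
  unfolding fn_comp[OF a(1) p u]
  by (rule pr_inj[OF o fn_closed[OF p d] fn_closed[OF q u]])
   (simp_all add: pm_fn[OF i(1) pr_hom(2)[OF t o(2)] d] pm_fn[OF pr_hom(1)[OF o(1) t] i(2) u] a(2-4)[OF u]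
    fn_ident pr_closed[OF o(1) pr_hom(4)[OF t o(2)] d] pr_closed[OF pr_hom(4)[OF o(1) t] o(2) u]
    pr_closed[OF o(1) t])
qed
qed

lemma hexagon_C:
 assumes o: "x : Obj C" "y : Obj C" "z : Obj C"
 shows "as y z x \<cdot> br x (PC y z) \<cdot> as x y z
  = pm y (PC x z) (Ident C y) (br x z) \<cdot> as y x z \<cdot> pm (PC x y) z (br x y) (Ident C z)"
proof -
note i = ident_hom[OF o(2)] ident_hom[OF o(3)]
note yz = pr_hom(4)[OF o(2,3)] and xz = pr_hom(4)[OF o(1,3)] and xy = pr_hom(4)[OF o(1,2)] and yx = pr_hom(4)[OF o(2,1)]
note a1 = as_hom[OF o(2,3,1)] and a2 = as_hom[OF o] and a3 = as_hom[OF o(2,1,3)]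
note b1 = br_hom[OF o(1) yz] and b2 = br_hom[OF o(1,3)] and b3 = br_hom[OF o(1,2)]
note p = pm_hom[OF i(1) b2(1)] and q = pm_hom[OF b3(1) i(2)]
note c1 = comp_hom[OF a2(1) comp_hom[OF b1(1) a1(1)]] and c2 = comp_hom[OF q comp_hom[OF a3(1) p]]
show ?thesis
proof (rule hom_eqI[OF c1 c2])
 fix u assume u: "u : car (PC (PC x y) z)"
 define d where "d = fn (as x y z) u"
 define e where "e = fn (br x (PC y z)) d"
 define g where "g = fn (pm (PC x y) z (br x y) (Ident C z)) u"
 define h where "h = fn (as y x z) g"
 have d: "d : car (PC x (PC y z))" unfolding d_def by (rule fn_closed[OF a2(1) u])
 have e: "e : car (PC (PC y z) x)" unfolding e_def by (rule fn_closed[OF b1(1) d])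
 have g: "g : car (PC (PC y x) z)" unfolding g_def by (rule fn_closed[OF q u])
 have h: "h : car (PC y (PC x z))" unfolding h_def by (rule fn_closed[OF a3(1) g])
 note u' = pr_closed[OF xy o(3) u] and g' = pr_closed[OF yx o(3) g] and h' = pr_closed[OF o(2) xz h]
 have ds: "pi1 x (PC y z) d = pi1 x y (pi1 (PC x y) z u)" "pi1 y z (pi2 x (PC y z) d) = pi2 x y (pi1 (PC x y) z u)"
  "pi2 y z (pi2 x (PC y z) d) = pi2 (PC x y) z u"
  unfolding d_def a2(2-4)[OF u] by (rule refl)+
 have es: "pi1 (PC y z) x e = pi2 x (PC y z) d" "pi2 (PC y z) x e = pi1 x (PC y z) d"
  unfolding e_def b1(2,3)[OF d] by (rule refl)+
 have gs: "pi1 (PC y x) z g = fn (br x y) (pi1 (PC x y) z u)" "pi2 (PC y x) z g = pi2 (PC x y) z u"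
  unfolding g_def pm_fn[OF b3(1) i(2) u] fn_ident[OF u'(2)] by (rule refl)+
 have hs: "pi1 y (PC x z) h = pi1 y x (pi1 (PC y x) z g)" "pi1 x z (pi2 y (PC x z) h) = pi2 y x (pi1 (PC y x) z g)"
  "pi2 x z (pi2 y (PC x z) h) = pi2 (PC y x) z g"
  unfolding h_def a3(2-4)[OF g] by (rule refl)+
 have "fn (as y z x) e = fn (pm y (PC x z) (Ident C y) (br x z)) h"
  by (rule prod_eqI3[OF o(2,3,1) fn_closed[OF a1(1) e] fn_closed[OF p h]])
   (simp_all add: a1(2-4)[OF e] es ds pm_fn[OF i(1) b2(1) h] fn_ident pr_closed[OF o(1,2) u'(1)] b2(2,3)[OF h'(2)] hs gs b3(2,3)[OF u'(1)])
 then show "fn (as y z x \<cdot> br x (PC y z) \<cdot> as x y z) u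
  = fn (pm y (PC x z) (Ident C y) (br x z) \<cdot> as y x z \<cdot> pm (PC x y) z (br x y) (Ident C z)) u"
  unfolding fn_comp[OF a2(1) comp_hom[OF b1(1) a1(1)] u] d_def[symmetric] fn_comp[OF b1(1) a1(1) d] e_def[symmetric]
   fn_comp[OF q comp_hom[OF a3(1) p] u] g_def[symmetric] fn_comp[OF a3(1) p g] h_def[symmetric] .
qed
qed

lemma braid_C:
 assumes o: "x : Obj C" "y : Obj C"
 shows "br y x \<cdot> br x y = Ident C (PC x y)"
proof -
note b = br_hom[OF o] and b' = br_hom[OF o(2,1)]
show ?thesis
proof (rule hom_eqI[OF comp_hom[OF b(1) b'(1)] ident_hom[OF pr_hom(4)[OF o]]])
 fix u assume u: "u : car (PC x y)"
 note v = fn_closed[OF b(1) u]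
 show "fn (br y x \<cdot> br x y) u = fn (Ident C (PC x y)) u"
  unfolding fn_comp[OF b(1) b'(1) u] fn_ident[OF u]
  by (rule pr_inj[OF o fn_closed[OF b'(1) v] u]) (simp_all add: b'(2,3)[OF v] b(2,3)[OF u])
qed
qed

text \<open>All structure arrows are graphs, and \<open>Gr\<close> respects composition and tensor
  products, so the coherence laws are images of those of \<open>C\<close>. Naturality involves
  arbitrary relations and rests on \<open>natural_square\<close>.\<close>

theorem T0_smc: "symmetric_monoidal_category T"
proof (unfold_locales, goal_cases)
case (1 f) then show ?case by (auto simp: T0_Arr T0_sel)
next
case (2 f) then show ?case by (auto simp: T0_Arr T0_sel)
next
case (3 x)
then have "Ident C x : Hom C x x" unfolding T0_sel by (rule ident_hom)
then show ?case unfolding T0_sel(4) by (rule Gr_hom)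
next
case (4 f x y g z)
then show ?case by (auto simp: T0_Hom T0_sel cmp_H)
next
case (5 f x y)
then show ?case by (auto simp: T0_Hom T0_sel(4,5) Gr_eq[OF ident_hom] cmp_ident)
next
case (6 f x y)
then show ?case by (auto simp: T0_Hom T0_sel(4,5) Gr_eq[OF ident_hom] cmp_ident)
next
case (7 f w x g y h z)
then show ?case by (auto simp: T0_Hom T0_sel cmp_assoc)
next
case 8 show ?case unfolding T0_sel by (rule terminal_obj(1))
next
case (9 x y) then show ?case unfolding T0_sel by (rule pr_hom(4))
next
case (10 f x y f' x' y')
then show ?case by (auto simp: T0_Hom T0_sel tns_H pr_hom(4))
next
case (11 x y)
then have o: "x : Obj C" "y : Obj C" unfolding T0_sel by auto
show ?case unfolding T0_sel(4,6) Gr_tens[OF ident_hom[OF o(1)] ident_hom[OF o(2)]] pm_ident[OF o] ..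
next
case (12 f x y g z f' x' y' g' z')
then show ?case by (auto simp: T0_Hom T0_sel tns_cmp)
next
case (13 x y z)
then have o: "x : Obj C" "y : Obj C" "z : Obj C" unfolding T0_sel by auto
show ?case unfolding T0_sel(6,9) using Gr_hom[OF as_hom(1)[OF o]] Gr_iso[OF as_hom(1)[OF o] as_bij[OF o]] by blast
next
case (14 f x x' g y y' h z z')
then obtain \<phi> \<psi> \<chi> where *: "f = (x, \<phi>, x')" "g = (y, \<psi>, y')" "h = (z, \<chi>, z')"
 and o: "x : Obj C" "x' : Obj C" "y : Obj C" "y' : Obj C" "z : Obj C" "z' : Obj C"
 and h: "\<phi> : H x x'" "\<psi> : H y y'" "\<chi> : H z z'" by (auto simp: T0_Hom)
show ?case
 unfolding * T0_sel(7,9) Gr_eq[OF as_hom(1)[OF o(1,3,5)]] Gr_eq[OF as_hom(1)[OF o(2,4,6)]] T0_sel(5)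
 using tns_assoc[OF o h] by simp
next
case (15 x)
then have o: "x : Obj C" unfolding T0_sel .
note p = pr_hom(2)[OF terminal_obj(1) o]
show ?case unfolding T0_sel(6,8,10) using Gr_hom[OF p] Gr_iso[OF p lunit_bij(1)[OF o]] by blast
next
case (16 f x y)
then obtain \<phi> where *: "f = (x, \<phi>, y)" and o: "x : Obj C" "y : Obj C" and h: "\<phi> : H x y" by (auto simp: T0_Hom)
show ?case
 unfolding * T0_sel(4,8,10) Gr_eq[OF pr_hom(2)[OF terminal_obj(1) o(1)]] Gr_eq[OF pr_hom(2)[OF terminal_obj(1) o(2)]]
  Gr_eq[OF ident_hom[OF terminal_obj(1)]] T0_sel(5,7)
 using tns_unit(1)[OF o h] by simp
next
case (17 x)
then have o: "x : Obj C" unfolding T0_sel .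
note p = pr_hom(1)[OF o terminal_obj(1)]
show ?case unfolding T0_sel(6,8,11) using Gr_hom[OF p] Gr_iso[OF p lunit_bij(2)[OF o]] by blast
next
case (18 f x y)
then obtain \<phi> where *: "f = (x, \<phi>, y)" and o: "x : Obj C" "y : Obj C" and h: "\<phi> : H x y" by (auto simp: T0_Hom)
show ?case
 unfolding * T0_sel(4,8,11) Gr_eq[OF pr_hom(1)[OF o(1) terminal_obj(1)]] Gr_eq[OF pr_hom(1)[OF o(2) terminal_obj(1)]]
  Gr_eq[OF ident_hom[OF terminal_obj(1)]] T0_sel(5,7)
 using tns_unit(2)[OF o h] by simp
next
case (19 x y)
then have o: "x : Obj C" "y : Obj C" unfolding T0_sel by auto
show ?case unfolding T0_sel(6,12) by (rule Gr_hom[OF br_hom(1)[OF o]])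
next
case (20 f x x' g y y')
then obtain \<phi> \<psi> where *: "f = (x, \<phi>, x')" "g = (y, \<psi>, y')"
 and o: "x : Obj C" "x' : Obj C" "y : Obj C" "y' : Obj C" and h: "\<phi> : H x x'" "\<psi> : H y y'" by (auto simp: T0_Hom)
show ?case
 unfolding * T0_sel(7,12) Gr_eq[OF br_hom(1)[OF o(1,3)]] Gr_eq[OF br_hom(1)[OF o(2,4)]] T0_sel(5)
 using tns_braid[OF o h] by simp
next
case (21 x y)
then have o: "x : Obj C" "y : Obj C" unfolding T0_sel by auto
show ?case unfolding T0_sel(4,6,12) Gr_comp[OF br_hom(1)[OF o] br_hom(1)[OF o(2,1)]] braid_C[OF o] ..
next
case (22 w x y z)
then have o: "w : Obj C" "x : Obj C" "y : Obj C" "z : Obj C" unfolding T0_sel by auto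
note wx = pr_hom(4)[OF o(1,2)] and xy = pr_hom(4)[OF o(2,3)] and yz = pr_hom(4)[OF o(3,4)]
note iw = ident_hom[OF o(1)] and iz = ident_hom[OF o(4)]
note a1 = as_hom(1)[OF o(2-4)] and a2 = as_hom(1)[OF o(1) xy o(4)] and a3 = as_hom(1)[OF o(1-3)]
 and a4 = as_hom(1)[OF o(1,2) yz] and a5 = as_hom(1)[OF wx o(3,4)]
note p1 = pm_hom[OF iw a1] and p2 = pm_hom[OF a3 iz]
show ?case
 unfolding T0_sel(4,6,9) Gr_tens[OF iw a1] Gr_tens[OF a3 iz] Gr_comp[OF a2 p1] Gr_comp[OF p2 comp_hom[OF a2 p1]]
  Gr_comp[OF a5 a4] pentagon_C[OF o] ..
next
case (23 x y)
then have o: "x : Obj C" "y : Obj C" unfolding T0_sel by auto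
note t = terminal_obj(1)
note i = ident_hom[OF o(1)] ident_hom[OF o(2)]
note a = as_hom(1)[OF o(1) t o(2)]
show ?case
 unfolding T0_sel(4,6,8-11) Gr_tens[OF i(1) pr_hom(2)[OF t o(2)]] Gr_tens[OF pr_hom(1)[OF o(1) t] i(2)]
  Gr_comp[OF a pm_hom[OF i(1) pr_hom(2)[OF t o(2)]]] triangle_C[OF o] ..
next
case (24 x y z)
then have o: "x : Obj C" "y : Obj C" "z : Obj C" unfolding T0_sel by auto
note i = ident_hom[OF o(2)] ident_hom[OF o(3)]
note yz = pr_hom(4)[OF o(2,3)]
note a1 = as_hom(1)[OF o(2,3,1)] and a2 = as_hom(1)[OF o] and a3 = as_hom(1)[OF o(2,1,3)]
note b1 = br_hom(1)[OF o(1) yz] and b2 = br_hom(1)[OF o(1,3)] and b3 = br_hom(1)[OF o(1,2)]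
note p = pm_hom[OF i(1) b2] and q = pm_hom[OF b3 i(2)]
show ?case
 unfolding T0_sel(4,6,9,12) Gr_tens[OF i(1) b2] Gr_tens[OF b3 i(2)] Gr_comp[OF b1 a1] Gr_comp[OF a2 comp_hom[OF b1 a1]]
  Gr_comp[OF a3 p] Gr_comp[OF q comp_hom[OF a3 p]] hexagon_C[OF o] ..
qed

theorem T0_additive: "additive_smc T H"
proof -
interpret T: symmetric_monoidal_category T by (rule T0_smc)
have Hadd: "Hadd T = (%(x, \<phi>, y) (_, \<psi>, _). (x, \<phi> + \<psi>, y))" "Hzero T = (%x y. (x, 0, y))"
 by (simp_all add: T0_def)
show ?thesis
 by unfold_locales (auto simp: T0_Arr T0_sel Hadd T0_Hom H_zero H_add rel_cmp_simps rel_tns_simps)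
qed

end

section \<open>Counting homomorphisms\<close>

context rep_category
begin

text \<open>The converse of the passage from a degree function to \<open>deg\<close>: an isomorphism
  invariant of objects that is multiplicative on exact sequences defines a degree function through
  its values on kernels. It serves both \<open>deg_Rep\<close> and \<open>deg_Vect\<close>.\<close>

lemma degree_functionI:
 fixes d :: "'o => 'k::field"
 assumes iso: "!!i S T. [|i : Hom C S T; bij_betw (fn i) (car S) (car T)|] ==> d S = d T"
  and exact: "!!e S T. [|e : Hom C S T; fn e ` car S = car T|] ==> d S = d (sub S (ker S e)) * d T"
  and zero: "!!S. [|S : Obj C; car S = {zr S}|] ==> d S = 1"
  and \<delta>: "!!e S T. [|e : Hom C S T; fn e ` car S = car T|] ==> \<delta> e = d (sub S (ker S e))"
 shows "degree_function C \<delta>"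
proof -
have sub_iso: "d (sub S A) = d (sub T B)"
 if f: "f : Hom C S T" and A: "is_sub S A" and B: "is_sub T B" and bij: "bij_betw (fn f) A B" for f S T A B
proof -
 note r = restrict_hom[OF f A B bij_betwE[OF bij, rule_format]]
 have "bij_betw (fn (arr (sub S A) (fn f) (sub T B))) A B"
  using bij by (rule bij_betw_cong[THEN iffD1, rotated]) (simp add: r(2))
 then show ?thesis using iso[OF r(1)] sub_obj(2)[OF hom_dom_obj[OF f] A] sub_obj(2)[OF hom_cod_obj[OF f] B] by simp
qed
show ?thesis
proof (intro degree_function.intro regular degree_function_axioms.intro)
 fix x assume x: "x : Obj C"
 note i = ident_in_hom[OF x]
 have "ker x (Ident C x) = {zr x}" using zr_closed[OF x] by (auto simp: ker_def hom_Cod[OF i] fn_ident)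
 then show "\<delta> (Ident C x) = 1"
  using \<delta>[OF i] zero[OF sub_obj(1)[OF x ker_is_sub[OF i]]] sub_obj(2,3)[OF x ker_is_sub[OF i]]
  by (simp add: fn_ident)
next
 fix e e' assume epi: "is_epi C e" "is_epi C e'" and comp: "Cod C e = Dom C e'"
 define X Y Z where "X = Dom C e" and "Y = Cod C e" and "Z = Cod C e'"
 have e: "e : Hom C X Y" and e': "e' : Hom C Y Z"
  using epi_Arr[OF epi(1)] epi_Arr[OF epi(2)] comp by (simp_all add: X_def Y_def Z_def)
 have s: "fn e ` car X = car Y" "fn e' ` car Y = car Z"
  using epi epi_iff[OF e] epi_iff[OF e'] by simp_all
 note c = comp_in_hom[OF e e']
 have "fn (e' \<cdot> e) ` car X = fn e' ` fn e ` car X"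
  unfolding image_image by (rule image_cong[OF refl fn_comp[OF e e']])
 then have sc: "fn (e' \<cdot> e) ` car X = car Z" unfolding s .
 let ?K = "ker X (e' \<cdot> e)" and ?L = "ker Y e'"
 note X = hom_dom_obj[OF e] and Y = hom_cod_obj[OF e]
 note K = ker_is_sub[OF c] and L = ker_is_sub[OF e'] and M = ker_is_sub[OF e]
 have KL: "fn e a : ?L" if "a : ?K" for a
  using that fn_closed[OF e] fn_comp[OF e e'] by (auto simp: ker_def hom_Cod[OF c] hom_Cod[OF e'])
 let ?r = "arr (sub X ?K) (fn e) (sub Y ?L)"
 have r: "?r : Hom C (sub X ?K) (sub Y ?L)" "!!a. a : ?K ==> fn ?r a = fn e a"
  using restrict_hom[OF e K L] KL by blast+
 \<comment> \<open>The kernels form an exact sequence 0 -> ker e -> ker (e' e) -> ker e' -> 0, to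
   which multiplicativity comes down.\<close>
 have "fn ?r ` ?K = ?L"
 proof (intro equalityI subsetI)
  fix b assume "b : fn ?r ` ?K" then show "b : ?L" using r(2) KL by auto
 next
  fix b assume b: "b : ?L"
  then obtain a where a: "a : car X" "b = fn e a" using s(1) unfolding ker_def by blast
  then have "a : ?K" using b fn_comp[OF e e'] by (simp add: ker_def hom_Cod[OF c] hom_Cod[OF e'])
  then show "b : fn ?r ` ?K" using r(2) a by auto
 qed
 then have 1: "d (sub X ?K) = d (sub (sub X ?K) (ker (sub X ?K) ?r)) * d (sub Y ?L)"
  using exact[OF r(1)] by (simp add: sub_obj(2)[OF X K] sub_obj(2)[OF Y L])
 have ker: "ker (sub X ?K) ?r = ker X e"
 proof -
  have "a : ?K" if "a : ker X e" for a
   using that fn_comp[OF e e'] fn_zr[OF e'] by (simp add: ker_def hom_Cod[OF e] hom_Cod[OF c])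
  moreover have "ker (sub X ?K) ?r = {a : ?K. fn e a = zr Y}"
   unfolding ker_def[of "sub X ?K"] sub_obj(2)[OF X K] hom_Cod[OF r(1)] sub_obj(3)[OF Y L]
   by (rule Collect_cong, rule conj_cong[OF refl], simp only: r(2))
  moreover have "{a : ?K. fn e a = zr Y} = {a : ker X e. a : ?K}" by (auto simp: ker_def hom_Cod[OF e])
  ultimately show ?thesis by blast
 qed
 have "d (sub (sub X ?K) (ker X e)) = d (sub X (ker X e))"
 proof (rule sub_iso[OF incl_hom[OF X K] _ M])
  show "is_sub (sub X ?K) (ker X e)" using ker_is_sub[OF r(1)] ker by simp
  have "a : ?K" if "a : ker X e" for a
   using that fn_comp[OF e e'] fn_zr[OF e'] by (simp add: ker_def hom_Cod[OF e] hom_Cod[OF c])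
  then show "bij_betw (fn (incl X ?K)) (ker X e) (ker X e)"
   by (simp add: bij_betw_def inj_on_def fn_incl[OF X K])
 qed
 then show "\<delta> (e' \<cdot> e) = \<delta> e' * \<delta> e" using 1 by (simp add: ker \<delta>[OF c sc] \<delta>[OF e s(1)] \<delta>[OF e' s(2)])
next
 fix e g p q assume epi: "is_epi C e" and pb: "is_pullback C e g p q"
 define X Y Z W where "X = Dom C e" and "Y = Dom C g" and "Z = Cod C e" and "W = Dom C p"
 have e: "e : Hom C X Z" by (simp add: X_def Z_def epi_Arr[OF epi])
 have g: "g : Hom C Y Z"
  using pb unfolding is_pullback_def commuting_square_def Hom_def Y_def Z_def by simp
 note d = pullbackD[OF pb e g, folded W_def]
 have s: "fn e ` car X = car Z" using epi epi_iff[OF e] by simp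
 have sq: "fn q ` car W = car Y"
 proof (intro equalityI subsetI)
  fix b assume b: "b : car Y"
  obtain a where "a : car X" "fn g b = fn e a" using fn_closed[OF g b] s by (metis imageE)
  then have "(a, b) : (%w. (fn p w, fn q w)) ` car W"
   unfolding bij_betw_imp_surj_on[OF d(3)] pb_rel_def using b by simp
  then show "b : fn q ` car W" by auto
 qed (use fn_closed[OF d(2)] in blast)
 have pr: "fn p w : car X" "fn q w : car Y" "fn e (fn p w) = fn g (fn q w)" if "w : car W" for w
  using bij_betwE[OF d(3)] that unfolding pb_rel_def by auto
 \<comment> \<open>Invariance under pullback holds because a base change has, up to isomorphism, the
   same kernel.\<close>
 have "bij_betw (fn p) (ker W q) (ker X e)"
  unfolding bij_betw_def
 proof (intro conjI inj_onI equalityI subsetI)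
  fix w w' assume "w : ker W q" "w' : ker W q" "fn p w = fn p w'"
  then show "w = w'"
   using inj_onD[OF bij_betw_imp_inj_on[OF d(3)], of w w'] by (simp add: ker_def)
 next
  fix a assume "a : fn p ` ker W q"
  then show "a : ker X e" using pr fn_zr[OF g] by (auto simp: ker_def hom_Cod[OF e] hom_Cod[OF d(2)])
 next
  fix a assume "a : ker X e"
  then have "(a, zr Y) : (%w. (fn p w, fn q w)) ` car W"
   unfolding bij_betw_imp_surj_on[OF d(3)] pb_rel_def
   using fn_zr[OF g] zr_closed[OF hom_dom_obj[OF g]] by (simp add: ker_def hom_Cod[OF e])
  then show "a : fn p ` ker W q" by (auto simp: ker_def hom_Cod[OF d(2)])
 qed
 then show "\<delta> q = \<delta> e"
  unfolding \<delta>[OF d(2) sq] \<delta>[OF e s] by (rule sub_iso[OF d(1) ker_is_sub[OF d(2)] ker_is_sub[OF e]])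
qed
qed

text \<open>The kernel of the equivariant projection is an invariant complement, since c = (c -
  \<pi> c) + \<pi> c.\<close>

lemma complement:
 assumes S: "S : Obj C" and A: "is_sub S A"
 shows "\<exists>\<pi>\<in>Hom C S S. fn \<pi> ` car S = A & (ALL a:A. fn \<pi> a = a) & is_sub S (ker S \<pi>)
  & bij_betw (%(b, a). pl S b a) (ker S \<pi> \<times> A) (car S)"
proof -
obtain \<pi> where \<pi>: "\<pi> : Hom C S S" "!!a. a : car S ==> fn \<pi> a : A" "!!a. a : A ==> fn \<pi> a = a"
 using projection[OF S A] by blast
have Ac: "a : car S" if "a : A" for a using A that unfolding is_sub_def by blast
have kD: "b : car S" "fn \<pi> b = zr S" if "b : ker S \<pi>" for b using that by (simp_all add: ker_def hom_Cod[OF \<pi>(1)])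
have \<pi>pl: "fn \<pi> (pl S b a) = a" if "b : ker S \<pi>" "a : A" for a b
 using that \<pi>(3) by (simp add: fn_pl[OF \<pi>(1)] kD Ac zr_pl[OF S])
have cancel: "pl S (pl S b a) (sm S (-1) a) = b" if "a : car S" "b : car S" for a b
 using that by (simp add: pl_assoc[OF S] sm_closed[OF S] pl_neg[OF S] pl_zr[OF S])
have "fn \<pi> ` car S = A" using \<pi>(2,3) Ac by (auto simp: image_iff) metis
moreover have "bij_betw (%(b, a). pl S b a) (ker S \<pi> \<times> A) (car S)"
 unfolding bij_betw_def
proof (intro conjI inj_onI equalityI subsetI)
 fix s t assume "s : ker S \<pi> \<times> A" "t : ker S \<pi> \<times> A" "(case s of (b, a) => pl S b a) = (case t of (b, a) => pl S b a)"
 then show "s = t" using \<pi>pl cancel kD(1) Ac by (cases s; cases t) (simp, metis)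
next
 fix c assume "c : (%(b, a). pl S b a) ` (ker S \<pi> \<times> A)"
 then show "c : car S" using kD(1) Ac pl_closed[OF S] by auto
next
 fix c assume c: "c : car S"
 note p = Ac[OF \<pi>(2)[OF c]]
 note m = sm_closed[OF S p, of "-1"]
 have "pl S c (sm S (-1) (fn \<pi> c)) : ker S \<pi>"
  using \<pi>(3)[OF \<pi>(2)[OF c]]
  by (simp add: ker_def hom_Cod[OF \<pi>(1)] pl_closed[OF S c m] fn_pl[OF \<pi>(1) c m] fn_sm[OF \<pi>(1) p] pl_neg[OF S p])
 moreover have "c = pl S (pl S c (sm S (-1) (fn \<pi> c))) (fn \<pi> c)"
  by (simp add: pl_assoc[OF S c m p] pl_comm[OF S m p] pl_neg[OF S p] pl_zr[OF S c])
 ultimately show "c : (%(b, a). pl S b a) ` (ker S \<pi> \<times> A)" using \<pi>(2)[OF c] by (auto simp: image_iff)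
qed
ultimately show ?thesis using \<pi>(1,3) ker_is_sub[OF \<pi>(1)] by blast
qed

text \<open>A recursive sum, so that additivity and decompositions can be handled by induction;
  \<open>finsum_eq_fs\<close> matches it with the sum in \<open>irr_decomposition\<close>.\<close>

primrec fs :: "'o => (nat => 'u) => nat => 'u" where
 "fs S u 0 = zr S"
| "fs S u (Suc n) = pl S (fs S u n) (u n)"

lemma fs_cong: "(!!i. i < n ==> u i = w i) ==> fs S u n = fs S w n"
 by (induction n) simp_all

lemma fs_closed: "[|S : Obj C; !!i. i < n ==> u i : car S|] ==> fs S u n : car S"
 by (induction n) (simp_all add: zr_closed pl_closed)

lemma fs_pl:
 assumes S: "S : Obj C" and "!!i. i < n ==> u i : car S" "!!i. i < n ==> w i : car S"
 shows "fs S (%i. pl S (u i) (w i)) n = pl S (fs S u n) (fs S w n)"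
 using assms(2,3)
proof (induction n)
case 0 show ?case by (simp add: pl_zr[OF S zr_closed[OF S]])
next
case (Suc n)
then have c: "fs S u n : car S" "fs S w n : car S" "u n : car S" "w n : car S" by (auto intro!: fs_closed[OF S])
have "pl S (pl S (fs S u n) (fs S w n)) (pl S (u n) (w n)) = pl S (fs S u n) (pl S (pl S (fs S w n) (u n)) (w n))"
 using c by (simp add: pl_assoc[OF S] pl_closed[OF S])
also have "... = pl S (fs S u n) (pl S (pl S (u n) (fs S w n)) (w n))" by (simp only: pl_comm[OF S c(2,3)])
also have "... = pl S (pl S (fs S u n) (u n)) (pl S (fs S w n) (w n))"
 using c by (simp add: pl_assoc[OF S] pl_closed[OF S])
finally show ?case using Suc by simp
qed

lemma fs_additive:
 assumes S: "S : Obj C" and "!!i. i < n ==> u i : car S" and "\<phi> (zr S) = zr T"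
  and add: "!!a b. [|a : car S; b : car S|] ==> \<phi> (pl S a b) = pl T (\<phi> a) (\<phi> b)"
 shows "\<phi> (fs S u n) = fs T (%i. \<phi> (u i)) n"
 using assms(2) by (induction n) (simp_all add: assms(3) add fs_closed[OF S])

lemma fs_zero: "S : Obj C ==> fs S (%_. zr S) n = zr S"
 by (induction n) (simp_all add: pl_zr zr_closed)

lemma fs_single:
 assumes S: "S : Obj C" and "i < n" "a : car S"
 shows "fs S (%j. if j = i then a else zr S) n = a"
 using assms(2)
proof (induction n)
case (Suc n)
show ?case
proof (cases "i = n")
 case True
 have "fs S (%j. if j = i then a else zr S) n = fs S (%_. zr S) n" by (rule fs_cong) (simp add: True)
 then show ?thesis using assms(3) by (simp add: True fs_zero[OF S] zr_pl[OF S])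
next
 case False
 then show ?thesis using Suc assms(3) by (simp add: pl_zr[OF S])
qed
qed simp

text \<open>The universal property of a finite direct sum, in the form of a count: an arrow to
  \<open>I\<close> amounts to one arrow on each summand.\<close>

lemma hom_count:
 assumes S: "S : Obj C" and I: "I : Obj C" and U: "!!i. i < n ==> is_sub S (U i)"
  and bij: "bij_betw (%u. fs S u n) (Pi\<^sub>E {..<n} U) (car S)"
 shows "card (Hom C S I) = (\<Prod>i<n. card (Hom C (sub S (U i)) I))"
proof -
\<comment> \<open>The components of a vector. By the uniqueness of decompositions, recorded in
  \<open>decI\<close>, each component is linear and equivariant.\<close>
define dec where "dec = inv_into (Pi\<^sub>E {..<n} U) (%u. fs S u n)"
have Uc: "a : car S" if "i < n" "a : U i" for i a using U[OF that(1)] that(2) unfolding is_sub_def by blast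
have decP: "dec a : Pi\<^sub>E {..<n} U" "fs S (dec a) n = a" if "a : car S" for a
proof -
 have *: "a : (%u. fs S u n) ` (Pi\<^sub>E {..<n} U)" using that bij_betw_imp_surj_on[OF bij] by simp
 show "dec a : Pi\<^sub>E {..<n} U" unfolding dec_def by (rule inv_into_into[OF *])
 show "fs S (dec a) n = a" unfolding dec_def by (rule f_inv_into_f[OF *])
qed
have decU: "dec a i : U i" if "a : car S" "i < n" for a i using decP(1)[OF that(1)] that(2) by (simp add: PiE_mem)
note decc = Uc[OF _ decU]
have decI: "dec a i = u i" if "a : car S" "i < n" "!!i. i < n ==> u i : U i" "fs S u n = a" for a i u
proof -
 have "restrict u {..<n} : Pi\<^sub>E {..<n} U" using that(3) by auto
 moreover have "fs S (restrict u {..<n}) n = fs S u n" by (rule fs_cong) simp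
 then have "fs S (restrict u {..<n}) n = fs S (dec a) n" using decP(2)[OF that(1)] that(4) by simp
 ultimately have "restrict u {..<n} = dec a" using inj_onD[OF bij_betw_imp_inj_on[OF bij]] decP(1)[OF that(1)] by blast
 then show ?thesis using that(2) by (metis lessThan_iff restrict_apply')
qed
have dec_pl: "dec (pl S a b) i = pl S (dec a i) (dec b i)" if "a : car S" "b : car S" "i < n" for a b i
 by (rule decI[OF pl_closed[OF S that(1,2)] that(3), of "%i. pl S (dec a i) (dec b i)"])
  (use U that decU decc decP in "auto simp: is_sub_def fs_pl[OF S]")
have dec_sm: "dec (sm S c a) i = sm S c (dec a i)" if "a : car S" "i < n" for a c i
 by (rule decI[OF sm_closed[OF S that(1)] that(2), of "%i. sm S c (dec a i)"])
  (use U that decU decc decP fs_additive[OF S, of n "dec a" "sm S c" S] in "auto simp: is_sub_def sm_zr[OF S] sm_pl[OF S]")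
have dec_ac: "dec (ac S g a) i = ac S g (dec a i)" if "a : car S" "i < n" "g : carrier G" for a g i
 by (rule decI[OF ac_closed[OF S that(3,1)] that(2), of "%i. ac S g (dec a i)"])
  (use U that decU decc decP fs_additive[OF S, of n "dec a" "ac S g" S] in "auto simp: is_sub_def ac_zr[OF S] ac_pl[OF S]")
have dec_in: "dec a j = (if j = i then a else zr S)" if "i < n" "a : U i" "j < n" for a i j
 by (rule decI[OF Uc[OF that(1,2)] that(3)])
  (use that U fs_single[OF S that(1) Uc[OF that(1,2)]] in "auto simp: is_sub_def")
\<comment> \<open>Restriction to the summands; its inverse \<open>\<Psi>\<close> applies the given
  arrows to the components and adds up.\<close>
define \<Theta> where "\<Theta> f = (\<lambda>i\<in>{..<n}. f \<cdot> incl S (U i))" for f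
define \<Psi> where "\<Psi> h = arr S (%a. fs I (%i. fn (h i) (dec a i)) n) I" for h
have hom: "h i : Hom C (sub S (U i)) I" if "h : (\<Pi>\<^sub>E i\<in>{..<n}. Hom C (sub S (U i)) I)" "i < n" for h i
 using PiE_mem[OF that(1), of i] that(2) by simp
have \<Psi>: "\<Psi> h : Hom C S I" if h: "h : (\<Pi>\<^sub>E i\<in>{..<n}. Hom C (sub S (U i)) I)" for h
 unfolding \<Psi>_def
proof (rule arr_hom[OF S I])
 have m: "fn (h i) (dec a i) : car I" if "a : car S" "i < n" for a i
  by (rule fn_closed[OF hom[OF h that(2)]]) (simp add: sub_obj(2)[OF S U[OF that(2)]] decU[OF that])
 fix a assume a: "a : car S"
 show "fs I (%i. fn (h i) (dec a i)) n : car I" by (rule fs_closed[OF I m[OF a]])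
 have L: "i < n ==> dec b i : car (sub S (U i))" if "b : car S" for b i using decU[OF that] sub_obj(2)[OF S U] by simp
 show "fs I (%i. fn (h i) (dec (pl S a b) i)) n = pl I (fs I (%i. fn (h i) (dec a i)) n) (fs I (%i. fn (h i) (dec b i)) n)"
  if b: "b : car S" for b
 proof -
  have "fs I (%i. fn (h i) (dec (pl S a b) i)) n = fs I (%i. pl I (fn (h i) (dec a i)) (fn (h i) (dec b i))) n"
  proof (rule fs_cong)
   fix i assume i: "i < n"
   show "fn (h i) (dec (pl S a b) i) = pl I (fn (h i) (dec a i)) (fn (h i) (dec b i))"
    using fn_pl[OF hom[OF h i] L[OF a i] L[OF b i]] by (simp only: sub_obj(4)[OF S U[OF i]] dec_pl[OF a b i])
  qed
  also have "... = pl I (fs I (%i. fn (h i) (dec a i)) n) (fs I (%i. fn (h i) (dec b i)) n)"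
   by (rule fs_pl[OF I m[OF a] m[OF b]])
  finally show ?thesis .
 qed
 show "fs I (%i. fn (h i) (dec (sm S c a) i)) n = sm I c (fs I (%i. fn (h i) (dec a i)) n)" for c
 proof -
  have "fs I (%i. fn (h i) (dec (sm S c a) i)) n = fs I (%i. sm I c (fn (h i) (dec a i))) n"
  proof (rule fs_cong)
   fix i assume i: "i < n"
   show "fn (h i) (dec (sm S c a) i) = sm I c (fn (h i) (dec a i))"
    using fn_sm[OF hom[OF h i] L[OF a i]] by (simp only: sub_obj(5)[OF S U[OF i]] dec_sm[OF a i])
  qed
  also have "... = sm I c (fs I (%i. fn (h i) (dec a i)) n)"
   by (rule fs_additive[symmetric, OF I m[OF a] sm_zr[OF I] sm_pl[OF I]])
  finally show ?thesis .
 qed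
 show "fs I (%i. fn (h i) (dec (ac S g a) i)) n = ac I g (fs I (%i. fn (h i) (dec a i)) n)" if g: "g : carrier G" for g
 proof -
  have "fs I (%i. fn (h i) (dec (ac S g a) i)) n = fs I (%i. ac I g (fn (h i) (dec a i))) n"
  proof (rule fs_cong)
   fix i assume i: "i < n"
   show "fn (h i) (dec (ac S g a) i) = ac I g (fn (h i) (dec a i))"
    using fn_ac[OF hom[OF h i] g L[OF a i]]
    by (simp only: sub_obj(6)[OF S U[OF i] g decU[OF a i]] dec_ac[OF a i g])
  qed
  also have "... = ac I g (fs I (%i. fn (h i) (dec a i)) n)"
   by (rule fs_additive[symmetric, OF I m[OF a] ac_zr[OF I g] ac_pl[OF I g]])
  finally show ?thesis .
 qed
qed
have "bij_betw \<Theta> (Hom C S I) (\<Pi>\<^sub>E i\<in>{..<n}. Hom C (sub S (U i)) I)"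
proof (rule bij_betw_byWitness[where f'=\<Psi>])
 have \<Theta>E: "\<Theta> f : (\<Pi>\<^sub>E i\<in>{..<n}. Hom C (sub S (U i)) I)" if "f : Hom C S I" for f
  unfolding \<Theta>_def restrict_PiE_iff using comp_in_hom[OF incl_hom[OF S U] that] by simp
 then show "\<Theta> ` Hom C S I <= (\<Pi>\<^sub>E i\<in>{..<n}. Hom C (sub S (U i)) I)" by blast
 show "\<Psi> ` (\<Pi>\<^sub>E i\<in>{..<n}. Hom C (sub S (U i)) I) <= Hom C S I" using \<Psi> by blast
 have \<Theta>fn: "fn (\<Theta> f i) a = fn f a" if "f : Hom C S I" "i < n" "a : U i" for f i a
  using fn_comp[OF incl_hom[OF S U[OF that(2)]] that(1)] fn_incl[OF S U[OF that(2)] that(3)] that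
  by (simp add: \<Theta>_def sub_obj(2)[OF S U[OF that(2)]])
 show "ALL f:Hom C S I. \<Psi> (\<Theta> f) = f"
 proof
  fix f assume f: "f : Hom C S I"
  show "\<Psi> (\<Theta> f) = f"
  proof (rule hom_eqI[OF \<Psi>[OF \<Theta>E[OF f]] f])
   fix a assume a: "a : car S"
   have "fn (\<Psi> (\<Theta> f)) a = fs I (%i. fn (\<Theta> f i) (dec a i)) n" by (simp add: \<Psi>_def fn_arr a)
   also have "... = fs I (%i. fn f (dec a i)) n" by (rule fs_cong) (rule \<Theta>fn[OF f _ decU[OF a]])
   also have "... = fn f (fs S (dec a) n)"
    by (rule fs_additive[symmetric, OF S decc[OF _ a] fn_zr[OF f] fn_pl[OF f]])
   finally show "fn (\<Psi> (\<Theta> f)) a = fn f a" unfolding decP(2)[OF a] .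
  qed
 qed
 show "ALL h:\<Pi>\<^sub>E i\<in>{..<n}. Hom C (sub S (U i)) I. \<Theta> (\<Psi> h) = h"
 proof
  fix h assume h: "h : (\<Pi>\<^sub>E i\<in>{..<n}. Hom C (sub S (U i)) I)"
  show "\<Theta> (\<Psi> h) = h"
  proof (rule PiE_ext[OF \<Theta>E[OF \<Psi>[OF h]] h])
   fix i assume "i : {..<n}"
   then have i: "i < n" by simp
   show "\<Theta> (\<Psi> h) i = h i"
   proof (rule hom_eqI[OF _ hom[OF h i]])
    show "\<Theta> (\<Psi> h) i : Hom C (sub S (U i)) I" by (rule hom[OF \<Theta>E[OF \<Psi>[OF h]] i])
    fix a assume "a : car (sub S (U i))"
    then have a: "a : U i" by (simp add: sub_obj(2)[OF S U[OF i]])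
    note m = fn_closed[OF hom[OF h i], unfolded sub_obj(2)[OF S U[OF i]], OF a]
    have "fn (\<Theta> (\<Psi> h) i) a = fn (\<Psi> h) a" by (rule \<Theta>fn[OF \<Psi>[OF h] i a])
    also have "... = fs I (%j. fn (h j) (dec a j)) n" unfolding \<Psi>_def by (rule fn_arr[OF Uc[OF i a]])
    also have "... = fs I (%j. if j = i then fn (h i) a else zr I) n"
     by (rule fs_cong) (use dec_in[OF i a] fn_zr[OF hom[OF h]] sub_obj(3)[OF S U] in auto)
    finally show "fn (\<Theta> (\<Psi> h) i) a = fn (h i) a" unfolding fs_single[OF I i m] .
   qed
  qed
 qed
qed
from bij_betw_same_card[OF this] show ?thesis by (simp add: card_PiE)
qed

lemma finite_Hom: assumes "S : Obj C" "T : Obj C" shows "finite (Hom C S T)"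
proof (rule finite_subset)
show "Hom C S T <= (%\<phi>. (S, \<phi>, T)) ` (car S \<rightarrow>\<^sub>E car T)"
proof
 fix f assume "f : Hom C S T"
 moreover obtain S' \<phi> T' where "f = (S', \<phi>, T')" by (cases f)
 ultimately show "f : (%\<phi>. (S, \<phi>, T)) ` (car S \<rightarrow>\<^sub>E car T)" by (auto simp: hom_iff PiE_def)
qed
show "finite ((%\<phi>. (S, \<phi>, T)) ` (car S \<rightarrow>\<^sub>E car T))"
 using assms by (intro finite_imageI finite_PiE) (auto simp: car_finite)
qed

lemma card_Hom_iso:
 assumes i: "i : Hom C X Y" and bij: "bij_betw (fn i) (car X) (car Y)"
 shows "card (Hom C Y I) = card (Hom C X I)" (is ?P) "card (Hom C I X) = card (Hom C I Y)" (is ?P1)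
proof -
obtain j where j: "j : Hom C Y X" "j \<cdot> i = Ident C X" "i \<cdot> j = Ident C Y" using inverse_ex[OF i bij] by blast
have "bij_betw (%f. f \<cdot> i) (Hom C Y I) (Hom C X I)"
 by (rule bij_betw_byWitness[where f'="%f. f \<cdot> j"])
  (use comp_hom[OF i] comp_hom[OF j(1)] comp_assoc[OF i j(1)] comp_assoc[OF j(1) i] ident_right j in auto)
then show ?P by (rule bij_betw_same_card)
have "bij_betw (%f. i \<cdot> f) (Hom C I X) (Hom C I Y)"
 by (rule bij_betw_byWitness[where f'="%f. j \<cdot> f"])
  (use comp_hom[OF _ i] comp_hom[OF _ j(1)] comp_assoc[OF _ i j(1), symmetric] comp_assoc[OF _ j(1) i, symmetric] ident_left j in auto)
then show ?P1 by (rule bij_betw_same_card)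
qed

text \<open>By Maschke the kernel has an invariant complement \<open>?B\<close>, which
  \<open>e\<close> maps isomorphically onto \<open>T\<close>; the sequence splits and the count for
  direct sums applies.\<close>

lemma card_Hom_exact:
 assumes e: "e : Hom C S T" and surj: "fn e ` car S = car T" and I: "I : Obj C"
 shows "card (Hom C S I) = card (Hom C (sub S (ker S e)) I) * card (Hom C T I)"
proof -
note S = hom_dom_obj[OF e] and T = hom_cod_obj[OF e] and K = ker_is_sub[OF e]
obtain \<pi> where \<pi>: "\<pi> : Hom C S S" "is_sub S (ker S \<pi>)"
 "bij_betw (%(b, a). pl S b a) (ker S \<pi> \<times> ker S e) (car S)" using complement[OF S K] by blast
let ?B = "ker S \<pi>" and ?K = "ker S e"
let ?U = "%i::nat. if i = 0 then ?B else ?K"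
have Bc: "b : car S" if "b : ?B" for b using that by (simp add: ker_def)
have Kc: "a : car S" "fn e a = zr T" if "a : ?K" for a using that by (simp_all add: ker_def hom_Cod[OF e])
\<comment> \<open>\<open>hom_count\<close> expects a family over an initial segment, so the pair of
  summands becomes a family indexed by 0 and 1.\<close>
have "bij_betw (%u. (u (0::nat), u 1)) (Pi\<^sub>E {..<2} ?U) (?B \<times> ?K)"
proof (rule bij_betw_byWitness[where f'="%(b, a). \<lambda>i\<in>{..<2}. if i = 0 then b else a"])
 show "ALL u:Pi\<^sub>E {..<2} ?U. (case (u 0, u 1) of (b, a) => \<lambda>i\<in>{..<2}. if i = 0 then b else a) = u"
 proof
  fix u assume u: "u : Pi\<^sub>E {..<2} ?U"
  have "(\<lambda>i\<in>{..<2::nat}. if i = 0 then u 0 else u 1) = u"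
  proof (rule ext)
   fix i show "(\<lambda>i\<in>{..<2::nat}. if i = 0 then u 0 else u 1) i = u i"
    using PiE_arb[OF u, of i] by (cases "i < 2") (auto simp: less_2_cases_iff)
  qed
  then show "(case (u 0, u 1) of (b, a) => \<lambda>i\<in>{..<2}. if i = 0 then b else a) = u"
   by (simp only: case_prod_conv)
 qed
 show "ALL s:?B \<times> ?K. ((case s of (b, a) => \<lambda>i\<in>{..<2::nat}. if i = 0 then b else a) 0,
   (case s of (b, a) => \<lambda>i\<in>{..<2::nat}. if i = 0 then b else a) 1) = s" by (simp add: split_beta)
 show "(%u. (u 0, u 1)) ` Pi\<^sub>E {..<2} ?U <= ?B \<times> ?K"
 proof
  fix t assume "t : (%u. (u 0, u 1)) ` Pi\<^sub>E {..<2} ?U"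
  then obtain u where u: "u : Pi\<^sub>E {..<2} ?U" "t = (u 0, u 1)" by blast
  show "t : ?B \<times> ?K" using PiE_mem[OF u(1), of 0] PiE_mem[OF u(1), of 1] u(2) by simp
 qed
 show "(%(b, a). \<lambda>i\<in>{..<2}. if i = 0 then b else a) ` (?B \<times> ?K) <= Pi\<^sub>E {..<2} ?U"
 proof
  fix t assume "t : (%(b, a). \<lambda>i\<in>{..<2::nat}. if i = 0 then b else a) ` (?B \<times> ?K)"
  then obtain s where s: "s : ?B \<times> ?K" "t = (case s of (b, a) => \<lambda>i\<in>{..<2::nat}. if i = 0 then b else a)" by blast
  obtain b a where ba: "s = (b, a)" by (cases s)
  have "b : ?B" "a : ?K" using s(1) ba by blast+
  then show "t : Pi\<^sub>E {..<2} ?U" unfolding s(2) ba case_prod_conv restrict_PiE_iff by simp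
 qed
qed
from bij_betw_trans[OF this \<pi>(3)]
have "bij_betw (%u. fs S u 2) (Pi\<^sub>E {..<2} ?U) (car S)"
proof (rule bij_betw_cong[THEN iffD1, rotated])
 fix u assume u: "u : Pi\<^sub>E {..<2} ?U"
 have "u 0 : car S" using PiE_mem[OF u, of 0] Bc by simp
 then show "((%(b, a). pl S b a) \<circ> (%u. (u 0, u 1))) u = fs S u 2" by (simp add: numeral_2_eq_2 zr_pl[OF S])
qed
from hom_count[OF S I _ this] have 1: "card (Hom C S I) = card (Hom C (sub S ?B) I) * card (Hom C (sub S ?K) I)"
 using \<pi>(2) K by (simp add: numeral_2_eq_2)
let ?r = "e \<cdot> incl S ?B"
note i = incl_hom[OF S \<pi>(2)]
note r = comp_in_hom[OF i e]
have fr: "fn ?r b = fn e b" if "b : ?B" for b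
 using fn_comp[OF i e] that by (simp add: sub_obj(2)[OF S \<pi>(2)] fn_incl[OF S \<pi>(2)])
have "bij_betw (fn ?r) ?B (car T)"
 unfolding bij_betw_def
proof (intro conjI inj_onI equalityI subsetI)
 fix b b' assume b: "b : ?B" "b' : ?B" and eq: "fn ?r b = fn ?r b'"
 \<comment> \<open>The difference of two vectors of the complement with the same image lies in the
   kernel, so b + d and b' + 0 are two decompositions of b' and must coincide.\<close>
 let ?d = "pl S b' (sm S (-1) b)"
 have n: "sm S (-1) b : car S" "?d : car S" using b by (simp_all add: sm_closed[OF S] pl_closed[OF S] Bc)
 have "fn e ?d = zr T"
  using b n eq fr fn_closed[OF e Bc[OF b(2)]] by (simp add: fn_pl[OF e] fn_sm[OF e] Bc pl_neg[OF T])
 then have "?d : ?K" using n by (simp add: ker_def hom_Cod[OF e])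
 moreover have "pl S b ?d = pl S b' (zr S)"
  using b n(1) by (simp add: Bc pl_assoc[OF S, symmetric] pl_comm[OF S, of b b'])
   (simp add: Bc pl_assoc[OF S] pl_neg[OF S])
 moreover have "zr S : ?K" using K by (simp add: is_sub_def)
 ultimately have "(b, ?d) = (b', zr S)"
  using b by (intro inj_onD[OF bij_betw_imp_inj_on[OF \<pi>(3)]]) auto
 then show "b = b'" by simp
next
 fix c assume "c : fn ?r ` ?B"
 then show "c : car T" using fr fn_closed[OF e Bc] by auto
next
 fix c assume "c : car T"
 then obtain a where a: "a : car S" "c = fn e a" using surj by blast
 have "a : (%(b, a). pl S b a) ` (?B \<times> ?K)" unfolding bij_betw_imp_surj_on[OF \<pi>(3)] by (rule a(1))
 then obtain s where "s : ?B \<times> ?K" "a = (case s of (b, a) => pl S b a)" by blast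
 then obtain b k where bk: "b : ?B" "k : ?K" "a = pl S b k" by (cases s) (simp, blast)
 have "c = fn ?r b"
  using bk by (simp add: a(2) fn_pl[OF e] Bc Kc fr pl_zr[OF T] fn_closed[OF e])
 then show "c : fn ?r ` ?B" using bk(1) by blast
qed
then have "card (Hom C T I) = card (Hom C (sub S ?B) I)"
 using card_Hom_iso(1)[OF r] by (simp add: sub_obj(2)[OF S \<pi>(2)])
then show ?thesis using 1 by simp
qed

end

section \<open>Multiplicities\<close>

locale rep_objects = rep_category G C "%S. S" "%S. S"
 for G :: "('g, 'm) monoid_scheme"
  and C :: "(('f::{field, finite}, 'g, 'u) rep, ('f, 'g, 'u) rep_arr) cat" (structure) +
 assumes C_eq: "C = Rep G"
begin

lemma sub_eq: "sub S A = subrep S A" by (simp add: sub_def)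

lemma subrep_subrep: "subrep (subrep S B) A = subrep S A" by (simp add: subrep_def)

lemma finsum_eq_fs:
 assumes S: "S : Obj C" and "!!i. i < n ==> u i : car S"
 shows "(\<Oplus>\<^bsub>fst S\<^esub>i\<in>{..<n}. u i) = fs S u n"
 using assms(2)
proof (induction n)
case 0
interpret abelian_monoid "fst S" by (rule abelian_monoid_rep[OF S])
show ?case by (simp add: zr_def)
next
case (Suc n)
interpret abelian_monoid "fst S" by (rule abelian_monoid_rep[OF S])
have "(\<Oplus>\<^bsub>fst S\<^esub>i\<in>{..<Suc n}. u i) = u n \<oplus>\<^bsub>fst S\<^esub> (\<Oplus>\<^bsub>fst S\<^esub>i\<in>{..<n}. u i)"
 unfolding lessThan_Suc by (rule finsum_insert) (use Suc.prems in "auto simp: car_def")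
also have "(\<Oplus>\<^bsub>fst S\<^esub>i\<in>{..<n}. u i) = fs S u n" using Suc by simp
also have "u n \<oplus>\<^bsub>fst S\<^esub> fs S u n = pl S (u n) (fs S u n)" by (simp add: pl_def)
also have "... = fs S u (Suc n)" using Suc.prems fs_closed[OF S, of n u] by (simp add: pl_comm[OF S])
finally show ?case .
qed

lemma irreducible_iff:
 "irreducible_rep G S \<longleftrightarrow> S : Obj C & car S ~= {zr S} & (ALL A. is_sub S A --> A = {zr S} | A = car S)"
 unfolding irreducible_rep_def C_eq[symmetric] using is_sub_iff[of S] by (auto simp: car_def zr_def)

lemma irr_decomposition_iff:
 assumes S: "S : Obj C"
 shows "irr_decomposition G S n U \<longleftrightarrow> (\<forall>i<n. is_sub S (U i) & irreducible_rep G (subrep S (U i)))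
  & bij_betw (%u. fs S u n) (Pi\<^sub>E {..<n} U) (car S)"
proof (cases "\<forall>i<n. is_sub S (U i)")
case True
have "(\<Oplus>\<^bsub>fst S\<^esub>i\<in>{..<n}. u i) = fs S u n" if u: "u : Pi\<^sub>E {..<n} U" for u
proof (rule finsum_eq_fs[OF S])
 fix i assume i: "i < n"
 then have "U i <= car S" using True by (simp add: is_sub_def)
 then show "u i : car S" using PiE_mem[OF u, of i] i by auto
qed
then have "bij_betw (%u. \<Oplus>\<^bsub>fst S\<^esub>i\<in>{..<n}. u i) (Pi\<^sub>E {..<n} U) (car S) \<longleftrightarrow> bij_betw (%u. fs S u n) (Pi\<^sub>E {..<n} U) (car S)"
 by (rule bij_betw_cong)
then show ?thesis unfolding irr_decomposition_def is_sub_iff[OF S] car_def by simp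
next
case False
then show ?thesis unfolding irr_decomposition_def is_sub_iff[OF S] by blast
qed

lemma isomorphic_iff: "isomorphic C S T \<longleftrightarrow> (EX i:Hom C S T. bij_betw (fn i) (car S) (car T))"
 unfolding isomorphic_def using iso_iff by blast

lemma sub_sub:
 assumes S: "S : Obj C" and A: "is_sub S A"
 shows "is_sub (sub S A) B \<longleftrightarrow> is_sub S B & B <= A"
proof -
note s = sub_obj[OF S A]
have "A <= car S" using A by (simp add: is_sub_def)
moreover have "(ALL g:carrier G. ALL a:B. ac (sub S A) g a : B) \<longleftrightarrow> (ALL g:carrier G. ALL a:B. ac S g a : B)" if "B <= A"
 by (intro ball_cong refl) (use s(6) that in auto)
ultimately show ?thesis unfolding is_sub_def s(2,3,4,5) by (cases "B <= A") auto
qed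

lemma is_sub_car: "S : Obj C ==> is_sub S (car S)"
 by (simp add: is_sub_def zr_closed pl_closed sm_closed ac_closed)

lemma decomposition_step:
 assumes S: "S : Obj C" and A: "is_sub S A" "irreducible_rep G (subrep S A)" and B: "is_sub S B"
  and bij: "bij_betw (%(b, a). pl S b a) (B \<times> A) (car S)" and U: "irr_decomposition G (subrep S B) n U"
 shows "irr_decomposition G S (Suc n) (U(n := A))"
proof -
note s = sub_obj[OF S B]
have U1: "!!i. i < n ==> is_sub S (U i) & U i <= B" "!!i. i < n ==> irreducible_rep G (subrep S (U i))"
 "bij_betw (%u. fs (sub S B) u n) (Pi\<^sub>E {..<n} U) B"
 using U irr_decomposition_iff[OF s(1)] by (auto simp: sub_eq[symmetric] sub_sub[OF S B] s(2)) (simp add: sub_eq subrep_subrep)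
have fs_eq: "fs (sub S B) u n = fs S u n" for u n by (induction n) (simp_all add: s(3,4))
have fsB: "fs S u n : B" if "!!i. i < n ==> u i : U i" for u
 using fs_closed[OF s(1), of n u] that U1(1) unfolding s(2) fs_eq by blast
have "bij_betw (%u. fs S u (Suc n)) (Pi\<^sub>E {..<Suc n} (U(n := A))) (car S)"
 unfolding bij_betw_def
proof (intro conjI inj_onI equalityI subsetI)
 fix u w assume u: "u : Pi\<^sub>E {..<Suc n} (U(n := A))" and w: "w : Pi\<^sub>E {..<Suc n} (U(n := A))"
  and eq: "fs S u (Suc n) = fs S w (Suc n)"
 have m: "u i : U i" "w i : U i" if "i < n" for i
  using PiE_mem[OF u, of i] PiE_mem[OF w, of i] that by auto
 have mn: "u n : A" "w n : A" using PiE_mem[OF u, of n] PiE_mem[OF w, of n] by auto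
 have "(fs S u n, u n) = (fs S w n, w n)"
  by (rule inj_onD[OF bij_betw_imp_inj_on[OF bij]]) (use eq fsB m mn in auto)
 then have e: "fs S u n = fs S w n" "u n = w n" by auto
 have "restrict u {..<n} = restrict w {..<n}"
 proof (rule inj_onD[OF bij_betw_imp_inj_on[OF U1(3)]])
  have "fs S (restrict u {..<n}) n = fs S u n" "fs S (restrict w {..<n}) n = fs S w n" by (auto intro: fs_cong)
  then show "fs (sub S B) (restrict u {..<n}) n = fs (sub S B) (restrict w {..<n}) n" unfolding fs_eq using e by simp
 qed (simp_all add: restrict_PiE_iff m)
 then have "u i = w i" if "i < n" for i using that by (metis lessThan_iff restrict_apply')
 then show "u = w" by (intro PiE_ext[OF u w]) (auto simp: less_Suc_eq e(2))
next
 fix c assume "c : (%u. fs S u (Suc n)) ` (Pi\<^sub>E {..<Suc n} (U(n := A)))"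
 then obtain u where u: "u : Pi\<^sub>E {..<Suc n} (U(n := A))" "c = fs S u (Suc n)" by blast
 have "u i : U i" if "i < n" for i using PiE_mem[OF u(1), of i] that by auto
 moreover have "u n : A" using PiE_mem[OF u(1), of n] by auto
 ultimately show "c : car S" using bij_betwE[OF bij] fsB u(2) by auto
next
 fix c assume "c : car S"
 then have "c : (%(b, a). pl S b a) ` (B \<times> A)" unfolding bij_betw_imp_surj_on[OF bij] .
 then obtain t where "t : B \<times> A" "c = (case t of (b, a) => pl S b a)" by blast
 then obtain b a where c: "b : B" "a : A" "c = pl S b a" by (cases t) (simp, blast)
 have "b : (%u. fs (sub S B) u n) ` (Pi\<^sub>E {..<n} U)" unfolding bij_betw_imp_surj_on[OF U1(3)] by (rule c(1))
 then obtain u where u: "u : Pi\<^sub>E {..<n} U" "b = fs S u n" unfolding fs_eq by blast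
 have "fs S (u(n := a)) n = fs S u n" by (rule fs_cong) simp
 then have "c = fs S (u(n := a)) (Suc n)" using c(3) u(2) by simp
 moreover have "u(n := a) : Pi\<^sub>E {..<Suc n} (U(n := A))"
  using u(1) c(2) by (auto simp: PiE_iff extensional_def less_Suc_eq)
 ultimately show "c : (%u. fs S u (Suc n)) ` (Pi\<^sub>E {..<Suc n} (U(n := A)))" by blast
qed
moreover have "is_sub S ((U(n := A)) i) & irreducible_rep G (subrep S ((U(n := A)) i))" if "i < Suc n" for i
 using that U1(1,2) A by (auto simp: less_Suc_eq)
ultimately show ?thesis unfolding irr_decomposition_iff[OF S] by blast
qed

text \<open>Induction on the number of vectors: a nonzero invariant subspace of least cardinality is
  irreducible, and it can be split off by Maschke's theorem.\<close>

lemma decomposition_ex: "S : Obj C ==> EX n U. irr_decomposition G S n U"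
proof (induction "card (car S)" arbitrary: S rule: less_induct)
case less
note S = less.prems
show ?case
proof (cases "car S = {zr S}")
 case True
 have "irr_decomposition G S 0 (%_. {})" unfolding irr_decomposition_iff[OF S] True by (simp add: bij_betw_def)
 then show ?thesis by blast
next
 case False
 define P where "P A \<longleftrightarrow> is_sub S A & A ~= {zr S}" for A
 have "P (car S)" using False is_sub_car[OF S] by (simp add: P_def)
 then obtain A where A: "P A" "!!A'. P A' ==> card A <= card A'" using ex_has_least_nat[of P "car S" card] by blast
 have As: "is_sub S A" using A(1) by (simp add: P_def)
 have finA: "finite A" using As car_finite[OF S] finite_subset by (auto simp: is_sub_def)
 have "A' = {zr S} | A' = A" if "is_sub S A'" "A' <= A" for A'
  using A(2)[of A'] that card_seteq[OF finA that(2)] by (auto simp: P_def)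
 then have irr: "irreducible_rep G (subrep S A)"
  unfolding irreducible_iff sub_eq[symmetric] sub_obj(2,3)[OF S As] sub_sub[OF S As]
  using sub_obj(1)[OF S As] A(1) by (auto simp: P_def)
 obtain \<pi> where \<pi>: "is_sub S (ker S \<pi>)" "bij_betw (%(b, a). pl S b a) (ker S \<pi> \<times> A) (car S)"
  using complement[OF S As] by blast
 have "EX a:A. a ~= zr S" "zr S : A" "zr S : ker S \<pi>" using A(1) \<pi>(1) by (auto simp: P_def is_sub_def)
 then obtain a where a: "a : A" "a ~= zr S" by blast
 have fB: "finite (ker S \<pi>)" using car_finite[OF S] by (simp add: ker_def)
 \<comment> \<open>With at least two vectors in \<open>A\<close>, the complement has at most half of
   the vectors of \<open>S\<close>, so the induction hypothesis applies to it.\<close>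
 have "card {zr S, a} <= card A" using a \<open>zr S : A\<close> finA by (intro card_mono) auto
 then have "2 <= card A" using a(2) by simp
 moreover have "0 < card (ker S \<pi>)" using fB \<open>zr S : ker S \<pi>\<close> by (auto simp: card_gt_0_iff)
 moreover have "card (car S) = card (ker S \<pi>) * card A"
  using bij_betw_same_card[OF \<pi>(2)] by (simp add: card_cartesian_product)
 ultimately have "card (car (sub S (ker S \<pi>))) < card (car S)" unfolding sub_obj(2)[OF S \<pi>(1)] by simp
 from less.hyps[OF this sub_obj(1)[OF S \<pi>(1)]] obtain n U where "irr_decomposition G (subrep S (ker S \<pi>)) n U"
  by (auto simp: sub_eq)
 from decomposition_step[OF S As irr \<pi>(1,2) this] show ?thesis by blast
qed
qed

lemma isomorphic_refl: "S : Obj C ==> isomorphic C S S"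
 unfolding isomorphic_iff using ident_in_hom[of S]
 by (intro bexI[of _ "Ident C S"]) (auto simp: bij_betw_def inj_on_def fn_ident)

lemma isomorphic_sym: "isomorphic C S T ==> isomorphic C T S"
 unfolding isomorphic_def is_iso_def using hom_Dom hom_Cod hom_Arr by metis

lemma isomorphic_trans:
 assumes "isomorphic C S T" "isomorphic C T U" shows "isomorphic C S U"
proof -
obtain i j where i: "i : Hom C S T" "bij_betw (fn i) (car S) (car T)" and j: "j : Hom C T U" "bij_betw (fn j) (car T) (car U)"
 using assms unfolding isomorphic_iff by blast
have "bij_betw (fn (j \<cdot> i)) (car S) (car U)"
 using bij_betw_trans[OF i(2) j(2)] by (rule bij_betw_cong[THEN iffD1, rotated]) (simp add: fn_comp[OF i(1) j(1)])
then show ?thesis unfolding isomorphic_iff using comp_in_hom[OF i(1) j(1)] by blast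
qed

lemma schur:
 assumes S: "irreducible_rep G S" and T: "irreducible_rep G T" and f: "f : Hom C S T"
 shows "(ALL a:car S. fn f a = zr T) | bij_betw (fn f) (car S) (car T)"
proof (cases "ker S f = {zr S}")
case True
have inj: "inj_on (fn f) (car S)"
proof (rule inj_onI)
 fix a b assume a: "a : car S" "b : car S" "fn f a = fn f b"
 note SO = hom_dom_obj[OF f] and TO = hom_cod_obj[OF f]
 have m: "sm S (-1) b : car S" by (rule sm_closed[OF SO a(2)])
 have "fn f (pl S a (sm S (-1) b)) = zr T"
  using fn_closed[OF f a(2)] by (simp add: fn_pl[OF f a(1) m] fn_sm[OF f a(2)] a(3) pl_neg[OF TO])
 then have "pl S a (sm S (-1) b) : ker S f" by (simp add: ker_def hom_Cod[OF f] pl_closed[OF SO a(1) m])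
 then show "a = b" using pl_eq_imp[OF SO a(1,2)] True by blast
qed
have "fn f ` car S ~= {zr T}"
proof
 assume *: "fn f ` car S = {zr T}"
 have "car S <= ker S f" using * by (auto simp: ker_def hom_Cod[OF f])
 then show False using True S zr_closed[OF hom_dom_obj[OF f]] unfolding irreducible_iff by blast
qed
then have "fn f ` car S = car T" using image_is_sub[OF f] T unfolding irreducible_iff by blast
then show ?thesis using inj by (simp add: bij_betw_def)
next
case False
then have "ker S f = car S" using ker_is_sub[OF f] S unfolding irreducible_iff by blast
then show ?thesis by (auto simp: ker_def hom_Cod[OF f])
qed

text \<open>By Schur's lemma, between irreducible representations that are not isomorphic the zero
  arrow is the only one, whence the value 1.\<close>

lemma card_Hom_irreducible:
 assumes S: "irreducible_rep G S" and T: "irreducible_rep G T"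
 shows "card (Hom C S T) = (if isomorphic C S T then card (Hom C T T) else 1)"
proof (cases "isomorphic C S T")
case True
then show ?thesis using card_Hom_iso(1) unfolding isomorphic_iff by metis
next
case False
have o: "S : Obj C" "T : Obj C" using S T by (simp_all add: irreducible_iff)
note z = zero_arr[OF o]
have "f = arr S (%_. zr T) T" if f: "f : Hom C S T" for f
proof (rule hom_eqI[OF f z])
 fix a assume a: "a : car S"
 have "\<not> bij_betw (fn f) (car S) (car T)" using False f unfolding isomorphic_iff by blast
 then show "fn f a = fn (arr S (%_. zr T) T) a" using schur[OF S T f] a by (simp add: fn_arr)
qed
then have "Hom C S T = {arr S (%_. zr T) T}" using z by blast
then show ?thesis using False by simp
qed

text \<open>Provides a base greater than 1, so that multiplicities can be read off as exponents; the
  identity and the zero arrow are two distinct endomorphisms.\<close>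

lemma card_End:
 assumes S: "irreducible_rep G S"
 shows "1 < card (Hom C S S)"
proof -
have o: "S : Obj C" and n: "car S ~= {zr S}" using S by (simp_all add: irreducible_iff)
obtain a where a: "a : car S" "a ~= zr S" using n zr_closed[OF o] by blast
have ne: "Ident C S ~= arr S (%_. zr S) S"
proof
 assume "Ident C S = arr S (%_. zr S) S"
 then have "fn (Ident C S) a = fn (arr S (%_. zr S) S) a" by simp
 then show False using a by (simp add: fn_ident fn_arr)
qed
have "card {Ident C S, arr S (%_. zr S) S} <= card (Hom C S S)"
 using ident_in_hom[OF o] zero_arr[OF o o] by (intro card_mono finite_Hom[OF o o]) simp
then show ?thesis using ne by simp
qed

definition "cls S = {T : Obj C. isomorphic C T S}"

lemma Irr_eq: "Irr G = cls ` {S. irreducible_rep G S}"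
 unfolding Irr_def C_eq[symmetric] cls_def by blast

text \<open>By \<open>hom_count\<close> the count is a product over the summands, in which a summand
  isomorphic to \<open>I\<close> contributes the number of endomorphisms of \<open>I\<close> and any
  other one contributes 1.\<close>

lemma card_Hom_decomposition:
 assumes S: "S : Obj C" and dec: "irr_decomposition G S n U" and I: "irreducible_rep G I"
 shows "card (Hom C S I) = card (Hom C I I) ^ card {i. i < n & subrep S (U i) : cls I}"
proof -
have U: "!!i. i < n ==> is_sub S (U i)" "!!i. i < n ==> irreducible_rep G (subrep S (U i))"
 "bij_betw (%u. fs S u n) (Pi\<^sub>E {..<n} U) (car S)" using dec unfolding irr_decomposition_iff[OF S] by blast+
have IO: "I : Obj C" using I by (simp add: irreducible_iff)
have "card (Hom C S I) = (\<Prod>i<n. card (Hom C (sub S (U i)) I))" by (rule hom_count[OF S IO U(1,3)])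
also have "... = (\<Prod>i<n. if subrep S (U i) : cls I then card (Hom C I I) else 1)"
proof (rule prod.cong[OF refl])
 fix i assume "i : {..<n}"
 then have i: "i < n" by simp
 have "subrep S (U i) : cls I \<longleftrightarrow> isomorphic C (subrep S (U i)) I" using U(2)[OF i] by (simp add: cls_def irreducible_iff)
 then show "card (Hom C (sub S (U i)) I) = (if subrep S (U i) : cls I then card (Hom C I I) else 1)"
  unfolding sub_eq using card_Hom_irreducible[OF U(2)[OF i] I] by simp
qed
also have "... = card (Hom C I I) ^ card {i. i < n & subrep S (U i) : cls I}"
 by (simp add: prod.inter_filter[symmetric])
finally show ?thesis .
qed

text \<open>The number of arrows to \<open>I\<close> does not depend on a decomposition and
  determines the exponent. Hence any two decompositions contain the class of \<open>I\<close>
  equally often, and the \<open>THE\<close> in the definition is justified.\<close>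

lemma multiplicity_decomposition:
 assumes S: "S : Obj C" and dec: "irr_decomposition G S n U" and I: "irreducible_rep G I"
 shows "multiplicity_in G S (cls I) = card {i. i < n & subrep S (U i) : cls I}"
 unfolding multiplicity_in_def
proof (rule the_equality)
show "EX n' U'. irr_decomposition G S n' U' & card {i. i < n & subrep S (U i) : cls I} = card {i. i < n' & subrep S (U' i) : cls I}"
 using dec by blast
fix k assume "EX n U. irr_decomposition G S n U & k = card {i. i < n & subrep S (U i) : cls I}"
then obtain n' U' where d: "irr_decomposition G S n' U'" "k = card {i. i < n' & subrep S (U' i) : cls I}" by blast
have "card (Hom C I I) ^ k = card (Hom C I I) ^ card {i. i < n & subrep S (U i) : cls I}"
 unfolding d(2) card_Hom_decomposition[OF S dec I, symmetric] card_Hom_decomposition[OF S d(1) I, symmetric] ..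
then show "k = card {i. i < n & subrep S (U i) : cls I}" unfolding power_inject_exp[OF card_End[OF I]] .
qed

lemma card_Hom_multiplicity:
 assumes S: "S : Obj C" and I: "irreducible_rep G I"
 shows "card (Hom C S I) = card (Hom C I I) ^ multiplicity_in G S (cls I)"
proof -
obtain n U where dec: "irr_decomposition G S n U" using decomposition_ex[OF S] by blast
show ?thesis unfolding card_Hom_decomposition[OF S dec I] multiplicity_decomposition[OF S dec I] ..
qed

lemma multiplicity_eqI:
 assumes S: "S : Obj C" and I: "irreducible_rep G I" and "card (Hom C S I) = card (Hom C I I) ^ k"
 shows "multiplicity_in G S (cls I) = k"
 using card_Hom_multiplicity[OF S I] assms(3) power_inject_exp[OF card_End[OF I]] by simp

lemma multiplicity_iso:
 assumes i: "i : Hom C S T" "bij_betw (fn i) (car S) (car T)" and I: "I : Irr G"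
 shows "multiplicity_in G S I = multiplicity_in G T I"
proof -
obtain I0 where I0: "irreducible_rep G I0" "I = cls I0" using I unfolding Irr_eq by blast
show ?thesis unfolding I0(2)
 using multiplicity_eqI[OF hom_dom_obj[OF i(1)] I0(1)] card_Hom_multiplicity[OF hom_cod_obj[OF i(1)] I0(1)] card_Hom_iso(1)[OF i]
 by simp
qed

text \<open>Counts of arrows to an irreducible multiply along exact sequences, so their exponents
  add.\<close>

lemma multiplicity_exact:
 assumes e: "e : Hom C S T" and surj: "fn e ` car S = car T" and I: "I : Irr G"
 shows "multiplicity_in G S I = multiplicity_in G (sub S (ker S e)) I + multiplicity_in G T I"
proof -
obtain I0 where I0: "irreducible_rep G I0" "I = cls I0" using I unfolding Irr_eq by blast
note S = hom_dom_obj[OF e] and T = hom_cod_obj[OF e] and K = ker_is_sub[OF e]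
have "I0 : Obj C" using I0(1) by (simp add: irreducible_iff)
from card_Hom_exact[OF e surj this] show ?thesis unfolding I0(2)
 unfolding card_Hom_multiplicity[OF T I0(1)] card_Hom_multiplicity[OF sub_obj(1)[OF S K] I0(1)] power_add[symmetric]
 by (rule multiplicity_eqI[OF S I0(1)])
qed

lemma multiplicity_zero:
 assumes S: "S : Obj C" "car S = {zr S}" and I: "I : Irr G"
 shows "multiplicity_in G S I = 0"
proof -
obtain I0 where I0: "irreducible_rep G I0" "I = cls I0" using I unfolding Irr_eq by blast
have "irr_decomposition G S 0 (%_. {})" unfolding irr_decomposition_iff[OF S(1)] S(2) by (simp add: bij_betw_def)
from multiplicity_decomposition[OF S(1) this I0(1)] show ?thesis by (simp add: I0(2))
qed

text \<open>The invariant of objects from which \<open>deg_Rep\<close> arises through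
  \<open>degree_functionI\<close>.\<close>

definition "wgt \<tau> S = (\<Prod>I\<in>Irr G. \<tau> I ^ multiplicity_in G S I)"

lemma hom_mod_hom:
 assumes "e : Hom C S T"
 shows "mod_hom.ker (fst S) (fst T) (fn e) = ker S e"
proof -
have "mod_hom class_ring (fst S) (fst T) (fn e)"
 using assms hom_dom_obj[OF assms, THEN Obj_vs] hom_cod_obj[OF assms, THEN Obj_vs] fn_closed[OF assms] fn_pl[OF assms] fn_sm[OF assms]
 unfolding mod_hom_def mod_hom_axioms_def LinearCombinations.module_hom_def vectorspace_def
 by (auto simp: car_def pl_def sm_def)
then show ?thesis unfolding mod_hom.ker_def by (simp add: ker_def hom_Cod[OF assms] car_def zr_def mod_hom.ker_def)
qed

lemma rker_eq:
 assumes "e : Hom C S T"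
 shows "rker e = sub S (ker S e)"
proof -
obtain S' f T' where "e = (S', f, T')" by (cases e)
then have e: "e = (S, fn e, T)" using assms by (auto simp: hom_iff fn_def)
show ?thesis by (subst e) (simp add: rker_def sub_eq hom_mod_hom[OF assms])
qed

lemma deg_Rep_eq: "e : Hom C S T ==> deg_Rep G \<tau> e = wgt \<tau> (sub S (ker S e))"
 by (simp add: deg_Rep_def wgt_def rker_eq)

theorem degree_Rep: "degree_function C (deg_Rep G (\<tau> :: _ => 'k::field))"
proof (rule degree_functionI[where d="wgt \<tau>"])
fix i S T assume "i : Hom C S T" "bij_betw (fn i) (car S) (car T)"
then show "wgt \<tau> S = wgt \<tau> T" unfolding wgt_def using multiplicity_iso by (auto intro: prod.cong)
next
fix e S T assume "e : Hom C S T" "fn e ` car S = car T"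
then show "wgt \<tau> S = wgt \<tau> (sub S (ker S e)) * wgt \<tau> T"
 unfolding wgt_def prod.distrib[symmetric] power_add[symmetric] using multiplicity_exact by (auto intro: prod.cong)
next
fix S assume "S : Obj C" "car S = {zr S}"
then show "wgt \<tau> S = 1" unfolding wgt_def by (intro prod.neutral) (simp add: multiplicity_zero)
qed (rule deg_Rep_eq)

end

lemma one_less_card_field: "1 < card (UNIV :: 'f::{field, finite} set)"
proof -
have "card {0, 1 :: 'f} <= card (UNIV :: 'f set)" by (rule card_mono) simp_all
then show ?thesis by simp
qed

lemma vdim_eqI:
 fixes V :: "('f::{field, finite}, 'u) module" and W :: "('f, 'v) module"
 assumes "vectorspace class_ring V" "finite (carrier V)" "vectorspace class_ring W" "finite (carrier W)"
  and "card (carrier V) = card (carrier W)"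
 shows "vdim V = vdim W"
 using assms(5) unfolding card_eq_power_vdim[OF assms(1,2)] card_eq_power_vdim[OF assms(3,4)]
  power_inject_exp[OF one_less_card_field] .

lemma (in rep_category) sm_inj:
 assumes o: "I : Obj C" and v: "v : car I" "v ~= zr I" and e: "sm I c v = sm I d v"
 shows "c = d"
proof (rule ccontr)
assume "c ~= d"
have "sm I (c + - 1 * d) v = zr I"
 unfolding add_sm[OF o v(1)] sm_sm[OF o v(1), symmetric] e by (rule pl_neg[OF o sm_closed[OF o v(1)]])
then have "sm I (inverse (c - d)) (sm I (c - d) v) = zr I" by (simp add: sm_zr[OF o])
then show False using \<open>c ~= d\<close> v by (simp add: sm_sm[OF o] sm_one[OF o])
qed

context rep_objects
begin

section \<open>Finiteness of the set of irreducible classes and the dimension formula\<close>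

lemma card_car: "S : Obj C ==> card (car S) = card (UNIV :: 'f set) ^ vdim (fst S)"
 using card_eq_power_vdim[OF Obj_vs] car_finite by (simp add: car_def)

text \<open>The element of the group algebra with coefficients \<open>a\<close>, applied to the
  vector \<open>v\<close>.\<close>

definition "osum S v a = avg S (%g. sm S (a g) v)"

abbreviation "FG \<equiv> carrier G \<rightarrow>\<^sub>E (UNIV :: 'f set)"

lemma osum:
 assumes S: "S : Obj C" and v: "v : car S"
 shows "osum S v a : car S"
  "osum S v (\<lambda>g\<in>carrier G. a g + b g) = pl S (osum S v a) (osum S v b)" (is ?P)
  "osum S v (\<lambda>g\<in>carrier G. c * a g) = sm S c (osum S v a)" (is ?P1)
  "h : carrier G ==> osum S v (\<lambda>g\<in>carrier G. a (inv\<^bsub>G\<^esub> h \<otimes>\<^bsub>G\<^esub> g)) = ac S h (osum S v a)"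
  "osum S v (\<lambda>g\<in>carrier G. if g = \<one>\<^bsub>G\<^esub> then 1 else 0) = v" (is ?P2)
proof -
note m = sm_closed[OF S v]
show "osum S v a : car S" unfolding osum_def by (rule avg_closed[OF S m])
have "osum S v (\<lambda>g\<in>carrier G. a g + b g) = avg S (%g. pl S (sm S (a g) v) (sm S (b g) v))"
 unfolding osum_def by (rule avg_cong[OF S]) (simp_all add: add_sm[OF S v] pl_closed[OF S] m)
then show ?P
 unfolding osum_def avg_pl[OF S m m] .
have "osum S v (\<lambda>g\<in>carrier G. c * a g) = avg S (%g. sm S c (sm S (a g) v))"
 unfolding osum_def by (rule avg_cong[OF S]) (simp_all add: sm_sm[OF S v] m)
then show ?P1 unfolding osum_def avg_sm[OF S m] .
show "osum S v (\<lambda>g\<in>carrier G. a (inv\<^bsub>G\<^esub> h \<otimes>\<^bsub>G\<^esub> g)) = ac S h (osum S v a)" if h: "h : carrier G"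
proof -
 have "osum S v (\<lambda>g\<in>carrier G. a (inv\<^bsub>G\<^esub> h \<otimes>\<^bsub>G\<^esub> g)) = avg S (%g. sm S (a (inv\<^bsub>G\<^esub> h \<otimes>\<^bsub>G\<^esub> g)) v)"
  unfolding osum_def by (rule avg_cong[OF S]) (simp_all add: m)
 then show ?thesis using avg_ac[OF S, of "%g. sm S (a g) v" h] m h by (simp add: osum_def)
qed
have "osum S v (\<lambda>g\<in>carrier G. if g = \<one>\<^bsub>G\<^esub> then 1 else 0) = avg S (%g. if g = \<one>\<^bsub>G\<^esub> then v else zr S)"
 unfolding osum_def by (rule avg_cong[OF S]) (simp_all add: sm_one[OF S v] sm_zero[OF S v] v zr_closed[OF S])
then show ?P2 unfolding avg_single[OF S v] .
qed

text \<open>The vectors obtained from \<open>v\<close> by the group algebra form an invariant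
  subspace containing \<open>v\<close>, which irreducibility forces to be everything.\<close>

lemma osum_surj:
 assumes irr: "irreducible_rep G S" and v: "v : car S" "v ~= zr S"
 shows "osum S v ` FG = car S"
proof -
have S: "S : Obj C" using irr by (simp add: irreducible_iff)
note o = osum[OF S v(1)]
have memI: "s : osum S v ` FG" if "s = osum S v a" "a : FG" for s a using that by blast
have mem: "v : osum S v ` FG" by (rule memI[OF o(5)[symmetric]]) simp
have "is_sub S (osum S v ` FG)"
 unfolding is_sub_def
proof (intro conjI ballI allI)
 show "osum S v ` FG <= car S" using o(1) by blast
 fix s assume "s : osum S v ` FG"
 then obtain a where a: "a : FG" "s = osum S v a" by blast
 show "sm S c s : osum S v ` FG" for c
  unfolding a(2) by (rule memI[OF o(3)[symmetric]]) simp
 show "ac S h s : osum S v ` FG" if "h : carrier G" for h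
  unfolding a(2) by (rule memI[OF o(4)[OF that, symmetric]]) simp
 fix t assume "t : osum S v ` FG"
 then obtain b where b: "b : FG" "t = osum S v b" by blast
 show "pl S s t : osum S v ` FG" unfolding a(2) b(2) by (rule memI[OF o(2)[symmetric]]) simp
next
 have "zr S = osum S v (\<lambda>g\<in>carrier G. 0 * (0::'f))" unfolding o(3)[of 0 "%_. 0"] sm_zero[OF S o(1)] ..
 then show "zr S : osum S v ` FG" by (rule memI) simp
qed
then show ?thesis using irr mem v(2) unfolding irreducible_iff by blast
qed

text \<open>Both representations are quotients of the regular one by the same left ideal: sending a
  v to a w is well defined and injective because the annihilators of \<open>v\<close> and
  \<open>w\<close> agree.\<close>

lemma annihilator_isomorphic:
 assumes S: "irreducible_rep G S" and v: "v : car S" "v ~= zr S"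
  and T: "irreducible_rep G T" and w: "w : car T" "w ~= zr T"
  and eq: "{a : FG. osum S v a = zr S} = {a : FG. osum T w a = zr T}"
 shows "isomorphic C S T"
proof -
have SO: "S : Obj C" and TO: "T : Obj C" using S T by (simp_all add: irreducible_iff)
note o = osum[OF SO v(1)] and p = osum[OF TO w(1)]
have iff: "osum S v a = osum S v b \<longleftrightarrow> osum T w a = osum T w b" if a: "a : FG" "b : FG" for a b
proof -
 \<comment> \<open>The difference of \<open>a\<close> and \<open>b\<close> in the group algebra; it
   annihilates a vector exactly when \<open>a\<close> and \<open>b\<close> act equally on
   it.\<close>
 define d where "d = (\<lambda>g\<in>carrier G. a g + (\<lambda>g\<in>carrier G. (-1) * b g) g)"
 have "d : FG" by (simp add: d_def)
 then have "osum S v d = zr S \<longleftrightarrow> osum T w d = zr T" using eq by blast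
 moreover have "pl U x (sm U (-1) y) = zr U \<longleftrightarrow> x = y" if "U : Obj C" "x : car U" "y : car U" for U x y
  using pl_eq_imp[OF that] pl_neg[OF that(1,3)] by blast
 ultimately show ?thesis unfolding d_def o(2) o(3) p(2) p(3) using o(1) p(1) SO TO by blast
qed
\<comment> \<open>By \<open>iff\<close> the value does not depend on which coefficients are chosen
  for \<open>s\<close>.\<close>
define \<phi> where "\<phi> s = osum T w (SOME a. a : FG & osum S v a = s)" for s
have \<phi>: "\<phi> (osum S v a) = osum T w a" if "a : FG" for a
proof -
 have "EX b. b : FG & osum S v b = osum S v a" using that by blast
 from someI_ex[OF this] show ?thesis unfolding \<phi>_def using iff that by blast
qed
have el: "EX a:FG. s = osum S v a" if "s : car S" for s using osum_surj[OF S v] that by blast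
have hom: "arr S \<phi> T : Hom C S T"
proof (rule arr_hom[OF SO TO])
 fix s assume "s : car S"
 then obtain a where a: "a : FG" "s = osum S v a" using el by blast
 show "\<phi> s : car T" unfolding a(2) \<phi>[OF a(1)] by (rule p(1))
 show "\<phi> (sm S c s) = sm T c (\<phi> s)" for c
  unfolding a(2) \<phi>[OF a(1)] o(3)[symmetric] p(3)[symmetric] by (rule \<phi>) simp
 show "\<phi> (ac S h s) = ac T h (\<phi> s)" if h: "h : carrier G" for h
  unfolding a(2) \<phi>[OF a(1)] o(4)[OF h, symmetric] p(4)[OF h, symmetric] by (rule \<phi>) simp
 fix t assume "t : car S"
 then obtain b where b: "b : FG" "t = osum S v b" using el by blast
 show "\<phi> (pl S s t) = pl T (\<phi> s) (\<phi> t)"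
  unfolding a(2) b(2) \<phi>[OF a(1)] \<phi>[OF b(1)] o(2)[symmetric] p(2)[symmetric] by (rule \<phi>) simp
qed
have "bij_betw \<phi> (car S) (car T)"
 unfolding bij_betw_def
proof (intro conjI inj_onI)
 fix s t assume st: "s : car S" "t : car S" "\<phi> s = \<phi> t"
 obtain a b where "a : FG" "s = osum S v a" "b : FG" "t = osum S v b" using el st(1,2) by metis
 then show "s = t" using st(3) \<phi> iff by metis
next
 have "\<phi> ` car S = \<phi> ` osum S v ` FG" by (simp only: osum_surj[OF S v])
 also have "... = osum T w ` FG" unfolding image_image by (rule image_cong[OF refl \<phi>])
 finally show "\<phi> ` car S = car T" by (simp only: osum_surj[OF T w])
qed
then have "bij_betw (fn (arr S \<phi> T)) (car S) (car T)"
 by (rule bij_betw_cong[THEN iffD1, rotated]) (simp add: fn_arr)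
then show ?thesis unfolding isomorphic_iff using hom by blast
qed

text \<open>An irreducible class is recovered from the annihilator of a nonzero vector, which is a
  subset of the finite group algebra. Finiteness gives the products over \<open>Irr G\<close> their
  intended value and allows \<open>vdim_sum\<close> to regroup summands by class.\<close>

lemma finite_Irr: "finite (Irr G :: ('f, 'g, 'u) rep set set)"
proof -
define P where "P I N \<longleftrightarrow> (EX S v. irreducible_rep G S & I = cls S & v : car S & v ~= zr S & N = {a : FG. osum S v a = zr S})"
 for I N
have "ALL I:Irr G. EX N. P I N"
proof
 fix I assume "I : (Irr G :: ('f, 'g, 'u) rep set set)"
 then obtain S where S: "irreducible_rep G S" "I = cls S" unfolding Irr_eq by blast
 obtain v where v: "v : car S" "v ~= zr S" using S(1) zr_closed[of S] unfolding irreducible_iff by blast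
 have "P I {a : FG. osum S v a = zr S}"
  unfolding P_def by (rule exI[of _ S], rule exI[of _ v]) (use S v in simp)
 then show "EX N. P I N" ..
qed
from bchoice[OF this] obtain N where N: "ALL I:Irr G. P I (N I)" ..
have "inj_on N (Irr G)"
proof (rule inj_onI)
 fix I I' assume I: "I : Irr G" "I' : Irr G" "N I = N I'"
 obtain S v where S: "irreducible_rep G S" "I = cls S" "v : car S" "v ~= zr S" "N I = {a : FG. osum S v a = zr S}"
  using bspec[OF N I(1)] unfolding P_def by (elim exE conjE)
 obtain T w where T: "irreducible_rep G T" "I' = cls T" "w : car T" "w ~= zr T" "N I' = {a : FG. osum T w a = zr T}"
  using bspec[OF N I(2)] unfolding P_def by (elim exE conjE)
 have "{a : FG. osum S v a = zr S} = {a : FG. osum T w a = zr T}" using S(5) T(5) I(3) by simp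
 from annihilator_isomorphic[OF S(1,3,4) T(1,3,4) this] show "I = I'"
  unfolding S(2) T(2) cls_def using isomorphic_trans isomorphic_sym by blast
qed
moreover have "N ` Irr G <= Pow FG" using N unfolding P_def by auto
ultimately show ?thesis using finite_group by (intro inj_on_finite[of N _ "Pow FG"]) (simp_all add: finite_PiE)
qed

lemma irr_dim_cls:
 assumes S: "irreducible_rep G S"
 shows "irr_dim (cls S) = vdim (fst S)"
proof -
have SO: "S : Obj C" using S by (simp add: irreducible_iff)
have "S : cls S" using SO isomorphic_refl[OF SO] by (simp add: cls_def)
then have "(SOME T. T : cls S) : cls S" by (rule someI)
then obtain i where T: "(SOME T. T : cls S) : Obj C" "i : Hom C (SOME T. T : cls S) S"
 "bij_betw (fn i) (car (SOME T. T : cls S)) (car S)" unfolding cls_def isomorphic_iff by blast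
show ?thesis unfolding irr_dim_def
 by (rule vdim_eqI) (use Obj_vs[OF T(1)] Obj_vs[OF SO] car_finite[OF T(1)] car_finite[OF SO] bij_betw_same_card[OF T(3)] in "simp_all add: car_def")
qed

text \<open>Counting the vectors of a decomposition gives the dimension as an exponent; the
  irreducible summands are then grouped by their classes.\<close>

lemma vdim_sum:
 assumes S: "S : Obj C"
 shows "vdim (fst S) = (\<Sum>I\<in>Irr G. irr_dim I * multiplicity_in G S I)"
proof -
obtain n U where dec: "irr_decomposition G S n U" using decomposition_ex[OF S] by blast
then have U: "!!i. i < n ==> is_sub S (U i)" "!!i. i < n ==> irreducible_rep G (subrep S (U i))"
 "bij_betw (%u. fs S u n) (Pi\<^sub>E {..<n} U) (car S)" unfolding irr_decomposition_iff[OF S] by blast+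
let ?c = "%i. cls (subrep S (U i))"
have "card (UNIV :: 'f set) ^ vdim (fst S) = card (car S)" by (rule card_car[OF S, symmetric])
also have "... = (\<Prod>i<n. card (U i))" using bij_betw_same_card[OF U(3)] by (simp add: card_PiE)
also have "... = (\<Prod>i<n. card (UNIV :: 'f set) ^ irr_dim (?c i))"
proof (rule prod.cong[OF refl])
 fix i assume "i : {..<n}"
 then have i: "i < n" by simp
 show "card (U i) = card (UNIV :: 'f set) ^ irr_dim (?c i)"
  unfolding irr_dim_cls[OF U(2)[OF i]] using card_car[OF sub_obj(1)[OF S U(1)[OF i]]]
  unfolding sub_obj(2)[OF S U(1)[OF i]] unfolding sub_eq .
qed
also have "... = card (UNIV :: 'f set) ^ (\<Sum>i<n. irr_dim (?c i))" by (rule power_sum[symmetric])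
finally have "vdim (fst S) = (\<Sum>i<n. irr_dim (?c i))" unfolding power_inject_exp[OF one_less_card_field] .
also have "... = (\<Sum>I\<in>Irr G. \<Sum>i\<in>{i : {..<n}. ?c i = I}. irr_dim (?c i))"
 by (rule sum.group[symmetric, OF _ finite_Irr]) (use U(2) in "auto simp: Irr_eq")
also have "... = (\<Sum>I\<in>Irr G. irr_dim I * multiplicity_in G S I)"
proof (rule sum.cong[OF refl])
 fix I assume "I : (Irr G :: ('f, 'g, 'u) rep set set)"
 then obtain T where T: "irreducible_rep G T" "I = cls T" unfolding Irr_eq by blast
 have "{i : {..<n}. ?c i = I} = {i. i < n & subrep S (U i) : cls T}"
 proof -
  have "?c i = cls T \<longleftrightarrow> subrep S (U i) : cls T" if i: "i < n" for i
  proof -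
   have o: "subrep S (U i) : Obj C" using U(2)[OF i] by (simp add: irreducible_iff)
   then show ?thesis unfolding cls_def using isomorphic_refl[OF o] isomorphic_trans isomorphic_sym by blast
  qed
  then show ?thesis unfolding T(2) by auto
 qed
 moreover have "(\<Sum>i\<in>{i : {..<n}. ?c i = I}. irr_dim (?c i)) = irr_dim I * card {i : {..<n}. ?c i = I}" by simp
 ultimately show "(\<Sum>i\<in>{i : {..<n}. ?c i = I}. irr_dim (?c i)) = irr_dim I * multiplicity_in G S I"
  by (simp add: multiplicity_decomposition[OF S dec T(1)] T(2))
qed
finally show ?thesis .
qed

lemma wgt_tau_of: "S : Obj C ==> wgt (tau_of t) S = t ^ vdim (fst S)"
 unfolding wgt_def tau_of_def vdim_sum power_sum power_mult ..

text \<open>Over a splitting field, multiplication by scalars is a bijection from the field onto the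
  endomorphisms; injectivity is tested on a nonzero vector.\<close>

lemma card_Hom_splitting:
 assumes spl: "splitting_field G TYPE('f) TYPE('u)" and I: "irreducible_rep G I"
 shows "card (Hom C I I) = card (UNIV :: 'f set)"
proof -
have o: "I : Obj C" using I by (simp add: irreducible_iff)
obtain v where v: "v : car I" "v ~= zr I" using I zr_closed[OF o] unfolding irreducible_iff by blast
have h: "arr I (sm I c) I : Hom C I I" for c
 by (rule arr_hom[OF o o])
  (simp_all add: sm_closed[OF o] sm_pl[OF o] sm_sm[OF o] ac_sm[OF o] mult.commute)
have "bij_betw (%c. arr I (sm I c) I) UNIV (Hom C I I)"
 unfolding bij_betw_def
proof (intro conjI inj_onI equalityI subsetI)
 fix c d assume "arr I (sm I c) I = arr I (sm I d) I"
 then have "fn (arr I (sm I c) I) v = fn (arr I (sm I d) I) v" by simp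
 then have e: "sm I c v = sm I d v" using v(1) by (simp add: fn_arr)
 show "c = d" by (rule sm_inj[OF o v e])
next
 fix f assume "f : (%c. arr I (sm I c) I) ` UNIV" then show "f : Hom C I I" using h by blast
next
 fix f assume f: "f : Hom C I I"
 then have "(I, fn f, I) : Arr (Rep G)" using hom_Arr[OF f] f unfolding C_eq[symmetric]
  by (cases f) (auto simp: fn_def hom_iff)
 then obtain c where c: "ALL a:car I. fn f a = sm I c a"
  using spl I unfolding splitting_field_def car_def sm_def by blast
 have "f = arr I (sm I c) I" by (rule hom_eqI[OF f h]) (use c in "simp add: fn_arr")
 then show "f : (%c. arr I (sm I c) I) ` UNIV" by blast
qed
from bij_betw_same_card[OF this] show ?thesis by simp
qed

end

section \<open>Functors given by powers\<close>

text \<open>For both functors of the theorem the vectors of \<open>F x\<close> are the families of vectors of \<open>x\<close>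
 indexed by a set \<open>J\<close>, with components \<open>ev x j\<close>: for the restriction \<open>J\<close> is a singleton, for the
 induction it is the group.\<close>

locale power_functor =
 C: rep_category G C emb mk + D: rep_category G' D emb' mk' + is_functor C D F
 for G :: "('g, 'm) monoid_scheme"
  and C :: "('o, 'o \<times> ('u => 'u) \<times> 'o) cat"
  and emb :: "'o => ('f::{field, finite}, 'g, 'u) rep"
  and mk :: "('f, 'g, 'u) rep => 'o"
  and G' :: "('h, 'n) monoid_scheme"
  and D :: "('p, 'p \<times> ('v => 'v) \<times> 'p) cat" (structure)
  and emb' :: "'p => ('f, 'h, 'v) rep"
  and mk' :: "('f, 'h, 'v) rep => 'p"
  and F :: "('o, 'o \<times> ('u => 'u) \<times> 'o, 'p, 'p \<times> ('v => 'v) \<times> 'p) ftr" +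
 fixes J :: "'j set" and ev :: "'o => 'j => 'v => 'u"
 assumes ev_bij: "x : Obj C ==> bij_betw (%v. \<lambda>j\<in>J. ev x j v) (D.car (on_obj F x)) (J \<rightarrow>\<^sub>E C.car x)"
  and ev_natural: "[|f : Hom C x y; v : D.car (on_obj F x); j : J|]
   ==> ev y j (D.fn (on_arr F f) v) = C.fn f (ev x j v)"
  and ev_zr: "[|x : Obj C; j : J|] ==> ev x j (D.zr (on_obj F x)) = C.zr x"
begin

abbreviation "FO \<equiv> on_obj F"
abbreviation "FA \<equiv> on_arr F"

lemma ev_closed:
 assumes "x : Obj C" "v : D.car (FO x)" "j : J" shows "ev x j v : C.car x"
proof -
have "(\<lambda>j\<in>J. ev x j v) : J \<rightarrow>\<^sub>E C.car x" using bij_betwE[OF ev_bij[OF assms(1)]] assms(2) by blast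
from PiE_mem[OF this assms(3)] show ?thesis using assms(3) by simp
qed

lemma ev_inj:
 assumes "x : Obj C" "v : D.car (FO x)" "v' : D.car (FO x)" "!!j. j : J ==> ev x j v = ev x j v'"
 shows "v = v'"
 by (rule inj_onD[OF bij_betw_imp_inj_on[OF ev_bij[OF assms(1)]] _ assms(2,3)]) (rule restrict_ext, rule assms(4))

lemma ev_surj:
 assumes "x : Obj C" "!!j. j : J ==> h j : C.car x"
 shows "EX v:D.car (FO x). ALL j:J. ev x j v = h j"
proof -
have "restrict h J : J \<rightarrow>\<^sub>E C.car x" using assms(2) by auto
then obtain v where "v : D.car (FO x)" "(\<lambda>j\<in>J. ev x j v) = restrict h J"
 using ev_bij[OF assms(1)] unfolding bij_betw_def by (metis (no_types, lifting) imageE)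
then show ?thesis by (metis restrict_apply')
qed

text \<open>The one fact about \<open>F\<close> behind its effect on pullbacks, products and
  subobjects: if \<open>p\<close> and \<open>q\<close> present a relation, their images present the
  relation that holds in every component.\<close>

lemma FA_bij:
 assumes p: "p : Hom C W X" and q: "q : Hom C W Y"
  and bij: "bij_betw (%w. (C.fn p w, C.fn q w)) (C.car W) R"
 shows "bij_betw (%w. (D.fn (FA p) w, D.fn (FA q) w)) (D.car (FO W))
  {(a, b) : D.car (FO X) \<times> D.car (FO Y). ALL j:J. (ev X j a, ev Y j b) : R}"
 unfolding bij_betw_def
proof (intro conjI equalityI subsetI)
note o = C.hom_dom_obj[OF p] C.hom_cod_obj[OF p] C.hom_cod_obj[OF q]
note p' = on_arr_hom[OF p] and q' = on_arr_hom[OF q]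
show "inj_on (%w. (D.fn (FA p) w, D.fn (FA q) w)) (D.car (FO W))"
proof (rule inj_onI)
 fix w w' assume w: "w : D.car (FO W)" "w' : D.car (FO W)"
  and eq: "(D.fn (FA p) w, D.fn (FA q) w) = (D.fn (FA p) w', D.fn (FA q) w')"
 show "w = w'"
 proof (rule ev_inj[OF o(1) w])
  fix j assume j: "j : J"
  have "C.fn p (ev W j w) = C.fn p (ev W j w')" "C.fn q (ev W j w) = C.fn q (ev W j w')"
   using ev_natural[OF p w(1) j] ev_natural[OF p w(2) j] ev_natural[OF q w(1) j] ev_natural[OF q w(2) j] eq by simp_all
  then show "ev W j w = ev W j w'"
   using inj_onD[OF bij_betw_imp_inj_on[OF bij] _ ev_closed[OF o(1) w(1) j] ev_closed[OF o(1) w(2) j]] by simp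
 qed
qed
fix t assume "t : (%w. (D.fn (FA p) w, D.fn (FA q) w)) ` D.car (FO W)"
then obtain w where w: "w : D.car (FO W)" "t = (D.fn (FA p) w, D.fn (FA q) w)" by blast
have "(C.fn p (ev W j w), C.fn q (ev W j w)) : R" if "j : J" for j
 using bij_betwE[OF bij] ev_closed[OF o(1) w(1) that] by blast
then show "t : {(a, b) : D.car (FO X) \<times> D.car (FO Y). ALL j:J. (ev X j a, ev Y j b) : R}"
 using w D.fn_closed[OF p' w(1)] D.fn_closed[OF q' w(1)] by (simp add: ev_natural[OF p w(1)] ev_natural[OF q w(1)])
next
note o = C.hom_dom_obj[OF p] C.hom_cod_obj[OF p] C.hom_cod_obj[OF q]
note p' = on_arr_hom[OF p] and q' = on_arr_hom[OF q]
fix t assume "t : {(a, b) : D.car (FO X) \<times> D.car (FO Y). ALL j:J. (ev X j a, ev Y j b) : R}"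
then obtain a b where t: "t = (a, b)" "a : D.car (FO X)" "b : D.car (FO Y)" "!!j. j : J ==> (ev X j a, ev Y j b) : R"
 by auto
have "EX w:C.car W. C.fn p w = ev X j a & C.fn q w = ev Y j b" if "j : J" for j
proof -
 have "(ev X j a, ev Y j b) : (%w. (C.fn p w, C.fn q w)) ` C.car W"
  unfolding bij_betw_imp_surj_on[OF bij] by (rule t(4)[OF that])
 then show ?thesis by auto
qed
then obtain h where h: "!!j. j : J ==> h j : C.car W" "!!j. j : J ==> C.fn p (h j) = ev X j a"
 "!!j. j : J ==> C.fn q (h j) = ev Y j b" by metis
obtain w where w: "w : D.car (FO W)" "!!j. j : J ==> ev W j w = h j"
 using ev_surj[where h=h, OF o(1) h(1)] by blast
have "D.fn (FA p) w = a"
 by (rule ev_inj[OF o(2) D.fn_closed[OF p' w(1)] t(2)]) (simp add: ev_natural[OF p w(1)] w(2) h(2))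
moreover have "D.fn (FA q) w = b"
 by (rule ev_inj[OF o(3) D.fn_closed[OF q' w(1)] t(3)]) (simp add: ev_natural[OF q w(1)] w(2) h(3))
ultimately show "t : (%w. (D.fn (FA p) w, D.fn (FA q) w)) ` D.car (FO W)" using w(1) t(1) by blast
qed

text \<open>Whether two vectors have the same image under the functor can be tested in each
  component, so the image of a fibre product is the fibre product of the images.\<close>

theorem power_preserves_pullbacks: "preserves_pullbacks C D F"
 unfolding preserves_pullbacks_def
proof (intro allI impI)
fix f g p q assume pb: "is_pullback C f g p q"
then have f: "f : Hom C (Dom C f) (Cod C f)" and g: "g : Hom C (Dom C g) (Cod C f)"
 unfolding is_pullback_def commuting_square_def Hom_def by simp_all
note d = C.pullbackD[OF pb f g]
let ?X = "Dom C f" and ?Y = "Dom C g"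
note f' = on_arr_hom[OF f] and g' = on_arr_hom[OF g]
have "{(a, b) : D.car (FO ?X) \<times> D.car (FO ?Y). ALL j:J. (ev ?X j a, ev ?Y j b) : C.pb_rel ?X ?Y f g}
 = D.pb_rel (FO ?X) (FO ?Y) (FA f) (FA g)"
proof -
 have "(ALL j:J. (ev ?X j a, ev ?Y j b) : C.pb_rel ?X ?Y f g) \<longleftrightarrow> D.fn (FA f) a = D.fn (FA g) b"
  if a: "a : D.car (FO ?X)" and b: "b : D.car (FO ?Y)" for a b
 proof
  assume *: "ALL j:J. (ev ?X j a, ev ?Y j b) : C.pb_rel ?X ?Y f g"
  show "D.fn (FA f) a = D.fn (FA g) b"
   by (rule ev_inj[OF C.hom_cod_obj[OF f] D.fn_closed[OF f' a] D.fn_closed[OF g' b]])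
    (use * in "simp add: ev_natural[OF f a] ev_natural[OF g b] C.pb_rel_def")
 next
  assume eq: "D.fn (FA f) a = D.fn (FA g) b"
  show "ALL j:J. (ev ?X j a, ev ?Y j b) : C.pb_rel ?X ?Y f g"
  proof
   fix j assume j: "j : J"
   show "(ev ?X j a, ev ?Y j b) : C.pb_rel ?X ?Y f g"
    using ev_natural[OF f a j] ev_natural[OF g b j] eq ev_closed[OF C.hom_dom_obj[OF f] a j]
     ev_closed[OF C.hom_dom_obj[OF g] b j] by (simp add: C.pb_rel_def)
  qed
 qed
 then show ?thesis unfolding D.pb_rel_def by blast
qed
then show "is_pullback D (FA f) (FA g) (FA p) (FA q)"
 using D.pullbackI[OF f' g' on_arr_hom[OF d(1)] on_arr_hom[OF d(2)]] FA_bij[OF d] by simp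
qed

lemma FO_terminal:
 assumes t: "is_terminal C t" shows "is_terminal D (FO t)"
proof -
have t: "t : Obj C" "C.car t = {C.zr t}" using t unfolding C.terminal_iff by auto
note z = D.zr_closed[OF on_obj_obj[OF t(1)]]
have "v = D.zr (FO t)" if v: "v : D.car (FO t)" for v
proof (rule ev_inj[OF t(1) v z])
 fix j assume "j : J"
 from ev_closed[OF t(1) v this] ev_closed[OF t(1) z this] show "ev t j v = ev t j (D.zr (FO t))"
  unfolding t(2) by simp
qed
then show ?thesis unfolding D.terminal_iff using on_obj_obj[OF t(1)] z by blast
qed

theorem power_preserves_terminals: "preserves_terminals C D F"
 unfolding preserves_terminals_def using FO_terminal by blast

text \<open>Preimages are chosen in each component and assembled to one vector.\<close>

theorem power_preserves_epi:
 assumes "is_epi C e" shows "is_epi D (FA e)"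
proof -
have e: "e : Hom C (Dom C e) (Cod C e)" by (rule C.epi_Arr[OF assms])
let ?X = "Dom C e" and ?Y = "Cod C e"
have surj: "C.fn e ` C.car ?X = C.car ?Y" using assms C.epi_iff[OF e] by simp
note o = C.hom_dom_obj[OF e] C.hom_cod_obj[OF e]
note e' = on_arr_hom[OF e]
have "b : D.fn (FA e) ` D.car (FO ?X)" if b: "b : D.car (FO ?Y)" for b
proof -
 have "ALL j:J. EX a:C.car ?X. C.fn e a = ev ?Y j b"
  using ev_closed[OF o(2) b] unfolding surj[symmetric] by (metis imageE)
 then obtain h where h: "!!j. j : J ==> h j : C.car ?X" "!!j. j : J ==> C.fn e (h j) = ev ?Y j b" by metis
 obtain a where a: "a : D.car (FO ?X)" "!!j. j : J ==> ev ?X j a = h j" using ev_surj[where h=h, OF o(1) h(1)] by blast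
 have "D.fn (FA e) a = b"
  by (rule ev_inj[OF o(2) D.fn_closed[OF e' a(1)] b]) (simp add: ev_natural[OF e a(1)] a(2) h(2))
 then show ?thesis using a(1) by blast
qed
then show ?thesis unfolding D.epi_iff[OF e'] using D.fn_closed[OF e'] by blast
qed

definition "FR x y R = {(a, b) : D.car (FO x) \<times> D.car (FO y). ALL j:J. (ev x j a, ev y j b) : R}"

lemma sub_map_eq:
 assumes o: "x : Obj C" "y : Obj C" and R: "R : C.Rel x y"
 shows "sub_map C D F x y (C.sb x y R) = D.sb (FO x) (FO y) (FR x y R)" (is ?P) "FR x y R : D.Rel (FO x) (FO y)"
proof -
define m where "m = (SOME m. m : C.sb x y R)"
have "m : C.sb x y R" unfolding m_def by (rule someI_ex[OF C.sb_nonempty[OF o R]])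
note d = C.sbD[OF this]
note p = C.pr_hom(1,2)[OF o]
note c = C.comp_hom[OF d(1) p(1)] C.comp_hom[OF d(1) p(2)]
let ?q = "%w. (C.fn (pr1 C x y \<cdot>\<^bsub>C\<^esub> m) w, C.fn (pr2 C x y \<cdot>\<^bsub>C\<^esub> m) w)"
have q: "?q w = (C.fn (pr1 C x y) (C.fn m w), C.fn (pr2 C x y) (C.fn m w))" if "w : C.car (Dom C m)" for w
 using C.fn_comp[OF d(1) p(1) that] C.fn_comp[OF d(1) p(2) that] by simp
have "bij_betw ?q (C.car (Dom C m)) R"
 unfolding bij_betw_def
proof
 show "inj_on ?q (C.car (Dom C m))"
 proof (rule inj_onI)
  fix w w' assume w: "w : C.car (Dom C m)" "w' : C.car (Dom C m)" and eq: "?q w = ?q w'"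
  have "C.fn m w = C.fn m w'"
   by (rule C.pr_inj[OF o C.fn_closed[OF d(1) w(1)] C.fn_closed[OF d(1) w(2)]]) (use eq q w in auto)
  then show "w = w'" by (rule inj_onD[OF d(2) _ w])
 qed
 show "?q ` C.car (Dom C m) = R" unfolding d(3) by (rule image_cong[OF refl q])
qed
note b = FA_bij[OF c this, folded FR_def]
note s = D.subobject_pairing[OF on_arr_hom[OF c(1)] on_arr_hom[OF c(2)] bij_betw_imp_inj_on[OF b]]
show ?P
 unfolding sub_map_def Let_def m_def[symmetric] s(1) bij_betw_imp_surj_on[OF b] ..
have P: "pairing D (FA (pr1 C x y \<cdot>\<^bsub>C\<^esub> m)) (FA (pr2 C x y \<cdot>\<^bsub>C\<^esub> m)) : D.sb (FO x) (FO y) (FR x y R)"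
 using s(2) unfolding bij_betw_imp_surj_on[OF b] .
have "D.relm (FO x) (FO y) (pairing D (FA (pr1 C x y \<cdot>\<^bsub>C\<^esub> m)) (FA (pr2 C x y \<cdot>\<^bsub>C\<^esub> m))) = FR x y R"
 using P by (simp add: D.sb_def)
then show "FR x y R : D.Rel (FO x) (FO y)"
 unfolding D.Rel_def using D.relm_is_rel[OF on_obj_obj[OF o(1)] on_obj_obj[OF o(2)] D.sbD(1)[OF P]] by simp
qed

text \<open>From left to right one middle vector is required for the whole family; middle vectors
  are chosen in each component and assembled by \<open>ev_surj\<close>.\<close>

lemma FR_comp:
 assumes o: "x : Obj C" "y : Obj C" "z : Obj C" and R: "R : C.Rel x y" "S : C.Rel y z"
 shows "FR x z (R O S) = FR x y R O FR y z S"
proof (intro equalityI subsetI)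
fix t assume "t : FR x z (R O S)"
then obtain a c where t: "t = (a, c)" "a : D.car (FO x)" "c : D.car (FO z)" "ALL j:J. (ev x j a, ev z j c) : R O S"
 by (auto simp: FR_def)
then have "ALL j:J. EX b. (ev x j a, b) : R & (b, ev z j c) : S" by blast
then obtain h where h: "!!j. j : J ==> (ev x j a, h j) : R" "!!j. j : J ==> (h j, ev z j c) : S" by metis
have "!!j. j : J ==> h j : C.car y" using C.Rel_car(2)[OF R(1)] h(1) by blast
from ev_surj[where h=h, OF o(2) this] obtain b where "b : D.car (FO y)" "ALL j:J. ev y j b = h j" by blast
then have "(a, b) : FR x y R" "(b, c) : FR y z S" using t h by (simp_all add: FR_def)
then show "t : FR x y R O FR y z S" using t(1) by blast
next
fix t assume "t : FR x y R O FR y z S"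
then obtain a b c where "t = (a, c)" "(a, b) : FR x y R" "(b, c) : FR y z S" by blast
then show "t : FR x z (R O S)" unfolding FR_def by blast
qed

lemma FR_grf:
 assumes f: "f : Hom C x y"
 shows "FR x y (C.grf f x) = D.grf (FA f) (FO x)"
proof (intro equalityI subsetI)
note o = C.hom_dom_obj[OF f] C.hom_cod_obj[OF f]
note f' = on_arr_hom[OF f]
fix t assume "t : FR x y (C.grf f x)"
then obtain a b where t: "t = (a, b)" "a : D.car (FO x)" "b : D.car (FO y)" "ALL j:J. (ev x j a, ev y j b) : C.grf f x"
 by (auto simp: FR_def)
have "b = D.fn (FA f) a"
 by (rule ev_inj[OF o(2) t(3) D.fn_closed[OF f' t(2)]]) (use t(4) in "auto simp: ev_natural[OF f t(2)] C.grf_def")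
then show "t : D.grf (FA f) (FO x)" using t by (simp add: D.grf_def)
next
note o = C.hom_dom_obj[OF f] C.hom_cod_obj[OF f]
note f' = on_arr_hom[OF f]
fix t assume "t : D.grf (FA f) (FO x)"
then obtain a where t: "t = (a, D.fn (FA f) a)" "a : D.car (FO x)" by (auto simp: D.grf_def)
then show "t : FR x y (C.grf f x)"
 using D.fn_closed[OF f' t(2)] ev_closed[OF o(1) t(2)] ev_natural[OF f t(2)] by (auto simp: FR_def C.grf_def)
qed

end

locale power_degree =
 power_functor G C emb mk G' D emb' mk' F J ev +
 C: rep_degree G C emb mk \<delta> + D: rep_degree G' D emb' mk' \<delta>'
 for G :: "('g, 'm) monoid_scheme"
  and C :: "('o, 'o \<times> ('u => 'u) \<times> 'o) cat"
  and emb :: "'o => ('f::{field, finite}, 'g, 'u) rep"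
  and mk :: "('f, 'g, 'u) rep => 'o"
  and G' :: "('h, 'n) monoid_scheme"
  and D :: "('p, 'p \<times> ('v => 'v) \<times> 'p) cat" (structure)
  and emb' :: "'p => ('f, 'h, 'v) rep"
  and mk' :: "('f, 'h, 'v) rep => 'p"
  and F :: "('o, 'o \<times> ('u => 'u) \<times> 'o, 'p, 'p \<times> ('v => 'v) \<times> 'p) ftr"
  and J :: "'j set" and ev :: "'o => 'j => 'v => 'u"
  and \<delta> :: "'o \<times> ('u => 'u) \<times> 'o => 'k::field"
  and \<delta>' :: "'p \<times> ('v => 'v) \<times> 'p => 'k" +
 assumes power_degree: "is_epi C e ==> \<delta>' (on_arr F e) = \<delta> e"
begin

theorem power_preserves_degree: "preserves_degree C \<delta> D \<delta>' F"
 by unfold_locales (use power_preserves_epi power_degree in blast)+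

text \<open>\<open>F\<close> maps the chosen terminal object to a terminal object, possibly not the
  chosen one; the difference is an isomorphism of degree 1.\<close>

lemma deg_FO:
 assumes N: "N : Obj C" shows "D.deg (FO N) = C.deg N"
proof -
define t where "t = C.arr N (%_. C.zr C.un) C.un"
have t: "t : Hom C N C.un" unfolding t_def by (rule C.zero_arr[OF N C.terminal_obj(1)])
have "C.fn t a = C.zr C.un" if "a : C.car N" for a using C.fn_closed[OF t that] C.terminal_obj(2) by auto
then have surj: "C.fn t ` C.car N = C.car C.un"
 using C.zr_closed[OF N] by (auto simp: C.terminal_obj(2) image_iff intro!: bexI[of _ "C.zr N"])
then have epi: "is_epi C t" using C.epi_iff[OF t] by simp
have s': "D.fn (FA t) ` D.car (FO N) = D.car (FO C.un)"
 using power_preserves_epi[OF epi] D.epi_iff[OF on_arr_hom[OF t]] by simp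
have "is_terminal D (FO C.un)" by (rule FO_terminal) (use C.terminal_obj in "auto simp: C.terminal_iff")
then have o: "FO C.un : Obj D" "D.car (FO C.un) = {D.zr (FO C.un)}" by (simp_all add: D.terminal_iff)
have "D.arr (FO C.un) (%_. D.zr D.un) D.un : Hom D (FO C.un) D.un" by (rule D.zero_arr[OF o(1) D.terminal_obj(1)])
moreover have "bij_betw (D.fn (D.arr (FO C.un) (%_. D.zr D.un) D.un)) (D.car (FO C.un)) (D.car D.un)"
 unfolding o(2) D.terminal_obj(2) bij_betw_def by (simp add: D.fn_arr o(2))
ultimately have "D.deg (FO C.un) = 1" unfolding D.deg_def by (rule D.\<delta>_iso)
then have "D.deg (FO N) = \<delta>' (FA t)" using D.deg_epi[OF on_arr_hom[OF t] s'] by simp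
also have "... = C.deg N" unfolding power_degree[OF epi] by (simp add: t_def C.deg_def)
finally show ?thesis .
qed

text \<open>The functor maps the inclusion of \<open>nul\<close> injectively onto the
  \<open>nul\<close> of the image relations, so a composite and its image carry the same
  weight.\<close>

lemma wt_FR:
 assumes o: "x : Obj C" "y : Obj C" "z : Obj C" and R: "R : C.Rel x y" "S : C.Rel y z"
 shows "D.wt (FO x) (FO y) (FO z) (FR x y R) (FR y z S) = C.wt x y z R S"
proof -
define N where "N = C.nul x y z R S"
have N: "C.is_sub y N" unfolding N_def by (rule C.nul_is_sub[OF o R])
note i = C.incl_hom[OF o(2) N] and i' = on_arr_hom[OF C.incl_hom[OF o(2) N]]
note sO = C.sub_obj(1)[OF o(2) N]
have fi: "ev y j (D.fn (FA (C.incl y N)) w) = ev (C.sub y N) j w" and eN: "ev (C.sub y N) j w : N"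
 if "w : D.car (FO (C.sub y N))" "j : J" for w j
proof -
 show "ev (C.sub y N) j w : N" using ev_closed[OF sO that] C.sub_obj(2)[OF o(2) N] by simp
 then show "ev y j (D.fn (FA (C.incl y N)) w) = ev (C.sub y N) j w"
  using ev_natural[OF i that] C.fn_incl[OF o(2) N] by simp
qed
have inj: "inj_on (D.fn (FA (C.incl y N))) (D.car (FO (C.sub y N)))"
proof (rule inj_onI)
 fix w w' assume w: "w : D.car (FO (C.sub y N))" "w' : D.car (FO (C.sub y N))"
  and eq: "D.fn (FA (C.incl y N)) w = D.fn (FA (C.incl y N)) w'"
 show "w = w'" by (rule ev_inj[OF sO w]) (use fi w eq in metis)
qed
have ker: "D.ker (FO (C.sub y N)) (FA (C.incl y N)) = {D.zr (FO (C.sub y N))}"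
proof -
 have z: "D.zr (FO (C.sub y N)) : D.car (FO (C.sub y N))" by (rule D.zr_closed[OF D.hom_dom_obj[OF i']])
 show ?thesis unfolding D.ker_def D.hom_Cod[OF i'] using z D.fn_zr[OF i'] inj_onD[OF inj] by force
qed
have nul: "(b : D.nul (FO x) (FO y) (FO z) (FR x y R) (FR y z S)) \<longleftrightarrow> b : D.car (FO y) & (ALL j:J. ev y j b : N)" for b
 using D.zr_closed[OF on_obj_obj[OF o(1)]] D.zr_closed[OF on_obj_obj[OF o(3)]]
 unfolding D.nul_def FR_def N_def C.nul_def by (auto simp: ev_zr[OF o(1)] ev_zr[OF o(3)])
have im: "D.fn (FA (C.incl y N)) ` D.car (FO (C.sub y N)) = D.nul (FO x) (FO y) (FO z) (FR x y R) (FR y z S)"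
proof (intro equalityI subsetI)
 fix b assume "b : D.fn (FA (C.incl y N)) ` D.car (FO (C.sub y N))"
 then obtain w where w: "w : D.car (FO (C.sub y N))" "b = D.fn (FA (C.incl y N)) w" by blast
 show "b : D.nul (FO x) (FO y) (FO z) (FR x y R) (FR y z S)"
  unfolding nul w(2) using D.fn_closed[OF i' w(1)] fi[OF w(1)] eN[OF w(1)] by simp
next
 fix b assume "b : D.nul (FO x) (FO y) (FO z) (FR x y R) (FR y z S)"
 then have b: "b : D.car (FO y)" "!!j. j : J ==> ev y j b : C.car (C.sub y N)"
  unfolding nul C.sub_obj(2)[OF o(2) N] by auto
 obtain w where w: "w : D.car (FO (C.sub y N))" "ALL j:J. ev (C.sub y N) j w = ev y j b"
  using ev_surj[where h="%j. ev y j b", OF sO b(2)] by blast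
 have "D.fn (FA (C.incl y N)) w = b"
  by (rule ev_inj[OF o(2) D.fn_closed[OF i' w(1)] b(1)]) (use w fi[OF w(1)] in simp)
 then show "b : D.fn (FA (C.incl y N)) ` D.car (FO (C.sub y N))" using w(1) by blast
qed
have "D.deg (FO (C.sub y N)) = D.wt (FO x) (FO y) (FO z) (FR x y R) (FR y z S)"
 using D.deg_ker_image[OF i'] unfolding ker im D.deg_zero[OF D.hom_dom_obj[OF i']] D.wt_def by simp
then show ?thesis using deg_FO[OF sO] by (simp add: C.wt_def N_def)
qed

section \<open>The induced functor on formal combinations of relations\<close>

definition "fl x y \<phi> = (\<Sum>r\<in>Poly_Mapping.keys \<phi>. Poly_Mapping.single (sub_map C D F x y r) (Poly_Mapping.lookup \<phi> r :: 'k))"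

abbreviation "TF \<equiv> T0_functor C D F :: ('o, ('o, 'o \<times> ('u => 'u) \<times> 'o, 'k) rel_arr,
 'p, ('p, 'p \<times> ('v => 'v) \<times> 'p, 'k) rel_arr) smftr"

lemma fl_zero: "fl x y 0 = 0" by (simp add: fl_def)

lemma fl_add: "fl x y (\<phi> + \<psi>) = fl x y \<phi> + fl x y \<psi>"
 unfolding fl_def by (rule sum_keys_add) (simp_all add: single_add)

lemma fl_bas:
 assumes "x : Obj C" "y : Obj C" "R : C.Rel x y"
 shows "fl x y (C.bas x y R c) = D.bas (FO x) (FO y) (FR x y R) c"
 unfolding fl_def sub_map_eq(1)[OF assms, symmetric] by (rule sum_keys_single) simp

lemma fl_H:
 assumes o: "x : Obj C" "y : Obj C" and "\<phi> : C.H x y"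
 shows "fl x y \<phi> : D.H (FO x) (FO y)"
 using assms(3)
 by (induction rule: C.H_induct)
  (simp_all add: fl_zero fl_add D.H_zero D.H_add fl_bas[OF o] D.H_bas sub_map_eq(2)[OF o])

lemma fl_cmp:
 assumes o: "x : Obj C" "y : Obj C" "z : Obj C" and "\<phi> : C.H x y" and \<psi>: "\<psi> : C.H y z"
 shows "fl x z (C.cmp x y z \<psi> \<phi>) = D.cmp (FO x) (FO y) (FO z) (fl y z \<psi>) (fl x y \<phi>)"
 using assms(4)
proof (induction rule: C.H_induct)
case (single R c)
note R = single
from \<psi> show ?case
proof (induction rule: C.H_induct)
 case (single S d)
 show ?case
  by (simp add: C.cmp_bas[OF o R single] fl_bas[OF o(1,2) R] fl_bas[OF o(2,3) single]
    fl_bas[OF o(1,3) C.Rel_comp[OF R single]] FR_comp[OF o R single] wt_FR[OF o R single]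
    D.cmp_bas[OF on_obj_obj[OF o(1)] on_obj_obj[OF o(2)] on_obj_obj[OF o(3)] sub_map_eq(2)[OF o(1,2) R]
     sub_map_eq(2)[OF o(2,3) single]])
qed (simp_all add: rel_cmp_simps fl_zero fl_add)
qed (simp_all add: rel_cmp_simps fl_zero fl_add)

lemma fl_pscale:
 assumes o: "x : Obj C" "y : Obj C" and "\<phi> : C.H x y"
 shows "fl x y (pscale c \<phi>) = pscale c (fl x y \<phi>)"
 using assms(3) by (induction rule: C.H_induct) (simp_all add: pscale_simps fl_zero fl_add fl_bas[OF o])

lemma fl_gr:
 assumes f: "f : Hom C x y"
 shows "fl x y (C.gr f x y) = D.gr (FA f) (FO x) (FO y)"
 using fl_bas[OF C.hom_dom_obj[OF f] C.hom_cod_obj[OF f] C.grf_Rel[OF f]] unfolding FR_grf[OF f] .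

lemma TF_sel: "on_obj TF = FO" "on_arr TF (x, \<phi>, y) = (FO x, fl x y \<phi>, FO y)"
 "Mu TF x y = transposed_graph_arr D (pairing D (FA (pr1 C x y)) (FA (pr2 C x y)))"
 "Eps TF = transposed_graph_arr D (to_terminal D (FO C.un))"
 by (simp_all add: T0_functor_def fl_def)

lemma TF_Gr: "f : Hom C x y ==> on_arr TF (C.Gr f) = D.Gr (FA f)"
 by (simp add: C.Gr_eq TF_sel fl_gr D.Gr_eq[OF on_arr_hom])

lemma TF_functor: "is_functor C.T D.T TF"
proof -
interpret CT: symmetric_monoidal_category C.T by (rule C.T0_smc)
interpret DT: symmetric_monoidal_category D.T by (rule D.T0_smc)
show ?thesis
proof (unfold_locales, goal_cases)
 case (1 x) then show ?case unfolding C.T0_sel D.T0_sel TF_sel by (rule on_obj_obj)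
next
 case (2 f x y)
 then show ?case by (auto simp: C.T0_Hom D.T0_Hom TF_sel fl_H on_obj_obj)
next
 case (3 x)
 then have x: "x : Obj C" unfolding C.T0_sel .
 show ?case unfolding C.T0_sel(4) D.T0_sel(4) TF_Gr[OF C.ident_hom[OF x]] TF_sel on_arr_ident[OF x] ..
next
 case (4 f x y g z)
 then show ?case by (auto simp: C.T0_Hom TF_sel C.T0_sel(5) D.T0_sel(5) fl_cmp)
qed
qed

text \<open>Inverting a bijection transposes its graph, so \<open>Mu\<close> and \<open>Eps\<close>
  are graphs of arrows of \<open>D\<close>, and their coherence laws become equations between
  arrows.\<close>

lemma transposed_graph_inverse:
 assumes c: "c : Hom D X Y" and bij: "bij_betw (D.fn c) (D.car X) (D.car Y)"
 shows "EX k:Hom D Y X. transposed_graph_arr D c = D.Gr k & (ALL u:D.car Y. D.fn c (D.fn k u) = u)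
  & bij_betw (D.fn k) (D.car Y) (D.car X)"
proof -
obtain k where k: "k : Hom D Y X" "k \<cdot> c = Ident D X" "c \<cdot> k = Ident D Y"
 using D.inverse_ex[OF c bij] by blast
have ck: "D.fn c (D.fn k u) = u" if "u : D.car Y" for u
 using D.fn_comp[OF k(1) c that] k(3) D.fn_ident[OF that] by simp
have kc: "D.fn k (D.fn c a) = a" if "a : D.car X" for a
 using D.fn_comp[OF c k(1) that] k(2) D.fn_ident[OF that] by simp
have "(D.grf c X)\<inverse> = D.grf k Y"
 using ck kc D.fn_closed[OF c] D.fn_closed[OF k(1)] by (auto simp: D.grf_def image_iff)
then have "transposed_graph_arr D c = D.Gr k" unfolding D.transposed_graph_arr_eq[OF c] D.Gr_eq[OF k(1)] by simp
moreover have "bij_betw (D.fn k) (D.car Y) (D.car X)"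
 using D.fn_closed[OF c] D.fn_closed[OF k(1)] ck kc by (intro bij_betw_byWitness[where f'="D.fn c"]) auto
ultimately show ?thesis using k(1) ck by blast
qed

section \<open>The comparison of products and its coherence\<close>

abbreviation "P1 x y \<equiv> D.fn (FA (pr1 C x y))"
abbreviation "P2 x y \<equiv> D.fn (FA (pr2 C x y))"

lemma F_prod_bij:
 assumes o: "x : Obj C" "y : Obj C"
 shows "bij_betw (%w. (P1 x y w, P2 x y w)) (D.car (FO (C.PC x y))) (D.car (FO x) \<times> D.car (FO y))"
proof -
have "{(a, b) : D.car (FO x) \<times> D.car (FO y). ALL j:J. (ev x j a, ev y j b) : C.car x \<times> C.car y}
  = D.car (FO x) \<times> D.car (FO y)"
 using ev_closed[OF o(1)] ev_closed[OF o(2)] by auto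
then show ?thesis using FA_bij[OF C.pr_hom(1-3)[OF o]] by simp
qed

lemma F_prod_eqI:
 assumes o: "x : Obj C" "y : Obj C"
  and "u : D.car (FO (C.PC x y))" "v : D.car (FO (C.PC x y))" "P1 x y u = P1 x y v" "P2 x y u = P2 x y v"
 shows "u = v"
 by (rule inj_onD[OF bij_betw_imp_inj_on[OF F_prod_bij[OF o]] _ assms(3,4)]) (use assms(5,6) in simp)

lemma Mu_ex:
 assumes o: "x : Obj C" "y : Obj C"
 shows "EX k:Hom D (D.PC (FO x) (FO y)) (FO (C.PC x y)). Mu TF x y = D.Gr k
  & (ALL u:D.car (D.PC (FO x) (FO y)). P1 x y (D.fn k u) = D.pi1 (FO x) (FO y) u & P2 x y (D.fn k u) = D.pi2 (FO x) (FO y) u)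
  & bij_betw (D.fn k) (D.car (D.PC (FO x) (FO y))) (D.car (FO (C.PC x y)))"
proof -
let ?c = "pairing D (FA (pr1 C x y)) (FA (pr2 C x y))"
note o' = on_obj_obj[OF o(1)] on_obj_obj[OF o(2)]
note p = on_arr_hom[OF C.pr_hom(1)[OF o]] on_arr_hom[OF C.pr_hom(2)[OF o]]
note c = D.pairing_hom(1)[OF p]
have fn: "D.pi1 (FO x) (FO y) (D.fn ?c w) = P1 x y w" "D.pi2 (FO x) (FO y) (D.fn ?c w) = P2 x y w"
 if "w : D.car (FO (C.PC x y))" for w using D.pairing_fn[OF p that] by simp_all
have bij: "bij_betw (D.fn ?c) (D.car (FO (C.PC x y))) (D.car (D.PC (FO x) (FO y)))"
 unfolding bij_betw_def
proof (intro conjI inj_onI equalityI subsetI)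
 fix w w' assume "w : D.car (FO (C.PC x y))" "w' : D.car (FO (C.PC x y))" "D.fn ?c w = D.fn ?c w'"
 then show "w = w'" using F_prod_eqI[OF o] fn by metis
next
 fix u assume "u : D.fn ?c ` D.car (FO (C.PC x y))"
 then show "u : D.car (D.PC (FO x) (FO y))" using D.fn_closed[OF c] by blast
next
 fix u assume u: "u : D.car (D.PC (FO x) (FO y))"
 have "(D.pi1 (FO x) (FO y) u, D.pi2 (FO x) (FO y) u) : (%w. (P1 x y w, P2 x y w)) ` D.car (FO (C.PC x y))"
  unfolding bij_betw_imp_surj_on[OF F_prod_bij[OF o]] using D.pr_closed[OF o' u] by simp
 then obtain w where w: "w : D.car (FO (C.PC x y))" "P1 x y w = D.pi1 (FO x) (FO y) u" "P2 x y w = D.pi2 (FO x) (FO y) u"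
  by auto
 have "D.fn ?c w = u" by (rule D.pr_inj[OF o' D.fn_closed[OF c w(1)] u]) (simp_all add: fn[OF w(1)] w)
 then show "u : D.fn ?c ` D.car (FO (C.PC x y))" using w(1) by blast
qed
obtain k where k: "k : Hom D (D.PC (FO x) (FO y)) (FO (C.PC x y))" "transposed_graph_arr D ?c = D.Gr k"
 "ALL u:D.car (D.PC (FO x) (FO y)). D.fn ?c (D.fn k u) = u"
 "bij_betw (D.fn k) (D.car (D.PC (FO x) (FO y))) (D.car (FO (C.PC x y)))"
 using transposed_graph_inverse[OF c bij] by blast
have "P1 x y (D.fn k u) = D.pi1 (FO x) (FO y) u & P2 x y (D.fn k u) = D.pi2 (FO x) (FO y) u"
 if u: "u : D.car (D.PC (FO x) (FO y))" for u
 using fn[OF D.fn_closed[OF k(1) u]] bspec[OF k(3) u] by simp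
then show ?thesis unfolding TF_sel using k by blast
qed

text \<open>A name for the inverse of the comparison arrow, pinned down by its components under the
  images of the projections; the coherence laws are verified through these components.\<close>

definition "\<mu> x y = (SOME k. k : Hom D (D.PC (FO x) (FO y)) (FO (C.PC x y)) & Mu TF x y = D.Gr k
  & (ALL u:D.car (D.PC (FO x) (FO y)). P1 x y (D.fn k u) = D.pi1 (FO x) (FO y) u & P2 x y (D.fn k u) = D.pi2 (FO x) (FO y) u)
  & bij_betw (D.fn k) (D.car (D.PC (FO x) (FO y))) (D.car (FO (C.PC x y))))"

lemma \<mu>:
 assumes o: "x : Obj C" "y : Obj C"
 shows "\<mu> x y : Hom D (D.PC (FO x) (FO y)) (FO (C.PC x y))" (is ?P) "Mu TF x y = D.Gr (\<mu> x y)"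
  "u : D.car (D.PC (FO x) (FO y)) ==> P1 x y (D.fn (\<mu> x y) u) = D.pi1 (FO x) (FO y) u"
  "u : D.car (D.PC (FO x) (FO y)) ==> P2 x y (D.fn (\<mu> x y) u) = D.pi2 (FO x) (FO y) u"
  "bij_betw (D.fn (\<mu> x y)) (D.car (D.PC (FO x) (FO y))) (D.car (FO (C.PC x y)))"
proof -
have "EX k. k : Hom D (D.PC (FO x) (FO y)) (FO (C.PC x y)) & Mu TF x y = D.Gr k
 & (ALL u:D.car (D.PC (FO x) (FO y)). P1 x y (D.fn k u) = D.pi1 (FO x) (FO y) u & P2 x y (D.fn k u) = D.pi2 (FO x) (FO y) u)
 & bij_betw (D.fn k) (D.car (D.PC (FO x) (FO y))) (D.car (FO (C.PC x y)))"
 using Mu_ex[OF o] by blast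
note s = someI_ex[OF this, folded \<mu>_def]
show ?P "Mu TF x y = D.Gr (\<mu> x y)"
 "u : D.car (D.PC (FO x) (FO y)) ==> P1 x y (D.fn (\<mu> x y) u) = D.pi1 (FO x) (FO y) u"
 "u : D.car (D.PC (FO x) (FO y)) ==> P2 x y (D.fn (\<mu> x y) u) = D.pi2 (FO x) (FO y) u"
 "bij_betw (D.fn (\<mu> x y)) (D.car (D.PC (FO x) (FO y))) (D.car (FO (C.PC x y)))"
 using s by blast+
qed

lemma Eps_ex: "EX e:Hom D D.un (FO C.un). Eps TF = D.Gr e & bij_betw (D.fn e) (D.car D.un) (D.car (FO C.un))"
proof -
have t: "is_terminal D (FO C.un)" by (rule FO_terminal) (use C.terminal_obj in "auto simp: C.terminal_iff")
then have o: "FO C.un : Obj D" "D.car (FO C.un) = {D.zr (FO C.un)}" by (simp_all add: D.terminal_iff)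
have "is_terminal D D.un" using D.terminal_obj by (auto simp: D.terminal_iff)
then have "\<exists>!f. f : Hom D (FO C.un) D.un" using o(1) unfolding is_terminal_def by blast
from theI'[OF this] have c: "to_terminal D (FO C.un) : Hom D (FO C.un) D.un" unfolding to_terminal_def .
have "bij_betw (D.fn (to_terminal D (FO C.un))) (D.car (FO C.un)) (D.car D.un)"
 unfolding o(2) D.terminal_obj(2) bij_betw_def using D.fn_zr[OF c] by simp
from transposed_graph_inverse[OF c this] show ?thesis unfolding TF_sel by blast
qed

lemma fn_comp2:
 assumes "f : Hom D X Y" "g : Hom D Y Z" "h : Hom D Z W" "u : D.car X"
 shows "D.fn (h \<cdot> g \<cdot> f) u = D.fn h (D.fn g (D.fn f u))"
 using D.fn_comp[OF assms(1) D.comp_in_hom[OF assms(2,3)] assms(4)] D.fn_comp[OF assms(2,3) D.fn_closed[OF assms(1,4)]]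
 by simp

lemma FA_fn:
 assumes "f : Hom C x y" "g : Hom C y z" "w : D.car (FO x)"
 shows "D.fn (FA g) (D.fn (FA f) w) = D.fn (FA (g \<cdot>\<^bsub>C\<^esub> f)) w"
 using on_arr_comp[OF assms(1,2)] D.fn_comp[OF on_arr_hom[OF assms(1)] on_arr_hom[OF assms(2)] assms(3)] by simp

lemma FA_as:
 assumes o: "x : Obj C" "y : Obj C" "z : Obj C" and w: "w : D.car (FO (C.PC (C.PC x y) z))"
 shows "P1 x (C.PC y z) (D.fn (FA (C.as x y z)) w) = P1 x y (P1 (C.PC x y) z w)" (is ?P)
  "P1 y z (P2 x (C.PC y z) (D.fn (FA (C.as x y z)) w)) = P2 x y (P1 (C.PC x y) z w)" (is ?P1)
  "P2 y z (P2 x (C.PC y z) (D.fn (FA (C.as x y z)) w)) = P2 (C.PC x y) z w" (is ?P2)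
proof -
note xy = C.pr_hom(4)[OF o(1,2)] and yz = C.pr_hom(4)[OF o(2,3)]
note p = C.pr_hom(1)[OF xy o(3)] C.pr_hom(2)[OF xy o(3)] C.pr_hom(1)[OF o(1,2)] C.pr_hom(2)[OF o(1,2)]
note q = C.pr_hom(1)[OF o(1) yz] C.pr_hom(2)[OF o(1) yz] C.pr_hom(1)[OF o(2,3)] C.pr_hom(2)[OF o(2,3)]
note a = C.as_hom(1)[OF o]
note h = C.comp_hom[OF p(1,3)] C.comp_hom[OF p(1,4)]
note b = C.pairing_hom[OF h(2) p(2)]
note d = C.pairing_hom(2,3)[OF h(1) b(1), folded C.as_def]
show ?P
 unfolding FA_fn[OF a q(1) w] FA_fn[OF p(1,3) w] d ..
show ?P1
 unfolding FA_fn[OF a q(2) w] FA_fn[OF p(1,4) w] d FA_fn[OF b(1) q(3) w] b ..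
show ?P2
 unfolding FA_fn[OF a q(2) w] d FA_fn[OF b(1) q(4) w] b ..
qed

lemma FA_br:
 assumes o: "x : Obj C" "y : Obj C" and w: "w : D.car (FO (C.PC x y))"
 shows "P1 y x (D.fn (FA (C.br x y)) w) = P2 x y w" (is ?P) "P2 y x (D.fn (FA (C.br x y)) w) = P1 x y w" (is ?P1)
proof -
note p = C.pr_hom(1)[OF o] C.pr_hom(2)[OF o] and q = C.pr_hom(1)[OF o(2,1)] C.pr_hom(2)[OF o(2,1)]
note b = C.br_hom(1)[OF o]
note e = C.pairing_hom(2,3)[OF p(2,1), folded C.br_def]
show ?P unfolding FA_fn[OF b q(1) w] e ..
show ?P1 unfolding FA_fn[OF b q(2) w] e ..
qed

text \<open>The images of the projections are jointly injective on the image of a product, so both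
  sides are compared after applying them; each component is then a projection of
  \<open>u\<close>.\<close>

lemma \<mu>_assoc:
 assumes o: "x : Obj C" "y : Obj C" "z : Obj C"
 shows "FA (C.as x y z) \<cdot> \<mu> (C.PC x y) z \<cdot> D.pm (D.PC (FO x) (FO y)) (FO z) (\<mu> x y) (Ident D (FO z))
  = \<mu> x (C.PC y z) \<cdot> D.pm (FO x) (D.PC (FO y) (FO z)) (Ident D (FO x)) (\<mu> y z) \<cdot> D.as (FO x) (FO y) (FO z)"
  (is "?l = ?r")
proof -
note xy = C.pr_hom(4)[OF o(1,2)] and yz = C.pr_hom(4)[OF o(2,3)]
note o' = on_obj_obj[OF o(1)] on_obj_obj[OF o(2)] on_obj_obj[OF o(3)]
note xy' = D.pr_hom(4)[OF o'(1,2)] and yz' = D.pr_hom(4)[OF o'(2,3)]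
note i = D.ident_hom[OF o'(1)] D.ident_hom[OF o'(3)]
note m1 = \<mu>(1,3,4)[OF o(1,2)] and m2 = \<mu>(1,3,4)[OF xy o(3)] and m3 = \<mu>(1,3,4)[OF o(2,3)] and m4 = \<mu>(1,3,4)[OF o(1) yz]
note p = D.pm_hom[OF m1(1) i(2)] and q = D.pm_hom[OF i(1) m3(1)]
note a = on_arr_hom[OF C.as_hom(1)[OF o]] and a' = D.as_hom[OF o']
note hl = D.comp_in_hom[OF p D.comp_in_hom[OF m2(1) a]]
note hr = D.comp_in_hom[OF a'(1) D.comp_in_hom[OF q m4(1)]]
show ?thesis
proof (rule D.hom_eqI[OF hl hr])
 fix u assume u: "u : D.car (D.PC (D.PC (FO x) (FO y)) (FO z))"
 note u1 = D.fn_closed[OF p u] and u2 = D.fn_closed[OF a'(1) u]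
 note v1 = D.fn_closed[OF m2(1) u1] and v2 = D.fn_closed[OF q u2]
 note l = D.fn_closed[OF hl u] and r = D.fn_closed[OF hr u]
 note pu = D.pr_closed[OF xy' o'(3) u] and pa = D.pr_closed[OF o'(1) yz' u2]
 note fl' = fn_comp2[OF p m2(1) a u] and fr' = fn_comp2[OF a'(1) q m4(1) u]
 note L = FA_as[OF o v1] m2(2,3)[OF u1] D.pm_fn[OF m1(1) i(2) u] m1(2,3)[OF pu(1)] D.fn_ident[OF pu(2)]
 note M = m4(2,3)[OF v2] D.pm_fn[OF i(1) m3(1) u2] m3(2,3)[OF pa(2)] D.fn_ident[OF D.pr_closed(1)[OF o'(1,2) pu(1)]] a'(2-4)[OF u]
 note P2h = on_arr_hom[OF C.pr_hom(2)[OF o(1) yz]]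
 show "D.fn ?l u = D.fn ?r u"
 proof (rule F_prod_eqI[OF o(1) yz l r])
  show "P1 x (C.PC y z) (D.fn ?l u) = P1 x (C.PC y z) (D.fn ?r u)"
   unfolding fl' fr' by (simp only: L M)
  show "P2 x (C.PC y z) (D.fn ?l u) = P2 x (C.PC y z) (D.fn ?r u)"
   by (rule F_prod_eqI[OF o(2,3) D.fn_closed[OF P2h l] D.fn_closed[OF P2h r]]; unfold fl' fr'; simp only: L M)
 qed
qed
qed

lemma \<mu>_braid:
 assumes o: "x : Obj C" "y : Obj C"
 shows "FA (C.br x y) \<cdot> \<mu> x y = \<mu> y x \<cdot> D.br (FO x) (FO y)"
proof -
note o' = on_obj_obj[OF o(1)] on_obj_obj[OF o(2)]
note m1 = \<mu>(1,3,4)[OF o] and m2 = \<mu>(1,3,4)[OF o(2,1)]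
note b = on_arr_hom[OF C.br_hom(1)[OF o]] and b' = D.br_hom[OF o']
note hl = D.comp_in_hom[OF m1(1) b] and hr = D.comp_in_hom[OF b'(1) m2(1)]
show ?thesis
proof (rule D.hom_eqI[OF hl hr])
 fix u assume u: "u : D.car (D.PC (FO x) (FO y))"
 note u1 = D.fn_closed[OF m1(1) u] and u2 = D.fn_closed[OF b'(1) u]
 show "D.fn (FA (C.br x y) \<cdot> \<mu> x y) u = D.fn (\<mu> y x \<cdot> D.br (FO x) (FO y)) u"
  by (rule F_prod_eqI[OF o(2,1) D.fn_closed[OF hl u] D.fn_closed[OF hr u]];
    simp only: D.fn_comp[OF m1(1) b u] D.fn_comp[OF b'(1) m2(1) u] FA_br[OF o u1] m1(2,3)[OF u] m2(2,3)[OF u2] b'(2,3)[OF u])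
qed
qed

lemma \<mu>_unit:
 assumes o: "x : Obj C" and e: "e : Hom D D.un (FO C.un)"
 shows "FA (pr2 C C.un x) \<cdot> \<mu> C.un x \<cdot> D.pm D.un (FO x) e (Ident D (FO x)) = pr2 D D.un (FO x)" (is ?P)
  "FA (pr1 C x C.un) \<cdot> \<mu> x C.un \<cdot> D.pm (FO x) D.un (Ident D (FO x)) e = pr1 D (FO x) D.un" (is ?P1)
proof -
note t = C.terminal_obj(1) and t' = D.terminal_obj(1) and o' = on_obj_obj[OF o]
note i = D.ident_hom[OF o']
note m1 = \<mu>(1,4)[OF t o] and m2 = \<mu>(1,3)[OF o t]
note p1 = D.pm_hom[OF e i] and p2 = D.pm_hom[OF i e]
note q1 = on_arr_hom[OF C.pr_hom(2)[OF t o]] and q2 = on_arr_hom[OF C.pr_hom(1)[OF o t]]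
show ?P
proof (rule D.hom_eqI[OF D.comp_in_hom[OF p1 D.comp_in_hom[OF m1(1) q1]] D.pr_hom(2)[OF t' o']])
 fix u assume u: "u : D.car (D.PC D.un (FO x))"
 show "D.fn (FA (pr2 C C.un x) \<cdot> \<mu> C.un x \<cdot> D.pm D.un (FO x) e (Ident D (FO x))) u = D.pi2 D.un (FO x) u"
  unfolding fn_comp2[OF p1 m1(1) q1 u] m1(2)[OF D.fn_closed[OF p1 u]] D.pm_fn(2)[OF e i u]
  by (rule D.fn_ident[OF D.pr_closed(2)[OF t' o' u]])
qed
show ?P1
proof (rule D.hom_eqI[OF D.comp_in_hom[OF p2 D.comp_in_hom[OF m2(1) q2]] D.pr_hom(1)[OF o' t']])
 fix u assume u: "u : D.car (D.PC (FO x) D.un)"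
 show "D.fn (FA (pr1 C x C.un) \<cdot> \<mu> x C.un \<cdot> D.pm (FO x) D.un (Ident D (FO x)) e) u = D.pi1 (FO x) D.un u"
  unfolding fn_comp2[OF p2 m2(1) q2 u] m2(2)[OF D.fn_closed[OF p2 u]] D.pm_fn(1)[OF i e u]
  by (rule D.fn_ident[OF D.pr_closed(1)[OF o' t' u]])
qed
qed

text \<open>The comparison leaves the two entries of a pair in place, so the product of image
  relations and the image of the product relation impose the same conditions. This is what
  \<open>natural_square\<close> asks for in the naturality of \<open>Mu\<close>.\<close>

lemma FR_trel:
 assumes o: "x : Obj C" "x' : Obj C" "y : Obj C" "y' : Obj C"
  and u: "u : D.car (D.PC (FO x) (FO y))" and v: "v : D.car (D.PC (FO x') (FO y'))"
 shows "(u, v) : D.trel (FO x) (FO x') (FO y) (FO y') (FR x x' R) (FR y y' S) \<longleftrightarrow>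
  (D.fn (\<mu> x y) u, D.fn (\<mu> x' y') v) : FR (C.PC x y) (C.PC x' y') (C.trel x x' y y' R S)"
proof -
note o' = on_obj_obj[OF o(1)] on_obj_obj[OF o(2)] on_obj_obj[OF o(3)] on_obj_obj[OF o(4)]
note xy = C.pr_hom[OF o(1,3)] and xy' = C.pr_hom[OF o(2,4)]
note m = \<mu>[OF o(1,3)] and m' = \<mu>[OF o(2,4)]
note a = D.fn_closed[OF m(1) u] and b = D.fn_closed[OF m'(1) v]
have e1: "C.pi1 x y (ev (C.PC x y) j (D.fn (\<mu> x y) u)) = ev x j (D.pi1 (FO x) (FO y) u)"
 "C.pi2 x y (ev (C.PC x y) j (D.fn (\<mu> x y) u)) = ev y j (D.pi2 (FO x) (FO y) u)"
 "C.pi1 x' y' (ev (C.PC x' y') j (D.fn (\<mu> x' y') v)) = ev x' j (D.pi1 (FO x') (FO y') v)"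
 "C.pi2 x' y' (ev (C.PC x' y') j (D.fn (\<mu> x' y') v)) = ev y' j (D.pi2 (FO x') (FO y') v)"
 "ev (C.PC x y) j (D.fn (\<mu> x y) u) : C.car (C.PC x y)" "ev (C.PC x' y') j (D.fn (\<mu> x' y') v) : C.car (C.PC x' y')"
 if j: "j : J" for j
 using ev_natural[OF xy(1) a j] ev_natural[OF xy(2) a j] ev_natural[OF xy'(1) b j] ev_natural[OF xy'(2) b j]
  ev_closed[OF xy(4) a j] ev_closed[OF xy'(4) b j] by (simp_all add: m(3,4)[OF u] m'(3,4)[OF v])
show ?thesis
 unfolding D.trel_def FR_def C.trel_def
 using u v a b D.pr_closed[OF o'(1,3) u] D.pr_closed[OF o'(2,4) v] by (auto simp: e1)
qed

lemma \<mu>_natural: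
 assumes o: "x : Obj C" "x' : Obj C" "y : Obj C" "y' : Obj C" and "\<phi> : C.H x x'" and \<psi>: "\<psi> : C.H y y'"
 shows "D.cmp (D.PC (FO x) (FO y)) (FO (C.PC x y)) (FO (C.PC x' y')) (fl (C.PC x y) (C.PC x' y') (C.tns x x' y y' \<phi> \<psi>))
   (D.gr (\<mu> x y) (D.PC (FO x) (FO y)) (FO (C.PC x y)))
  = D.cmp (D.PC (FO x) (FO y)) (D.PC (FO x') (FO y')) (FO (C.PC x' y')) (D.gr (\<mu> x' y') (D.PC (FO x') (FO y')) (FO (C.PC x' y')))
   (D.tns (FO x) (FO x') (FO y) (FO y') (fl x x' \<phi>) (fl y y' \<psi>))"
 using assms(5)
proof (induction rule: C.H_induct)
case (single R c)
note R = single
note o' = on_obj_obj[OF o(1)] on_obj_obj[OF o(2)] on_obj_obj[OF o(3)] on_obj_obj[OF o(4)]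
from \<psi> show ?case
proof (induction rule: C.H_induct)
 case (single S d)
 note t = C.trel_Rel[OF o R single] and xy = C.pr_hom(4)[OF o(1,3)] C.pr_hom(4)[OF o(2,4)]
 note f = sub_map_eq(2)[OF o(1,2) R] sub_map_eq(2)[OF o(3,4) single]
 show ?case
  unfolding C.tns_bas[OF o R single] fl_bas[OF o(1,2) R] fl_bas[OF o(3,4) single] fl_bas[OF xy t] D.tns_bas[OF o' f]
  by (rule D.natural_square[symmetric, OF \<mu>(1)[OF o(1,3)] \<mu>(1)[OF o(2,4)] \<mu>(5)[OF o(2,4)] D.trel_Rel[OF o' f]
     sub_map_eq(2)[OF xy t]]) (rule FR_trel[OF o])
qed (simp_all add: rel_cmp_simps rel_tns_simps fl_zero fl_add)
qed (simp_all add: rel_cmp_simps rel_tns_simps fl_zero fl_add)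

text \<open>Naturality of \<open>Mu\<close> is the only monoidal law about arbitrary relations; the
  others are equations between graphs and come from the corresponding equations in
  \<open>D\<close>.\<close>

theorem TF_smf: "symmetric_monoidal_functor C.T D.T TF"
proof -
interpret CT: symmetric_monoidal_category C.T by (rule C.T0_smc)
interpret DT: symmetric_monoidal_category D.T by (rule D.T0_smc)
interpret TF: is_functor C.T D.T TF by (rule TF_functor)
obtain e where e: "e : Hom D D.un (FO C.un)" "Eps TF = D.Gr e" "bij_betw (D.fn e) (D.car D.un) (D.car (FO C.un))"
 using Eps_ex by blast
note t = C.terminal_obj(1)
show ?thesis
proof (unfold_locales, goal_cases)
 case (1 x y)
 then have o: "x : Obj C" "y : Obj C" unfolding C.T0_sel by auto
 show ?case unfolding C.T0_sel(6) D.T0_sel(6) TF_sel(1) \<mu>(2)[OF o]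
  using D.Gr_hom[OF \<mu>(1)[OF o]] D.Gr_iso[OF \<mu>(1)[OF o] \<mu>(5)[OF o]] by blast
next
 case (2 f x x' g y y')
 then obtain \<phi> \<psi> where *: "f = (x, \<phi>, x')" "g = (y, \<psi>, y')"
  and o: "x : Obj C" "x' : Obj C" "y : Obj C" "y' : Obj C" and h: "\<phi> : C.H x x'" "\<psi> : C.H y y'" by (auto simp: C.T0_Hom)
 show ?case
  unfolding * C.T0_sel(7) \<mu>(2)[OF o(1,3)] \<mu>(2)[OF o(2,4)] TF_sel(2) D.T0_sel(7) D.Gr_eq[OF \<mu>(1)[OF o(1,3)]]
   D.Gr_eq[OF \<mu>(1)[OF o(2,4)]] D.T0_sel(5) \<mu>_natural[OF o h] ..
next
 case 3
 show ?case unfolding C.T0_sel(8) D.T0_sel(8) TF_sel(1) e(2) using D.Gr_hom[OF e(1)] D.Gr_iso[OF e(1,3)] by blast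
next
 case (4 x y z)
 then have o: "x : Obj C" "y : Obj C" "z : Obj C" unfolding C.T0_sel by auto
 note xy = C.pr_hom(4)[OF o(1,2)] and yz = C.pr_hom(4)[OF o(2,3)]
 note o' = on_obj_obj[OF o(1)] on_obj_obj[OF o(2)] on_obj_obj[OF o(3)]
 note i = D.ident_hom[OF o'(1)] D.ident_hom[OF o'(3)]
 note m = \<mu>(1)[OF o(1,2)] \<mu>(1)[OF xy o(3)] \<mu>(1)[OF o(2,3)] \<mu>(1)[OF o(1) yz]
 note p = D.pm_hom[OF m(1) i(2)] and q = D.pm_hom[OF i(1) m(3)]
 note a = on_arr_hom[OF C.as_hom(1)[OF o]] and a' = D.as_hom(1)[OF o']
 show ?case
  unfolding C.T0_sel(6,9) D.T0_sel(4,9) TF_sel(1) TF_Gr[OF C.as_hom(1)[OF o]]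
   \<mu>(2)[OF o(1,2)] \<mu>(2)[OF xy o(3)] \<mu>(2)[OF o(2,3)] \<mu>(2)[OF o(1) yz]
   D.Gr_tens[OF m(1) i(2)] D.Gr_tens[OF i(1) m(3)] D.Gr_comp[OF m(2) a] D.Gr_comp[OF p D.comp_in_hom[OF m(2) a]]
   D.Gr_comp[OF q m(4)] D.Gr_comp[OF a' D.comp_in_hom[OF q m(4)]] \<mu>_assoc[OF o] ..
next
 case (5 x)
 then have o: "x : Obj C" unfolding C.T0_sel .
 note i = D.ident_hom[OF on_obj_obj[OF o]] and m = \<mu>(1)[OF t o] and q = on_arr_hom[OF C.pr_hom(2)[OF t o]]
 show ?case
  unfolding C.T0_sel(8,10) D.T0_sel(4,10) TF_sel(1) e(2) TF_Gr[OF C.pr_hom(2)[OF t o]] \<mu>(2)[OF t o]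
   D.Gr_tens[OF e(1) i] D.Gr_comp[OF m q] D.Gr_comp[OF D.pm_hom[OF e(1) i] D.comp_in_hom[OF m q]] \<mu>_unit(1)[OF o e(1)]
  ..
next
 case (6 x)
 then have o: "x : Obj C" unfolding C.T0_sel .
 note i = D.ident_hom[OF on_obj_obj[OF o]] and m = \<mu>(1)[OF o t] and q = on_arr_hom[OF C.pr_hom(1)[OF o t]]
 show ?case
  unfolding C.T0_sel(8,11) D.T0_sel(4,11) TF_sel(1) e(2) TF_Gr[OF C.pr_hom(1)[OF o t]] \<mu>(2)[OF o t]
   D.Gr_tens[OF i e(1)] D.Gr_comp[OF m q] D.Gr_comp[OF D.pm_hom[OF i e(1)] D.comp_in_hom[OF m q]] \<mu>_unit(2)[OF o e(1)]
  ..
next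
 case (7 x y)
 then have o: "x : Obj C" "y : Obj C" unfolding C.T0_sel by auto
 note o' = on_obj_obj[OF o(1)] on_obj_obj[OF o(2)]
 note b = on_arr_hom[OF C.br_hom(1)[OF o]]
 show ?case
  unfolding C.T0_sel(12) D.T0_sel(12) TF_sel(1) TF_Gr[OF C.br_hom(1)[OF o]] \<mu>(2)[OF o] \<mu>(2)[OF o(2,1)]
   D.Gr_comp[OF \<mu>(1)[OF o] b] D.Gr_comp[OF D.br_hom(1)[OF o'] \<mu>(1)[OF o(2,1)]] \<mu>_braid[OF o] ..
qed
qed

theorem TF_linear: "linear_functor C.T D.T TF"
 unfolding linear_functor_def
proof (intro conjI allI ballI)
fix x y f g assume "f : Hom C.T x y" "g : Hom C.T x y"
then obtain \<phi> \<psi> where "f = (x, \<phi>, y)" "g = (x, \<psi>, y)" by (auto simp: C.T0_Hom)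
then show "on_arr TF (Hadd C.T f g) = Hadd D.T (on_arr TF f) (on_arr TF g)"
 by (simp add: T0_def TF_sel fl_add)
next
fix c f assume "f : Arr C.T"
then show "on_arr TF (Hscale C.T c f) = Hscale D.T c (on_arr TF f)"
 unfolding C.T0_Arr by (auto simp: T0_def TF_sel fl_pscale)
qed

theorem induced_functor:
 "symmetric_monoidal_functor (\<T> C \<delta>) (\<T> D \<delta>') (induced_functor C \<delta> D \<delta>' F)"
 "linear_functor (\<T> C \<delta>) (\<T> D \<delta>') (induced_functor C \<delta> D \<delta>' F)"
proof -
interpret K: additive_smf C.T C.H D.T D.H TF
 by (intro additive_smf.intro additive_smf_axioms.intro C.T0_additive D.T0_additive TF_smf TF_linear)
show "symmetric_monoidal_functor (\<T> C \<delta>) (\<T> D \<delta>') (induced_functor C \<delta> D \<delta>' F)"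
 "linear_functor (\<T> C \<delta>) (\<T> D \<delta>') (induced_functor C \<delta> D \<delta>' F)"
 unfolding tensor_envelope_def induced_functor_def using K.Karoubi_functor_smf K.Karoubi_functor_linear by blast+
qed

end

section \<open>Vector spaces as representations of the trivial group\<close>

text \<open>A group of order 1, which no characteristic divides; its representations are vector
  spaces with the trivial action, so the theory of representation categories covers
  \<open>Vect\<close>.\<close>

definition triv :: "unit monoid" where
 "triv = \<lparr>carrier = {()}, mult = (%_ _. ()), one = ()\<rparr>"

lemma triv_sel [simp]: "carrier triv = UNIV" by (auto simp: triv_def)

locale vect = rep_category triv C "%V. (V, %_ v. v)" fst
 for C :: "(('f::{field, finite}, 'u) module, ('f, 'u) vect_arr) cat" (structure) +
 assumes C_eq: "C = Vect"

lemma triv_Obj: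
 fixes V :: "('f::{field, finite}, 'u) module"
 shows "(V, %_ v. v) : Obj (Rep triv) \<longleftrightarrow> V : Obj Vect"
 by (auto simp: Obj_Rep Obj_Vect)

lemma triv_action: "(V, \<rho>) : Obj (Rep triv) ==> v : carrier V ==> \<rho> g v = v"
 by (auto simp: Rep_def Let_def triv_def)

lemma vect_Vect:
 assumes inf: "infinite (UNIV :: 'u set)"
 shows "vect (Vect :: (('f::{field, finite}, 'u) module, ('f, 'u) vect_arr) cat)"
proof (intro vect.intro rep_category.intro vect_axioms.intro refl inf)
show "group triv" by (rule groupI) (auto simp: triv_def)
show "finite (carrier triv)" by simp
show "\<not> CHAR('f) dvd Coset.order triv"
proof
 assume "CHAR('f) dvd Coset.order triv"
 then have "CHAR('f) = 1" by (simp add: Coset.order_def)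
 then have "(of_nat 1 :: 'f) = 0" by (metis of_nat_CHAR)
 then show False by simp
qed
show "Obj Vect = {V :: ('f, 'u) module. (V, %_ v. v) : Obj (Rep triv)}" by (simp add: triv_Obj)
have "(V, f, W) : Arr Vect \<longleftrightarrow> ((V, %_ v. v), f, (W, %_ v. v)) : Arr (Rep triv)" for V W :: "('f, 'u) module" and f
 unfolding Arr_Rep triv_Obj by (auto simp: Vect_def Let_def linear_map_iff)
then show "Arr Vect = {(V :: ('f, 'u) module, f, W). ((V, %_ v. v), f, (W, %_ v. v)) : Arr (Rep triv)}" by auto
show "snd (fst R, %_ v. v) g v = snd R g v" if "R : Obj (Rep triv)" "v : carrier (fst R)"
 for R :: "('f, unit, 'u) rep" and g v
 using triv_action[of "fst R" "snd R" v g] that by simp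
qed (simp_all add: Vect_def Let_def)

context vect
begin

lemma car_eq: "car S = carrier S" by (simp add: car_def)

lemma card_carrier: "S : Obj C ==> card (car S) = card (UNIV :: 'f set) ^ vdim S"
 using card_eq_power_vdim[OF Obj_vs[of S]] car_finite[of S] by (simp add: car_def)

lemma sub_eq: "sub S A = S\<lparr>carrier := A\<rparr>" by (simp add: sub_def subrep_def)

lemma hom_linear_map:
 assumes "e : Hom C S T" shows "linear_map class_ring S T (fn e)"
 unfolding linear_map_iff
 using hom_dom_obj[OF assms, THEN Obj_vs] hom_cod_obj[OF assms, THEN Obj_vs] fn_closed[OF assms] fn_pl[OF assms] fn_sm[OF assms]
 by (auto simp: car_def pl_def sm_def)

lemma mod_hom_ker:
 assumes "e : Hom C S T" shows "mod_hom.ker S T (fn e) = ker S e"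
proof -
have "mod_hom class_ring S T (fn e)" using hom_linear_map[OF assms] by (simp add: linear_map_def)
from mod_hom.ker_def[OF this] show ?thesis by (simp add: ker_def hom_Cod[OF assms] car_def zr_def)
qed

lemma vdim_exact:
 assumes e: "e : Hom C S T" and surj: "fn e ` car S = car T"
 shows "vdim S = vdim (sub S (ker S e)) + vdim T"
proof -
interpret linear_map class_ring S T "fn e" by (rule hom_linear_map[OF e])
have "vectorspace.fin_dim class_ring S"
 using hom_dom_obj[OF e] by (auto simp: C_eq Vect_def Let_def)
from rank_nullity_main(1)[OF this] show ?thesis
 using surj by (simp add: vdim_def sub_eq mod_hom_ker[OF e] im_def car_eq)
qed

lemma deg_Vect_eq:
 assumes e: "e : Hom C S T" shows "deg_Vect t e = t ^ vdim (sub S (ker S e))"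
proof -
obtain S' f T' where "e = (S', f, T')" by (cases e)
then have *: "e = (S, fn e, T)" using e by (auto simp: hom_iff fn_def)
show ?thesis by (subst *) (simp add: deg_Vect_def vker_def sub_eq mod_hom_ker[OF e])
qed

theorem degree_Vect: "degree_function C (deg_Vect (t :: 'k::field))"
proof (rule degree_functionI[where d="%S. t ^ vdim S"])
fix i S T assume i: "i : Hom C S T" "bij_betw (fn i) (car S) (car T)"
have "vdim S = vdim T"
 by (rule vdim_eqI) (use hom_dom_obj[OF i(1)] hom_cod_obj[OF i(1)] bij_betw_same_card[OF i(2)] in "auto simp: C_eq Obj_Vect car_eq")
then show "t ^ vdim S = t ^ vdim T" by simp
next
fix e S T assume "e : Hom C S T" "fn e ` car S = car T"
then show "t ^ vdim S = t ^ vdim (sub S (ker S e)) * t ^ vdim T" by (simp add: vdim_exact power_add)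
next
fix S assume S: "S : Obj C" "car S = {zr S}"
have "card (UNIV :: 'f set) ^ vdim S = card (UNIV :: 'f set) ^ 0" using card_carrier[OF S(1)] S(2) by simp
then show "t ^ vdim S = 1" unfolding power_inject_exp[OF one_less_card_field] by simp
qed (rule deg_Vect_eq)

text \<open>An arrow on the line through \<open>v\<close> is determined by the image of
  \<open>v\<close>, which may be any vector.\<close>

lemma card_Hom_line:
 assumes V: "V : Obj C" and v: "v : car V" "v ~= zr V" and S: "S : Obj C" and L: "L = range (%c. sm V c v)"
 shows "is_sub V L" "card L = card (UNIV :: 'f set)" "card (Hom C (sub V L) S) = card (car S)" (is ?P)
proof -
show sub: "is_sub V L"
 unfolding is_sub_def L
proof (intro conjI ballI allI)
 show "zr V : range (%c. sm V c v)" using sm_zero[OF V v(1)] by (metis rangeI)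
 fix a assume "a : range (%c. sm V c v)"
 then obtain c where a: "a = sm V c v" by blast
 show "sm V d a : range (%c. sm V c v)" for d unfolding a sm_sm[OF V v(1)] by blast
 show "ac V g a : range (%c. sm V c v)" for g unfolding ac_def using \<open>a : _\<close> by simp
 fix b assume "b : range (%c. sm V c v)"
 then obtain d where b: "b = sm V d v" by blast
 show "pl V a b : range (%c. sm V c v)" unfolding a b add_sm[OF V v(1), symmetric] by blast
qed (use sm_closed[OF V v(1)] in blast)
note s = sub_obj[OF V sub]
have inj: "inj (%c. sm V c v)" by (rule injI) (rule sm_inj[OF V v])
show "card L = card (UNIV :: 'f set)" unfolding L by (rule card_image[OF inj])
define co where "co = inv_into UNIV (%c. sm V c v)"
have co: "co (sm V c v) = c" for c unfolding co_def by (rule inv_into_f_f[OF inj UNIV_I])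
have vL: "v : L" unfolding L using sm_one[OF V v(1)] by (metis rangeI)
have el: "EX c. a = sm V c v" if "a : L" for a using that unfolding L by blast
have hom: "arr (sub V L) (%a. sm S (co a) t) S : Hom C (sub V L) S" if t: "t : car S" for t
proof (rule arr_hom[OF s(1) S])
 fix a assume "a : car (sub V L)"
 then obtain c where a: "a = sm V c v" using el unfolding s(2) by blast
 show "sm S (co a) t : car S" by (rule sm_closed[OF S t])
 show "sm S (co (sm (sub V L) d a)) t = sm S d (sm S (co a) t)" for d
  unfolding s(5) a sm_sm[OF V v(1)] co sm_sm[OF S t] ..
 show "sm S (co (ac (sub V L) g a)) t = ac S g (sm S (co a) t)" for g by (simp add: ac_def)
 fix b assume "b : car (sub V L)"
 then obtain d where b: "b = sm V d v" using el unfolding s(2) by blast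
 show "sm S (co (pl (sub V L) a b)) t = pl S (sm S (co a) t) (sm S (co b) t)"
  unfolding s(4) a b add_sm[OF V v(1), symmetric] co add_sm[OF S t] ..
qed
have "bij_betw (%f. fn f v) (Hom C (sub V L) S) (car S)"
 unfolding bij_betw_def
proof (intro conjI inj_onI equalityI subsetI)
 fix f h assume f: "f : Hom C (sub V L) S" "h : Hom C (sub V L) S" "fn f v = fn h v"
 show "f = h"
 proof (rule hom_eqI[OF f(1,2)])
  fix a assume "a : car (sub V L)"
  then obtain c where a: "a = sm (sub V L) c v" using el unfolding s(2) s(5) by blast
  have "v : car (sub V L)" unfolding s(2) by (rule vL)
  then show "fn f a = fn h a" unfolding a using fn_sm[OF f(1)] fn_sm[OF f(2)] f(3) by simp
 qed
next
 fix t assume "t : (%f. fn f v) ` Hom C (sub V L) S"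
 then obtain f where f: "f : Hom C (sub V L) S" "t = fn f v" by blast
 show "t : car S" unfolding f(2) by (rule fn_closed[OF f(1)]) (simp add: s(2) vL)
next
 fix t assume t: "t : car S"
 have "fn (arr (sub V L) (%a. sm S (co a) t) S) v = sm S (co v) t" by (rule fn_arr) (simp add: s(2) vL)
 also have "co v = 1" using co[of 1] sm_one[OF V v(1)] by simp
 also have "sm S 1 t = t" by (rule sm_one[OF S t])
 finally show "t : (%f. fn f v) ` Hom C (sub V L) S" using hom[OF t] by (intro image_eqI) simp_all
qed
then show ?P by (rule bij_betw_same_card)
qed

text \<open>Induction on the dimension: the kernel of a projection onto a line has one dimension
  less, and counts of arrows multiply along the exact sequence.\<close>

lemma card_Hom:
 assumes "V : Obj C" and S: "S : Obj C"
 shows "card (Hom C V S) = card (car S) ^ vdim V"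
 using assms(1)
proof (induction "vdim V" arbitrary: V)
case 0
then have "card (car V) = 1" using card_carrier[of V] by simp
then have z: "car V = {zr V}" using zr_closed[OF 0(2)] by (auto simp: card_1_singleton_iff)
note h = zero_arr[OF 0(2) S]
have "f = arr V (%_. zr S) S" if f: "f : Hom C V S" for f
 by (rule hom_eqI[OF f h]) (simp add: z fn_arr fn_zr[OF f])
then have "Hom C V S = {arr V (%_. zr S) S}" using h by blast
then show ?case using 0 by simp
next
case (Suc n)
note V = Suc.prems
have "car V ~= {zr V}"
proof
 assume "car V = {zr V}"
 then have "card (UNIV :: 'f set) ^ vdim V = card (UNIV :: 'f set) ^ 0" using card_carrier[OF V] by simp
 then show False using Suc.hyps(2) unfolding power_inject_exp[OF one_less_card_field] by simp
qed
then obtain v where v: "v : car V" "v ~= zr V" using zr_closed[OF V] by blast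
define L where "L = range (%c. sm V c v)"
note l = card_Hom_line[OF V v S L_def]
note s = sub_obj[OF V l(1)]
obtain \<pi> where \<pi>: "\<pi> : Hom C V V" "fn \<pi> ` car V = L" using complement[OF V l(1)] by blast
let ?e = "arr V (fn \<pi>) (sub V L)"
have e: "?e : Hom C V (sub V L)"
 by (rule arr_hom[OF V s(1)])
  (use \<pi>(2) in "auto simp: s(2,4,5) fn_pl[OF \<pi>(1)] fn_sm[OF \<pi>(1)] ac_def")
have surj: "fn ?e ` car V = car (sub V L)"
 unfolding s(2) by (rule trans[OF _ \<pi>(2)], rule image_cong[OF refl]) (simp add: fn_arr)
note K = ker_is_sub[OF e]
have "card (UNIV :: 'f set) ^ vdim (sub V L) = card (UNIV :: 'f set) ^ 1"
 using card_carrier[OF s(1)] l(2) by (simp add: s(2))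
then have d1: "vdim (sub V L) = 1" unfolding power_inject_exp[OF one_less_card_field] .
then have d: "vdim V = Suc (vdim (sub V (ker V ?e)))" using vdim_exact[OF e surj] by simp
then have "card (Hom C (sub V (ker V ?e)) S) = card (car S) ^ vdim (sub V (ker V ?e))"
 using Suc.hyps(1)[OF _ sub_obj(1)[OF V K]] Suc.hyps(2) by simp
then show ?case unfolding card_Hom_exact[OF e surj S] l(3) d by simp
qed

end

section \<open>Induced representations\<close>

locale ind_setup = V: vect C + R: rep_objects G D
 for C :: "(('f::{field, finite}, 'u) module, ('f, 'u) vect_arr) cat"
  and G :: "('g, 'm) monoid_scheme"
  and D :: "(('f, 'g, 'g => 'u) rep, ('f, 'g, 'g => 'u) rep_arr) cat"
begin

lemma ind_sel:
 "carrier (ind_module G V) = carrier G \<rightarrow>\<^sub>E carrier V"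
 "\<zero>\<^bsub>ind_module G V\<^esub> = (\<lambda>g\<in>carrier G. \<zero>\<^bsub>V\<^esub>)"
 "v \<oplus>\<^bsub>ind_module G V\<^esub> w = (\<lambda>g\<in>carrier G. v g \<oplus>\<^bsub>V\<^esub> w g)"
 "c \<odot>\<^bsub>ind_module G V\<^esub> v = (\<lambda>g\<in>carrier G. c \<odot>\<^bsub>V\<^esub> v g)"
 by (simp_all add: ind_module_def)

lemma ind_ops:
 "R.car (ind_rep G V) = carrier G \<rightarrow>\<^sub>E V.car V"
 "R.zr (ind_rep G V) = (\<lambda>g\<in>carrier G. V.zr V)"
 "R.pl (ind_rep G V) v w = (\<lambda>g\<in>carrier G. V.pl V (v g) (w g))"
 "R.sm (ind_rep G V) c v = (\<lambda>g\<in>carrier G. V.sm V c (v g))"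
 "R.ac (ind_rep G V) h v = (\<lambda>g\<in>carrier G. v (inv\<^bsub>G\<^esub> h \<otimes>\<^bsub>G\<^esub> g))"
 by (simp_all add: R.ops_def V.ops_def ind_rep_def ind_sel)

lemma restrict_eqI: "[|w : A \<rightarrow>\<^sub>E B; !!g. g : A ==> F g = w g|] ==> restrict F A = w"
 by (auto simp: PiE_iff extensional_def restrict_def)

lemma vectorspace_ind:
 assumes V: "V : Obj C"
 shows "vectorspace class_ring (ind_module G V)"
proof -
note c = V.pl_closed[OF V] V.sm_closed[OF V] V.zr_closed[OF V]
have n: "EX w:carrier (ind_module G V). v \<oplus>\<^bsub>ind_module G V\<^esub> w = \<zero>\<^bsub>ind_module G V\<^esub>" if v: "v : carrier (ind_module G V)" for v
proof (rule bexI)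
 show "(\<lambda>g\<in>carrier G. V.sm V (-1) (v g)) : carrier (ind_module G V)"
  using v c(2) unfolding ind_sel by (auto simp: V.car_def)
 have "V.pl V (v g) (V.sm V (-1) (v g)) = V.zr V" if "g : carrier G" for g
  using V.pl_neg[OF V] v that unfolding ind_sel by (auto simp: V.car_def)
 then show "v \<oplus>\<^bsub>ind_module G V\<^esub> (\<lambda>g\<in>carrier G. V.sm V (-1) (v g)) = \<zero>\<^bsub>ind_module G V\<^esub>"
  unfolding ind_sel by (intro restrict_ext) (simp add: V.pl_def V.zr_def)
qed
have m: "v g : carrier V" if "v : carrier G \<rightarrow>\<^sub>E carrier V" "g : carrier G" for v g
 using that by (rule PiE_mem)
show ?thesis
proof (rule vs_criteria[OF field_class_ring], goal_cases)
 case 1 then show ?case using c(3) unfolding ind_sel by (auto simp: V.ops_def)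
next
 case 2 then show ?case using c(1) unfolding ind_sel by (auto simp: V.ops_def)
next
 case 3 then show ?case using n by blast
next
 case 4 then show ?case using c(2) unfolding ind_sel by (auto simp: V.ops_def)
next
 case 5
 show ?case unfolding ind_sel using V.pl_comm[OF V, unfolded V.ops_def fst_conv]
  by (auto intro!: restrict_ext simp: m)
next
 case 6
 show ?case unfolding ind_sel using V.pl_assoc[OF V, unfolded V.ops_def fst_conv]
  by (auto intro!: restrict_ext simp: m)
next
 case 7
 show ?case unfolding ind_sel using V.pl_zr[OF V, unfolded V.ops_def fst_conv]
  by (auto intro!: restrict_eqI simp: m)
next
 case 8
 show ?case unfolding ind_sel using V.sm_sm[OF V, unfolded V.ops_def fst_conv]
  by (auto intro!: restrict_ext simp: m)
next
 case 9
 show ?case unfolding ind_sel using V.sm_one[OF V, unfolded V.ops_def fst_conv]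
  by (auto intro!: restrict_eqI simp: m)
next
 case 10
 show ?case unfolding ind_sel using V.add_sm[OF V, unfolded V.ops_def fst_conv]
  by (auto intro!: restrict_ext simp: m)
next
 case 11
 show ?case unfolding ind_sel using V.sm_pl[OF V, unfolded V.ops_def fst_conv]
  by (auto intro!: restrict_ext simp: m)
qed
qed

lemma ind_obj:
 assumes V: "V : Obj C"
 shows "ind_rep G V : Obj D"
 unfolding R.Obj_iff
proof (intro conjI ballI allI)
show "vectorspace class_ring (fst (ind_rep G V))" using vectorspace_ind[OF V] by (simp add: ind_rep_def)
show "finite (R.car (ind_rep G V))"
 unfolding ind_ops by (intro finite_PiE R.finite_group V.car_finite[OF V])
fix g v assume g: "g : carrier G" and v: "v : R.car (ind_rep G V)"
note i = R.G.m_closed[OF R.G.inv_closed[OF g]]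
show "R.ac (ind_rep G V) g v : R.car (ind_rep G V)" using v i unfolding ind_ops by auto
show "R.ac (ind_rep G V) g (R.pl (ind_rep G V) v w) = R.pl (ind_rep G V) (R.ac (ind_rep G V) g v) (R.ac (ind_rep G V) g w)" for w
 unfolding ind_ops by (rule restrict_ext) (simp add: i)
show "R.ac (ind_rep G V) g (R.sm (ind_rep G V) c v) = R.sm (ind_rep G V) c (R.ac (ind_rep G V) g v)" for c
 unfolding ind_ops by (rule restrict_ext) (simp add: i)
fix h assume h: "h : carrier G"
show "R.ac (ind_rep G V) (g \<otimes>\<^bsub>G\<^esub> h) v = R.ac (ind_rep G V) g (R.ac (ind_rep G V) h v)"
 unfolding ind_ops by (rule restrict_ext) (use g h in "simp add: R.G.inv_mult_group R.G.m_assoc")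
next
fix v assume v: "v : R.car (ind_rep G V)"
show "R.ac (ind_rep G V) \<one>\<^bsub>G\<^esub> v = v"
 using v unfolding ind_ops by (intro restrict_eqI[of v _ "V.car V"]) simp_all
qed

lemma Ind_sel: "on_obj (Ind G) V = ind_rep G V"
 "on_arr (Ind G) (V, f, W) = R.arr (ind_rep G V) (%v. \<lambda>g\<in>carrier G. f (v g)) (ind_rep G W)"
 by (simp_all add: Ind_def R.arr_def ind_ops V.car_def)

lemma Ind_arr:
 assumes f: "f : Hom C V W"
 shows "on_arr (Ind G) f = R.arr (ind_rep G V) (%v. \<lambda>g\<in>carrier G. V.fn f (v g)) (ind_rep G W)"
proof -
obtain V' \<phi> W' where "f = (V', \<phi>, W')" by (cases f)
then have *: "f = (V, V.fn f, W)" using f by (auto simp: V.hom_iff V.fn_def)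
show ?thesis by (subst *) (simp add: Ind_sel V.fn_def)
qed

lemma Ind_hom:
 assumes f: "f : Hom C V W"
 shows "on_arr (Ind G) f : Hom D (ind_rep G V) (ind_rep G W)" (is ?P)
  "v : R.car (ind_rep G V) ==> R.fn (on_arr (Ind G) f) v = (\<lambda>g\<in>carrier G. V.fn f (v g))"
proof -
note V = V.hom_dom_obj[OF f] and W = V.hom_cod_obj[OF f]
have m: "v g : V.car V" if "v : R.car (ind_rep G V)" "g : carrier G" for v g
 using that unfolding ind_ops by (rule PiE_mem)
show ?P
 unfolding Ind_arr[OF f]
proof (rule R.arr_hom[OF ind_obj[OF V] ind_obj[OF W]])
 fix v assume v: "v : R.car (ind_rep G V)"
 show "(\<lambda>g\<in>carrier G. V.fn f (v g)) : R.car (ind_rep G W)"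
  unfolding ind_ops restrict_PiE_iff using V.fn_closed[OF f] m[OF v] by simp
 show "(\<lambda>g\<in>carrier G. V.fn f (R.sm (ind_rep G V) c v g)) = R.sm (ind_rep G W) c (\<lambda>g\<in>carrier G. V.fn f (v g))" for c
  unfolding ind_ops by (rule restrict_ext) (simp add: V.fn_sm[OF f] m[OF v])
 show "(\<lambda>g\<in>carrier G. V.fn f (R.ac (ind_rep G V) h v g)) = R.ac (ind_rep G W) h (\<lambda>g\<in>carrier G. V.fn f (v g))"
  if "h : carrier G" for h
  unfolding ind_ops by (rule restrict_ext) (simp add: that)
 fix w assume w: "w : R.car (ind_rep G V)"
 show "(\<lambda>g\<in>carrier G. V.fn f (R.pl (ind_rep G V) v w g))
  = R.pl (ind_rep G W) (\<lambda>g\<in>carrier G. V.fn f (v g)) (\<lambda>g\<in>carrier G. V.fn f (w g))"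
  unfolding ind_ops by (rule restrict_ext) (simp add: V.fn_pl[OF f] m[OF v] m[OF w])
qed
show "v : R.car (ind_rep G V) ==> R.fn (on_arr (Ind G) f) v = (\<lambda>g\<in>carrier G. V.fn f (v g))"
 unfolding Ind_arr[OF f] by (rule R.fn_arr)
qed

lemma Ind_functor: "is_functor C D (Ind G)"
proof (intro is_functor.intro is_functor_axioms.intro V.category_axioms R.category_axioms)
show "on_obj (Ind G) V : Obj D" if "V : Obj C" for V unfolding Ind_sel by (rule ind_obj[OF that])
show "on_arr (Ind G) f : Hom D (on_obj (Ind G) V) (on_obj (Ind G) W)" if "f : Hom C V W" for f V W
 unfolding Ind_sel by (rule Ind_hom(1)[OF that])
show "on_arr (Ind G) (Ident C V) = Ident D (on_obj (Ind G) V)" if V: "V : Obj C" for V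
 unfolding Ind_sel
proof (rule R.hom_eqI[OF Ind_hom(1)[OF V.ident_in_hom[OF V]] R.ident_in_hom[OF ind_obj[OF V]]])
 fix v assume v: "v : R.car (ind_rep G V)"
 have "(\<lambda>g\<in>carrier G. V.fn (Ident C V) (v g)) = v"
  by (rule restrict_eqI[OF v[unfolded ind_ops]]) (use v in "auto simp: ind_ops intro!: V.fn_ident")
 then show "R.fn (on_arr (Ind G) (Ident C V)) v = R.fn (Ident D (ind_rep G V)) v"
  using Ind_hom(2)[OF V.ident_in_hom[OF V] v] R.fn_ident[OF v] by simp
qed
show "on_arr (Ind G) (g \<cdot>\<^bsub>C\<^esub> f) = on_arr (Ind G) g \<cdot>\<^bsub>D\<^esub> on_arr (Ind G) f" if f: "f : Hom C V W" and g: "g : Hom C W X" for f g V W X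
proof (rule R.hom_eqI[OF Ind_hom(1)[OF V.comp_in_hom[OF f g]] R.comp_in_hom[OF Ind_hom(1)[OF f] Ind_hom(1)[OF g]]])
 fix v assume v: "v : R.car (ind_rep G V)"
 have m: "v h : V.car V" if "h : carrier G" for h using v that unfolding ind_ops by (rule PiE_mem)
 have c: "(\<lambda>h\<in>carrier G. V.fn f (v h)) : R.car (ind_rep G W)"
  unfolding ind_ops restrict_PiE_iff using V.fn_closed[OF f] m by simp
 show "R.fn (on_arr (Ind G) (g \<cdot>\<^bsub>C\<^esub> f)) v = R.fn (on_arr (Ind G) g \<cdot>\<^bsub>D\<^esub> on_arr (Ind G) f) v"
  unfolding R.fn_comp[OF Ind_hom(1)[OF f] Ind_hom(1)[OF g] v] Ind_hom(2)[OF V.comp_in_hom[OF f g] v] Ind_hom(2)[OF f v]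
   Ind_hom(2)[OF g c]
  by (rule restrict_ext) (simp add: V.fn_comp[OF f g] m)
qed
qed

lemma ind_sub:
 "R.sub (ind_rep G V) (carrier G \<rightarrow>\<^sub>E A) = ind_rep G (V.sub V A)"
 by (simp add: R.sub_eq V.sub_eq subrep_def ind_rep_def ind_module_def)

lemma ind_ker:
 assumes e: "e : Hom C V W"
 shows "R.ker (ind_rep G V) (on_arr (Ind G) e) = carrier G \<rightarrow>\<^sub>E V.ker V e"
proof -
have "v : R.car (ind_rep G V) & R.fn (on_arr (Ind G) e) v = R.zr (ind_rep G W) \<longleftrightarrow> v : carrier G \<rightarrow>\<^sub>E V.ker V e" for v
proof -
 have "(\<lambda>g\<in>carrier G. V.fn e (v g)) = (\<lambda>g\<in>carrier G. V.zr W) \<longleftrightarrow> (ALL g:carrier G. V.fn e (v g) = V.zr W)"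
  by (auto simp: restrict_def fun_eq_iff)
 then show ?thesis
  using Ind_hom(2)[OF e, of v] unfolding ind_ops V.ker_def V.hom_Cod[OF e] by (auto simp: PiE_iff)
qed
then show ?thesis unfolding R.ker_def R.hom_Cod[OF Ind_hom(1)[OF e]] by blast
qed

text \<open>\<open>\<delta> v\<close> is the tensor of the unit of the group with \<open>v\<close>.
  These elements generate the induced representation, because the translate of
  \<open>\<delta> (\<omega> h)\<close> by \<open>h\<close> has the value \<open>\<omega> h\<close>
  at \<open>h\<close> and zero elsewhere.\<close>

lemma delta_ind:
 assumes V: "V : Obj C"
 defines "\<delta> \<equiv> %v. \<lambda>g\<in>carrier G. if g = \<one>\<^bsub>G\<^esub> then v else V.zr V"
 shows "v : V.car V ==> \<delta> v : R.car (ind_rep G V)"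
  "[|v : V.car V; w : V.car V|] ==> \<delta> (V.pl V v w) = R.pl (ind_rep G V) (\<delta> v) (\<delta> w)"
  "v : V.car V ==> \<delta> (V.sm V c v) = R.sm (ind_rep G V) c (\<delta> v)"
  "[|R.is_sub (ind_rep G V) E; !!v. v : V.car V ==> \<delta> v : E; \<omega> : R.car (ind_rep G V)|] ==> \<omega> : E"
proof -
show c: "v : V.car V ==> \<delta> v : R.car (ind_rep G V)" for v
 unfolding ind_ops \<delta>_def restrict_PiE_iff using V.zr_closed[OF V] by simp
show "[|v : V.car V; w : V.car V|] ==> \<delta> (V.pl V v w) = R.pl (ind_rep G V) (\<delta> v) (\<delta> w)"
 unfolding ind_ops \<delta>_def using V.zr_closed[OF V] by (intro restrict_ext) (simp add: V.pl_zr[OF V])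
show "v : V.car V ==> \<delta> (V.sm V c v) = R.sm (ind_rep G V) c (\<delta> v)"
 unfolding ind_ops \<delta>_def by (intro restrict_ext) (simp add: V.sm_zr[OF V])
assume E: "R.is_sub (ind_rep G V) E" and d: "!!v. v : V.car V ==> \<delta> v : E" and \<omega>: "\<omega> : R.car (ind_rep G V)"
have m: "\<omega> h : V.car V" if "h : carrier G" for h using \<omega> that unfolding ind_ops by (rule PiE_mem)
have "(\<lambda>g\<in>carrier G. if g : A then \<omega> g else V.zr V) : E" if "A <= carrier G" for A
 using finite_subset[OF that R.finite_group] that
proof (induction A rule: finite_induct)
 case empty
 have "R.zr (ind_rep G V) : E" using E by (simp add: R.is_sub_def)
 then show ?case unfolding ind_ops by (simp add: restrict_def)
next
 case (insert h A)
 have h: "h : carrier G" using insert.prems by blast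
 have "R.ac (ind_rep G V) h (\<delta> (\<omega> h)) : E" using E d[OF m[OF h]] h unfolding R.is_sub_def by blast
 moreover have "(\<lambda>g\<in>carrier G. if g : A then \<omega> g else V.zr V) : E" using insert by blast
 ultimately have "R.pl (ind_rep G V) (R.ac (ind_rep G V) h (\<delta> (\<omega> h))) (\<lambda>g\<in>carrier G. if g : A then \<omega> g else V.zr V) : E"
  using E unfolding R.is_sub_def by blast
 also have "R.pl (ind_rep G V) (R.ac (ind_rep G V) h (\<delta> (\<omega> h))) (\<lambda>g\<in>carrier G. if g : A then \<omega> g else V.zr V)
  = (\<lambda>g\<in>carrier G. if g : insert h A then \<omega> g else V.zr V)"
  unfolding ind_ops
 proof (rule restrict_ext)
  fix g assume g: "g : carrier G"
  have "inv\<^bsub>G\<^esub> h \<otimes>\<^bsub>G\<^esub> g = \<one>\<^bsub>G\<^esub> \<longleftrightarrow> g = h" using g h by (metis R.G.inv_closed R.G.inv_equality R.G.inv_inv R.G.l_inv)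
  then show "V.pl V ((\<lambda>g\<in>carrier G. \<delta> (\<omega> h) (inv\<^bsub>G\<^esub> h \<otimes>\<^bsub>G\<^esub> g)) g) ((\<lambda>g\<in>carrier G. if g : A then \<omega> g else V.zr V) g)
   = (if g : insert h A then \<omega> g else V.zr V)"
   using g h m[OF g] V.zr_closed[OF V] insert.hyps(2)
   by (auto simp: \<delta>_def V.pl_zr[OF V] V.zr_pl[OF V])
 qed
 finally show ?case .
qed
from this[OF subset_refl] have "(\<lambda>g\<in>carrier G. if g : carrier G then \<omega> g else V.zr V) : E" .
moreover have "(\<lambda>g\<in>carrier G. if g : carrier G then \<omega> g else V.zr V) = \<omega>"
 by (rule restrict_eqI[OF \<omega>[unfolded ind_ops]]) simp
ultimately show "\<omega> : E" by simp
qed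

text \<open>Frobenius reciprocity, in the form of a count.\<close>

lemma card_Hom_ind:
 assumes V: "V : Obj C" and S: "S : Obj D"
 shows "card (Hom D (ind_rep G V) S) = card (R.car S) ^ vdim V"
proof -
\<comment> \<open>The vectors of \<open>S\<close> have the type \<open>'g => 'u\<close>; the copy
  \<open>S'\<close> is the underlying space of \<open>S\<close> as an object of
  \<open>C\<close>.\<close>
have "(fst S, %_ v. v) : Obj (Rep triv)" using R.Obj_vs[OF S] R.car_finite[OF S] by (simp add: triv_Obj Obj_Vect R.car_def)
from V.copy[OF this] obtain S' j where S': "S' : Obj C" and j: "bij_betw j (V.car S') (R.car S)"
 "!!a b. [|a : V.car S'; b : V.car S'|] ==> j (V.pl S' a b) = R.pl S (j a) (j b)"
 "!!c a. a : V.car S' ==> j (V.sm S' c a) = R.sm S c (j a)"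
 by (auto simp: R.car_def R.pl_def R.sm_def)
note jc = bij_betwE[OF j(1), rule_format] and jinj = inj_onD[OF bij_betw_imp_inj_on[OF j(1)]]
define i where "i = inv_into (V.car S') j"
have i: "i a : V.car S'" "j (i a) = a" if "a : R.car S" for a
 using that j(1) unfolding i_def by (simp_all add: bij_betw_def inv_into_into f_inv_into_f)
define \<delta> where "\<delta> v = (\<lambda>g\<in>carrier G. if g = \<one>\<^bsub>G\<^esub> then v else V.zr V)" for v
note d = delta_ind[OF V, folded \<delta>_def]
note IV = ind_obj[OF V]
\<comment> \<open>The two directions of the adjunction: a linear map \<open>k\<close> extends to
  families by summing g k(w g), and an equivariant map restricts to the tensors of the unit with
  vectors of \<open>V\<close>. For the count it is enough that both directions are
  injective.\<close>
define \<Phi> where "\<Phi> k = R.arr (ind_rep G V) (%w. R.avg S (%g. j (V.fn k (w g)))) S" for k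
define \<Psi> where "\<Psi> f = V.arr V (%v. i (R.fn f (\<delta> v))) S'" for f
have m: "w g : V.car V" if "w : R.car (ind_rep G V)" "g : carrier G" for w g
 using that unfolding ind_ops by (rule PiE_mem)
have \<Phi>: "\<Phi> k : Hom D (ind_rep G V) S" if k: "k : Hom C V S'" for k
 unfolding \<Phi>_def
proof (rule R.arr_hom[OF IV S])
 fix w assume w: "w : R.car (ind_rep G V)"
 have c: "j (V.fn k (w g)) : R.car S" if "g : carrier G" for g by (rule jc[OF V.fn_closed[OF k m[OF w that]]])
 show "R.avg S (%g. j (V.fn k (w g))) : R.car S" by (rule R.avg_closed[OF S c])
 have "R.avg S (%g. j (V.fn k (R.sm (ind_rep G V) a w g))) = R.avg S (%g. R.sm S a (j (V.fn k (w g))))" for a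
  by (rule R.avg_cong[OF S])
   (simp_all add: ind_ops V.fn_sm[OF k] m[OF w] j(3) V.fn_closed[OF k] R.sm_closed[OF S] c)
 then show "R.avg S (%g. j (V.fn k (R.sm (ind_rep G V) a w g))) = R.sm S a (R.avg S (%g. j (V.fn k (w g))))" for a
  using R.avg_sm[OF S, of "%g. j (V.fn k (w g))" a] c by simp
 show "R.avg S (%g. j (V.fn k (R.ac (ind_rep G V) h w g))) = R.ac S h (R.avg S (%g. j (V.fn k (w g))))"
  if h: "h : carrier G" for h
 proof -
  have "R.avg S (%g. j (V.fn k (R.ac (ind_rep G V) h w g))) = R.avg S (%g. j (V.fn k (w (inv\<^bsub>G\<^esub> h \<otimes>\<^bsub>G\<^esub> g))))"
   by (rule R.avg_cong[OF S]) (simp_all add: ind_ops c h)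
  also have "... = R.ac S h (R.avg S (%g. j (V.fn k (w g))))"
   using R.avg_ac[OF S, of "%g. j (V.fn k (w g))" h] c h by simp
  finally show ?thesis .
 qed
 fix u assume u: "u : R.car (ind_rep G V)"
 have c': "j (V.fn k (u g)) : R.car S" if "g : carrier G" for g by (rule jc[OF V.fn_closed[OF k m[OF u that]]])
 have "R.avg S (%g. j (V.fn k (R.pl (ind_rep G V) w u g))) = R.avg S (%g. R.pl S (j (V.fn k (w g))) (j (V.fn k (u g))))"
  by (rule R.avg_cong[OF S])
   (simp_all add: ind_ops V.fn_pl[OF k] m[OF w] m[OF u] j(2) V.fn_closed[OF k] R.pl_closed[OF S] c c')
 then show "R.avg S (%g. j (V.fn k (R.pl (ind_rep G V) w u g)))
  = R.pl S (R.avg S (%g. j (V.fn k (w g)))) (R.avg S (%g. j (V.fn k (u g))))"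
  using R.avg_pl[OF S, of "%g. j (V.fn k (w g))" "%g. j (V.fn k (u g))"] c c' by simp
qed
have \<Phi>\<delta>: "R.fn (\<Phi> k) (\<delta> v) = j (V.fn k v)" if k: "k : Hom C V S'" and v: "v : V.car V" for k v
proof -
 have z: "j (V.zr S') = R.zr S"
  using j(3)[OF V.zr_closed[OF S'], of 0] V.sm_zero[OF S' V.zr_closed[OF S']] R.sm_zero[OF S jc[OF V.zr_closed[OF S']]] by simp
 have "R.fn (\<Phi> k) (\<delta> v) = R.avg S (%g. j (V.fn k (\<delta> v g)))" unfolding \<Phi>_def by (rule R.fn_arr[OF d(1)[OF v]])
 also have "... = R.avg S (%g. if g = \<one>\<^bsub>G\<^esub> then j (V.fn k v) else R.zr S)"
  by (rule R.avg_cong[OF S])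
   (simp_all add: \<delta>_def V.fn_zr[OF k] z jc[OF V.fn_closed[OF k v]] R.zr_closed[OF S])
 also have "... = j (V.fn k v)" by (rule R.avg_single[OF S jc[OF V.fn_closed[OF k v]]])
 finally show ?thesis .
qed
have "inj_on \<Phi> (Hom C V S')"
proof (rule inj_onI)
 fix k l assume k: "k : Hom C V S'" "l : Hom C V S'" "\<Phi> k = \<Phi> l"
 show "k = l"
 proof (rule V.hom_eqI[OF k(1,2)])
  fix v assume v: "v : V.car V"
  have "j (V.fn k v) = j (V.fn l v)" using \<Phi>\<delta>[OF k(1) v] \<Phi>\<delta>[OF k(2) v] k(3) by simp
  then show "V.fn k v = V.fn l v" by (rule jinj[OF _ V.fn_closed[OF k(1) v] V.fn_closed[OF k(2) v]])
 qed
qed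
then have le1: "card (Hom C V S') <= card (Hom D (ind_rep G V) S)"
 by (rule card_inj_on_le) (use \<Phi> R.finite_Hom[OF IV S] in auto)
have \<Psi>: "\<Psi> f : Hom C V S'" if f: "f : Hom D (ind_rep G V) S" for f
 unfolding \<Psi>_def
proof (rule V.arr_hom[OF V S'])
 fix v assume v: "v : V.car V"
 note fv = R.fn_closed[OF f d(1)[OF v]]
 show "i (R.fn f (\<delta> v)) : V.car S'" by (rule i(1)[OF fv])
 show "i (R.fn f (\<delta> (V.sm V c v))) = V.sm S' c (i (R.fn f (\<delta> v)))" for c
 proof (rule jinj)
  show "j (i (R.fn f (\<delta> (V.sm V c v)))) = j (V.sm S' c (i (R.fn f (\<delta> v))))"
   unfolding d(3)[OF v] R.fn_sm[OF f d(1)[OF v]] j(3)[OF i(1)[OF fv]] i(2)[OF fv] by (rule i(2)[OF R.sm_closed[OF S fv]])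
 qed (use i(1)[OF R.fn_closed[OF f d(1)[OF V.sm_closed[OF V v]]]] V.sm_closed[OF S' i(1)[OF fv]] in auto)
 show "i (R.fn f (\<delta> (V.ac V g v))) = V.ac S' g (i (R.fn f (\<delta> v)))" for g by (simp add: V.ac_def)
 fix w assume w: "w : V.car V"
 note fw = R.fn_closed[OF f d(1)[OF w]]
 show "i (R.fn f (\<delta> (V.pl V v w))) = V.pl S' (i (R.fn f (\<delta> v))) (i (R.fn f (\<delta> w)))"
 proof (rule jinj)
  show "j (i (R.fn f (\<delta> (V.pl V v w)))) = j (V.pl S' (i (R.fn f (\<delta> v))) (i (R.fn f (\<delta> w))))"
   unfolding d(2)[OF v w] R.fn_pl[OF f d(1)[OF v] d(1)[OF w]] j(2)[OF i(1)[OF fv] i(1)[OF fw]] i(2)[OF fv] i(2)[OF fw]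
   by (rule i(2)[OF R.pl_closed[OF S fv fw]])
 qed (use i(1)[OF R.fn_closed[OF f d(1)[OF V.pl_closed[OF V v w]]]] V.pl_closed[OF S' i(1)[OF fv] i(1)[OF fw]] in auto)
qed
have "inj_on \<Psi> (Hom D (ind_rep G V) S)"
proof (rule inj_onI)
 fix f h assume f: "f : Hom D (ind_rep G V) S" "h : Hom D (ind_rep G V) S" "\<Psi> f = \<Psi> h"
 have eq: "R.fn f (\<delta> v) = R.fn h (\<delta> v)" if v: "v : V.car V" for v
 proof -
  have "V.fn (\<Psi> f) v = V.fn (\<Psi> h) v" using f(3) by simp
  then have "i (R.fn f (\<delta> v)) = i (R.fn h (\<delta> v))" unfolding \<Psi>_def V.fn_arr[OF v] .
  then show ?thesis using i(2)[OF R.fn_closed[OF f(1) d(1)[OF v]]] i(2)[OF R.fn_closed[OF f(2) d(1)[OF v]]] by metis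
 qed
 \<comment> \<open>The vectors on which both arrows agree form an invariant subspace, and it
   contains the generators.\<close>
 let ?E = "{w : R.car (ind_rep G V). R.fn f w = R.fn h w}"
 have E: "R.is_sub (ind_rep G V) ?E"
  unfolding R.is_sub_def
  by (auto simp: R.zr_closed[OF IV] R.pl_closed[OF IV] R.sm_closed[OF IV] R.ac_closed[OF IV] R.fn_zr[OF f(1)] R.fn_zr[OF f(2)]
    R.fn_pl[OF f(1)] R.fn_pl[OF f(2)] R.fn_sm[OF f(1)] R.fn_sm[OF f(2)] R.fn_ac[OF f(1)] R.fn_ac[OF f(2)])
 show "f = h"
 proof (rule R.hom_eqI[OF f(1,2)])
  fix w assume w: "w : R.car (ind_rep G V)"
  have "w : ?E" by (rule d(4)[OF E _ w]) (simp add: d(1) eq)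
  then show "R.fn f w = R.fn h w" by simp
 qed
qed
then have le2: "card (Hom D (ind_rep G V) S) <= card (Hom C V S')"
 by (rule card_inj_on_le) (use \<Psi> V.finite_Hom[OF V S'] in auto)
show ?thesis using le1 le2 V.card_Hom[OF V S'] bij_betw_same_card[OF j(1)] by simp
qed

text \<open>With q the number of scalars, an irreducible \<open>S\<close> has q^(dim S) vectors and,
  over a splitting field, q endomorphisms; comparing exponents in the reciprocity count gives the
  multiplicity dim S dim V.\<close>

lemma wgt_ind:
 assumes spl: "splitting_field G TYPE('f) TYPE('g => 'u)" and V: "V : Obj C"
 shows "R.wgt \<tau> (ind_rep G V) = t_of G \<tau> ^ vdim V"
proof -
have "multiplicity_in G (ind_rep G V) I = irr_dim I * vdim V" if "I : Irr G" for I
proof -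
 obtain S where S: "irreducible_rep G S" "I = R.cls S" using \<open>I : Irr G\<close> unfolding R.Irr_eq by blast
 then have SO: "S : Obj D" by (simp add: R.irreducible_iff)
 have "card (Hom D (ind_rep G V) S) = card (Hom D S S) ^ (irr_dim I * vdim V)"
  unfolding card_Hom_ind[OF V SO] R.card_Hom_splitting[OF spl S(1)] R.card_car[OF SO] S(2) R.irr_dim_cls[OF S(1)]
  by (simp add: power_mult)
 then show ?thesis unfolding S(2) by (rule R.multiplicity_eqI[OF ind_obj[OF V] S(1)])
qed
then show ?thesis unfolding R.wgt_def t_of_def prod_power_distrib power_mult[symmetric] by (intro prod.cong) auto
qed

text \<open>Induction commutes with kernels, so the claim is \<open>wgt_ind\<close> for the kernel
  of \<open>e\<close>.\<close>

lemma degree_Ind: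
 assumes spl: "splitting_field G TYPE('f) TYPE('g => 'u)" and e: "is_epi C e"
 shows "deg_Rep G \<tau> (on_arr (Ind G) e) = deg_Vect (t_of G \<tau>) e"
proof -
note e = V.epi_Arr[OF e]
note V = V.hom_dom_obj[OF e]
show ?thesis
 unfolding R.deg_Rep_eq[OF Ind_hom(1)[OF e]] V.deg_Vect_eq[OF e] ind_ker[OF e] ind_sub
 by (rule wgt_ind[OF spl V.sub_obj(1)[OF V V.ker_is_sub[OF e]]])
qed

end

section \<open>Restriction to the underlying vector space\<close>

lemma rep_objects_Rep:
 fixes G :: "('g, 'm) monoid_scheme"
 assumes "group G" "finite (carrier G)" "\<not> CHAR('f::{field, finite}) dvd Coset.order G" "infinite (UNIV :: 'u set)"
 shows "rep_objects G (Rep G :: (('f, 'g, 'u) rep, ('f, 'g, 'u) rep_arr) cat)"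
 by (intro rep_objects.intro rep_category.intro rep_objects_axioms.intro assms refl) (auto simp: Rep_def Let_def)

locale res_setup = R: rep_objects G C + V: vect D
 for G :: "('g, 'm) monoid_scheme"
  and C :: "(('f::{field, finite}, 'g, 'u) rep, ('f, 'g, 'u) rep_arr) cat"
  and D :: "(('f, 'u) module, ('f, 'u) vect_arr) cat"
begin

lemma Res_eq: "f : Hom C S T ==> on_arr Res f = (fst S, R.fn f, fst T)"
 by (cases f) (auto simp: Res_def R.hom_iff R.fn_def)

lemma Res_obj: "S : Obj C ==> fst S : Obj D"
 using R.Obj_vs[of S] R.car_finite[of S] by (simp add: V.C_eq Obj_Vect R.car_def)

lemma Res_car: "V.car (fst S) = R.car S" by (simp add: V.car_def R.car_def)

lemma Res_hom:
 assumes f: "f : Hom C S T" shows "on_arr Res f : Hom D (fst S) (fst T)"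
proof -
have "R.fn f : extensional (R.car S)" using f by (cases f) (auto simp: R.hom_iff R.fn_def)
then show ?thesis
 unfolding Res_eq[OF f] V.hom_iff
 using Res_obj[OF R.hom_dom_obj[OF f]] Res_obj[OF R.hom_cod_obj[OF f]] R.fn_closed[OF f] R.fn_pl[OF f] R.fn_sm[OF f]
 by (auto simp: V.ops_def R.ops_def)
qed

lemma Res_fn: "f : Hom C S T ==> V.fn (on_arr Res f) = R.fn f"
 by (simp add: Res_eq V.fn_def)

lemma Res_functor: "is_functor C D Res"
proof (intro is_functor.intro is_functor_axioms.intro V.category_axioms R.category_axioms)
show "on_obj Res S : Obj D" if "S : Obj C" for S using Res_obj[OF that] by (simp add: Res_def)
show "on_arr Res f : Hom D (on_obj Res S) (on_obj Res T)" if "f : Hom C S T" for f S T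
 using Res_hom[OF that] by (simp add: Res_def)
show "on_arr Res (Ident C S) = Ident D (on_obj Res S)" if "S : Obj C" for S
 by (simp add: Res_def R.Ident_C V.Ident_C)
show "on_arr Res (g \<cdot>\<^bsub>C\<^esub> f) = on_arr Res g \<cdot>\<^bsub>D\<^esub> on_arr Res f" for f g
 by (simp add: Res_def R.Comp_C V.Comp_C split_beta)
qed

lemma Res_power: "power_functor G C (%S. S) (%S. S) triv D (%V. (V, %_ v. v)) fst Res {()} (%_ _ v. v)"
proof (intro power_functor.intro power_functor_axioms.intro R.rep_category_axioms V.rep_category_axioms Res_functor)
show "bij_betw (%v. \<lambda>j\<in>{()}. v) (V.car (on_obj Res S)) ({()} \<rightarrow>\<^sub>E R.car S)" for S
 unfolding Res_def ftr.simps Res_car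
 by (rule bij_betw_byWitness[where f'="%h. h ()"]) (auto simp: fun_eq_iff)
show "V.fn (on_arr Res f) v = R.fn f v" if "f : Hom C S T" for f S T v by (simp add: Res_fn[OF that])
show "V.zr (on_obj Res S) = R.zr S" for S by (simp add: Res_def V.zr_def R.zr_def)
qed

text \<open>Restriction keeps the kernel as a space, and by \<open>wgt_tau_of\<close> its weight for
  \<open>tau_of t\<close> is t to its dimension.\<close>

lemma degree_Res:
 assumes "is_epi C e" shows "deg_Vect t (on_arr Res e) = deg_Rep G (tau_of t) e"
proof -
note e = R.epi_Arr[OF assms]
note S = R.hom_dom_obj[OF e] and K = R.ker_is_sub[OF e] and e' = Res_hom[OF e]
have "V.ker (fst (Dom C e)) (on_arr Res e) = R.ker (Dom C e) e"
 by (simp add: V.ker_def R.ker_def V.hom_Cod[OF e'] Res_car Res_fn[OF e] V.zr_def R.zr_def)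
then have "V.sub (fst (Dom C e)) (V.ker (fst (Dom C e)) (on_arr Res e)) = fst (R.sub (Dom C e) (R.ker (Dom C e) e))"
 by (simp add: V.sub_eq R.sub_eq subrep_def)
then show ?thesis
 unfolding V.deg_Vect_eq[OF e'] R.deg_Rep_eq[OF e] R.wgt_tau_of[OF R.sub_obj(1)[OF S K]] by simp
qed

lemma Res_power_degree:
 "power_degree G C (%S. S) (%S. S) triv D (%V. (V, %_ v. v)) fst Res {()} (%_ _ v. v)
  (deg_Rep G (tau_of (t :: 'k::field))) (deg_Vect t)"
 by (intro power_degree.intro power_degree_axioms.intro rep_degree.intro Res_power R.rep_category_axioms V.rep_category_axioms
   R.degree_Rep V.degree_Vect degree_Res)

end

context ind_setup
begin

text \<open>A vector of the induced representation is a function on the group, and its values are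
  the components.\<close>

lemma Ind_power: "power_functor triv C (%V. (V, %_ v. v)) fst G D (%S. S) (%S. S) (Ind G) (carrier G) (%_ g v. v g)"
proof (intro power_functor.intro power_functor_axioms.intro R.rep_category_axioms V.rep_category_axioms Ind_functor)
show "bij_betw (%v. \<lambda>g\<in>carrier G. v g) (R.car (on_obj (Ind G) V)) (carrier G \<rightarrow>\<^sub>E V.car V)" for V
 unfolding Ind_sel ind_ops
 by (rule bij_betw_cong[THEN iffD1, OF _ bij_betw_id]) (simp add: restrict_eqI)
show "R.fn (on_arr (Ind G) f) v g = V.fn f (v g)"
 if "f : Hom C V W" "v : R.car (on_obj (Ind G) V)" "g : carrier G" for f V W v g
 using Ind_hom(2)[OF that(1)] that(2,3) by (simp add: Ind_sel)
show "R.zr (on_obj (Ind G) V) g = V.zr V" if "g : carrier G" for V g using that by (simp add: Ind_sel ind_ops)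
qed

lemma Ind_power_degree:
 assumes "splitting_field G TYPE('f) TYPE('g => 'u)"
 shows "power_degree triv C (%V. (V, %_ v. v)) fst G D (%S. S) (%S. S) (Ind G) (carrier G) (%_ g v. v g)
  (deg_Vect (t_of G (\<tau> :: _ => 'k::field))) (deg_Rep G \<tau>)"
 by (intro power_degree.intro power_degree_axioms.intro rep_degree.intro Ind_power R.rep_category_axioms V.rep_category_axioms
   R.degree_Rep V.degree_Vect degree_Ind[OF assms])

end

theorem corollary4p2p4:
  fixes G :: "('g, 'm) monoid_scheme"
  assumes "group G"
    and "finite (carrier G)"
    and "\<not> CHAR('f::{field, finite}) dvd Coset.order G"
    and "infinite (UNIV :: 'u set)"
  shows
    "(\<forall>t::'k::field.
        preserves_degree (Rep G :: (('f, 'g, 'u) rep, ('f, 'g, 'u) rep_arr) cat)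
          (deg_Rep G (tau_of t)) Vect (deg_Vect t) Res \<and>
        preserves_pullbacks (Rep G :: (('f, 'g, 'u) rep, ('f, 'g, 'u) rep_arr) cat) Vect Res \<and>
        preserves_terminals (Rep G :: (('f, 'g, 'u) rep, ('f, 'g, 'u) rep_arr) cat) Vect Res \<and>
        (let Res_bar = induced_functor (Rep G :: (('f, 'g, 'u) rep, ('f, 'g, 'u) rep_arr) cat)
               (deg_Rep G (tau_of t)) Vect (deg_Vect t) Res
         in symmetric_monoidal_functor (\<T> (Rep G) (deg_Rep G (tau_of t))) (Rep_GL t) Res_bar \<and>
            linear_functor (\<T> (Rep G) (deg_Rep G (tau_of t))) (Rep_GL t) Res_bar))
     \<and>
     is_functor (Vect :: (('f, 'u) module, ('f, 'u) vect_arr) cat) (Rep G) (Ind G) \<and>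
     preserves_pullbacks (Vect :: (('f, 'u) module, ('f, 'u) vect_arr) cat) (Rep G) (Ind G) \<and>
     preserves_terminals (Vect :: (('f, 'u) module, ('f, 'u) vect_arr) cat) (Rep G) (Ind G) \<and>
     (splitting_field G TYPE('f) TYPE('g \<Rightarrow> 'u) \<longrightarrow>
      (\<forall>\<tau> :: ('f, 'g, 'g \<Rightarrow> 'u) rep set \<Rightarrow> 'k.
        preserves_degree (Vect :: (('f, 'u) module, ('f, 'u) vect_arr) cat)
          (deg_Vect (t_of G \<tau>)) (Rep G) (deg_Rep G \<tau>) (Ind G) \<and>
        (let Ind_bar = induced_functor (Vect :: (('f, 'u) module, ('f, 'u) vect_arr) cat)
               (deg_Vect (t_of G \<tau>)) (Rep G) (deg_Rep G \<tau>) (Ind G)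
         in symmetric_monoidal_functor (Rep_GL (t_of G \<tau>)) (\<T> (Rep G) (deg_Rep G \<tau>)) Ind_bar \<and>
            linear_functor (Rep_GL (t_of G \<tau>)) (\<T> (Rep G) (deg_Rep G \<tau>)) Ind_bar)))"
proof -
  \<comment> \<open>Constant functions embed the original vectors, so the vector type of the induced
    representations is infinite as well.\<close>
  have "inj (\<lambda>u :: 'u. \<lambda>_ :: 'g. u)" by (rule injI) (metis)
  then have inf: "infinite (UNIV :: ('g \<Rightarrow> 'u) set)" using assms(4) by (metis finite_imageD infinite_super top_greatest)
  interpret res: res_setup G "Rep G :: (('f, 'g, 'u) rep, ('f, 'g, 'u) rep_arr) cat" Vect
    by (intro res_setup.intro rep_objects_Rep vect_Vect assms)
  interpret ind: ind_setup "Vect :: (('f, 'u) module, ('f, 'u) vect_arr) cat" G "Rep G"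
    by (intro ind_setup.intro rep_objects_Rep vect_Vect assms inf)
  note r = res.Res_power_degree
  note i = ind.Ind_power_degree
  show ?thesis
    unfolding Let_def Rep_GL_def
    using power_degree.power_preserves_degree[OF r] power_functor.power_preserves_pullbacks[OF res.Res_power]
      power_functor.power_preserves_terminals[OF res.Res_power] power_degree.induced_functor[OF r]
      ind.Ind_functor power_functor.power_preserves_pullbacks[OF ind.Ind_power]
      power_functor.power_preserves_terminals[OF ind.Ind_power]
      power_degree.power_preserves_degree[OF i] power_degree.induced_functor[OF i]
    by (intro conjI allI impI) assumption+
qed

end
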